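(* Let $E$ be a trivial vector bundle over $S^1$. Let $\tilde\pi$ be the projection $FIO^*_{\mathrm{Diff}}(S^1,E)\to\mathrm{Diff}(S^1)$. Then $$\tilde\pi^{-1}(\mathrm{Diff}_+(S^1))\subset FIO_{res}(S^1,E).$$
   Context: $\mathrm{Diff}_+(S^1)$ is the group of orientation preserving diffeomorphisms of $S^1$. $FIO^*_{\mathrm{Diff}}(S^1,E)$ is the group of invertible Fourier integral operators on $C^\infty(S^1,E)$ whose phase function is $\phi(x,\xi)=g(x)\cdot\xi$ with $g\in\mathrm{Diff}(S^1)$, i.e. operators $T_g\circ A$ with $T_gf=f\circ g$ and $A$ an invertible pseudo-differential operator; $\tilde\pi$ sends such an operator to the diffeomorphism $g$ (up to the convention $g$ or $g^{-1}$ making it a group morphism). $FIO_{res}(S^1,E)$ is the set of Fourier integral operators $A$ on $C^\infty(S^1,E)$ such that $[A,\epsilon]$ is a smoothing operator. Here, if $E=S^1\times\mathbb C^k$, $\epsilon=\epsilon(D)=D|D|^{-1}$ with $D=-i\frac{d}{dx}$ and $|D|=(-d^2/dx^2)^{1/2}$, modified to be the identity on constants; if $E$ is real with a Riemannian connection $\nabla$, $\epsilon=\epsilon(\nabla)=D|D|^{-1}$ with $D=\frac{\nabla}{dt}+p_{\ker\frac{\nabla}{dt}}$ ($\frac{\nabla}{dt}$ the covariant derivative along the unit vector field, $p_{\ker\frac{\nabla}{dt}}$ the $L^2$-orthogonal projection onto its kernel) and $|D|=(D^*D)^{1/2}$. *)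

theory Defs
  imports "HOL-Analysis.Analysis"
begin

section \<open>The circle and its smooth functions\<close>

typedef circle = "{z::complex. norm z = 1}"
  by (rule exI[of _ 1]) simp

definition circ :: "real \<Rightarrow> circle" where
  "circ t = Abs_circle (cis t)"

definition smooth_curve :: "(real \<Rightarrow> 'v::real_normed_vector) \<Rightarrow> bool" where
  "smooth_curve f \<longleftrightarrow> (\<exists>F :: nat \<Rightarrow> real \<Rightarrow> 'v. F 0 = f \<and>
     (\<forall>n t. (F n has_vector_derivative F (Suc n) t) (at t)))"

text \<open>For open \<open>S\<close>, a family \<open>F\<close> as below exists iff \<open>f\<close> is smooth on \<open>S\<close>; then \<open>F i j\<close> is
  the \<open>i\<close>-th partial derivative in the first and \<open>j\<close>-th in the second variable.\<close>

definition partials_on ::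
  "(real \<times> real) set \<Rightarrow> (real \<Rightarrow> real \<Rightarrow> 'v::real_normed_vector)
    \<Rightarrow> (nat \<Rightarrow> nat \<Rightarrow> real \<Rightarrow> real \<Rightarrow> 'v) \<Rightarrow> bool" where
  "partials_on S f F \<longleftrightarrow>
     (\<forall>(x, y) \<in> S. F 0 0 x y = f x y) \<and>
     (\<forall>i j. continuous_on S (\<lambda>(x, y). F i j x y)) \<and>
     (\<forall>i j. \<forall>(x, y) \<in> S.
        ((\<lambda>s. F i j s y) has_vector_derivative F (Suc i) j x y) (at x) \<and>
        ((\<lambda>s. F i j x s) has_vector_derivative F i (Suc j) x y) (at y))"

text \<open>Sections of the trivial bundle with fibre \<open>'v\<close> are functions \<open>circle \<Rightarrow> 'v\<close>. An operator on
  smooth sections is represented by a function on all sections; only its values on \<open>Cinf\<close>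
  are ever referred to.\<close>

definition Cinf :: "(circle \<Rightarrow> 'v::real_normed_vector) set" where
  "Cinf = {f. smooth_curve (\<lambda>t. f (circ t))}"

definition ddt :: "(circle \<Rightarrow> 'v::real_normed_vector) \<Rightarrow> circle \<Rightarrow> 'v" where
  "ddt f p = vector_derivative (\<lambda>t. f (circ t)) (at (Arg (Rep_circle p)))"


section \<open>Diffeomorphisms\<close>

definition Diff :: "(circle \<Rightarrow> circle) set" where
  "Diff = {g. bij g \<and> (\<lambda>p. Rep_circle (g p)) \<in> Cinf \<and> (\<lambda>p. Rep_circle (inv g p)) \<in> Cinf}"

text \<open>If \<open>g (cis t) = cis (G t)\<close> for a smooth \<open>G\<close>, the expression below is \<open>G' t\<close>.\<close>

definition Diff_plus :: "(circle \<Rightarrow> circle) set" where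
  "Diff_plus = {g \<in> Diff.
     \<forall>p. Im (cnj (Rep_circle (g p)) * ddt (\<lambda>q. Rep_circle (g q)) p) > 0}"


section \<open>Smoothing, pseudo-differential and Fourier integral operators\<close>

definition smooth_kernel :: "(circle \<Rightarrow> circle \<Rightarrow> 'v::real_normed_vector) \<Rightarrow> bool" where
  "smooth_kernel K \<longleftrightarrow> (\<exists>F. partials_on UNIV (\<lambda>x y. K (circ x) (circ y)) F)"

definition kernel_op ::
  "(circle \<Rightarrow> circle \<Rightarrow> 'f::{real_normed_field,euclidean_space}^'k^'k)
    \<Rightarrow> (circle \<Rightarrow> 'f^'k) \<Rightarrow> circle \<Rightarrow> 'f^'k" where
  "kernel_op K f p = integral {0..2*pi} (\<lambda>t. K p (circ t) *v f (circ t))"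

definition smoothing ::
  "((circle \<Rightarrow> 'f::{real_normed_field,euclidean_space}^'k) \<Rightarrow> circle \<Rightarrow> 'f^'k) \<Rightarrow> bool" where
  "smoothing R \<longleftrightarrow> (\<exists>K. smooth_kernel K \<and> (\<forall>f\<in>Cinf. R f = kernel_op K f))"

text \<open>Matrix-valued symbols of Hoermander type \<open>(1,0)\<close> and order \<open>m\<close>, uniformly in \<open>x\<close>.
  They are only used for operators localized to a compact set of \<open>x\<close>.\<close>

definition symbol :: "real \<Rightarrow> (real \<Rightarrow> real \<Rightarrow> complex^'k^'k) \<Rightarrow> bool" where
  "symbol m a \<longleftrightarrow> (\<exists>F. partials_on UNIV a F \<and>
     (\<forall>i j. \<exists>C. \<forall>x \<xi>. norm (F i j x \<xi>) \<le> C * (1 + \<bar>\<xi>\<bar>) powr (m - real j)))"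

definition fourier :: "(real \<Rightarrow> complex^'k) \<Rightarrow> real \<Rightarrow> complex^'k" where
  "fourier u \<xi> = (LBINT y. cis (- (y * \<xi>)) *s u y)"

definition osc ::
  "(real \<Rightarrow> real \<Rightarrow> real) \<Rightarrow> (real \<Rightarrow> real \<Rightarrow> complex^'k^'k)
    \<Rightarrow> (real \<Rightarrow> complex^'k) \<Rightarrow> real \<Rightarrow> complex^'k" where
  "osc \<phi> a u x = (1 / (2*pi)) *\<^sub>R (LBINT \<xi>. cis (\<phi> x \<xi>) *s (a x \<xi> *v fourier u \<xi>))"

definition phase_on :: "real set \<Rightarrow> (real \<Rightarrow> real \<Rightarrow> real) \<Rightarrow> bool" where
  "phase_on I \<phi> \<longleftrightarrow>
     (\<forall>x\<in>I. \<forall>\<xi>. \<forall>t>0. \<phi> x (t * \<xi>) = t * \<phi> x \<xi>) \<and>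
     (\<exists>F. partials_on (I \<times> (- {0})) \<phi> F \<and> (\<forall>x\<in>I. \<forall>\<xi>. \<xi> \<noteq> 0 \<longrightarrow> F 1 1 x \<xi> \<noteq> 0))"

text \<open>Smooth functions supported in the closed arc of radius \<open>r < pi\<close> around \<open>circ c\<close>.\<close>

definition cutoff :: "real \<Rightarrow> real \<Rightarrow> (circle \<Rightarrow> complex) \<Rightarrow> bool" where
  "cutoff c r \<eta> \<longleftrightarrow> \<eta> \<in> Cinf \<and> (\<forall>t. c + r < t \<and> t < c + 2*pi - r \<longrightarrow> \<eta> (circ t) = 0)"

definition lift :: "real \<Rightarrow> (circle \<Rightarrow> complex^'k) \<Rightarrow> real \<Rightarrow> complex^'k" where
  "lift c f t = (if \<bar>t - c\<bar> < pi then f (circ t) else 0)"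

text \<open>In the angular coordinate on \<open>\<bar>x - c\<bar> < \<delta>\<close> (target) and on \<open>\<bar>y - d\<bar> < pi\<close> (source), the
  operator \<open>\<eta> A \<psi>\<close> is, up to a smoothing operator, the oscillatory integral operator with
  phase \<open>\<phi>\<close> and some symbol of order \<open>m\<close>.\<close>

definition osc_rep ::
  "real \<Rightarrow> (real \<Rightarrow> real \<Rightarrow> real) \<Rightarrow> real \<Rightarrow> real \<Rightarrow> real \<Rightarrow> (circle \<Rightarrow> complex) \<Rightarrow> (circle \<Rightarrow> complex)
    \<Rightarrow> ((circle \<Rightarrow> complex^'k) \<Rightarrow> circle \<Rightarrow> complex^'k) \<Rightarrow> bool" where
  "osc_rep m \<phi> c \<delta> d \<eta> \<psi> A \<longleftrightarrow>
     (\<exists>a K. symbol m a \<and> smooth_kernel K \<and>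
       (\<forall>f\<in>Cinf. \<forall>x. \<bar>x - c\<bar> < \<delta> \<longrightarrow>
          \<eta> (circ x) *s A (\<lambda>p. \<psi> p *s f p) (circ x)
          = osc \<phi> a (lift d (\<lambda>p. \<psi> p *s f p)) x + kernel_op K f (circ x)))"

definition linear_op :: "((circle \<Rightarrow> complex^'k) \<Rightarrow> circle \<Rightarrow> complex^'k) \<Rightarrow> bool" where
  "linear_op A \<longleftrightarrow> (\<forall>f\<in>Cinf. A f \<in> Cinf) \<and>
     (\<forall>f\<in>Cinf. \<forall>g\<in>Cinf. \<forall>c. A (\<lambda>p. c *s f p + g p) = (\<lambda>p. c *s A f p + A g p))"

text \<open>Any two points of the circle lie in a common arc \<open>\<bar>t - c\<bar> \<le> r\<close> with \<open>r < pi\<close>, so smoothness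
  of the kernel off the diagonal is part of this condition.\<close>

definition PDO :: "((circle \<Rightarrow> complex^'k) \<Rightarrow> circle \<Rightarrow> complex^'k) set" where
  "PDO = {A. linear_op A \<and>
     (\<exists>m. \<forall>c r \<eta> \<psi>. 0 < r \<and> r < pi \<and> cutoff c r \<eta> \<and> cutoff c r \<psi> \<longrightarrow>
        osc_rep m (\<lambda>x \<xi>. x * \<xi>) c pi c \<eta> \<psi> A)}"

definition FIO :: "((circle \<Rightarrow> complex^'k) \<Rightarrow> circle \<Rightarrow> complex^'k) set" where
  "FIO = {A. linear_op A \<and>
     (\<exists>m. \<forall>c d. \<exists>\<delta> \<phi>. 0 < \<delta> \<and> \<delta> \<le> pi \<and> phase_on {c - \<delta> <..< c + \<delta>} \<phi> \<and>
        (\<forall>r \<eta> \<psi>. 0 < r \<and> r < \<delta> \<and> cutoff c r \<eta> \<and> cutoff d r \<psi> \<longrightarrow>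
           osc_rep m \<phi> c \<delta> d \<eta> \<psi> A))}"

text \<open>Operators on real sections belong to a class iff their complexifications do.\<close>

definition complexify ::
  "((circle \<Rightarrow> real^'k) \<Rightarrow> circle \<Rightarrow> real^'k) \<Rightarrow> (circle \<Rightarrow> complex^'k) \<Rightarrow> circle \<Rightarrow> complex^'k" where
  "complexify A f p =
     (\<chi> i. Complex (A (\<lambda>q. \<chi> j. Re (f q $ j)) p $ i) (A (\<lambda>q. \<chi> j. Im (f q $ j)) p $ i))"

definition PDO_real :: "((circle \<Rightarrow> real^'k) \<Rightarrow> circle \<Rightarrow> real^'k) set" where
  "PDO_real = {A. complexify A \<in> PDO}"

definition FIO_real :: "((circle \<Rightarrow> real^'k) \<Rightarrow> circle \<Rightarrow> real^'k) set" where
  "FIO_real = {A. complexify A \<in> FIO}"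

text \<open>Below, \<open>P\<close> is the algebra of pseudo-differential operators (\<open>PDO\<close> or \<open>PDO_real\<close>) and
  \<open>Q\<close> the corresponding class of Fourier integral operators.\<close>

definition invertibles ::
  "((circle \<Rightarrow> 'v::real_normed_vector) \<Rightarrow> circle \<Rightarrow> 'v) set
    \<Rightarrow> ((circle \<Rightarrow> 'v) \<Rightarrow> circle \<Rightarrow> 'v) set" where
  "invertibles P = {A \<in> P. \<exists>B\<in>P. \<forall>f\<in>Cinf. A (B f) = f \<and> B (A f) = f}"

definition is_FIO_over ::
  "((circle \<Rightarrow> 'v::real_normed_vector) \<Rightarrow> circle \<Rightarrow> 'v) set \<Rightarrow> (circle \<Rightarrow> circle)
    \<Rightarrow> ((circle \<Rightarrow> 'v) \<Rightarrow> circle \<Rightarrow> 'v) \<Rightarrow> bool" where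
  "is_FIO_over P g A \<longleftrightarrow> g \<in> Diff \<and> (\<exists>B\<in>invertibles P. \<forall>f\<in>Cinf. A f = B f \<circ> g)"

definition FIO_Diff ::
  "((circle \<Rightarrow> 'v::real_normed_vector) \<Rightarrow> circle \<Rightarrow> 'v) set
    \<Rightarrow> ((circle \<Rightarrow> 'v) \<Rightarrow> circle \<Rightarrow> 'v) set" where
  "FIO_Diff P = {A. \<exists>g. is_FIO_over P g A}"

text \<open>For \<open>P\<close> one of the two algebras above, \<open>A\<close> determines \<open>g\<close> uniquely, so the choice operator
  only names this \<open>g\<close>.\<close>

definition pi_tilde ::
  "((circle \<Rightarrow> 'v::real_normed_vector) \<Rightarrow> circle \<Rightarrow> 'v) set
    \<Rightarrow> ((circle \<Rightarrow> 'v) \<Rightarrow> circle \<Rightarrow> 'v) \<Rightarrow> circle \<Rightarrow> circle" where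
  "pi_tilde P A = (SOME g. is_FIO_over P g A)"

definition FIO_res ::
  "((circle \<Rightarrow> 'f::{real_normed_field,euclidean_space}^'k) \<Rightarrow> circle \<Rightarrow> 'f^'k) set
    \<Rightarrow> ((circle \<Rightarrow> 'f^'k) \<Rightarrow> circle \<Rightarrow> 'f^'k)
    \<Rightarrow> ((circle \<Rightarrow> 'f^'k) \<Rightarrow> circle \<Rightarrow> 'f^'k) set" where
  "FIO_res Q \<epsilon> = {A \<in> Q. smoothing (\<lambda>f p. A (\<epsilon> f) p - \<epsilon> (A f) p)}"


section \<open>The operators \<open>\<epsilon>\<close>\<close>

text \<open>Operators determined on \<open>Cinf\<close> by an inner product \<open>ip\<close> are named by the choice operator.
  In the square root, symmetry on all of \<open>Cinf\<close> forces linearity.\<close>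

definition pos_sqrt ::
  "((circle \<Rightarrow> 'v::real_normed_vector) \<Rightarrow> (circle \<Rightarrow> 'v) \<Rightarrow> 'f::real_algebra_1)
    \<Rightarrow> ((circle \<Rightarrow> 'v) \<Rightarrow> circle \<Rightarrow> 'v) \<Rightarrow> (circle \<Rightarrow> 'v) \<Rightarrow> circle \<Rightarrow> 'v" where
  "pos_sqrt ip S = (SOME P. (\<forall>f\<in>Cinf. P f \<in> Cinf) \<and>
     (\<forall>f\<in>Cinf. \<forall>g\<in>Cinf. ip (P f) g = ip f (P g)) \<and>
     (\<forall>f\<in>Cinf. ip (P f) f \<in> nonneg_Reals) \<and>
     (\<forall>f\<in>Cinf. P (P f) = S f))"

definition l2_adjoint ::
  "((circle \<Rightarrow> 'v::real_normed_vector) \<Rightarrow> (circle \<Rightarrow> 'v) \<Rightarrow> 'f::real_algebra_1)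
    \<Rightarrow> ((circle \<Rightarrow> 'v) \<Rightarrow> circle \<Rightarrow> 'v) \<Rightarrow> (circle \<Rightarrow> 'v) \<Rightarrow> circle \<Rightarrow> 'v" where
  "l2_adjoint ip T = (SOME T'. (\<forall>f\<in>Cinf. T' f \<in> Cinf) \<and>
     (\<forall>f\<in>Cinf. \<forall>g\<in>Cinf. ip (T f) g = ip f (T' g)))"

definition kernel_proj ::
  "((circle \<Rightarrow> 'v::real_normed_vector) \<Rightarrow> (circle \<Rightarrow> 'v) \<Rightarrow> 'f::real_algebra_1)
    \<Rightarrow> ((circle \<Rightarrow> 'v) \<Rightarrow> circle \<Rightarrow> 'v) \<Rightarrow> (circle \<Rightarrow> 'v) \<Rightarrow> circle \<Rightarrow> 'v" where
  "kernel_proj ip T = (SOME p. \<forall>f\<in>Cinf. p f \<in> Cinf \<and> T (p f) = (\<lambda>_. 0) \<and>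
     (\<forall>h\<in>Cinf. T h = (\<lambda>_. 0) \<longrightarrow> ip (\<lambda>q. f q - p f q) h = 0))"

subsection \<open>The complex case\<close>

definition ip_complex :: "(circle \<Rightarrow> complex^'k) \<Rightarrow> (circle \<Rightarrow> complex^'k) \<Rightarrow> complex" where
  "ip_complex f g = integral {0..2*pi} (\<lambda>t. \<Sum>i\<in>UNIV. f (circ t) $ i * cnj (g (circ t) $ i))"

definition D_complex :: "(circle \<Rightarrow> complex^'k) \<Rightarrow> circle \<Rightarrow> complex^'k" where
  "D_complex f p = (- \<i>) *s ddt f p"

definition absD_complex :: "(circle \<Rightarrow> complex^'k) \<Rightarrow> circle \<Rightarrow> complex^'k" where
  "absD_complex = pos_sqrt ip_complex (\<lambda>f p. - ddt (ddt f) p)"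

definition mean :: "(circle \<Rightarrow> complex^'k) \<Rightarrow> complex^'k" where
  "mean f = (1 / (2*pi)) *\<^sub>R integral {0..2*pi} (\<lambda>t. f (circ t))"

text \<open>\<open>absD_complex\<close> vanishes on constants and is bijective on sections of mean zero, the orthogonal
  complement of the constants. There \<open>\<epsilon> = D |D|\<^sup>-\<^sup>1\<close>, while \<open>\<epsilon>\<close> is the identity on constants.\<close>

definition eps_complex :: "(circle \<Rightarrow> complex^'k) \<Rightarrow> circle \<Rightarrow> complex^'k" where
  "eps_complex f p =
     D_complex (inv_into {h \<in> Cinf. mean h = 0} absD_complex (\<lambda>q. f q - mean f)) p + mean f"

subsection \<open>The real case\<close>

definition fibre_metric :: "(circle \<Rightarrow> real^'k^'k) \<Rightarrow> bool" where
  "fibre_metric H \<longleftrightarrow> H \<in> Cinf \<and>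
     (\<forall>p. transpose (H p) = H p \<and> (\<forall>v. v \<noteq> 0 \<longrightarrow> v \<bullet> (H p *v v) > 0))"

text \<open>Covariant derivative along the unit vector field, for the connection form \<open>\<omega>\<close>; every
  connection on the trivial bundle is of this form.\<close>

definition nabla :: "(circle \<Rightarrow> real^'k^'k) \<Rightarrow> (circle \<Rightarrow> real^'k) \<Rightarrow> circle \<Rightarrow> real^'k" where
  "nabla \<omega> f p = ddt f p + \<omega> p *v f p"

definition riemannian_connection ::
  "(circle \<Rightarrow> real^'k^'k) \<Rightarrow> (circle \<Rightarrow> real^'k^'k) \<Rightarrow> bool" where
  "riemannian_connection H \<omega> \<longleftrightarrow> fibre_metric H \<and> \<omega> \<in> Cinf \<and>
     (\<forall>f\<in>Cinf. \<forall>g\<in>Cinf. \<forall>p. ddt (\<lambda>q. f q \<bullet> (H q *v g q)) p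
        = nabla \<omega> f p \<bullet> (H p *v g p) + f p \<bullet> (H p *v nabla \<omega> g p))"

definition ip_real ::
  "(circle \<Rightarrow> real^'k^'k) \<Rightarrow> (circle \<Rightarrow> real^'k) \<Rightarrow> (circle \<Rightarrow> real^'k) \<Rightarrow> real" where
  "ip_real H f g = integral {0..2*pi} (\<lambda>t. f (circ t) \<bullet> (H (circ t) *v g (circ t)))"

definition D_real ::
  "(circle \<Rightarrow> real^'k^'k) \<Rightarrow> (circle \<Rightarrow> real^'k^'k) \<Rightarrow> (circle \<Rightarrow> real^'k) \<Rightarrow> circle \<Rightarrow> real^'k" where
  "D_real H \<omega> f p = nabla \<omega> f p + kernel_proj (ip_real H) (nabla \<omega>) f p"

definition absD_real ::
  "(circle \<Rightarrow> real^'k^'k) \<Rightarrow> (circle \<Rightarrow> real^'k^'k) \<Rightarrow> (circle \<Rightarrow> real^'k) \<Rightarrow> circle \<Rightarrow> real^'k" where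
  "absD_real H \<omega> =
     pos_sqrt (ip_real H) (\<lambda>f. l2_adjoint (ip_real H) (D_real H \<omega>) (D_real H \<omega> f))"

definition eps_real ::
  "(circle \<Rightarrow> real^'k^'k) \<Rightarrow> (circle \<Rightarrow> real^'k^'k) \<Rightarrow> (circle \<Rightarrow> real^'k) \<Rightarrow> circle \<Rightarrow> real^'k" where
  "eps_real H \<omega> f = D_real H \<omega> (inv_into Cinf (absD_real H \<omega>) f)"

end

theory Submission
  imports Defs "HOL-Computational_Algebra.Fundamental_Theorem_Algebra"
begin

text \<open>Write \<open>A f = B f \<circ> g\<close> with \<open>B\<close> pseudo-differential, and lift \<open>g\<close> to \<open>G\<close> on the line, with
  \<open>G' \<ge> c > 0\<close>. For a smooth section \<open>w\<close> and \<open>e\<^sub>n t = cis (n * t)\<close>, \<open>A\<close> maps \<open>e\<^sub>n w\<close> to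
  \<open>(1 + \<bar>n\<bar>) ^ M * cis (n * G t)\<close> times a section whose derivatives are bounded uniformly in \<open>n\<close>. If \<open>n\<close>
  and \<open>m\<close> have opposite signs, the phase \<open>n * G t - m * t\<close> has derivative at least
  \<open>min c 1 * (\<bar>n\<bar> + \<bar>m\<bar>)\<close> in absolute value, so the \<open>m\<close>-th Fourier coefficient of \<open>A (e\<^sub>n w)\<close> decays rapidly
  in \<open>n\<close> and \<open>m\<close>. In a suitable smooth frame, \<open>\<epsilon>\<close> is a Fourier multiplier which is constant on \<open>n > 0\<close> and
  on \<open>n < 0\<close>; hence only such coefficients (and those with \<open>n = 0\<close> or \<open>m = 0\<close>, which decay as well) survive
  in the commutator of \<open>A\<close> and \<open>\<epsilon>\<close>, and its kernel is smooth.

  In the complex case the standard frame and the multiplier \<open>sgn n\<close> do. In the real case, a parallel frame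
  of the complexified bundle which diagonalizes the (unitary) monodromy becomes periodic after
  multiplication with \<open>cis (\<theta>\<^sub>j * t)\<close>, \<open>0 \<le> \<theta>\<^sub>j < 1\<close>. The covariant derivative acts on it by
  \<open>\<i> * (n + \<theta>\<^sub>j)\<close>, and \<open>\<epsilon>\<close> by \<open>\<i> * sgn (n + \<theta>\<^sub>j)\<close>, or \<open>1\<close> where \<open>n + \<theta>\<^sub>j = 0\<close>. The square roots
  in the definition of \<open>\<epsilon>\<close> are identified by their action on eigensections.\<close>

section \<open>Families with uniformly bounded derivatives\<close>

text \<open>Operators are assumed to be linear on smooth sections and nothing more, so they do not
  pass through Fourier series by themselves, and their oscillatory representations hold one arc at a
  time, up to smooth kernels. Both gaps are closed chart by chart: termwise action on
  \<open>ser c p *s w p\<close> and the estimate for \<open>ee n p *s w p\<close> are proved for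
  each localized piece and added up under a partition of unity. Three bumps on half circles suffice,
  since any two of them lie in one arc of radius 5*pi/6 < pi. The order of the operator costs one
  fixed power of 1 + |n|, while nonstationary phase gains arbitrary powers; what matters is that all
  constants are uniform in n, hence the calculus of families below. Besides smoothness of the
  commutator, membership in the class of Fourier integral operators has to be shown, by transporting
  charts along g. In the real case operators are complexified; the multipliers are functions of the
  frequency n + \<theta>_j taking conjugate values at opposite frequencies, which is the condition
  for returning to real sections.\<close>

primrec ubk :: "real set \<Rightarrow> nat \<Rightarrow> ('a \<Rightarrow> real \<Rightarrow> 'v::real_normed_vector) \<Rightarrow> bool" where
  "ubk T 0 F \<longleftrightarrow> (\<exists>C. \<forall>\<alpha>. \<forall>t\<in>T. norm (F \<alpha> t) \<le> C)"
| "ubk T (Suc k) F \<longleftrightarrow> (\<exists>C. \<forall>\<alpha>. \<forall>t\<in>T. norm (F \<alpha> t) \<le> C) \<and>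
     (\<exists>F'. (\<forall>\<alpha> t. (F \<alpha> has_vector_derivative F' \<alpha> t) (at t)) \<and> ubk T k F')"

text \<open>Differentiability is required on the whole line, the bounds only on T and uniformly in
  the index. So \<open>ub {}\<close> expresses mere smoothness of each member, and
  \<open>ub UNIV\<close> uniform control of all derivatives; the finite depths k make induction
  available for the closure properties.\<close>

definition ub :: "real set \<Rightarrow> ('a \<Rightarrow> real \<Rightarrow> 'v::real_normed_vector) \<Rightarrow> bool" where
  "ub T F \<longleftrightarrow> (\<forall>k. ubk T k F)"

definition dv :: "('a \<Rightarrow> real \<Rightarrow> 'v::real_normed_vector) \<Rightarrow> 'a \<Rightarrow> real \<Rightarrow> 'v" where
  "dv F \<alpha> t = vector_derivative (F \<alpha>) (at t)"

lemma ubk_bound: "ubk T k F \<Longrightarrow> \<exists>C. \<forall>\<alpha>. \<forall>t\<in>T. norm (F \<alpha> t) \<le> C"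
  by (cases k) auto

lemma ubk_SucI:
  assumes "\<exists>C. \<forall>\<alpha>. \<forall>t\<in>T. norm (F \<alpha> t) \<le> C"
    and "\<forall>\<alpha> t. (F \<alpha> has_vector_derivative F' \<alpha> t) (at t)" "ubk T k F'"
  shows "ubk T (Suc k) F"
  unfolding ubk.simps(2) using assms by blast

lemma ubk_mono: "ubk T (Suc k) F \<Longrightarrow> ubk T k F"
proof (induction k arbitrary: F)
  case (Suc k)
  then obtain F' where "\<forall>\<alpha> t. (F \<alpha> has_vector_derivative F' \<alpha> t) (at t)" "ubk T (Suc k) F'"
    by auto
  with Suc show ?case
    by (metis ubk.simps(2) ubk_bound)
qed simp

lemma dv_eq:
  assumes "\<And>\<alpha> t. (F \<alpha> has_vector_derivative F' \<alpha> t) (at t)"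
  shows "dv F = F'"
  using assms by (auto simp: dv_def fun_eq_iff intro!: vector_derivative_at)

lemma ub_deriv: "ub T F \<Longrightarrow> (F \<alpha> has_vector_derivative dv F \<alpha> t) (at t)"
proof -
  assume "ub T F"
  then have "ubk T (Suc 0) F" by (simp only: ub_def)
  then obtain F' where "\<And>\<alpha> t. (F \<alpha> has_vector_derivative F' \<alpha> t) (at t)" by auto
  then show ?thesis using dv_eq by metis
qed

lemma ub_dv: "ub T F \<Longrightarrow> ub T (dv F)"
  unfolding ub_def
proof
  fix k assume "\<forall>k. ubk T k F"
  then have "ubk T (Suc k) F" by blast
  then obtain F' where "\<And>\<alpha> t. (F \<alpha> has_vector_derivative F' \<alpha> t) (at t)" "ubk T k F'" by auto
  then show "ubk T k (dv F)" using dv_eq by metis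
qed

lemma ub_bound: "ub T F \<Longrightarrow> \<exists>C. \<forall>\<alpha>. \<forall>t\<in>T. norm (F \<alpha> t) \<le> C"
  unfolding ub_def using ubk_bound by blast

lemma ub_boundE:
  assumes "ub T F"
  obtains C where "C > 0" "\<And>\<alpha> t. t \<in> T \<Longrightarrow> norm (F \<alpha> t) \<le> C"
proof -
  from ub_bound[OF assms] obtain C where "\<And>\<alpha> t. t \<in> T \<Longrightarrow> norm (F \<alpha> t) \<le> C" by blast
  then have "\<And>\<alpha> t. t \<in> T \<Longrightarrow> norm (F \<alpha> t) \<le> max C 1" by (meson max.coboundedI1)
  then show ?thesis using that[of "max C 1"] by simp
qed

lemma ub_continuous: "ub T F \<Longrightarrow> continuous_on A (F \<alpha>)"
  by (meson ub_deriv continuous_at_imp_continuous_on has_vector_derivative_continuous)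

lemma ubk_reindex: "ubk T k F \<Longrightarrow> ubk T k (\<lambda>\<beta>. F (h \<beta>))"
proof (induction k arbitrary: F)
  case 0 then show ?case by auto
next
  case (Suc k)
  then obtain F' where "\<forall>\<alpha> t. (F \<alpha> has_vector_derivative F' \<alpha> t) (at t)" "ubk T k F'"
    by auto
  moreover have "\<exists>C. \<forall>\<beta>. \<forall>t\<in>T. norm (F (h \<beta>) t) \<le> C" using Suc.prems by (auto; blast)
  ultimately show ?case using Suc.IH[of F'] by (auto intro!: exI[of _ "\<lambda>\<beta>. F' (h \<beta>)"])
qed

lemma ub_reindex: "ub T F \<Longrightarrow> ub T (\<lambda>\<beta>. F (h \<beta>))"
  unfolding ub_def using ubk_reindex by blast

lemma ubk_subset: "ubk T k F \<Longrightarrow> S \<subseteq> T \<Longrightarrow> ubk S k F"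
proof (induction k arbitrary: F)
  case 0 then show ?case by (auto; meson subsetD)
next
  case (Suc k)
  then obtain F' where "\<forall>\<alpha> t. (F \<alpha> has_vector_derivative F' \<alpha> t) (at t)" "ubk T k F'"
    by auto
  moreover have "\<exists>C. \<forall>\<alpha>. \<forall>t\<in>S. norm (F \<alpha> t) \<le> C" using Suc.prems by (auto; meson subsetD)
  ultimately show ?case using Suc.IH Suc.prems by auto
qed

lemma ub_subset: "ub T F \<Longrightarrow> S \<subseteq> T \<Longrightarrow> ub S F"
  unfolding ub_def using ubk_subset by blast

lemma ubk_zero: "ubk T k (\<lambda>\<alpha> t. 0)"
  by (induction k) (auto intro!: exI[of _ "\<lambda>\<alpha> t. 0"] exI[of _ "0::real"])

lemma ubk_const: "\<forall>\<alpha>. norm (c \<alpha>) \<le> C \<Longrightarrow> ubk T k (\<lambda>\<alpha> t. c \<alpha>)"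
  using ubk_zero[of T "k - 1"] by (cases k) (auto intro!: exI[of _ "\<lambda>\<alpha> t. 0"])

lemma ub_const: "\<forall>\<alpha>. norm (c \<alpha>) \<le> C \<Longrightarrow> ub T (\<lambda>\<alpha> t. c \<alpha>)"
  by (auto simp: ub_def intro: ubk_const)

lemma ub_const': "ub T (\<lambda>\<alpha> t. c)"
  by (rule ub_const) auto

lemma ubk_add: "ubk T k F \<Longrightarrow> ubk T k G \<Longrightarrow> ubk T k (\<lambda>\<alpha> t. F \<alpha> t + G \<alpha> t)"
proof (induction k arbitrary: F G)
  case 0
  then obtain C D where "\<forall>\<alpha>. \<forall>t\<in>T. norm (F \<alpha> t) \<le> C" "\<forall>\<alpha>. \<forall>t\<in>T. norm (G \<alpha> t) \<le> D" by auto
  then show ?case by (auto intro!: exI[of _ "C + D"] norm_triangle_mono)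
next
  case (Suc k)
  from Suc.prems obtain C D F' G' where *: "\<forall>\<alpha>. \<forall>t\<in>T. norm (F \<alpha> t) \<le> C" "\<forall>\<alpha>. \<forall>t\<in>T. norm (G \<alpha> t) \<le> D"
    "\<forall>\<alpha> t. (F \<alpha> has_vector_derivative F' \<alpha> t) (at t)" "ubk T k F'"
    "\<forall>\<alpha> t. (G \<alpha> has_vector_derivative G' \<alpha> t) (at t)" "ubk T k G'"
    by auto
  have "\<exists>C. \<forall>\<alpha>. \<forall>t\<in>T. norm (F \<alpha> t + G \<alpha> t) \<le> C"
    using * by (auto intro!: exI[of _ "C + D"] norm_triangle_mono)
  moreover have "\<forall>\<alpha> t. ((\<lambda>t. F \<alpha> t + G \<alpha> t) has_vector_derivative F' \<alpha> t + G' \<alpha> t) (at t)"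
    using * by (auto intro!: derivative_eq_intros)
  ultimately show ?case using Suc.IH[OF *(4,6)] by (rule ubk_SucI)
qed

lemma ub_add: "ub T F \<Longrightarrow> ub T G \<Longrightarrow> ub T (\<lambda>\<alpha> t. F \<alpha> t + G \<alpha> t)"
  by (auto simp: ub_def intro: ubk_add)

lemma ub_sum: "(\<And>i. i \<in> I \<Longrightarrow> ub T (F i)) \<Longrightarrow> ub T (\<lambda>\<alpha> t. \<Sum>i\<in>I. F i \<alpha> t)"
  by (induction I rule: infinite_finite_induct) (auto intro: ub_add ub_const')

lemma bilinear_family_bound:
  assumes b: "bounded_bilinear b"
    and *: "\<forall>\<alpha>. \<forall>t\<in>T. norm (F \<alpha> t) \<le> C" "\<forall>\<alpha>. \<forall>t\<in>T. norm (G \<alpha> t) \<le> D"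
  shows "\<exists>K. \<forall>\<alpha>. \<forall>t\<in>T. norm (b (F \<alpha> t) (G \<alpha> t)) \<le> K"
proof -
  obtain K where K: "K \<ge> 0" "\<And>x y. norm (b x y) \<le> norm x * norm y * K"
    using bounded_bilinear.nonneg_bounded[OF b] by blast
  have "norm (b (F \<alpha> t) (G \<alpha> t)) \<le> \<bar>C\<bar> * \<bar>D\<bar> * K" if "t \<in> T" for \<alpha> t
  proof -
    have "norm (F \<alpha> t) \<le> \<bar>C\<bar>" "norm (G \<alpha> t) \<le> \<bar>D\<bar>"
      using * that by (meson abs_ge_self order_trans)+
    then have "norm (F \<alpha> t) * norm (G \<alpha> t) * K \<le> \<bar>C\<bar> * \<bar>D\<bar> * K"
      using K(1) by (intro mult_mono) auto
    then show ?thesis using K(2) order_trans by blast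
  qed
  then show ?thesis by blast
qed

text \<open>The Leibniz rule, for a general bounded bilinear map so that scalar, matrix-vector and
  other products are all instances.\<close>

lemma ubk_bilinear:
  assumes b: "bounded_bilinear b"
  shows "ubk T k F \<Longrightarrow> ubk T k G \<Longrightarrow> ubk T k (\<lambda>\<alpha> t. b (F \<alpha> t) (G \<alpha> t))"
proof (induction k arbitrary: F G)
  case 0
  then show ?case by (auto intro: bilinear_family_bound[OF b])
next
  case (Suc k)
  from Suc.prems obtain C D F' G' where *: "\<forall>\<alpha>. \<forall>t\<in>T. norm (F \<alpha> t) \<le> C" "\<forall>\<alpha>. \<forall>t\<in>T. norm (G \<alpha> t) \<le> D"
    "\<forall>\<alpha> t. (F \<alpha> has_vector_derivative F' \<alpha> t) (at t)" "ubk T k F'"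
    "\<forall>\<alpha> t. (G \<alpha> has_vector_derivative G' \<alpha> t) (at t)" "ubk T k G'"
    by auto
  have "\<exists>K. \<forall>\<alpha>. \<forall>t\<in>T. norm (b (F \<alpha> t) (G \<alpha> t)) \<le> K"
    by (rule bilinear_family_bound[OF b *(1,2)])
  moreover have "\<forall>\<alpha> t. ((\<lambda>t. b (F \<alpha> t) (G \<alpha> t)) has_vector_derivative
      b (F \<alpha> t) (G' \<alpha> t) + b (F' \<alpha> t) (G \<alpha> t)) (at t)"
    using * by (auto intro!: bounded_bilinear.has_vector_derivative[OF b])
  moreover have "ubk T k (\<lambda>\<alpha> t. b (F \<alpha> t) (G' \<alpha> t) + b (F' \<alpha> t) (G \<alpha> t))"
    by (intro ubk_add Suc.IH * ubk_mono[OF Suc.prems(1)] ubk_mono[OF Suc.prems(2)])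
  ultimately show ?case by (intro ubk_SucI[of T _ _ k]) blast+
qed

lemma ub_bilinear:
  "bounded_bilinear b \<Longrightarrow> ub T F \<Longrightarrow> ub T G \<Longrightarrow> ub T (\<lambda>\<alpha> t. b (F \<alpha> t) (G \<alpha> t))"
  by (auto simp: ub_def intro: ubk_bilinear)

text \<open>The linear map is viewed as the bilinear map \<open>x *\<^sub>R h y\<close>, fed with
  the constant 1 in its first argument.\<close>

lemma ub_linear:
  assumes h: "bounded_linear h" and F: "ub T F"
  shows "ub T (\<lambda>\<alpha> t. h (F \<alpha> t))"
proof -
  have "bounded_bilinear (\<lambda>(x::real) y. x *\<^sub>R h y)"
    using bounded_bilinear.comp[OF bounded_bilinear_scaleR bounded_linear_ident h] by simp
  from ub_bilinear[OF this ub_const'[of T 1] F] show ?thesis by simp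
qed

lemmas ub_scaleR = ub_bilinear[OF bounded_bilinear_scaleR]
lemmas ub_mult = ub_bilinear[OF bounded_bilinear_mult]

lemma ub_uminus: "ub T F \<Longrightarrow> ub T (\<lambda>\<alpha> t. - F \<alpha> t)"
  by (rule ub_linear[OF bounded_linear_minus[OF bounded_linear_ident]])

lemma ub_diff: "ub T F \<Longrightarrow> ub T G \<Longrightarrow> ub T (\<lambda>\<alpha> t. F \<alpha> t - G \<alpha> t)"
  using ub_add[OF _ ub_uminus] by fastforce

text \<open>Boundedness is asked of G' rather than of G, because G will be a lift of a circle map or
  a translation, which is unbounded on the line. The chain rule produces a product to which the
  induction hypothesis applies.\<close>

lemma ubk_comp:
  assumes G: "\<And>\<alpha> t. (G \<alpha> has_vector_derivative G' \<alpha> t) (at t)" "\<And>k. ubk T k G'"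
    and T: "\<And>\<alpha> t. t \<in> T \<Longrightarrow> G \<alpha> t \<in> T'"
  shows "ubk T' k F \<Longrightarrow> ubk T k (\<lambda>\<alpha> t. F \<alpha> (G \<alpha> t))"
proof (induction k arbitrary: F)
  case 0 then show ?case using T by fastforce
next
  case (Suc k)
  from Suc.prems obtain C F' where *: "\<forall>\<alpha>. \<forall>t\<in>T'. norm (F \<alpha> t) \<le> C"
    "\<forall>\<alpha> t. (F \<alpha> has_vector_derivative F' \<alpha> t) (at t)" "ubk T' k F'"
    by auto
  have "\<exists>C. \<forall>\<alpha>. \<forall>t\<in>T. norm (F \<alpha> (G \<alpha> t)) \<le> C"
    using *(1) T by blast
  moreover have "\<forall>\<alpha> t. ((\<lambda>t. F \<alpha> (G \<alpha> t)) has_vector_derivative G' \<alpha> t *\<^sub>R F' \<alpha> (G \<alpha> t)) (at t)"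
    using vector_diff_chain_at[OF G(1), unfolded o_def] *(2) by blast
  moreover have "ubk T k (\<lambda>\<alpha> t. G' \<alpha> t *\<^sub>R F' \<alpha> (G \<alpha> t))"
    by (intro ubk_bilinear[OF bounded_bilinear_scaleR] G Suc.IH *)
  ultimately show ?case by (intro ubk_SucI)
qed

lemma ub_comp:
  assumes "\<And>\<alpha> t. (G \<alpha> has_vector_derivative G' \<alpha> t) (at t)" "ub T G'"
    and "\<And>\<alpha> t. t \<in> T \<Longrightarrow> G \<alpha> t \<in> T'" "ub T' F"
  shows "ub T (\<lambda>\<alpha> t. F \<alpha> (G \<alpha> t))"
  using ubk_comp[of G G' T T'] assms unfolding ub_def by blast

text \<open>Induction on the depth: the derivative -F'/F^2 involves the inverse at the lower depth.
  Nonvanishing everywhere gives differentiability, the lower bound on T gives the estimates.\<close>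

lemma ub_inverse:
  fixes F :: "'a \<Rightarrow> real \<Rightarrow> 'v::real_normed_field"
  assumes F: "ub T F" and nz: "\<And>\<alpha> t. F \<alpha> t \<noteq> 0"
    and c: "c > 0" "\<And>\<alpha> t. t \<in> T \<Longrightarrow> norm (F \<alpha> t) \<ge> c"
  shows "ub T (\<lambda>\<alpha> t. inverse (F \<alpha> t))"
proof -
  have bd: "norm (inverse (F \<alpha> t)) \<le> inverse c" if "t \<in> T" for \<alpha> t
    using c(1) c(2)[OF that] by (simp add: norm_inverse le_imp_inverse_le)
  have "ubk T k (\<lambda>\<alpha> t. inverse (F \<alpha> t))" for k
  proof (induction k)
    case 0 then show ?case using bd by auto
  next
    case (Suc k)
    have "((\<lambda>t. inverse (F \<alpha> t)) has_vector_derivative - (inverse (F \<alpha> t) * dv F \<alpha> t * inverse (F \<alpha> t))) (at t)" for \<alpha> t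
      using Deriv.has_derivative_inverse[OF nz ub_deriv[OF F, unfolded has_vector_derivative_def], of \<alpha> t]
      unfolding has_vector_derivative_def by simp
    moreover have "ubk T k (\<lambda>\<alpha> t. - (inverse (F \<alpha> t) * dv F \<alpha> t * inverse (F \<alpha> t)))"
    proof -
      have "ubk T k (dv F)" using ub_dv[OF F] by (simp add: ub_def)
      with Suc have "ubk T k (\<lambda>\<alpha> t. inverse (F \<alpha> t) * dv F \<alpha> t * inverse (F \<alpha> t))"
        by (intro ubk_bilinear[OF bounded_bilinear_mult])
      from ubk_bilinear[OF bounded_bilinear_scaleR ubk_const[of "\<lambda>_. -1" 1] this] show ?thesis by simp
    qed
    ultimately show ?case using bd by (intro ubk_SucI[of T _ _ k] allI) blast+
  qed
  then show ?thesis by (simp add: ub_def)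
qed

lemma ub_chain:
  assumes "ub T F"
  shows "((((dv ^^ n) F) \<alpha>) has_vector_derivative ((dv ^^ Suc n) F) \<alpha> t) (at t)" "ub T ((dv ^^ n) F)"
proof -
  show "ub T ((dv ^^ n) F)" by (induction n) (auto intro: ub_dv assms)
  from ub_deriv[OF this] show "((((dv ^^ n) F) \<alpha>) has_vector_derivative ((dv ^^ Suc n) F) \<alpha> t) (at t)"
    by simp
qed

lemma ub_of_chain:
  assumes "\<And>n \<alpha> t. (F n \<alpha> has_vector_derivative F (Suc n) \<alpha> t) (at t)"
    and "\<And>n. \<exists>C. \<forall>\<alpha>. \<forall>t\<in>T. norm (F n \<alpha> t) \<le> C"
  shows "ub T (F n)"
proof -
  have "ubk T k (F n)" for k
    by (induction k arbitrary: n) (use assms in \<open>blast intro: ubk_SucI iffD2[OF ubk.simps(1)]\<close>)+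
  then show ?thesis by (simp add: ub_def)
qed

lemma smooth_curve_ub: "smooth_curve f \<longleftrightarrow> ub {} (\<lambda>_::unit. f)"
proof
  assume "smooth_curve f"
  then obtain F where F: "F 0 = f" "\<And>n t. (F n has_vector_derivative F (Suc n) t) (at t)"
    by (auto simp: smooth_curve_def)
  show "ub {} (\<lambda>_::unit. f)"
    using ub_of_chain[of "\<lambda>n (_::unit). F n" "{}" 0] F by simp
next
  assume *: "ub {} (\<lambda>_::unit. f)"
  show "smooth_curve f" unfolding smooth_curve_def
    by (rule exI[of _ "\<lambda>n. (dv ^^ n) (\<lambda>_::unit. f) ()"]) (use ub_chain(1)[OF *, where \<alpha>="()"] in simp)
qed

lemma ub_smooth: "ub T F \<Longrightarrow> smooth_curve (F \<alpha>)"
  unfolding smooth_curve_ub using ub_subset[of T F "{}"] ub_reindex[of "{}" F "\<lambda>_. \<alpha>"] by simp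

text \<open>As no bounds are demanded, the derivative chains of the members can be chosen
  independently of each other.\<close>

lemma ub_smooth_iff: "ub {} F \<longleftrightarrow> (\<forall>\<alpha>. smooth_curve (F \<alpha>))"
proof
  assume *: "\<forall>\<alpha>. smooth_curve (F \<alpha>)"
  then have "\<exists>E. E 0 = F \<alpha> \<and> (\<forall>n t. (E n has_vector_derivative E (Suc n) t) (at t))" for \<alpha>
    by (simp add: smooth_curve_def)
  then obtain E where E: "\<And>\<alpha>. E \<alpha> 0 = F \<alpha>" "\<And>\<alpha> n t. (E \<alpha> n has_vector_derivative E \<alpha> (Suc n) t) (at t)"
    by metis
  have "ub {} (\<lambda>\<alpha>. E \<alpha> 0)"
    by (rule ub_of_chain[of "\<lambda>n \<alpha>. E \<alpha> n"]) (use E in auto)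
  then show "ub {} F" by (simp add: E)
qed (blast dest: ub_smooth)

section \<open>The circle, its angles and smooth sections\<close>

lemma circ_2pi [simp]: "circ (t + 2*pi) = circ t"
  by (simp add: circ_def cis.ctr)

lemma Rep_circ [simp]: "Rep_circle (circ t) = cis t"
  by (simp add: circ_def Abs_circle_inverse)

lemma norm_Rep [simp]: "norm (Rep_circle p) = 1"
  using Rep_circle[of p] by simp

lemma circ_Arg [simp]: "circ (Arg (Rep_circle p)) = p"
proof -
  have "Rep_circle p \<noteq> 0" by (metis norm_Rep norm_zero zero_neq_one)
  then have "cis (Arg (Rep_circle p)) = Rep_circle p" by (simp add: cis_Arg sgn_div_norm)
  then show ?thesis by (simp add: circ_def Rep_circle_inverse)
qed

lemma circ_surj: obtains t where "p = circ t"
  using circ_Arg by metis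

lemma cis_2pi_int: "cis (t + 2*pi * of_int n) = cis t"
proof -
  have "cis (2*pi * of_int n) = 1" by (rule cis_multiple_2pi) simp
  then show ?thesis by (simp flip: cis_mult)
qed

lemma circ_2pi_int: "circ (t + 2*pi * of_int n) = circ t"
  by (simp add: circ_def cis_2pi_int)

lemma circ_eq_iff: "circ s = circ t \<longleftrightarrow> (\<exists>n::int. s = t + 2*pi * of_int n)"
proof
  assume "circ s = circ t"
  then have "cis s = cis t" by (metis Rep_circ)
  then have "cis (s - t) = 1" by (simp flip: cis_divide)
  then have "cos (s - t) = 1" by (simp add: complex_eq_iff)
  then obtain n::int where "s - t = of_int n * 2 * pi"
    by (auto simp: cos_one_2pi_int)
  then show "\<exists>n::int. s = t + 2*pi * of_int n" by (intro exI[of _ n]) (simp add: algebra_simps)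
qed (auto simp: circ_2pi_int)

lemma period_window:
  obtains n :: int where "a \<le> t + 2*pi * of_int n" "t + 2*pi * of_int n < a + 2*pi"
proof -
  define n where "n = - \<lfloor>(t - a)/(2*pi)\<rfloor>"
  have "real_of_int \<lfloor>(t - a)/(2*pi)\<rfloor> \<le> (t - a)/(2*pi)" "(t - a)/(2*pi) < of_int \<lfloor>(t - a)/(2*pi)\<rfloor> + 1"
    by linarith+
  then have "of_int \<lfloor>(t - a)/(2*pi)\<rfloor> * (2*pi) \<le> t - a" "t - a < (of_int \<lfloor>(t - a)/(2*pi)\<rfloor> + 1) * (2*pi)"
    by (simp_all only: pos_le_divide_eq pos_divide_less_eq pi_gt_zero mult_pos_pos zero_less_numeral)
  then show ?thesis by (intro that[of n]) (simp_all only: n_def of_int_minus, simp_all add: algebra_simps)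
qed

lemma circ_window: obtains t where "a \<le> t" "t < a + 2*pi" "p = circ t"
  by (metis circ_surj period_window circ_2pi_int)

lemma periodic_int:
  fixes f :: "real \<Rightarrow> 'v"
  assumes "\<And>t. f (t + 2*pi) = f t"
  shows "f (t + 2*pi * of_int n) = f t"
proof -
  have nat: "f (t + 2*pi * of_nat k) = f t" for t k
  proof (induction k)
    case (Suc k)
    have "t + 2*pi * of_nat (Suc k) = (t + 2*pi * of_nat k) + 2*pi" by (simp add: algebra_simps)
    then show ?case using Suc assms by metis
  qed simp
  show ?thesis
  proof (cases "n \<ge> 0")
    case True then show ?thesis using nat[of t "nat n"] by simp
  next
    case False
    then show ?thesis using nat[of "t + 2*pi * of_int n" "nat (-n)"] by (simp add: algebra_simps)
  qed
qed

lemma periodic_bounded: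
  fixes f :: "real \<Rightarrow> 'v::real_normed_vector"
  assumes "\<And>t. f (t + 2*pi) = f t" "continuous_on UNIV f"
  shows "\<exists>C. \<forall>t. norm (f t) \<le> C"
proof -
  have "compact (f ` {0..2*pi})" using assms(2) by (intro compact_continuous_image) (auto intro: continuous_on_subset)
  then obtain C where C: "\<And>t. t \<in> {0..2*pi} \<Longrightarrow> norm (f t) \<le> C"
    by (meson compact_imp_bounded bounded_iff imageI)
  have "norm (f t) \<le> C" for t
  proof -
    obtain n::int where "0 \<le> t + 2*pi * of_int n" "t + 2*pi * of_int n < 0 + 2*pi" by (rule period_window)
    then show ?thesis using C[of "t + 2*pi * of_int n"] periodic_int[of f t n] assms(1) by auto
  qed
  then show ?thesis by blast
qed

lemma periodic_deriv:
  assumes "\<And>t. f (t + 2*pi) = f t" "\<And>t. (f has_vector_derivative f' t) (at t)"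
  shows "f' (t + 2*pi) = f' t"
proof -
  have "((f \<circ> (\<lambda>t. t + 2*pi)) has_vector_derivative 1 *\<^sub>R f' (t + 2*pi)) (at t)"
    by (rule vector_diff_chain_at) (auto intro!: derivative_eq_intros assms(2))
  moreover have "f \<circ> (\<lambda>t. t + 2*pi) = f" using assms(1) by auto
  ultimately show ?thesis using assms(2)[of t] vector_derivative_unique_at by fastforce
qed

text \<open>Derivatives of a periodic function are periodic, hence bounded by compactness of one
  period. The index type of the resulting constant family is left free, so that it can be combined
  with families of any index.\<close>

lemma ub_periodic:
  assumes F: "ub {} F" and p: "\<And>\<alpha> t. F \<alpha> (t + 2*pi) = F \<alpha> t"
  shows "ub UNIV (\<lambda>_::'b. F \<alpha>)"
proof -
  have per: "(dv ^^ n) F \<alpha> (t + 2*pi) = (dv ^^ n) F \<alpha> t" for n t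
  proof (induction n arbitrary: t)
    case (Suc n)
    show ?case by (rule periodic_deriv[OF Suc ub_chain(1)[OF F]])
  qed (simp add: p)
  have "ub UNIV (\<lambda>_::'b. (dv ^^ 0) F \<alpha>)"
  proof (rule ub_of_chain[of "\<lambda>n _. (dv ^^ n) F \<alpha>"])
    fix n show "\<exists>C. \<forall>(_::'b). \<forall>t\<in>UNIV. norm ((dv ^^ n) F \<alpha> t) \<le> C"
      using periodic_bounded[OF per[of n] ub_continuous[OF ub_chain(2)[OF F]]] by auto
  qed (use ub_chain(1)[OF F] in simp)
  then show ?thesis by simp
qed

lemma Cinf_ub: "f \<in> Cinf \<longleftrightarrow> ub UNIV (\<lambda>_::'b. \<lambda>t. f (circ t))"
proof
  assume "f \<in> Cinf"
  then have "ub {} (\<lambda>_::unit. \<lambda>t. f (circ t))" by (simp add: Cinf_def smooth_curve_ub)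
  from ub_periodic[OF this] show "ub UNIV (\<lambda>_::'b. \<lambda>t. f (circ t))" by simp
qed (auto simp: Cinf_def dest: ub_smooth)

text \<open>\<open>ddt\<close> differentiates at the principal argument; any other angle of the same
  point differs from it by a multiple of 2*pi, and the derivative of a periodic function is
  periodic.\<close>

lemma Cinf_deriv:
  assumes "f \<in> Cinf"
  shows "((\<lambda>t. f (circ t)) has_vector_derivative ddt f (circ t)) (at t)"
proof -
  let ?f = "\<lambda>t. f (circ t)"
  have ub: "ub {} (\<lambda>_::unit. ?f)" using assms by (simp add: Cinf_def smooth_curve_ub)
  note d = ub_deriv[OF ub, of "()"]
  let ?s = "Arg (Rep_circle (circ t))"
  have "circ ?s = circ t" by (rule circ_Arg)
  then obtain n where n: "?s = t + 2*pi * of_int n" by (auto simp only: circ_eq_iff)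
  have "dv (\<lambda>_::unit. ?f) () ?s = dv (\<lambda>_::unit. ?f) () t"
    unfolding n by (rule periodic_int, rule periodic_deriv[OF _ d]) simp
  then show ?thesis using d[of t] by (simp add: ddt_def dv_def)
qed

lemma Cinf_ddt: "f \<in> Cinf \<Longrightarrow> ddt f \<in> Cinf"
proof -
  assume f: "f \<in> Cinf"
  then have "ub {} (\<lambda>_::unit. \<lambda>t. f (circ t))" by (simp add: Cinf_def smooth_curve_ub)
  from ub_dv[OF this] dv_eq[of "\<lambda>_::unit. \<lambda>t. f (circ t)"] Cinf_deriv[OF f]
  have "ub {} (\<lambda>_::unit. \<lambda>t. ddt f (circ t))" by metis
  then show ?thesis by (simp add: Cinf_def smooth_curve_ub)
qed

lemma ddt_eq: "(\<And>t. ((\<lambda>t. f (circ t)) has_vector_derivative f' (circ t)) (at t)) \<Longrightarrow> ddt f = f'"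
proof
  fix p assume *: "\<And>t. ((\<lambda>t. f (circ t)) has_vector_derivative f' (circ t)) (at t)"
  have "ddt f p = f' (circ (Arg (Rep_circle p)))"
    unfolding ddt_def by (rule vector_derivative_at[OF *])
  then show "ddt f p = f' p" by (simp only: circ_Arg)
qed

lemma Cinf_continuous: "f \<in> Cinf \<Longrightarrow> continuous_on A (\<lambda>t. f (circ t))"
  by (rule ub_continuous[of UNIV "\<lambda>_::unit. \<lambda>t. f (circ t)"]) (simp add: Cinf_ub[symmetric])

lemma Cinf_const: "(\<lambda>_. c) \<in> Cinf"
  by (simp add: Cinf_def smooth_curve_ub ub_const')

lemma Cinf_add: "f \<in> Cinf \<Longrightarrow> g \<in> Cinf \<Longrightarrow> (\<lambda>p. f p + g p) \<in> Cinf"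
  by (simp add: Cinf_def smooth_curve_ub ub_add)

lemma Cinf_diff: "f \<in> Cinf \<Longrightarrow> g \<in> Cinf \<Longrightarrow> (\<lambda>p. f p - g p) \<in> Cinf"
  by (simp add: Cinf_def smooth_curve_ub ub_diff)

lemma Cinf_sum: "(\<And>i. i \<in> I \<Longrightarrow> f i \<in> Cinf) \<Longrightarrow> (\<lambda>p. \<Sum>i\<in>I. f i p) \<in> Cinf"
  by (simp add: Cinf_def smooth_curve_ub ub_sum)

lemma Cinf_bilinear: "bounded_bilinear b \<Longrightarrow> f \<in> Cinf \<Longrightarrow> g \<in> Cinf \<Longrightarrow> (\<lambda>p. b (f p) (g p)) \<in> Cinf"
  unfolding Cinf_def smooth_curve_ub mem_Collect_eq by (rule ub_bilinear)

lemma Cinf_linear: "bounded_linear h \<Longrightarrow> f \<in> Cinf \<Longrightarrow> (\<lambda>p. h (f p)) \<in> Cinf"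
  unfolding Cinf_def smooth_curve_ub mem_Collect_eq by (rule ub_linear)

lemma ddt_linear: "bounded_linear h \<Longrightarrow> f \<in> Cinf \<Longrightarrow> ddt (\<lambda>p. h (f p)) = (\<lambda>p. h (ddt f p))"
  by (rule ddt_eq) (rule bounded_linear.has_vector_derivative[OF _ Cinf_deriv])

lemma smooth_curve_cis_mult: "smooth_curve (\<lambda>t. cis (a * t))"
  unfolding smooth_curve_def
proof (intro exI[of _ "\<lambda>n t. (\<i> * a) ^ n * cis (a * t)"] conjI allI)
  fix n t
  have "((\<lambda>t. cis (a * t)) has_vector_derivative (\<i> * a) * cis (a * t)) (at t)"
    unfolding has_vector_derivative_def by (auto intro!: derivative_eq_intros simp: scaleR_conv_of_real mult_ac)
  from bounded_linear.has_vector_derivative[OF bounded_linear_mult_right[of "(\<i> * a) ^ n"] this]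
  show "((\<lambda>t. (\<i> * a) ^ n * cis (a * t)) has_vector_derivative (\<i> * a) ^ Suc n * cis (a * t)) (at t)"
    by (simp add: mult_ac)
qed auto

lemma ub_cis: "ub UNIV (\<lambda>_ t. cis t)"
proof -
  have "ub {} (\<lambda>_::unit. cis)" using smooth_curve_cis_mult[of 1] by (simp add: smooth_curve_ub)
  have "cis (t + 2*pi) = cis t" for t using cis_2pi_int[of t 1] by simp
  from ub_periodic[OF \<open>ub {} (\<lambda>_::unit. cis)\<close> this] show ?thesis .
qed

section \<open>Integrals depending on a parameter, and series as integrals\<close>

lemma vector_derivative_bound_linearization:
  fixes f :: "real \<Rightarrow> 'v::real_normed_vector"
  assumes d: "\<And>x. x \<in> {a<..<b} \<Longrightarrow> (f has_vector_derivative f' x) (at x)"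
    and B: "\<And>x. x \<in> {a<..<b} \<Longrightarrow> norm (f' x) \<le> B"
    and xy: "x \<in> {a<..<b}" "y \<in> {a<..<b}"
  shows "norm (f y - f x) \<le> B * \<bar>y - x\<bar>"
proof -
  have "norm (f y - f x) \<le> B * norm (y - x)"
  proof (rule differentiable_bound[of "{a<..<b}" f "\<lambda>x h. h *\<^sub>R f' x"])
    show "(f has_derivative (\<lambda>h. h *\<^sub>R f' x)) (at x within {a<..<b})" if "x \<in> {a<..<b}" for x
      using d[OF that] has_vector_derivative_def has_derivative_at_withinI by blast
    show "onorm (\<lambda>h. h *\<^sub>R f' x) \<le> B" if "x \<in> {a<..<b}" for x
      using B[OF that] onorm_scaleR_left[of "\<lambda>h::real. h" "f' x"] onorm_id[where 'a=real] by (simp add: bounded_linear_ident)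
  qed (use xy in auto)
  then show ?thesis by simp
qed

text \<open>The functions q are first-order remainders divided by the increment: they tend to 0
  pointwise and are dominated by 2 * W through the mean value inequality, so dominated convergence
  applies. The measure is arbitrary, which covers series as well.\<close>

lemma has_vector_derivative_integral:
  fixes g :: "real \<Rightarrow> 'z \<Rightarrow> 'v::{banach,second_countable_topology}"
  assumes int: "\<And>x. x \<in> {a<..<b} \<Longrightarrow> integrable M (g x)"
    and d: "\<And>x z. x \<in> {a<..<b} \<Longrightarrow> ((\<lambda>x. g x z) has_vector_derivative g' x z) (at x)"
    and W: "\<And>x z. x \<in> {a<..<b} \<Longrightarrow> norm (g' x z) \<le> W z" "integrable M W"
    and m: "g' x0 \<in> borel_measurable M"
    and x0: "x0 \<in> {a<..<b}"
  shows "((\<lambda>x. LINT z|M. g x z) has_vector_derivative (LINT z|M. g' x0 z)) (at x0)"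
proof -
  have g'int: "integrable M (g' x0)"
    by (rule Bochner_Integration.integrable_bound[OF W(2) m]) (use W(1)[OF x0] in \<open>auto intro: order_trans[OF _ abs_ge_self]\<close>)
  define q where "q y z = (1 / \<bar>y - x0\<bar>) *\<^sub>R (g y z - (g x0 z + (y - x0) *\<^sub>R g' x0 z))" for y z
  have qm: "q y \<in> borel_measurable M" if "y \<in> {a<..<b}" for y
    unfolding q_def using int[OF that, THEN borel_measurable_integrable] int[OF x0, THEN borel_measurable_integrable] m by measurable
  have qb: "norm (q y z) \<le> 2 * W z" if "y \<in> {a<..<b}" for y z
  proof (cases "y = x0")
    case True
    have "0 \<le> W z" using W(1)[OF x0] norm_ge_zero order_trans by blast
    then show ?thesis by (simp add: q_def True)
  next
    case False
    have "norm (g y z - g x0 z) \<le> W z * \<bar>y - x0\<bar>"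
      by (rule vector_derivative_bound_linearization[OF d W(1) x0 that])
    moreover have "norm ((y - x0) *\<^sub>R g' x0 z) \<le> W z * \<bar>y - x0\<bar>"
      using mult_left_mono[OF W(1)[OF x0, of z], of "\<bar>y - x0\<bar>"] by (simp add: mult.commute)
    ultimately have "norm (g y z - (g x0 z + (y - x0) *\<^sub>R g' x0 z)) \<le> 2 * W z * \<bar>y - x0\<bar>"
      using norm_triangle_ineq4[of "g y z - g x0 z" "(y - x0) *\<^sub>R g' x0 z"] by (simp add: algebra_simps)
    then have "(1 / \<bar>y - x0\<bar>) * norm (g y z - (g x0 z + (y - x0) *\<^sub>R g' x0 z)) \<le> (1 / \<bar>y - x0\<bar>) * (2 * W z * \<bar>y - x0\<bar>)"
      by (intro mult_left_mono) auto
    also have "\<dots> = 2 * W z" using False by simp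
    finally show ?thesis by (simp add: q_def)
  qed
  have "((\<lambda>y. LINT z|M. q y z) \<longlongrightarrow> 0) (at x0)"
    unfolding tendsto_at_iff_sequentially
  proof (intro allI impI)
    fix X assume X: "\<forall>i::nat. X i \<in> UNIV - {x0}" "X \<longlonglongrightarrow> x0"
    have "eventually (\<lambda>n. X n \<in> {a<..<b}) sequentially"
      by (rule topological_tendstoD[OF X(2) open_greaterThanLessThan x0])
    then obtain N where N: "\<And>n. n \<ge> N \<Longrightarrow> X n \<in> {a<..<b}" by (auto simp: eventually_sequentially)
    have "(\<lambda>n. LINT z|M. q (X (n + N)) z) \<longlonglongrightarrow> (LINT z|M. 0)"
    proof (rule integral_dominated_convergence[where w = "\<lambda>z. 2 * W z"])
      show "AE z in M. (\<lambda>n. q (X (n + N)) z) \<longlonglongrightarrow> 0"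
      proof (rule AE_I2)
        fix z
        have "((\<lambda>y. q y z) \<longlongrightarrow> 0) (at x0)"
          using d[OF x0, of z] unfolding has_vector_derivative_def has_derivative_within q_def by simp
        then have "(\<lambda>n. q (X n) z) \<longlonglongrightarrow> 0"
          using X unfolding tendsto_at_iff_sequentially by (auto simp: o_def)
        then show "(\<lambda>n. q (X (n + N)) z) \<longlonglongrightarrow> 0" by (rule LIMSEQ_ignore_initial_segment)
      qed
      show "AE z in M. norm (q (X (n + N)) z) \<le> 2 * W z" for n using N qb by auto
      show "q (X (n + N)) \<in> borel_measurable M" for n using N qm by simp
    qed (use W(2) in auto)
    then have "(\<lambda>n. LINT z|M. q (X n) z) \<longlonglongrightarrow> 0" by (simp add: LIMSEQ_offset[of _ N])
    then show "((\<lambda>y. LINT z|M. q y z) \<circ> X) \<longlonglongrightarrow> 0" by (simp add: o_def)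
  qed
  moreover have "eventually (\<lambda>y. (LINT z|M. q y z) = (1 / \<bar>y - x0\<bar>) *\<^sub>R ((LINT z|M. g y z) - ((LINT z|M. g x0 z) + (y - x0) *\<^sub>R (LINT z|M. g' x0 z)))) (at x0)"
  proof (rule eventually_at_in_open'[THEN eventually_mono, of "{a<..<b}"])
    fix y assume "y \<in> {a<..<b}"
    then show "(LINT z|M. q y z) = (1 / \<bar>y - x0\<bar>) *\<^sub>R ((LINT z|M. g y z) - ((LINT z|M. g x0 z) + (y - x0) *\<^sub>R (LINT z|M. g' x0 z)))"
      unfolding q_def using int[of y] int[OF x0] g'int by simp
  qed (use x0 in auto)
  ultimately have "((\<lambda>y. (1 / \<bar>y - x0\<bar>) *\<^sub>R ((LINT z|M. g y z) - ((LINT z|M. g x0 z) + (y - x0) *\<^sub>R (LINT z|M. g' x0 z)))) \<longlongrightarrow> 0) (at x0)"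
    by (rule Lim_transform_eventually)
  then show ?thesis
    unfolding has_vector_derivative_def has_derivative_within by (simp add: bounded_linear_scaleR_left)
qed

lemma continuous_on_integral_dominated:
  fixes g :: "'x::metric_space \<Rightarrow> 'z \<Rightarrow> 'v::{banach,second_countable_topology}"
  assumes "\<And>z. continuous_on S (\<lambda>x. g x z)" "\<And>x. x \<in> S \<Longrightarrow> g x \<in> borel_measurable M"
    and "\<And>x z. x \<in> S \<Longrightarrow> norm (g x z) \<le> W z" "integrable M W"
  shows "continuous_on S (\<lambda>x. LINT z|M. g x z)"
  unfolding continuous_on_sequentially
proof (intro allI ballI impI)
  fix X a assume a: "a \<in> S" and X: "(\<forall>n::nat. X n \<in> S) \<and> X \<longlonglongrightarrow> a"
  have "(\<lambda>n. LINT z|M. g (X n) z) \<longlonglongrightarrow> (LINT z|M. g a z)"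
  proof (rule integral_dominated_convergence[where w = W])
    show "AE z in M. (\<lambda>n. g (X n) z) \<longlonglongrightarrow> g a z"
      using assms(1) a X unfolding continuous_on_sequentially by (auto simp: o_def)
  qed (use assms a X in auto)
  then show "((\<lambda>x. LINT z|M. g x z) \<circ> X) \<longlonglongrightarrow> (LINT z|M. g a z)" by (simp add: o_def)
qed

text \<open>Series over countable index sets are written as integrals over the counting measure, so
  that dominated convergence, Fubini and differentiation under the integral sign apply to them
  unchanged.\<close>

abbreviation lsum :: "('i \<Rightarrow> 'v::{banach,second_countable_topology}) \<Rightarrow> 'v" where
  "lsum a \<equiv> integral\<^sup>L (count_space UNIV) a"

abbreviation asum :: "('i \<Rightarrow> 'v::{banach,second_countable_topology}) \<Rightarrow> bool" where
  "asum a \<equiv> integrable (count_space UNIV) a"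

lemma asum_bound:
  fixes a :: "'i \<Rightarrow> 'v::{banach,second_countable_topology}" and w :: "'i \<Rightarrow> real"
  assumes "asum w" "\<And>n. norm (a n) \<le> w n"
  shows "asum a"
  by (rule Bochner_Integration.integrable_bound[OF assms(1)]) (use assms(2) in \<open>auto intro: order_trans[OF _ abs_ge_self]\<close>)

lemma lsum_swap:
  fixes f :: "'i::countable \<Rightarrow> 'z \<Rightarrow> 'v::{banach,second_countable_topology}"
  assumes M: "sigma_finite_measure M"
    and int: "\<And>i. integrable M (f i)" and w: "\<And>i. (LINT z|M. norm (f i z)) \<le> w i" "asum w"
  shows "(LINT z|M. lsum (\<lambda>i. f i z)) = lsum (\<lambda>i. LINT z|M. f i z)" "integrable M (\<lambda>z. lsum (\<lambda>i. f i z))"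
proof -
  interpret P: pair_sigma_finite "count_space (UNIV::'i set)" M
    by (intro pair_sigma_finite.intro M sigma_finite_measure_count_space)
  have fm: "(\<lambda>(i, z). f i z) \<in> borel_measurable (count_space UNIV \<Otimes>\<^sub>M M)"
    by (rule measurable_pair_measure_countable1) (use int in auto)
  have I: "integrable (count_space UNIV \<Otimes>\<^sub>M M) (\<lambda>(i, z). f i z)"
  proof (rule P.Fubini_integrable)
    show "asum (\<lambda>i. LINT z|M. norm (case (i, z) of (i, z) \<Rightarrow> f i z))"
      by (rule asum_bound[OF w(2)]) (use w(1) in \<open>auto simp: integral_nonneg_AE\<close>)
  qed (use fm int in auto)
  show "(LINT z|M. lsum (\<lambda>i. f i z)) = lsum (\<lambda>i. LINT z|M. f i z)"
    using P.Fubini_integral[OF I] by simp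
  show "integrable M (\<lambda>z. lsum (\<lambda>i. f i z))"
    using P.integrable_snd[OF I] by simp
qed

lemma lsum_swap_bound:
  fixes f :: "'i::countable \<Rightarrow> 'z \<Rightarrow> 'v::{banach,second_countable_topology}"
  assumes M: "sigma_finite_measure M"
    and m: "\<And>i. f i \<in> borel_measurable M" and b: "\<And>i z. norm (f i z) \<le> w i * v z" and "asum w" "integrable M v"
  shows "(LINT z|M. lsum (\<lambda>i. f i z)) = lsum (\<lambda>i. LINT z|M. f i z)" "integrable M (\<lambda>z. lsum (\<lambda>i. f i z))"
    "\<And>i. integrable M (f i)"
proof -
  show i: "integrable M (f i)" for i
    by (rule Bochner_Integration.integrable_bound[OF integrable_mult_right[OF assms(5), of "w i"] m])
       (use b in \<open>auto intro: order_trans[OF _ abs_ge_self]\<close>)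
  have *: "(LINT z|M. norm (f i z)) \<le> w i * (LINT z|M. v z)" for i
  proof -
    have "(LINT z|M. norm (f i z)) \<le> (LINT z|M. w i * v z)"
      by (intro integral_mono integrable_norm i integrable_mult_right assms)
    then show ?thesis by simp
  qed
  show "(LINT z|M. lsum (\<lambda>i. f i z)) = lsum (\<lambda>i. LINT z|M. f i z)" "integrable M (\<lambda>z. lsum (\<lambda>i. f i z))"
    by (rule lsum_swap[OF M i *], rule integrable_mult_left[OF assms(4)])+
qed

lemma lsum_prod:
  fixes f :: "'i::countable \<times> 'j::countable \<Rightarrow> 'v::{banach,second_countable_topology}"
  assumes "asum f"
  shows "lsum f = lsum (\<lambda>i. lsum (\<lambda>j. f (i, j)))" "lsum f = lsum (\<lambda>j. lsum (\<lambda>i. f (i, j)))"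
proof -
  interpret P: pair_sigma_finite "count_space (UNIV::'i set)" "count_space (UNIV::'j set)"
    by (intro pair_sigma_finite.intro sigma_finite_measure_count_space)
  have "count_space (UNIV::'i set) \<Otimes>\<^sub>M count_space (UNIV::'j set) = count_space UNIV"
    by (subst pair_measure_countable) auto
  with assms have I: "integrable (count_space (UNIV::'i set) \<Otimes>\<^sub>M count_space (UNIV::'j set)) (case_prod (\<lambda>i j. f (i, j)))" by simp
  show "lsum f = lsum (\<lambda>i. lsum (\<lambda>j. f (i, j)))" "lsum f = lsum (\<lambda>j. lsum (\<lambda>i. f (i, j)))"
    using P.integral_fst[OF I] P.integral_snd[OF I] by (simp_all add: \<open>_ = count_space UNIV\<close>)
qed

lemma asum_prod:
  fixes u :: "'i::countable \<Rightarrow> real" and v :: "'j::countable \<Rightarrow> real"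
  assumes "asum u" "asum v" "\<And>i. u i \<ge> 0" "\<And>i. v i \<ge> 0"
  shows "asum (\<lambda>(i, j). u i * v j)"
proof -
  interpret P: pair_sigma_finite "count_space (UNIV::'i set)" "count_space (UNIV::'j set)"
    by (intro pair_sigma_finite.intro sigma_finite_measure_count_space)
  have eq: "count_space (UNIV::'i set) \<Otimes>\<^sub>M count_space (UNIV::'j set) = count_space UNIV"
    by (subst pair_measure_countable) auto
  have "integrable (count_space (UNIV::'i set) \<Otimes>\<^sub>M count_space (UNIV::'j set)) (\<lambda>(i, j). u i * v j)"
    by (rule P.Fubini_integrable) (use assms in \<open>auto simp: eq abs_mult\<close>)
  then show ?thesis by (simp add: eq)
qed

lemma asum_int: "asum (\<lambda>n::int. 1 / (1 + \<bar>real_of_int n\<bar>) ^ 2)" (is "asum ?f")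
proof -
  have "summable (\<lambda>n. 1 / real (Suc n) ^ 2)"
    using inverse_power_summable[of 2, where 'a=real] by (subst summable_Suc_iff) (simp add: field_simps)
  then have nat: "Infinite_Set_Sum.abs_summable_on (\<lambda>n. 1 / (1 + real n) ^ 2) UNIV"
    by (simp add: abs_summable_on_nat_iff' algebra_simps)
  have "Infinite_Set_Sum.abs_summable_on ?f (range int)"
    by (subst abs_summable_on_reindex_iff[symmetric]) (use nat in \<open>auto simp: inj_def\<close>)
  moreover have "Infinite_Set_Sum.abs_summable_on ?f (range (\<lambda>n. - int n))"
    by (subst abs_summable_on_reindex_iff[symmetric]) (use nat in \<open>auto simp: inj_def\<close>)
  ultimately have "Infinite_Set_Sum.abs_summable_on ?f (range int \<union> range (\<lambda>n. - int n))"
    by (rule abs_summable_on_union)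
  moreover have "range int \<union> range (\<lambda>n. - int n) = UNIV"
    by (auto intro: int_cases2)
  ultimately show ?thesis by (simp add: abs_summable_on_def)
qed

lemma integrable_inverse_square: "integrable lborel (\<lambda>x::real. 1 / (1 + \<bar>x\<bar>) ^ 2)"
proof -
  have 1: "(\<integral>\<^sup>+x. ennreal (1 / (1 + \<bar>x\<bar>) ^ 2) * indicator {0..} x \<partial>lborel) < \<infinity>"
  proof -
    have "(\<integral>\<^sup>+x. ennreal (1 / (1 + \<bar>x\<bar>) ^ 2) * indicator {0..} x \<partial>lborel) = (\<integral>\<^sup>+x. ennreal (1 / (1 + x) ^ 2) * indicator {0..} x \<partial>lborel)"
      by (intro nn_integral_cong) (auto simp: indicator_def)
    also have "\<dots> = ennreal (0 - (- 1 / (1 + 0)))"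
    proof (rule nn_integral_FTC_atLeast)
      show "((\<lambda>x. - 1 / (1 + x)) has_real_derivative 1 / (1 + x) ^ 2) (at x)" if "0 \<le> x" for x :: real
        using that by (auto intro!: derivative_eq_intros simp: power2_eq_square divide_simps)
      show "((\<lambda>x::real. - 1 / (1 + x)) \<longlongrightarrow> 0) at_top"
        by (intro tendsto_divide_0[OF tendsto_const] filterlim_at_top_imp_at_infinity filterlim_tendsto_add_at_top[OF tendsto_const] filterlim_ident)
    qed auto
    finally show ?thesis by simp
  qed
  have ind: "(indicator {..0} (0 + - 1 * (x::real)) :: ennreal) = indicator {0..} x" for x
    by (simp add: indicator_def)
  have 2: "(\<integral>\<^sup>+x. ennreal (1 / (1 + \<bar>x\<bar>) ^ 2) * indicator {..0} x \<partial>lborel) < \<infinity>"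
    using 1 by (subst nn_integral_real_affine[where c = "-1" and t = 0]) (simp_all only: ind, simp_all)
  have "(\<integral>\<^sup>+(x::real). ennreal (norm (1 / (1 + \<bar>x\<bar>) ^ 2)) \<partial>lborel) \<le>
     (\<integral>\<^sup>+x. ennreal (1 / (1 + \<bar>x\<bar>) ^ 2) * indicator {0..} x + ennreal (1 / (1 + \<bar>x\<bar>) ^ 2) * indicator {..0} x \<partial>lborel)"
  proof (rule nn_integral_mono)
    fix x :: real
    show "ennreal (norm (1 / (1 + \<bar>x\<bar>) ^ 2)) \<le> ennreal (1 / (1 + \<bar>x\<bar>) ^ 2) * indicator {0..} x + ennreal (1 / (1 + \<bar>x\<bar>) ^ 2) * indicator {..0} x"
      by (cases "x \<ge> 0") simp_all
  qed
  also have "\<dots> = (\<integral>\<^sup>+x. ennreal (1 / (1 + \<bar>x\<bar>) ^ 2) * indicator {0..} x \<partial>lborel) + (\<integral>\<^sup>+x. ennreal (1 / (1 + \<bar>x\<bar>) ^ 2) * indicator {..0} x \<partial>lborel)"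
    by (intro nn_integral_add) auto
  also have "\<dots> < \<infinity>" using 1 2 by simp
  finally show ?thesis by (intro integrableI_bounded) auto
qed

text \<open>Bridges the gauge integral over an interval, in which the operators are defined, and the
  Lebesgue integral over a finite measure space, for which the convergence theorems are
  available.\<close>

lemma integral_restrict:
  fixes f :: "real \<Rightarrow> 'v::euclidean_space"
  assumes "continuous_on {a..b} f"
  shows "integral {a..b} f = (LINT t|restrict_space lborel {a..b}. f t)" "integrable (restrict_space lborel {a..b}) f"
proof -
  have si: "set_integrable lborel {a..b} f" by (rule borel_integrable_atLeastAtMost') fact
  show "integrable (restrict_space lborel {a..b}) f"
    using si by (simp add: set_integrable_def integrable_restrict_space)
  show "integral {a..b} f = (LINT t|restrict_space lborel {a..b}. f t)"
    using set_borel_integral_eq_integral(2)[OF si] by (simp add: set_lebesgue_integral_def integral_restrict_space)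
qed

lemma sigma_finite_restrict: "sigma_finite_measure (restrict_space lborel {a..b::real})"
  using emeasure_compact_finite[of "{a..b}"]
  by (intro finite_measure.axioms(1)[OF finite_measureI]) (simp add: emeasure_restrict_space)

lemma integral_lsum:
  fixes f :: "'i::countable \<Rightarrow> real \<Rightarrow> 'v::euclidean_space"
  assumes c: "\<And>i. continuous_on UNIV (f i)" and b: "\<And>i t. norm (f i t) \<le> w i" and w: "asum w"
  shows "integral {a..b} (\<lambda>t. lsum (\<lambda>i. f i t)) = lsum (\<lambda>i. integral {a..b} (f i))"
    "continuous_on S (\<lambda>t. lsum (\<lambda>i. f i t))"
proof -
  let ?M = "restrict_space lborel {a..b}"
  show cont: "continuous_on S (\<lambda>t. lsum (\<lambda>i. f i t))" for S
    by (rule continuous_on_integral_dominated[where W=w]) (use assms in \<open>auto intro: continuous_on_subset\<close>)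
  have "(LINT t|?M. lsum (\<lambda>i. f i t)) = lsum (\<lambda>i. LINT t|?M. f i t)"
  proof (rule lsum_swap_bound(1)[OF sigma_finite_restrict, where v = "\<lambda>_. 1" and w = w])
    show "f i \<in> borel_measurable ?M" for i
      by (rule borel_measurable_integrable[OF integral_restrict(2)[OF continuous_on_subset[OF c subset_UNIV]]])
    show "integrable ?M (\<lambda>_. 1::real)" by (rule integral_restrict(2)) simp
  qed (use b w in auto)
  then show "integral {a..b} (\<lambda>t. lsum (\<lambda>i. f i t)) = lsum (\<lambda>i. integral {a..b} (f i))"
    using integral_restrict(1)[OF cont] integral_restrict(1)[OF continuous_on_subset[OF c subset_UNIV]] by simp
qed

lemma deriv_lsum:
  fixes f :: "real \<Rightarrow> 'i \<Rightarrow> 'v::{banach,second_countable_topology}"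
  assumes "\<And>i t. ((\<lambda>t. f t i) has_vector_derivative f' t i) (at t)" "\<And>i t. norm (f t i) \<le> w i" "asum w"
    "\<And>i t. norm (f' t i) \<le> w' i" "asum w'"
  shows "((\<lambda>t. lsum (f t)) has_vector_derivative lsum (f' t)) (at t)"
  by (rule has_vector_derivative_integral[where a = "t - 1" and b = "t + 1" and W = w'])
     (use assms in \<open>auto intro: asum_bound\<close>)

lemma global_antiderivative:
  fixes f :: "real \<Rightarrow> 'v::euclidean_space"
  assumes "continuous_on UNIV f"
  obtains \<Phi> where "\<And>t. (\<Phi> has_vector_derivative f t) (at t)"
proof -
  have "\<exists>F. \<forall>x::real. - \<infinity> < ereal x \<longrightarrow> ereal x < \<infinity> \<longrightarrow> (F has_vector_derivative f x) (at x)"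
    by (rule einterval_antiderivative) (use assms in \<open>auto simp: continuous_on_eq_continuous_at\<close>)
  then show ?thesis using that by auto
qed

lemma vector_derivative_continuous_on:
  "(\<And>t. (f has_vector_derivative f' t) (at t)) \<Longrightarrow> continuous_on A f"
  by (rule continuous_at_imp_continuous_on) (auto intro: has_vector_derivative_continuous)

text \<open>The increment of an antiderivative over one period has derivative f (t + 2*pi) - f t =
  0.\<close>

lemma periodic_integral:
  fixes f :: "real \<Rightarrow> 'v::euclidean_space"
  assumes c: "continuous_on UNIV f" and p: "\<And>t. f (t + 2*pi) = f t"
  shows "integral {a..a + 2*pi} f = integral {0..2*pi} f"
proof -
  obtain \<Phi> where \<Phi>: "\<And>t. (\<Phi> has_vector_derivative f t) (at t)" using global_antiderivative[OF c] by blast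
  have I: "integral {a..a + 2*pi} f = \<Phi> (a + 2*pi) - \<Phi> a" for a
    by (intro integral_unique fundamental_theorem_of_calculus) (auto intro: has_vector_derivative_at_within \<Phi>)
  have d: "((\<lambda>t. \<Phi> (t + 2*pi) - \<Phi> t) has_vector_derivative 0) (at t within UNIV)" for t
  proof -
    have "((\<Phi> \<circ> (\<lambda>t. t + 2*pi)) has_vector_derivative 1 *\<^sub>R f (t + 2*pi)) (at t)"
      by (rule vector_diff_chain_at) (auto intro!: derivative_eq_intros \<Phi>)
    from has_vector_derivative_diff[OF this \<Phi>] show ?thesis by (simp add: o_def p)
  qed
  obtain c where c: "\<And>t. \<Phi> (t + 2*pi) - \<Phi> t = c"
    by (rule has_vector_derivative_zero_constant[OF convex_UNIV d]) simp
  then have "\<Phi> (a + 2*pi) - \<Phi> a = \<Phi> (0 + 2*pi) - \<Phi> 0" using c[of a] c[of 0] by (simp only:)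
  then show ?thesis using I[of a] I[of 0] by (simp only: add_0)
qed

lemma periodic_integral_deriv:
  fixes f :: "real \<Rightarrow> 'v::euclidean_space"
  assumes "\<And>t. (f has_vector_derivative f' t) (at t)" "f (a + 2*pi) = f a"
  shows "(f' has_integral 0) {a..a + 2*pi}"
  using fundamental_theorem_of_calculus[of a "a + 2*pi" f f'] assms
  by (auto intro: has_vector_derivative_at_within)

text \<open>It is the product that has to agree at both ends, not each factor. This admits factors
  \<open>cis (- (y * \<xi>))\<close> with real \<xi>, which are not periodic, against sections
  vanishing at the ends.\<close>

lemma periodic_by_parts:
  fixes b :: "'u::real_normed_vector \<Rightarrow> 'w::real_normed_vector \<Rightarrow> 'v::euclidean_space"
  assumes b: "bounded_bilinear b"
    and d: "\<And>t. (f has_vector_derivative f' t) (at t)" "\<And>t. (g has_vector_derivative g' t) (at t)"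
    and c: "continuous_on UNIV f'" "continuous_on UNIV g'"
    and p: "b (f (a + 2*pi)) (g (a + 2*pi)) = b (f a) (g a)"
  shows "integral {a..a + 2*pi} (\<lambda>t. b (f' t) (g t)) = - integral {a..a + 2*pi} (\<lambda>t. b (f t) (g' t))"
proof -
  have cf: "continuous_on UNIV f" "continuous_on UNIV g"
    by (rule vector_derivative_continuous_on[OF d(1)], rule vector_derivative_continuous_on[OF d(2)])
  have "((\<lambda>t. b (f t) (g' t) + b (f' t) (g t)) has_integral 0) {a..a + 2*pi}"
    by (rule periodic_integral_deriv[OF bounded_bilinear.has_vector_derivative[OF b d] p])
  moreover have "(\<lambda>t. b (f t) (g' t)) integrable_on {a..a + 2*pi}" "(\<lambda>t. b (f' t) (g t)) integrable_on {a..a + 2*pi}"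
    by (rule integrable_continuous_interval, rule bounded_bilinear.continuous_on[OF b]; rule continuous_on_subset[OF _ subset_UNIV]; fact c cf)+
  ultimately have "integral {a..a + 2*pi} (\<lambda>t. b (f t) (g' t)) + integral {a..a + 2*pi} (\<lambda>t. b (f' t) (g t)) = 0"
    by (simp add: integral_add[symmetric] integral_unique)
  then show ?thesis by (simp add: eq_neg_iff_add_eq_0 add.commute)
qed

section \<open>Fourier series\<close>

definition ee :: "int \<Rightarrow> circle \<Rightarrow> complex" where
  "ee n p = Rep_circle p powi n"

lemma ee_circ [simp]: "ee n (circ t) = cis (of_int n * t)"
  by (simp add: ee_def cis_power_int)

lemma norm_ee [simp]: "norm (ee n p) = 1"
  by (metis circ_surj ee_circ norm_cis)

lemma ee_Cinf: "ee n \<in> Cinf"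
  by (simp add: Cinf_def smooth_curve_cis_mult)

lemma cis_mult_deriv: "((\<lambda>t. cis (a * t)) has_vector_derivative \<i> * of_real a * cis (a * t)) (at t)"
  unfolding has_vector_derivative_def by (auto intro!: derivative_eq_intros simp: scaleR_conv_of_real mult_ac)

definition fc :: "(circle \<Rightarrow> complex) \<Rightarrow> int \<Rightarrow> complex" where
  "fc \<phi> n = (1 / (2*pi)) * integral {0..2*pi} (\<lambda>t. \<phi> (circ t) * cis (- (of_int n * t)))"

lemma integral_cis_int:
  "integral {0..2*pi} (\<lambda>t. cis (of_int k * t)) = (if k = 0 then of_real (2*pi) else 0)"
proof (cases "k = 0")
  case False
  have "((\<lambda>t. \<i> * of_real (of_int k) * cis (of_int k * t)) has_integral 0) {0..0 + 2*pi}"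
    by (rule periodic_integral_deriv[of "\<lambda>t. cis (of_int k * t)"])
       (use cis_mult_deriv[of "of_int k"] cis_2pi_int[of 0 k] in \<open>auto simp: mult_ac\<close>)
  then have "((\<lambda>t. (1 / (\<i> * of_int k)) * (\<i> * of_real (of_int k) * cis (of_int k * t))) has_integral (1 / (\<i> * of_int k)) * 0) {0..2*pi}"
    by (intro has_integral_mult_right) simp
  then have "((\<lambda>t. cis (of_int k * t)) has_integral 0) {0..2*pi}" using False by simp
  then show ?thesis using False by (simp add: integral_unique)
qed (simp add: scaleR_conv_of_real)

lemma integral_zero_continuous:
  fixes f :: "real \<Rightarrow> real"
  assumes "continuous_on {a..b} f" "\<And>t. f t \<ge> 0" "integral {a..b} f = 0" "t \<in> {a..b}" "a < b"
  shows "f t = 0"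
proof -
  have "(f has_integral 0) (cbox a b)"
    using assms(1,3) by (metis cbox_interval integrable_continuous_interval integrable_integral)
  then show ?thesis
    using assms by (intro has_integral_0_cbox_imp_0[of a b f t]) (auto simp: cbox_interval)
qed

text \<open>Stone-Weierstrass is applied on the unit circle inside the complex plane, so continuity
  in the angle has to be transferred there. Near z0 the angle \<open>t0 + Arg (z * cnj z0)\<close>
  is a continuous choice of argument, as the branch cut of Arg stays away from 1.\<close>

lemma continuous_on_sphere_of_circ:
  fixes \<phi> :: "circle \<Rightarrow> 'v::real_normed_vector"
  assumes "continuous_on UNIV (\<lambda>t. \<phi> (circ t))"
  shows "continuous_on {z. norm z = 1} (\<lambda>z. \<phi> (Abs_circle z))"
  unfolding continuous_on_eq_continuous_within
proof
  fix z0 :: complex assume z0: "z0 \<in> {z. norm z = 1}"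
  define t0 where "t0 = Arg z0"
  have z0': "z0 = cis t0" using z0 cis_Arg[of z0] by (cases "z0 = 0") (auto simp: t0_def sgn_div_norm)
  have eq: "\<phi> (Abs_circle z) = \<phi> (circ (t0 + Arg (z * cnj z0)))" if "norm z = 1" for z
  proof -
    have "z * cnj z0 \<noteq> 0" using that z0 by auto
    then have "cis (Arg (z * cnj z0)) = z * cnj z0" using that z0 by (simp add: cis_Arg sgn_div_norm norm_mult)
    then have "cis (t0 + Arg (z * cnj z0)) = z"
      using z0' z0 by (simp flip: cis_mult) (simp add: cis_cnj mult.left_commute cis_mult)
    then show ?thesis by (simp add: circ_def)
  qed
  have "isCont (\<lambda>z. t0 + Arg (z * cnj z0)) z0"
  proof -
    have "z0 * cnj z0 = 1" using z0' by (simp add: cis_cnj cis_mult)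
    then have "isCont Arg (z0 * cnj z0)" by (intro continuous_at_Arg) (simp add: complex_nonpos_Reals_iff)
    moreover have "isCont (\<lambda>z. z * cnj z0) z0" by (intro continuous_intros)
    ultimately have "isCont (\<lambda>z. Arg (z * cnj z0)) z0" by (intro isCont_o2[of z0 "\<lambda>z. z * cnj z0" Arg])
    then show ?thesis by (intro continuous_add continuous_const)
  qed
  moreover have "isCont (\<lambda>t. \<phi> (circ t)) (t0 + Arg (z0 * cnj z0))"
    using assms by (simp add: continuous_on_eq_continuous_at)
  ultimately have "isCont (\<lambda>z. \<phi> (circ (t0 + Arg (z * cnj z0)))) z0"
    by (rule isCont_o2)
  then have "continuous (at z0 within {z. norm z = 1}) (\<lambda>z. \<phi> (circ (t0 + Arg (z * cnj z0))))"
    by (rule continuous_at_imp_continuous_within)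
  then show "continuous (at z0 within {z. norm z = 1}) (\<lambda>z. \<phi> (Abs_circle z))"
    by (rule continuous_transform_within[of _ _ _ 1]) (use z0 eq in auto)
qed

lemma continuous_on_poly_cis:
  fixes q :: "complex \<Rightarrow> real"
  assumes "real_polynomial_function q"
  shows "continuous_on A (\<lambda>t. complex_of_real (q (cis t)))"
proof -
  have q: "continuous_on UNIV q"
    using continuous_on_polymonial_function assms real_polynomial_function_eq by blast
  have "continuous_on A (\<lambda>t. q (cis t))"
    by (rule continuous_on_compose2[OF q]) (auto intro: continuous_intros)
  then show ?thesis by (rule continuous_on_of_real)
qed

text \<open>On the unit circle a real-linear function of z is a combination of \<open>cis t\<close>
  and \<open>cis (- t)\<close>, so multiplication by it shifts frequencies by one. Generalizing over
  h and n lets the product case absorb one factor into h.\<close>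

lemma poly_orthogonal:
  fixes q :: "complex \<Rightarrow> real"
  assumes "real_polynomial_function q" "continuous_on UNIV h"
    and "\<And>n::int. integral {0..2*pi} (\<lambda>t. h t * cis (of_int n * t)) = 0"
  shows "integral {0..2*pi} (\<lambda>t. h t * q (cis t) * cis (of_int n * t)) = 0"
  using assms
proof (induction q arbitrary: h n)
  case (linear f)
  interpret bounded_linear f by fact
  define \<alpha> \<beta> where "\<alpha> = (of_real (f 1) - \<i> * of_real (f \<i>)) / 2" and "\<beta> = (of_real (f 1) + \<i> * of_real (f \<i>)) / 2"
  have f: "complex_of_real (f (cis t)) = \<alpha> * cis t + \<beta> * cis (-t)" for t
  proof -
    have "f (cis t) = f (cos t *\<^sub>R 1 + sin t *\<^sub>R \<i>)" by (rule arg_cong[of _ _ f]) (simp add: complex_eq_iff)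
    also have "\<dots> = cos t * f 1 + sin t * f \<i>" by (simp add: add scaleR)
    finally show ?thesis by (simp add: \<alpha>_def \<beta>_def complex_eq_iff field_simps)
  qed
  have "(\<lambda>t. h t * f (cis t) * cis (of_int n * t)) =
     (\<lambda>t. \<alpha> * (h t * cis (of_int (n + 1) * t)) + \<beta> * (h t * cis (of_int (n - 1) * t)))"
    unfolding f by (rule ext) (simp add: ring_distribs mult_ac add_ac cis_mult)
  moreover have "(\<lambda>t. \<gamma> * (h t * cis (of_int m * t))) integrable_on {0..2*pi}" for \<gamma> and m::int
    by (intro integrable_continuous_interval continuous_intros continuous_on_subset[OF linear.prems(1)]) auto
  ultimately show ?case by (simp only: integral_add integral_mult_right linear.prems(2) mult_zero_right add_0)
next
  case (const c)
  have "(\<lambda>t. h t * c * cis (of_int n * t)) = (\<lambda>t. c * (h t * cis (of_int n * t)))" by (simp add: mult_ac)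
  then show ?case using const.prems(2) by simp
next
  case (add f g)
  have cont: "continuous_on {0..2*pi} (\<lambda>t. complex_of_real (f (cis t)))" "continuous_on {0..2*pi} (\<lambda>t. complex_of_real (g (cis t)))"
    by (rule continuous_on_poly_cis; fact)+
  have "(\<lambda>t. h t * (f (cis t) + g (cis t)) * cis (of_int n * t)) =
      (\<lambda>t. h t * f (cis t) * cis (of_int n * t) + h t * g (cis t) * cis (of_int n * t))"
    by (simp add: ring_distribs)
  moreover have "(\<lambda>t. h t * f (cis t) * cis (of_int n * t)) integrable_on {0..2*pi}" "(\<lambda>t. h t * g (cis t) * cis (of_int n * t)) integrable_on {0..2*pi}"
    by (intro integrable_continuous_interval continuous_intros continuous_on_subset[OF add.prems(1)] cont; simp)+
  ultimately show ?case using add.IH[OF add.prems] by (simp add: integral_add)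
next
  case (mult f g)
  have cont: "continuous_on UNIV (\<lambda>t. complex_of_real (f (cis t)))"
    by (rule continuous_on_poly_cis; fact)
  have "integral {0..2*pi} (\<lambda>t. (h t * f (cis t)) * g (cis t) * cis (of_int n * t)) = 0"
    by (rule mult.IH(2)) (use mult.IH(1)[OF mult.prems] in \<open>auto intro!: continuous_intros mult.prems cont\<close>)
  then show ?case by (simp add: mult.assoc)
qed

text \<open>By Stone-Weierstrass the function integrates to 0 against every continuous real u.
  Taking for u its own real and imaginary parts shows that its squared modulus has integral
  0.\<close>

lemma fourier_unique:
  assumes c: "continuous_on UNIV (\<lambda>t. \<phi> (circ t))" and z: "\<And>n. fc \<phi> n = 0"
  shows "\<phi> = (\<lambda>_. 0)"
proof -
  let ?h = "\<lambda>t. \<phi> (circ t)"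
  have h0: "integral {0..2*pi} (\<lambda>t. ?h t * cis (of_int n * t)) = 0" for n
    using z[of "- n"] by (simp add: fc_def)
  obtain B where B: "\<And>t. norm (?h t) \<le> B" using periodic_bounded[OF _ c] by auto
  have key: "integral {0..2*pi} (\<lambda>t. ?h t * of_real (u (circ t))) = 0"
    if u: "continuous_on UNIV (\<lambda>t. u (circ t))" for u :: "circle \<Rightarrow> real"
  proof -
    let ?I = "integral {0..2*pi} (\<lambda>t. ?h t * of_real (u (circ t)))"
    have "norm ?I \<le> 0 + e" if "e > 0" for e
    proof -
      \<comment> \<open>With this d the error |B| * d * 2*pi stays below e; adding 1 keeps the
        denominator positive.\<close>
      define d where "d = e / (2*pi*(\<bar>B\<bar> + 1))"
      have d: "d > 0" using that by (simp add: d_def add_nonneg_pos)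
      have "compact {z::complex. norm z = 1}" using compact_sphere[of "0::complex" 1] by (simp add: sphere_def)
      from Stone_Weierstrass_real_polynomial_function[OF this continuous_on_sphere_of_circ[OF u] d]
      obtain q where q: "real_polynomial_function q" "\<And>z. norm z = 1 \<Longrightarrow> \<bar>u (Abs_circle z) - q z\<bar> < d" by auto
      have qc: "continuous_on {0..2*pi} (\<lambda>t. complex_of_real (q (cis t)))"
        by (rule continuous_on_poly_cis[OF q(1)])
      have *: "integral {0..2*pi} (\<lambda>t. ?h t * of_real (q (cis t))) = 0"
        using poly_orthogonal[OF q(1) c h0, of 0] by simp
      have i1: "(\<lambda>t. ?h t * of_real (q (cis t))) integrable_on {0..2*pi}"
        by (intro integrable_continuous_interval continuous_intros qc continuous_on_subset[OF c]) auto
      have i2: "(\<lambda>t. ?h t * of_real (u (circ t))) integrable_on {0..2*pi}"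
        by (intro integrable_continuous_interval continuous_intros continuous_on_subset[OF c] continuous_on_subset[OF u]) auto
      have "?I = integral {0..2*pi} (\<lambda>t. ?h t * of_real (u (circ t)) - ?h t * of_real (q (cis t)))"
        using * by (simp add: integral_diff[OF i2 i1])
      also have "norm \<dots> \<le> integral {0..2*pi} (\<lambda>t. \<bar>B\<bar> * d)"
      proof (rule integral_norm_bound_integral[OF integrable_diff[OF i2 i1]])
        fix t
        have "norm (?h t * of_real (u (circ t)) - ?h t * of_real (q (cis t))) = norm (?h t) * \<bar>u (circ t) - q (cis t)\<bar>"
          by (simp flip: right_diff_distrib of_real_diff add: norm_mult)
        also have "\<dots> \<le> \<bar>B\<bar> * d"
          using B[of t] q(2)[of "cis t"] by (intro mult_mono) (auto simp: circ_def)
        finally show "norm (?h t * of_real (u (circ t)) - ?h t * of_real (q (cis t))) \<le> \<bar>B\<bar> * d" .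
      qed auto
      also have "\<dots> = e * (\<bar>B\<bar> / (\<bar>B\<bar> + 1))" proof -
        have d: "d * (2*pi) = e / (\<bar>B\<bar> + 1)" by (simp add: d_def)
        have "integral {0..2*pi} (\<lambda>t. \<bar>B\<bar> * d) = \<bar>B\<bar> * d * (2*pi)" by (simp add: mult_ac)
        also have "\<dots> = \<bar>B\<bar> * (e / (\<bar>B\<bar> + 1))" by (simp only: d mult.assoc)
        finally show ?thesis by simp
      qed
      also have "\<dots> \<le> e * 1" using that by (intro mult_left_mono) auto
      finally show ?thesis by simp
    qed
    then have "norm ?I \<le> 0" by (rule field_le_epsilon)
    then show ?thesis by simp
  qed
  have cR: "continuous_on UNIV (\<lambda>t. Re (?h t))" "continuous_on UNIV (\<lambda>t. Im (?h t))" by (intro continuous_intros c)+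
  \<comment> \<open>Re h - i * Im h is the conjugate of h, so the integrand is the squared
    modulus.\<close>
  have "integral {0..2*pi} (\<lambda>t. ?h t * of_real (Re (?h t)) - \<i> * (?h t * of_real (Im (?h t)))) = 0"
    apply (subst integral_diff)
    subgoal by (intro integrable_continuous_interval continuous_intros continuous_on_subset[OF c]) auto
    subgoal by (intro integrable_continuous_interval continuous_intros continuous_on_subset[OF c]) auto
    using key[of "\<lambda>p. Re (\<phi> p)"] key[of "\<lambda>p. Im (\<phi> p)"] cR by simp
  moreover have "(\<lambda>t. ?h t * of_real (Re (?h t)) - \<i> * (?h t * of_real (Im (?h t)))) = (\<lambda>t. of_real ((norm (?h t))\<^sup>2))"
    by (rule ext) (simp add: complex_eq_iff cmod_power2, simp add: power2_eq_square)
  ultimately have "integral {0..2*pi} (\<lambda>t. complex_of_real ((norm (?h t))\<^sup>2)) = 0" by simp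
  moreover have "integral {0..2*pi} (\<lambda>t. complex_of_real ((norm (?h t))\<^sup>2)) = of_real (integral {0..2*pi} (\<lambda>t. (norm (?h t))\<^sup>2))"
    by (rule integral_linear[OF _ bounded_linear_of_real, unfolded o_def])
       (intro integrable_continuous_interval continuous_intros continuous_on_subset[OF c]; simp)
  ultimately have I0: "integral {0..2*pi} (\<lambda>t. (norm (?h t))\<^sup>2) = 0" by simp
  have "?h t = 0" if "t \<in> {0..2*pi}" for t
  proof -
    have "continuous_on {0..2*pi} (\<lambda>t. (norm (?h t))\<^sup>2)"
      by (intro continuous_intros continuous_on_subset[OF c]) auto
    from integral_zero_continuous[OF this _ I0 that] show ?thesis by simp
  qed
  then show ?thesis
    by (metis (no_types, opaque_lifting) add_0 atLeastAtMost_iff circ_window less_imp_le)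
qed

lemma integral_fc_integrable:
  "continuous_on UNIV (\<lambda>t. \<phi> (circ t)) \<Longrightarrow> (\<lambda>t. \<phi> (circ t) * cis (- (of_int n * t))) integrable_on {0..2*pi}"
  by (intro integrable_continuous_interval continuous_intros) (auto elim: continuous_on_subset)

lemma fc_add:
  assumes "continuous_on UNIV (\<lambda>t. \<phi> (circ t))" "continuous_on UNIV (\<lambda>t. \<psi> (circ t))"
  shows "fc (\<lambda>p. \<phi> p + \<psi> p) n = fc \<phi> n + fc \<psi> n"
  by (simp add: fc_def ring_distribs integral_add integral_fc_integrable assms)

lemma fc_mult: "fc (\<lambda>p. c * \<phi> p) n = c * fc \<phi> n"
proof -
  have "(\<lambda>t. (c * \<phi> (circ t)) * cis (- (of_int n * t))) = (\<lambda>t. c * (\<phi> (circ t) * cis (- (of_int n * t))))"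
    by (simp add: mult.assoc)
  then show ?thesis unfolding fc_def by (simp only: integral_mult_right) (simp add: mult_ac)
qed

lemma fc_diff:
  assumes "continuous_on UNIV (\<lambda>t. \<phi> (circ t))" "continuous_on UNIV (\<lambda>t. \<psi> (circ t))"
  shows "fc (\<lambda>p. \<phi> p - \<psi> p) n = fc \<phi> n - fc \<psi> n"
  by (simp add: fc_def ring_distribs integral_diff integral_fc_integrable assms)

lemma fc_bound:
  assumes c: "continuous_on UNIV (\<lambda>t. \<phi> (circ t))" and B: "\<And>p. norm (\<phi> p) \<le> B"
  shows "norm (fc \<phi> n) \<le> B"
proof -
  have "norm (integral {0..2*pi} (\<lambda>t. \<phi> (circ t) * cis (- (of_int n * t)))) \<le> integral {0..2*pi} (\<lambda>_. B)"
    by (rule integral_norm_bound_integral[OF integral_fc_integrable[OF c]]) (auto simp: norm_mult B)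
  then show ?thesis by (simp add: fc_def norm_mult norm_divide field_simps)
qed

lemma fc_ddt:
  assumes "\<phi> \<in> Cinf"
  shows "fc (ddt \<phi>) n = \<i> * of_int n * fc \<phi> n"
proof -
  have d: "((\<lambda>t. cis (- (of_int n * t))) has_vector_derivative - (\<i> * of_int n * cis (- (of_int n * t)))) (at t)" for t
    using cis_mult_deriv[of "- of_int n" t] by simp
  have "integral {0..0 + 2*pi} (\<lambda>t. ddt \<phi> (circ t) * cis (- (of_int n * t)))
      = - integral {0..0 + 2*pi} (\<lambda>t. \<phi> (circ t) * - (\<i> * of_int n * cis (- (of_int n * t))))"
    by (rule periodic_by_parts[OF bounded_bilinear_mult Cinf_deriv[OF assms] d])
       (use cis_2pi_int[of 0 "-n"] circ_2pi[of 0] in \<open>auto intro!: continuous_intros Cinf_continuous Cinf_ddt assms simp: mult_ac\<close>)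
  also have "(\<lambda>t. \<phi> (circ t) * - (\<i> * of_int n * cis (- (of_int n * t)))) = (\<lambda>t. (- (\<i> * of_int n)) * (\<phi> (circ t) * cis (- (of_int n * t))))"
    by (simp add: mult_ac)
  finally show ?thesis unfolding fc_def by (simp only: integral_mult_right) (simp add: mult_ac)
qed

definition rapid :: "(int \<Rightarrow> 'v::real_normed_vector) \<Rightarrow> bool" where
  "rapid a \<longleftrightarrow> (\<forall>N. \<exists>C. \<forall>n. norm (a n) * (1 + \<bar>real_of_int n\<bar>) ^ N \<le> C)"

lemma rapid_bound:
  assumes "rapid a"
  obtains C where "C \<ge> 0" "\<And>n. norm (a n) \<le> C / (1 + \<bar>real_of_int n\<bar>) ^ N"
proof -
  obtain C where C: "\<And>n. norm (a n) * (1 + \<bar>real_of_int n\<bar>) ^ N \<le> C" using assms by (auto simp: rapid_def)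
  have "0 \<le> C" using C[of 0] order_trans[OF norm_ge_zero[of "a 0"], of C] by simp
  moreover have "norm (a n) \<le> C / (1 + \<bar>real_of_int n\<bar>) ^ N" for n
    using C[of n] by (subst pos_le_divide_eq) (auto intro: zero_less_power add_pos_nonneg)
  ultimately show ?thesis using that by blast
qed

lemma rapid_poly:
  assumes "rapid a" "\<And>n. norm (b n) \<le> K * (1 + \<bar>real_of_int n\<bar>) ^ M * norm (a n)"
  shows "rapid b"
  unfolding rapid_def
proof
  fix N
  obtain C where C: "\<And>n. norm (a n) * (1 + \<bar>real_of_int n\<bar>) ^ (M + N) \<le> C" using assms(1) unfolding rapid_def by blast
  have "norm (b n) * (1 + \<bar>real_of_int n\<bar>) ^ N \<le> \<bar>K\<bar> * C" for n
  proof -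
    have "norm (b n) * (1 + \<bar>real_of_int n\<bar>) ^ N \<le> (\<bar>K\<bar> * (1 + \<bar>real_of_int n\<bar>) ^ M * norm (a n)) * (1 + \<bar>real_of_int n\<bar>) ^ N"
      by (intro mult_right_mono order_trans[OF assms(2)]) auto
    also have "\<dots> = \<bar>K\<bar> * (norm (a n) * (1 + \<bar>real_of_int n\<bar>) ^ (M + N))" by (simp add: power_add mult_ac)
    also have "\<dots> \<le> \<bar>K\<bar> * C" by (intro mult_left_mono C) auto
    finally show ?thesis .
  qed
  then show "\<exists>C. \<forall>n. norm (b n) * (1 + \<bar>real_of_int n\<bar>) ^ N \<le> C" by blast
qed

lemma rapid_asum:
  fixes a :: "int \<Rightarrow> 'v::{banach,second_countable_topology}"
  assumes "rapid a"
  shows "asum (\<lambda>n. norm (a n))" "asum a"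
proof -
  obtain C where C: "C \<ge> 0" "\<And>n. norm (a n) \<le> C / (1 + \<bar>real_of_int n\<bar>) ^ 2"
    using rapid_bound[OF assms, of 2] by blast
  have *: "asum (\<lambda>n. C * (1 / (1 + \<bar>real_of_int n\<bar>) ^ 2))" by (intro integrable_mult_right asum_int)
  show "asum (\<lambda>n. norm (a n))" "asum a"
    by (rule asum_bound[OF *]; use C in simp)+
qed

text \<open>Reduces decay with weight (1 + |n|)^N to two bounds: one for the coefficient of a
  function and one for that of its N-th derivative.\<close>

lemma power_one_plus_le: "(x::real) \<ge> 0 \<Longrightarrow> (1 + x) ^ N \<le> 2 ^ N * (1 + x ^ N)"
proof -
  assume x: "x \<ge> 0"
  have "(1 + x) ^ N \<le> (2 * max 1 x) ^ N" using x by (intro power_mono) auto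
  also have "\<dots> = 2 ^ N * (max 1 x) ^ N" by (simp add: power_mult_distrib)
  also have "\<dots> \<le> 2 ^ N * (1 + x ^ N)" using x by (intro mult_left_mono) (auto simp: max_def)
  finally show ?thesis .
qed

lemma rapid_fc:
  assumes "\<phi> \<in> Cinf"
  shows "rapid (fc \<phi>)"
  unfolding rapid_def
proof
  fix N
  have iter: "(ddt ^^ N) \<phi> \<in> Cinf \<and> (\<forall>n. fc ((ddt ^^ N) \<phi>) n = (\<i> * of_int n) ^ N * fc \<phi> n)"
    by (induction N) (auto simp: assms Cinf_ddt fc_ddt mult_ac)
  have bdd: "\<exists>B. \<forall>p. norm (\<psi> p) \<le> B" if "\<psi> \<in> Cinf" for \<psi> :: "circle \<Rightarrow> complex"
    using periodic_bounded[of "\<lambda>t. \<psi> (circ t)"] Cinf_continuous[OF that] by (metis circ_2pi circ_surj)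
  obtain B0 where B0: "\<And>p. norm (\<phi> p) \<le> B0" using bdd[OF assms] by blast
  obtain B where B: "\<And>p. norm ((ddt ^^ N) \<phi> p) \<le> B" using bdd iter by blast
  have "norm (fc \<phi> n) * (1 + \<bar>real_of_int n\<bar>) ^ N \<le> 2 ^ N * (B0 + B)" for n
  proof -
    have "norm (fc \<phi> n) * (1 + \<bar>real_of_int n\<bar>) ^ N \<le> norm (fc \<phi> n) * (2 ^ N * (1 + \<bar>real_of_int n\<bar> ^ N))"
      by (intro mult_left_mono power_one_plus_le) auto
    also have "\<dots> = 2 ^ N * (norm (fc \<phi> n) + norm (fc ((ddt ^^ N) \<phi>) n))"
      using iter by (simp add: norm_mult norm_power algebra_simps)
    also have "\<dots> \<le> 2 ^ N * (B0 + B)"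
      by (intro mult_left_mono add_mono fc_bound B0 B Cinf_continuous) (use assms iter in auto)
    finally show ?thesis .
  qed
  then show "\<exists>C. \<forall>n. norm (fc \<phi> n) * (1 + \<bar>real_of_int n\<bar>) ^ N \<le> C" by blast
qed

definition ser :: "(int \<Rightarrow> complex) \<Rightarrow> circle \<Rightarrow> complex" where
  "ser a p = lsum (\<lambda>n. a n * ee n p)"

lemma rapid_deriv_coeff: "rapid a \<Longrightarrow> rapid (\<lambda>n. \<i> * of_int n * a n)"
  by (rule rapid_poly[where K = 1 and M = 1]) (auto simp: norm_mult intro!: mult_right_mono)

lemma ser_deriv:
  assumes "rapid a"
  shows "((\<lambda>t. ser a (circ t)) has_vector_derivative ser (\<lambda>n. \<i> * of_int n * a n) (circ t)) (at t)"
  unfolding ser_def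
proof (rule deriv_lsum[where w = "\<lambda>n. norm (a n)" and w' = "\<lambda>n. norm (\<i> * of_int n * a n)"])
  fix n t
  show "((\<lambda>t. a n * ee n (circ t)) has_vector_derivative \<i> * of_int n * a n * ee n (circ t)) (at t)"
    using bounded_linear.has_vector_derivative[OF bounded_linear_mult_right[of "a n"] cis_mult_deriv[of "of_int n" t]]
    by (simp add: mult_ac)
qed (use rapid_asum(1)[OF assms] rapid_asum(1)[OF rapid_deriv_coeff[OF assms]] in \<open>auto simp: norm_mult\<close>)

lemma ser_Cinf:
  assumes "rapid a"
  shows "ser a \<in> Cinf"
proof -
  have r: "rapid (((\<lambda>a n. \<i> * of_int n * a n) ^^ N) a)" for N
    by (induction N) (auto intro: assms rapid_deriv_coeff)
  have "smooth_curve (\<lambda>t. ser a (circ t))"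
    unfolding smooth_curve_def
    by (rule exI[of _ "\<lambda>N t. ser (((\<lambda>a n. \<i> * of_int n * a n) ^^ N) a) (circ t)"])
       (use ser_deriv[OF r] in simp)
  then show ?thesis by (simp add: Cinf_def)
qed

lemma lsum_single: "lsum (\<lambda>n. if n = m then c else 0) = c"
  by (cases "c = 0") (simp_all add: lebesgue_integral_count_space_finite_support)

lemma fc_ser:
  assumes "rapid a"
  shows "fc (ser a) m = a m"
proof -
  have "integral {0..2*pi} (\<lambda>t. ser a (circ t) * cis (- (of_int m * t)))
      = integral {0..2*pi} (\<lambda>t. lsum (\<lambda>n. a n * cis (of_int (n - m) * t)))"
  proof (rule integral_cong)
    fix t
    have "ser a (circ t) * cis (- (of_int m * t)) = lsum (\<lambda>n. a n * ee n (circ t) * cis (- (of_int m * t)))"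
      unfolding ser_def by simp
    also have "\<dots> = lsum (\<lambda>n. a n * cis (of_int (n - m) * t))"
      by (simp add: mult.assoc cis_mult algebra_simps)
    finally show "ser a (circ t) * cis (- (of_int m * t)) = lsum (\<lambda>n. a n * cis (of_int (n - m) * t))" .
  qed
  also have "\<dots> = lsum (\<lambda>n. integral {0..2*pi} (\<lambda>t. a n * cis (of_int (n - m) * t)))"
    by (rule integral_lsum(1)[OF _ _ rapid_asum(1)[OF assms]]) (auto intro!: continuous_intros simp: norm_mult)
  also have "\<dots> = lsum (\<lambda>n. if n = m then of_real (2*pi) * a m else 0)"
    by (rule Bochner_Integration.integral_cong) (auto simp only: integral_mult_right integral_cis_int, auto)
  also have "\<dots> = of_real (2*pi) * a m" by (rule lsum_single)
  finally show ?thesis by (simp add: fc_def)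
qed

text \<open>Both sides are continuous with the same Fourier coefficients, so the uniqueness theorem
  applies.\<close>

lemma ser_fc:
  assumes "\<phi> \<in> Cinf"
  shows "ser (fc \<phi>) = \<phi>"
proof -
  note r = rapid_fc[OF assms]
  have "(\<lambda>p. ser (fc \<phi>) p - \<phi> p) = (\<lambda>_. 0)"
    by (rule fourier_unique)
       (use assms r in \<open>auto intro!: Cinf_continuous Cinf_diff ser_Cinf simp: fc_diff fc_ser Cinf_continuous ser_Cinf\<close>)
  then show ?thesis by (simp add: fun_eq_iff)
qed

text \<open>\<phi> alone is expanded; integrating its series termwise against the bounded conjugate
  of \<psi> produces the conjugated coefficients of \<psi>.\<close>

lemma parseval:
  assumes "\<phi> \<in> Cinf" "\<psi> \<in> Cinf"
  shows "integral {0..2*pi} (\<lambda>t. \<phi> (circ t) * cnj (\<psi> (circ t))) = of_real (2*pi) * lsum (\<lambda>n. fc \<phi> n * cnj (fc \<psi> n))"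
proof -
  note r = rapid_fc[OF assms(1)]
  obtain B where B: "\<And>t. norm (\<psi> (circ t)) \<le> B"
    using periodic_bounded[of "\<lambda>t. \<psi> (circ t)"] Cinf_continuous[OF assms(2)] by auto
  have cj: "cnj (fc \<psi> n) = (1 / of_real (2*pi)) * integral {0..2*pi} (\<lambda>t. cis (of_int n * t) * cnj (\<psi> (circ t)))" for n
  proof -
    have "cnj (integral {0..2*pi} (\<lambda>t. \<psi> (circ t) * cis (- (of_int n * t)))) = integral {0..2*pi} (\<lambda>t. cnj (\<psi> (circ t) * cis (- (of_int n * t))))"
      by (rule integral_linear[OF integral_fc_integrable bounded_linear_cnj, unfolded o_def, symmetric]) (rule Cinf_continuous[OF assms(2)])
    then show ?thesis by (simp add: fc_def cis_cnj mult.commute)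
  qed
  have "integral {0..2*pi} (\<lambda>t. \<phi> (circ t) * cnj (\<psi> (circ t))) = integral {0..2*pi} (\<lambda>t. lsum (\<lambda>n. fc \<phi> n * ee n (circ t) * cnj (\<psi> (circ t))))"
  proof (rule integral_cong)
    fix t
    have "\<phi> (circ t) * cnj (\<psi> (circ t)) = ser (fc \<phi>) (circ t) * cnj (\<psi> (circ t))" by (simp add: ser_fc assms)
    then show "\<phi> (circ t) * cnj (\<psi> (circ t)) = lsum (\<lambda>n. fc \<phi> n * ee n (circ t) * cnj (\<psi> (circ t)))"
      unfolding ser_def by simp
  qed
  also have "\<dots> = lsum (\<lambda>n. integral {0..2*pi} (\<lambda>t. fc \<phi> n * ee n (circ t) * cnj (\<psi> (circ t))))"
  proof (rule integral_lsum(1)[where w = "\<lambda>n. norm (fc \<phi> n) * B"])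
    show "continuous_on UNIV (\<lambda>t. fc \<phi> n * ee n (circ t) * cnj (\<psi> (circ t)))" for n
      by (intro continuous_intros Cinf_continuous ee_Cinf assms)
    show "norm (fc \<phi> n * ee n (circ t) * cnj (\<psi> (circ t))) \<le> norm (fc \<phi> n) * B" for n t
      using B[of t] by (simp add: norm_mult mult_left_mono)
  qed (intro integrable_mult_left rapid_asum(1) r)
  also have "\<dots> = lsum (\<lambda>n. of_real (2*pi) * (fc \<phi> n * cnj (fc \<psi> n)))"
  proof (rule Bochner_Integration.integral_cong)
    fix n
    have "integral {0..2*pi} (\<lambda>t. fc \<phi> n * ee n (circ t) * cnj (\<psi> (circ t))) = fc \<phi> n * integral {0..2*pi} (\<lambda>t. cis (of_int n * t) * cnj (\<psi> (circ t)))"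
      by (simp only: mult.assoc integral_mult_right ee_circ)
    then show "integral {0..2*pi} (\<lambda>t. fc \<phi> n * ee n (circ t) * cnj (\<psi> (circ t))) = of_real (2*pi) * (fc \<phi> n * cnj (fc \<psi> n))"
      by (simp add: cj)
  qed simp
  finally show ?thesis by simp
qed

lemma fc_lsum:
  fixes f :: "'i::countable \<Rightarrow> circle \<Rightarrow> complex"
  assumes c: "\<And>i. f i \<in> Cinf" and b: "\<And>i p. norm (f i p) \<le> w i" and w: "asum w"
  shows "fc (\<lambda>p. lsum (\<lambda>i. f i p)) n = lsum (\<lambda>i. fc (f i) n)"
proof -
  have "integral {0..2*pi} (\<lambda>t. lsum (\<lambda>i. f i (circ t)) * cis (- (of_int n * t)))
     = integral {0..2*pi} (\<lambda>t. lsum (\<lambda>i. f i (circ t) * cis (- (of_int n * t))))" by simp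
  also have "\<dots> = lsum (\<lambda>i. integral {0..2*pi} (\<lambda>t. f i (circ t) * cis (- (of_int n * t))))"
    by (rule integral_lsum(1)[OF _ _ w]) (use b in \<open>auto intro!: continuous_intros Cinf_continuous c simp: norm_mult\<close>)
  finally show ?thesis by (simp add: fc_def)
qed

section \<open>Nonstationary phase\<close>

text \<open>Writing the oscillating factor as its derivative divided by i * \<Lambda> * \<theta>'
  and integrating by parts gains a factor 1 / \<Lambda> and replaces h by the derivative of h /
  \<theta>'. The phases are normalized, with bounds on \<theta>' independent of the index, so the
  new amplitude is again a uniformly bounded periodic family and the step can be repeated with
  uniform constants. The large parameter \<Lambda> itself varies with the index.\<close>

lemma nonstationary_phase:
  fixes h :: "'a \<Rightarrow> real \<Rightarrow> complex" and \<theta> :: "'a \<Rightarrow> real \<Rightarrow> real"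
  assumes d: "\<And>\<alpha> t. (\<theta> \<alpha> has_vector_derivative \<theta>' \<alpha> t) (at t)" and \<theta>': "ub UNIV \<theta>'"
    and c: "c > 0" "\<And>\<alpha> t. \<bar>\<theta>' \<alpha> t\<bar> \<ge> c"
    and p: "\<And>\<alpha> t. \<theta>' \<alpha> (t + 2*pi) = \<theta>' \<alpha> t" "\<And>\<alpha>. cis (\<Lambda> \<alpha> * \<theta> \<alpha> (2*pi)) = cis (\<Lambda> \<alpha> * \<theta> \<alpha> 0)"
  shows "ub UNIV h \<Longrightarrow> (\<And>\<alpha> t. h \<alpha> (t + 2*pi) = h \<alpha> t) \<Longrightarrow>
    \<exists>C. \<forall>\<alpha>. norm (integral {0..2*pi} (\<lambda>t. cis (\<Lambda> \<alpha> * \<theta> \<alpha> t) * h \<alpha> t)) * \<bar>\<Lambda> \<alpha>\<bar> ^ N \<le> C"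
proof (induction N arbitrary: h)
  case 0
  obtain B where B: "B > 0" "\<And>\<alpha> t. t \<in> UNIV \<Longrightarrow> norm (h \<alpha> t) \<le> B" using ub_boundE[OF 0(1)] by blast
  have c\<theta>: "continuous_on A (\<theta> \<alpha>)" for A \<alpha> by (rule vector_derivative_continuous_on[OF d])
  have "norm (integral {0..2*pi} (\<lambda>t. cis (\<Lambda> \<alpha> * \<theta> \<alpha> t) * h \<alpha> t)) \<le> integral {0..2*pi} (\<lambda>_. B)" for \<alpha>
    by (rule integral_norm_bound_integral)
       (use B in \<open>auto intro!: integrable_continuous_interval continuous_intros c\<theta> ub_continuous[OF 0(1)] simp: norm_mult\<close>)
  then show ?case by auto
next
  case (Suc N)
  define q where "q = (\<lambda>\<alpha> t. of_real (inverse (\<theta>' \<alpha> t)) * h \<alpha> t)"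
  have nz: "\<theta>' \<alpha> t \<noteq> 0" for \<alpha> t using c(1) c(2)[of \<alpha> t] by auto
  have qu: "ub UNIV q"
    unfolding q_def
    by (intro ub_mult ub_linear[OF bounded_linear_of_real] ub_inverse[OF \<theta>' nz c(1)] Suc.prems(1)) (use c in simp)
  have qp: "q \<alpha> (t + 2*pi) = q \<alpha> t" for \<alpha> t by (simp add: q_def p Suc.prems)
  have dqp: "dv q \<alpha> (t + 2*pi) = dv q \<alpha> t" for \<alpha> t
    by (rule periodic_deriv[OF qp ub_deriv[OF qu]])
  obtain C where C: "\<And>\<alpha>. norm (integral {0..2*pi} (\<lambda>t. cis (\<Lambda> \<alpha> * \<theta> \<alpha> t) * dv q \<alpha> t)) * \<bar>\<Lambda> \<alpha>\<bar> ^ N \<le> C"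
    using Suc.IH[OF ub_dv[OF qu] dqp] by blast
  have "norm (integral {0..2*pi} (\<lambda>t. cis (\<Lambda> \<alpha> * \<theta> \<alpha> t) * h \<alpha> t)) * \<bar>\<Lambda> \<alpha>\<bar> ^ Suc N \<le> \<bar>C\<bar>" for \<alpha>
  \<comment> \<open>For \<Lambda> = 0 the positive power makes the left-hand side 0.\<close>
  proof (cases "\<Lambda> \<alpha> = 0")
    case False
    let ?e = "\<lambda>t. cis (\<Lambda> \<alpha> * \<theta> \<alpha> t)" and ?e' = "\<lambda>t. \<i> * of_real (\<Lambda> \<alpha> * \<theta>' \<alpha> t) * cis (\<Lambda> \<alpha> * \<theta> \<alpha> t)"
    have de: "(?e has_vector_derivative ?e' t) (at t)" for t
      using d[of \<alpha> t] unfolding has_vector_derivative_def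
      by (auto intro!: derivative_eq_intros simp: scaleR_conv_of_real mult_ac)
    have c\<theta>: "continuous_on A (\<theta> \<alpha>)" for A by (rule vector_derivative_continuous_on[OF d])
    have "integral {0..0 + 2*pi} (\<lambda>t. ?e' t * q \<alpha> t) = - integral {0..0 + 2*pi} (\<lambda>t. ?e t * dv q \<alpha> t)"
    proof (rule periodic_by_parts[OF bounded_bilinear_mult de ub_deriv[OF qu]])
      show "continuous_on UNIV ?e'" by (intro continuous_intros c\<theta> ub_continuous[OF \<theta>'])
      show "?e (0 + 2*pi) * q \<alpha> (0 + 2*pi) = ?e 0 * q \<alpha> 0" using p(2)[of \<alpha>] qp[of \<alpha> 0] by simp
    qed (rule ub_continuous[OF ub_dv[OF qu]])
    moreover have "(\<lambda>t. ?e' t * q \<alpha> t) = (\<lambda>t. (\<i> * of_real (\<Lambda> \<alpha>)) * (?e t * h \<alpha> t))"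
      by (rule ext) (simp add: q_def nz field_simps)
    ultimately have "\<i> * of_real (\<Lambda> \<alpha>) * integral {0..2*pi} (\<lambda>t. ?e t * h \<alpha> t) = - integral {0..2*pi} (\<lambda>t. ?e t * dv q \<alpha> t)"
      by (simp only: integral_mult_right add_0)
    then have "norm (integral {0..2*pi} (\<lambda>t. ?e t * dv q \<alpha> t)) = \<bar>\<Lambda> \<alpha>\<bar> * norm (integral {0..2*pi} (\<lambda>t. ?e t * h \<alpha> t))"
      by (metis (no_types, lifting) norm_minus_cancel norm_mult norm_ii norm_of_real mult_1)
    then show ?thesis using C[of \<alpha>] by (simp add: mult_ac)
  qed simp
  then show ?case by blast
qed

section \<open>Bilinear operations on the fibres and linear operators on sections\<close>

definition dotc :: "complex^'k \<Rightarrow> complex^'k \<Rightarrow> complex" where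
  "dotc u v = (\<Sum>i\<in>UNIV. u $ i * v $ i)"

text \<open>The rank-one matrix sending f to \<open>dotc v f *s u\<close>; it turns a matrix
  coefficient of an operator into a piece of its kernel.\<close>

definition outer :: "complex^'k \<Rightarrow> complex^'k \<Rightarrow> complex^'k^'k" where
  "outer u v = (\<chi> a c. u $ a * v $ c)"

lemma bb_smult: "bounded_bilinear (\<lambda>(c::complex) (v::complex^'k). c *s v)"
  unfolding bilinear_conv_bounded_bilinear[symmetric] bilinear_def
  by (auto intro!: linearI simp: vec_eq_iff distrib_left distrib_right)

lemma bb_dotc: "bounded_bilinear (dotc :: complex^'k \<Rightarrow> _)"
  unfolding bilinear_conv_bounded_bilinear[symmetric] bilinear_def
  by (auto intro!: linearI simp: dotc_def distrib_left distrib_right sum.distrib scaleR_sum_right)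

lemma bb_outer: "bounded_bilinear (outer :: complex^'k \<Rightarrow> _)"
  unfolding bilinear_conv_bounded_bilinear[symmetric] bilinear_def
  by (auto intro!: linearI simp: outer_def vec_eq_iff distrib_left distrib_right)

lemma bb_matvec: "bounded_bilinear (\<lambda>(M::complex^'k^'k) v. M *v v)"
  unfolding bilinear_conv_bounded_bilinear[symmetric] bilinear_def
  by (auto intro!: linearI simp: matrix_vector_mult_def vec_eq_iff distrib_left distrib_right sum.distrib scaleR_sum_right)

lemma outer_mult: "outer u v *v f = dotc v f *s u"
  by (simp add: outer_def dotc_def matrix_vector_mult_def vec_eq_iff sum_distrib_left mult_ac)

lemma norm_smult: "norm (c *s v :: complex^'k) = norm c * norm v"
  by (simp add: norm_vec_def norm_mult L2_set_right_distrib)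

lemma bb_bound:
  assumes "bounded_bilinear b"
  obtains K where "K > 0" "\<And>x y. norm (b x y) \<le> K * (norm x * norm y)"
  using bounded_bilinear.pos_bounded[OF assms] by (metis mult.commute)

lemma smult_assoc: "c *s (d *s v) = (c * d) *s (v :: complex^'k)"
  by (simp add: vec_eq_iff)

lemma dotc_smult: "dotc (c *s u) v = c * dotc u v" "dotc u (c *s v) = c * dotc u v"
  by (simp_all add: dotc_def sum_distrib_left mult_ac)

lemma dotc_sum: "dotc u (\<Sum>i\<in>I. f i) = (\<Sum>i\<in>I. dotc u (f i))"
  using bounded_linear.linear[OF bounded_bilinear.bounded_linear_right[OF bb_dotc]] linear_sum by blast

lemma dotc_add: "dotc u (v + v') = dotc u v + dotc u v'" and dotc_diff: "dotc u (v - v') = dotc u v - dotc u v'"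
  by (simp_all add: dotc_def algebra_simps sum.distrib sum_subtractf)

lemma linear_op_add: "linear_op A \<Longrightarrow> f \<in> Cinf \<Longrightarrow> g \<in> Cinf \<Longrightarrow> A (\<lambda>p. f p + g p) = (\<lambda>p. A f p + A g p)"
  unfolding linear_op_def by (metis (no_types, lifting) vec.scale_one ext)

lemma linear_op_zero: "linear_op A \<Longrightarrow> A (\<lambda>_. 0) = (\<lambda>_. 0)"
proof -
  assume "linear_op A"
  from linear_op_add[OF this Cinf_const[of 0] Cinf_const[of 0]] show ?thesis by (auto simp: fun_eq_iff)
qed

lemma linear_op_Cinf: "linear_op A \<Longrightarrow> f \<in> Cinf \<Longrightarrow> A f \<in> Cinf"
  by (simp add: linear_op_def)

lemma linear_op_sum:
  assumes A: "linear_op A" and "finite I" and f: "\<And>i. i \<in> I \<Longrightarrow> f i \<in> Cinf"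
  shows "A (\<lambda>p. \<Sum>i\<in>I. f i p) = (\<lambda>p. \<Sum>i\<in>I. A (f i) p)"
  using assms(2,3)
proof (induction I)
  case (insert i I)
  have "A (\<lambda>p. f i p + (\<Sum>i\<in>I. f i p)) = (\<lambda>p. A (f i) p + A (\<lambda>p. \<Sum>i\<in>I. f i p) p)"
    by (rule linear_op_add[OF A]) (use insert in \<open>auto intro: Cinf_sum\<close>)
  then show ?case using insert by simp
qed (simp add: linear_op_zero[OF A])

lemma ub_smult: "ub T F \<Longrightarrow> ub T G \<Longrightarrow> ub T (\<lambda>\<alpha> t. F \<alpha> t *s (G \<alpha> t :: complex^'k))"
  by (rule ub_bilinear[OF bb_smult])

lemma Cinf_smult: "f \<in> Cinf \<Longrightarrow> g \<in> Cinf \<Longrightarrow> (\<lambda>p. f p *s (g p :: complex^'k)) \<in> Cinf"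
  by (rule Cinf_bilinear[OF bb_smult])

lemma Cinf_dotc: "f \<in> Cinf \<Longrightarrow> g \<in> Cinf \<Longrightarrow> (\<lambda>p. dotc (f p) (g p)) \<in> Cinf"
  by (rule Cinf_bilinear[OF bb_dotc])

lemma one_plus_abs_ge_1: "1 \<le> 1 + \<bar>x\<bar>" for x :: real by simp

text \<open>Derivatives of \<open>t \<mapsto> cis (\<mu> * t) g(t)\<close> grow polynomially in \<open>\<mu>\<close>; normalizing the \<open>i\<close>-th one by
  \<open>(1 + \<bar>\<mu>\<bar>) ^ i\<close> keeps the factor in front of \<open>cis (\<mu> * t)\<close> in a uniformly bounded family.\<close>

lemma modulated_family:
  fixes g :: "'a \<Rightarrow> real \<Rightarrow> 'v::real_normed_vector" and \<mu> :: "'a \<Rightarrow> real"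
  assumes sc: "bounded_bilinear sc" and sc_assoc: "\<And>c d v. sc c (sc d v) = sc (c * d) v" and g: "ub UNIV g"
  obtains E :: "nat \<Rightarrow> 'a \<Rightarrow> real \<Rightarrow> 'v" and C :: "nat \<Rightarrow> real"
  where "\<And>m t. E 0 m t = sc (cis (\<mu> m * t)) (g m t)"
    "\<And>i m t. (E i m has_vector_derivative E (Suc i) m t) (at t)"
    "\<And>i m t. norm (E i m t) \<le> C i * (1 + \<bar>\<mu> m\<bar>) ^ i"
proof -
  interpret sc: bounded_bilinear sc by (rule sc)
  define N where "N m = 1 + \<bar>\<mu> m\<bar>" for m
  have N: "N m \<ge> 1" "N m > 0" "N m \<noteq> 0" for m by (auto simp: N_def)
  define c where "c m = \<i> * of_real (\<mu> m / N m)" for m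
  define step where "step Q = (\<lambda>m t. sc (c m) (Q m t) + (1 / N m) *\<^sub>R dv Q m t)" for Q :: "'a \<Rightarrow> real \<Rightarrow> 'v"
  define Q where "Q i = (step ^^ i) g" for i
  have cb: "norm (c m) \<le> 1" for m by (simp add: c_def norm_mult norm_divide N_def del: of_real_add)
  have Qu: "ub UNIV (Q i)" for i
  proof (induction i)
    case (Suc i)
    have "ub UNIV (step (Q i))" unfolding step_def
      by (intro ub_add ub_bilinear[OF sc] ub_scaleR ub_dv Suc ub_const[where C = 1] ub_const[where C = 1]) (use cb N in \<open>auto simp: abs_of_pos\<close>)
    then show ?case by (simp add: Q_def)
  qed (use g in \<open>simp add: Q_def\<close>)
  define E where "E i m t = (N m ^ i) *\<^sub>R sc (cis (\<mu> m * t)) (Q i m t)" for i m t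
  have "(E i m has_vector_derivative E (Suc i) m t) (at t)" for i m t
  proof -
    let ?e = "cis (\<mu> m * t)"
    have "((\<lambda>t. sc (cis (\<mu> m * t)) (Q i m t)) has_vector_derivative
        sc ?e (dv (Q i) m t) + sc (\<i> * of_real (\<mu> m) * ?e) (Q i m t)) (at t)"
      by (rule bounded_bilinear.has_vector_derivative[OF sc cis_mult_deriv ub_deriv[OF Qu]])
    from bounded_linear.has_vector_derivative[OF bounded_linear_scaleR_right[of "N m ^ i"] this]
    have "(E i m has_vector_derivative (N m ^ i) *\<^sub>R (sc ?e (dv (Q i) m t) + sc (\<i> * of_real (\<mu> m) * ?e) (Q i m t))) (at t)"
      unfolding E_def .
    moreover have "sc ?e (dv (Q i) m t) + sc (\<i> * of_real (\<mu> m) * ?e) (Q i m t) = N m *\<^sub>R sc ?e (Q (Suc i) m t)"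
    proof -
      have "N m *\<^sub>R (?e * c m) = \<i> * of_real (\<mu> m) * ?e"
        using N(3)[of m] by (simp add: c_def scaleR_conv_of_real)
      then have "N m *\<^sub>R sc ?e (sc (c m) (Q i m t)) = sc (\<i> * of_real (\<mu> m) * ?e) (Q i m t)"
        by (simp only: sc_assoc sc.scaleR_left[symmetric])
      moreover have "N m *\<^sub>R sc ?e ((1 / N m) *\<^sub>R dv (Q i) m t) = sc ?e (dv (Q i) m t)"
        using N(3)[of m] by (simp add: sc.scaleR_right)
      moreover have "Q (Suc i) m t = sc (c m) (Q i m t) + (1 / N m) *\<^sub>R dv (Q i) m t" by (simp add: Q_def step_def)
      ultimately show ?thesis by (simp add: sc.add_right scaleR_right_distrib add.commute)
    qed
    ultimately show ?thesis by (simp add: E_def mult.commute)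
  qed
  moreover have "\<exists>C. \<forall>m t. norm (E i m t) \<le> C * (1 + \<bar>\<mu> m\<bar>) ^ i" for i
  proof -
    obtain C where C: "C > 0" "\<And>m t. t \<in> UNIV \<Longrightarrow> norm (Q i m t) \<le> C" using ub_boundE[OF Qu[of i]] by blast
    obtain K where K: "K > 0" "\<And>x y. norm (sc x y) \<le> K * (norm x * norm y)" using bb_bound[OF sc] by blast
    have "norm (E i m t) \<le> (K * C) * N m ^ i" for m t
    proof -
      have "norm (sc (cis (\<mu> m * t)) (Q i m t)) \<le> K * C"
        by (rule order_trans[OF K(2)]) (use K C in simp)
      then show ?thesis using N(2)[of m] by (simp add: E_def mult.commute mult_left_mono)
    qed
    then show ?thesis unfolding N_def by blast
  qed
  moreover have "E 0 m t = sc (cis (\<mu> m * t)) (g m t)" for m t by (simp add: E_def Q_def)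
  ultimately show ?thesis using that[of E] by metis
qed

section \<open>Smooth kernels given by double Fourier series\<close>

definition rapid2 :: "(int \<Rightarrow> int \<Rightarrow> complex) \<Rightarrow> bool" where
  "rapid2 r \<longleftrightarrow> (\<forall>N. \<exists>C. \<forall>n m. norm (r n m) * ((1 + \<bar>real_of_int n\<bar>) ^ N * (1 + \<bar>real_of_int m\<bar>) ^ N) \<le> C)"

lemma asum_weight2:
  "asum (\<lambda>(n::int, m::int). C * (1 / (1 + \<bar>real_of_int n\<bar>) ^ 2 * (1 / (1 + \<bar>real_of_int m\<bar>) ^ 2)))"
proof -
  have "asum (\<lambda>(n::int, m::int). (1 / (1 + \<bar>real_of_int n\<bar>) ^ 2 * (1 / (1 + \<bar>real_of_int m\<bar>) ^ 2)))"
    by (rule asum_prod[OF asum_int asum_int]) auto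
  from integrable_mult_right[OF this, of C] show ?thesis by (simp add: case_prod_unfold)
qed

text \<open>Two powers beyond those spent on i and k derivatives leave a weight that is summable
  over pairs of integers.\<close>

lemma rapid2_bound:
  assumes "rapid2 r"
  obtains C where "C \<ge> 0" "\<And>n m. norm (r n m) * ((1 + \<bar>real_of_int n\<bar>) ^ i * (1 + \<bar>real_of_int m\<bar>) ^ k) \<le>
      C * (1 / (1 + \<bar>real_of_int n\<bar>) ^ 2 * (1 / (1 + \<bar>real_of_int m\<bar>) ^ 2))"
proof -
  obtain C where C: "\<And>n m. norm (r n m) * ((1 + \<bar>real_of_int n\<bar>) ^ (i + k + 2) * (1 + \<bar>real_of_int m\<bar>) ^ (i + k + 2)) \<le> C"
    using assms unfolding rapid2_def by blast
  have C0: "C \<ge> 0" using C[of 0 0] by (simp add: order_trans[OF norm_ge_zero])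
  have "norm (r n m) * ((1 + \<bar>real_of_int n\<bar>) ^ i * (1 + \<bar>real_of_int m\<bar>) ^ k) \<le>
      C * (1 / (1 + \<bar>real_of_int n\<bar>) ^ 2 * (1 / (1 + \<bar>real_of_int m\<bar>) ^ 2))" for n m
  proof -
    let ?n = "1 + \<bar>real_of_int n\<bar>" and ?m = "1 + \<bar>real_of_int m\<bar>"
    have "norm (r n m) * (?n ^ i * ?m ^ k) * (?n ^ 2 * ?m ^ 2) = norm (r n m) * (?n ^ (i + 2) * ?m ^ (k + 2))"
      by (simp only: power_add mult_ac)
    also have "\<dots> \<le> norm (r n m) * (?n ^ (i + k + 2) * ?m ^ (i + k + 2))"
      by (intro mult_left_mono mult_mono power_increasing) auto
    also have "\<dots> \<le> C" by (rule C)
    finally have "norm (r n m) * (?n ^ i * ?m ^ k) \<le> C / (?n ^ 2 * ?m ^ 2)"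
      by (subst pos_le_divide_eq) (auto intro!: mult_pos_pos zero_less_power add_pos_nonneg)
    then show ?thesis by simp
  qed
  with C0 show ?thesis using that by blast
qed

text \<open>Each derivative of a term costs one power of 1 + |n| or of 1 + |m|, which the rapid
  decrease of r pays for; hence the series may be differentiated termwise. The factor
  \<open>ee (- n) q\<close> is chosen so that integration against f yields the n-th Fourier
  coefficient of the coordinate \<open>dotc (v q) (f q)\<close>.\<close>

lemma kernel_series:
  fixes u v :: "circle \<Rightarrow> complex^'k"
  assumes r: "rapid2 r" and u: "u \<in> Cinf" and v: "v \<in> Cinf"
  defines "K \<equiv> \<lambda>p q. lsum (\<lambda>(n, m). outer (r n m *s (ee m p *s u p)) (ee (- n) q *s v q))"
  shows "smooth_kernel K"
    and "f \<in> Cinf \<Longrightarrow> kernel_op K f p = lsum (\<lambda>(n, m). (r n m * (of_real (2*pi) * fc (\<lambda>q. dotc (v q) (f q)) n)) *s (ee m p *s u p))"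
    and "continuous_on UNIV (\<lambda>t. K p (circ t))"
proof -
  obtain E CE where E: "\<And>m t. E 0 m t = cis (of_int m * t) *s u (circ t)"
    "\<And>i m t. (E i m has_vector_derivative E (Suc i) m t) (at t)"
    "\<And>i m t. norm (E i m t) \<le> CE i * (1 + \<bar>real_of_int m\<bar>) ^ i"
    using modulated_family[OF bb_smult smult_assoc iffD1[OF Cinf_ub u], of real_of_int] by metis
  obtain E' CE' where E': "\<And>m t. E' 0 m t = cis (of_int m * t) *s v (circ t)"
    "\<And>i m t. (E' i m has_vector_derivative E' (Suc i) m t) (at t)"
    "\<And>i m t. norm (E' i m t) \<le> CE' i * (1 + \<bar>real_of_int m\<bar>) ^ i"
    using modulated_family[OF bb_smult smult_assoc iffD1[OF Cinf_ub v], of real_of_int] by metis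
  \<comment> \<open>\<open>T i k\<close> is the general term of the series for the derivative of
    order i in x and k in y.\<close>
  define T where "T i k = (\<lambda>(n, m) x y. outer (r n m *s E i m x) (E' k (- n) y))" for i k
  obtain Ko where Ko: "Ko > 0" "\<And>x y. norm (outer (x::complex^'k) y) \<le> Ko * (norm x * norm y)" using bb_bound[OF bb_outer[where 'k='k]] by blast
  have Tb: "\<exists>W. asum W \<and> (\<forall>z x y. norm (T i k z x y) \<le> W z)" for i k
  proof -
    obtain C where C: "C \<ge> 0" "\<And>n m. norm (r n m) * ((1 + \<bar>real_of_int n\<bar>) ^ k * (1 + \<bar>real_of_int m\<bar>) ^ i) \<le>
      C * (1 / (1 + \<bar>real_of_int n\<bar>) ^ 2 * (1 / (1 + \<bar>real_of_int m\<bar>) ^ 2))" by (rule rapid2_bound[OF r, where i = k and k = i]) (rule that)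
    define D where "D = Ko * \<bar>CE i\<bar> * \<bar>CE' k\<bar> * C"
    have "norm (T i k (n, m) x y) \<le> D * (1 / (1 + \<bar>real_of_int n\<bar>) ^ 2 * (1 / (1 + \<bar>real_of_int m\<bar>) ^ 2))" for n m x y
    proof -
      have e: "norm (E i m x) \<le> \<bar>CE i\<bar> * (1 + \<bar>real_of_int m\<bar>) ^ i" "norm (E' k (-n) y) \<le> \<bar>CE' k\<bar> * (1 + \<bar>real_of_int n\<bar>) ^ k"
        using order_trans[OF E(3)[of i m x] mult_right_mono[OF abs_ge_self]] order_trans[OF E'(3)[of k "-n" y] mult_right_mono[OF abs_ge_self]] by simp_all
      have "norm (T i k (n, m) x y) \<le> Ko * (norm (r n m) * norm (E i m x) * norm (E' k (-n) y))"
        using Ko(2)[of "r n m *s E i m x"] by (simp add: T_def norm_smult)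
      also have "\<dots> \<le> Ko * (norm (r n m) * (\<bar>CE i\<bar> * (1 + \<bar>real_of_int m\<bar>) ^ i) * (\<bar>CE' k\<bar> * (1 + \<bar>real_of_int n\<bar>) ^ k))"
        using Ko(1) e by (intro mult_left_mono mult_mono) auto
      also have "\<dots> = (Ko * \<bar>CE i\<bar> * \<bar>CE' k\<bar>) * (norm (r n m) * ((1 + \<bar>real_of_int n\<bar>) ^ k * (1 + \<bar>real_of_int m\<bar>) ^ i))"
        by (simp add: mult_ac)
      also have "\<dots> \<le> (Ko * \<bar>CE i\<bar> * \<bar>CE' k\<bar>) * (C * (1 / (1 + \<bar>real_of_int n\<bar>) ^ 2 * (1 / (1 + \<bar>real_of_int m\<bar>) ^ 2)))"
        using Ko(1) by (intro mult_left_mono C) auto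
      finally show ?thesis by (simp add: D_def mult_ac)
    qed
    then show ?thesis using asum_weight2[of D] by (intro exI[of _ "\<lambda>(n, m). D * (1 / (1 + \<bar>real_of_int n\<bar>) ^ 2 * (1 / (1 + \<bar>real_of_int m\<bar>) ^ 2))"]) auto
  qed
  have Td1: "((\<lambda>x. T i k z x y) has_vector_derivative T (Suc i) k z x y) (at x)" for i k z x y
  proof (cases z)
    case (Pair n m)
    have bl: "bounded_linear (\<lambda>w. outer (r n m *s w) (E' k (-n) y))"
      by (rule bounded_linear_compose[OF bounded_bilinear.bounded_linear_left[OF bb_outer] bounded_bilinear.bounded_linear_right[OF bb_smult]])
    from bounded_linear.has_vector_derivative[OF bl E(2)] show ?thesis by (simp add: T_def Pair)
  qed
  have Td2: "((\<lambda>y. T i k z x y) has_vector_derivative T i (Suc k) z x y) (at y)" for i k z x y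
  proof (cases z)
    case (Pair n m)
    from bounded_linear.has_vector_derivative[OF bounded_bilinear.bounded_linear_right[OF bb_outer] E'(2)] show ?thesis by (simp add: T_def Pair)
  qed
  define F where "F i k x y = lsum (\<lambda>z. T i k z x y)" for i k x y
  have cE: "continuous_on A (E i m)" "continuous_on A (E' i m)" for A i m
    by (rule vector_derivative_continuous_on[OF E(2)], rule vector_derivative_continuous_on[OF E'(2)])
  have cT: "continuous_on UNIV (\<lambda>z'. T i k z (fst z') (snd z'))" for i k z
  proof (cases z)
    case (Pair n m)
    have "continuous_on UNIV (\<lambda>z'. E i m (fst z'))" "continuous_on UNIV (\<lambda>z'. E' k (-n) (snd z'))"
      by (rule continuous_on_compose2[OF cE(1)[of UNIV]] continuous_on_compose2[OF cE(2)[of UNIV]]; auto intro: continuous_intros)+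
    then show ?thesis unfolding T_def Pair prod.case
      by (intro bounded_bilinear.continuous_on[OF bb_outer] bounded_bilinear.continuous_on[OF bb_smult] continuous_on_const)
  qed
  have KF: "K (circ x) (circ y) = F 0 0 x y" for x y
    by (simp add: K_def F_def T_def E E' case_prod_unfold)
  have "partials_on UNIV (\<lambda>x y. K (circ x) (circ y)) F"
    unfolding partials_on_def
  proof (intro conjI allI ballI)
    fix z show "case z of (x, y) \<Rightarrow> F 0 0 x y = K (circ x) (circ y)" by (auto simp: KF)
  next
    fix i k
    obtain W where W: "asum W" "\<And>z x y. norm (T i k z x y) \<le> W z" using Tb by blast
    have "continuous_on UNIV (\<lambda>z'. lsum (\<lambda>z. T i k z (fst z') (snd z')))"
      by (rule continuous_on_integral_dominated[OF cT _ W(2) W(1)]) simp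
    then show "continuous_on UNIV (\<lambda>(x, y). F i k x y)" by (simp add: F_def case_prod_unfold)
  next
    fix i k and z :: "real \<times> real"
    obtain x y where z: "z = (x, y)" by (cases z)
    obtain W where W: "asum W" "\<And>z x y. norm (T i k z x y) \<le> W z" using Tb by blast
    obtain W1 where W1: "asum W1" "\<And>z x y. norm (T (Suc i) k z x y) \<le> W1 z" using Tb by blast
    obtain W2 where W2: "asum W2" "\<And>z x y. norm (T i (Suc k) z x y) \<le> W2 z" using Tb by blast
    have "((\<lambda>s. F i k s y) has_vector_derivative F (Suc i) k x y) (at x)" unfolding F_def
      by (rule deriv_lsum[OF Td1 W(2) W(1) W1(2) W1(1)])
    moreover have "((\<lambda>s. F i k x s) has_vector_derivative F i (Suc k) x y) (at y)" unfolding F_def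
      by (rule deriv_lsum[OF Td2 W(2) W(1) W2(2) W2(1)])
    ultimately show "case z of (x, y) \<Rightarrow> ((\<lambda>s. F i k s y) has_vector_derivative F (Suc i) k x y) (at x) \<and>
        ((\<lambda>s. F i k x s) has_vector_derivative F i (Suc k) x y) (at y)" by (simp add: z)
  qed
  then show "smooth_kernel K" unfolding smooth_kernel_def by blast
  obtain W where W: "asum W" "\<And>z x y. norm (T 0 0 z x y) \<le> W z" using Tb by blast
  obtain x where p: "p = circ x" by (rule circ_surj)
  have cTy: "continuous_on UNIV (\<lambda>y. T 0 0 z x y)" for z
    by (rule vector_derivative_continuous_on[OF Td2])
  show "continuous_on UNIV (\<lambda>t. K p (circ t))"
    unfolding p KF F_def by (rule integral_lsum(2)[OF cTy W(2) W(1)])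
  show "kernel_op K f p = lsum (\<lambda>(n, m). (r n m * (of_real (2*pi) * fc (\<lambda>q. dotc (v q) (f q)) n)) *s (ee m p *s u p))" if f: "f \<in> Cinf"
  proof -
    obtain Kv where Kv: "Kv > 0" "\<And>M f. norm ((M::complex^'k^'k) *v f) \<le> Kv * (norm M * norm f)" using bb_bound[OF bb_matvec[where 'k='k]] by blast
    obtain B where B: "\<And>t. norm (f (circ t)) \<le> B" using periodic_bounded[of "\<lambda>t. f (circ t)"] Cinf_continuous[OF f] by auto
    have B0: "B \<ge> 0" using B[of 0] norm_ge_zero order_trans by blast
    have "kernel_op K f p = integral {0..2*pi} (\<lambda>t. lsum (\<lambda>z. T 0 0 z x t *v f (circ t)))"
      unfolding kernel_op_def p KF F_def
    proof (rule integral_cong)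
      fix t
      have "asum (\<lambda>z. T 0 0 z x t)" by (rule asum_bound[OF W])
      from integral_bounded_linear[OF bounded_bilinear.bounded_linear_left[OF bb_matvec] this]
      show "lsum (\<lambda>z. T 0 0 z x t) *v f (circ t) = lsum (\<lambda>z. T 0 0 z x t *v f (circ t))" by simp
    qed
    also have "\<dots> = lsum (\<lambda>z. integral {0..2*pi} (\<lambda>t. T 0 0 z x t *v f (circ t)))"
    proof (rule integral_lsum(1)[where w = "\<lambda>z. Kv * (W z * B)"])
      show "continuous_on UNIV (\<lambda>t. T 0 0 z x t *v f (circ t))" for z
        by (rule bounded_bilinear.continuous_on[OF bb_matvec cTy Cinf_continuous[OF f]])
      have W0: "W z \<ge> 0" for z using W(2)[of z 0 0] norm_ge_zero order_trans by blast
      show "norm (T 0 0 z x t *v f (circ t)) \<le> Kv * (W z * B)" for z t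
        by (rule order_trans[OF Kv(2)]) (intro mult_left_mono mult_mono W(2) B W0 norm_ge_zero less_imp_le[OF Kv(1)])
      show "asum (\<lambda>z. Kv * (W z * B))" by (intro integrable_mult_right integrable_mult_left W)
    qed
    also have "\<dots> = lsum (\<lambda>(n, m). (r n m * (of_real (2*pi) * fc (\<lambda>q. dotc (v q) (f q)) n)) *s (ee m p *s u p))"
    proof (rule Bochner_Integration.integral_cong, simp, clarify)
      fix n m
      have "integral {0..2*pi} (\<lambda>t. T 0 0 (n, m) x t *v f (circ t)) =
         integral {0..2*pi} (\<lambda>t. (dotc (v (circ t)) (f (circ t)) * cis (- (of_int n * t))) *s (r n m *s (ee m p *s u p)))"
        by (rule integral_cong) (simp add: T_def E E' outer_mult dotc_smult p mult_ac)
      also have "\<dots> = integral {0..2*pi} (\<lambda>t. dotc (v (circ t)) (f (circ t)) * cis (- (of_int n * t))) *s (r n m *s (ee m p *s u p))"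
        by (rule integral_linear[OF _ bounded_bilinear.bounded_linear_left[OF bb_smult], unfolded o_def])
           (rule integral_fc_integrable[of "\<lambda>q. dotc (v q) (f q)"], rule Cinf_continuous[OF Cinf_dotc[OF v f]])
      finally show "integral {0..2*pi} (\<lambda>t. T 0 0 (n, m) x t *v f (circ t)) =
          (r n m * (of_real (2*pi) * fc (\<lambda>q. dotc (v q) (f q)) n)) *s (ee m p *s u p)"
        by (simp add: fc_def smult_assoc mult_ac)
    qed
    finally show ?thesis .
  qed
qed

section \<open>Frames and Fourier multipliers\<close>

lemma smooth_kernel_add: "smooth_kernel K \<Longrightarrow> smooth_kernel L \<Longrightarrow> smooth_kernel (\<lambda>p q. K p q + L p q)"
proof -
  assume "smooth_kernel K" "smooth_kernel L"
  then obtain F G where FG: "partials_on UNIV (\<lambda>x y. K (circ x) (circ y)) F" "partials_on UNIV (\<lambda>x y. L (circ x) (circ y)) G"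
    unfolding smooth_kernel_def by blast
  have "partials_on UNIV (\<lambda>x y. K (circ x) (circ y) + L (circ x) (circ y)) (\<lambda>i j x y. F i j x y + G i j x y)"
    using FG unfolding partials_on_def
    by (auto simp: case_prod_unfold intro!: continuous_on_add has_vector_derivative_add)
  then show ?thesis unfolding smooth_kernel_def by blast
qed

lemma smooth_kernel_linear:
  assumes h: "bounded_linear h" and "smooth_kernel K"
  shows "smooth_kernel (\<lambda>p q. h (K p q))"
proof -
  obtain F where F: "partials_on UNIV (\<lambda>x y. K (circ x) (circ y)) F"
    using assms(2) unfolding smooth_kernel_def by blast
  have "partials_on UNIV (\<lambda>x y. h (K (circ x) (circ y))) (\<lambda>i j x y. h (F i j x y))"
    using F unfolding partials_on_def
    by (auto simp: case_prod_unfold intro!: bounded_linear.continuous_on[OF h] bounded_linear.has_vector_derivative[OF h])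
  then show ?thesis unfolding smooth_kernel_def by blast
qed

lemma smooth_kernel_zero: "smooth_kernel (\<lambda>p q. 0)"
  unfolding smooth_kernel_def partials_on_def by (intro exI[of _ "\<lambda>i j x y. 0"]) auto

lemma smooth_kernel_sum: "(\<And>i. i \<in> I \<Longrightarrow> smooth_kernel (K i)) \<Longrightarrow> smooth_kernel (\<lambda>p q. \<Sum>i\<in>I. K i p q)"
  by (induction I rule: infinite_finite_induct) (auto simp: smooth_kernel_zero intro: smooth_kernel_add)

lemma smooth_kernel_continuous:
  assumes "smooth_kernel K"
  shows "continuous_on UNIV (\<lambda>(x, y). K (circ x) (circ y))" "continuous_on UNIV (\<lambda>t. K p (circ t))"
proof -
  obtain F where F: "partials_on UNIV (\<lambda>x y. K (circ x) (circ y)) F"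
    using assms unfolding smooth_kernel_def by blast
  then have "(\<lambda>(x, y). F 0 0 x y) = (\<lambda>(x, y). K (circ x) (circ y))"
    by (auto simp: partials_on_def fun_eq_iff)
  moreover have "continuous_on UNIV (\<lambda>(x, y). F 0 0 x y)" using F unfolding partials_on_def by blast
  ultimately show c: "continuous_on UNIV (\<lambda>(x, y). K (circ x) (circ y))" by (simp only:)
  obtain x where p: "p = circ x" by (rule circ_surj)
  have "continuous_on UNIV (\<lambda>t. case (x, t) of (x, y) \<Rightarrow> K (circ x) (circ y))"
    by (rule continuous_on_compose2[OF c]) (auto intro!: continuous_intros)
  then show "continuous_on UNIV (\<lambda>t. K p (circ t))" by (simp add: p)
qed

lemma kernel_op_sum:
  fixes K :: "'i \<Rightarrow> circle \<Rightarrow> circle \<Rightarrow> complex^'k^'k"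
  assumes "finite I" "\<And>i. i \<in> I \<Longrightarrow> smooth_kernel (K i)" "f \<in> Cinf"
  shows "kernel_op (\<lambda>p q. \<Sum>i\<in>I. K i p q) f p = (\<Sum>i\<in>I. kernel_op (K i) f p)"
proof -
  have "(\<Sum>i\<in>I. K i p q) *v v = (\<Sum>i\<in>I. K i p q *v v)" for q v
    using linear_sum[OF bounded_linear.linear[OF bounded_bilinear.bounded_linear_left[OF bb_matvec]]] by blast
  moreover have "(\<lambda>t. K i p (circ t) *v f (circ t)) integrable_on {0..2*pi}" if "i \<in> I" for i
    by (intro integrable_continuous_interval bounded_bilinear.continuous_on[OF bb_matvec] Cinf_continuous[OF assms(3)]
      continuous_on_subset[OF smooth_kernel_continuous(2)[OF assms(2)[OF that]] subset_UNIV])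
  ultimately show ?thesis unfolding kernel_op_def by (simp add: integral_sum assms(1))
qed

lemma fc_sum:
  assumes "finite I" "\<And>i. i \<in> I \<Longrightarrow> \<phi> i \<in> Cinf"
  shows "fc (\<lambda>p. \<Sum>i\<in>I. \<phi> i p) n = (\<Sum>i\<in>I. fc (\<phi> i) n)"
  using assms
proof (induction I)
  case empty show ?case by (simp add: fc_def)
next
  case (insert i I)
  have "fc (\<lambda>p. \<phi> i p + (\<Sum>i\<in>I. \<phi> i p)) n = fc (\<phi> i) n + fc (\<lambda>p. \<Sum>i\<in>I. \<phi> i p) n"
    by (rule fc_add[OF Cinf_continuous Cinf_continuous]) (use insert in \<open>auto intro: Cinf_sum\<close>)
  then show ?case using insert by simp
qed

lemma Cinf_bounded:
  assumes "f \<in> Cinf"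
  obtains B where "B > 0" "\<And>p. norm (f p) \<le> B"
proof -
  obtain C where C: "\<And>t. norm (f (circ t)) \<le> C"
    using periodic_bounded[of "\<lambda>t. f (circ t)"] Cinf_continuous[OF assms] by auto
  have "norm (f p) \<le> max C 1" for p
    by (rule circ_surj[of p]) (use C in \<open>auto simp: le_max_iff_disj\<close>)
  then show ?thesis using that[of "max C 1"] by auto
qed

lemma lsum_smult:
  fixes v :: "complex^'k"
  assumes "asum x"
  shows "lsum (\<lambda>i. x i *s v) = lsum x *s v"
  by (rule integral_bounded_linear[OF bounded_bilinear.bounded_linear_left[OF bb_smult] assms])

text \<open>The last condition replaces the continuity of \<open>A\<close>.\<close>

definition amp :: "(real \<Rightarrow> real) \<Rightarrow> ((circle \<Rightarrow> complex^'k) \<Rightarrow> circle \<Rightarrow> complex^'k) \<Rightarrow> bool" where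
  "amp G A \<longleftrightarrow> linear_op A \<and>
     (\<forall>w\<in>Cinf. \<exists>M H. ub UNIV H \<and> (\<forall>n t. A (\<lambda>p. ee n p *s w p) (circ t) =
        (of_real ((1 + \<bar>real_of_int n\<bar>) ^ M) * cis (of_int n * G t)) *s H n t)) \<and>
     (\<forall>w\<in>Cinf. \<forall>c. rapid c \<longrightarrow> (\<forall>p. A (\<lambda>p. ser c p *s w p) p = lsum (\<lambda>n. c n *s A (\<lambda>p. ee n p *s w p) p)))"

lemma one_plus_le_double: "1 \<le> x + y \<Longrightarrow> 0 \<le> x \<Longrightarrow> 0 \<le> y \<Longrightarrow> 1 + x \<le> 2 * (x + y)" for x y :: real
  by simp

lemma power_regroup: "(x ^ M * I) * (x ^ N * x ^ N) = x ^ (2 * N + M) * I" for x I :: real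
  by (simp add: mult_2 power_add)

text \<open>Dividing the phase by |n| + |m| puts all pairs (n, m) of weakly opposite signs into a
  single family with uniform bounds, so that one application of nonstationary phase serves them
  all.\<close>

lemma amp_decay:
  fixes A :: "(circle \<Rightarrow> complex^'k) \<Rightarrow> circle \<Rightarrow> complex^'k"
  assumes A: "amp G A" and G: "\<And>t. (G has_vector_derivative G' t) (at t)" "ub UNIV (\<lambda>_::int\<times>int. G')"
    and c: "c > 0" "\<And>t. G' t \<ge> c" and p: "\<And>t. G' (t + 2*pi) = G' t" "\<And>t. circ (G (t + 2*pi)) = circ (G t)"
    and w: "w \<in> Cinf" and \<beta>: "\<beta> \<in> Cinf"
  shows "\<exists>C. \<forall>n m. (n \<ge> 0 \<and> m \<le> 0 \<or> n \<le> 0 \<and> m \<ge> 0) \<longrightarrow>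
    norm (fc (\<lambda>p. dotc (\<beta> p) (A (\<lambda>p. ee n p *s w p) p)) m) * ((1 + \<bar>real_of_int n\<bar>) ^ N * (1 + \<bar>real_of_int m\<bar>) ^ N) \<le> C"
proof -
  obtain M and H :: "int \<Rightarrow> real \<Rightarrow> complex^'k" where H: "ub UNIV H"
    "\<And>n t. A (\<lambda>p. ee n p *s w p) (circ t) = (of_real ((1 + \<bar>real_of_int n\<bar>) ^ M) * cis (of_int n * G t)) *s H n t"
    using A w unfolding amp_def by blast
  \<comment> \<open>Pairs outside the range of interest, and (0, 0), where the normalization would
    divide by 0, are sent to the harmless pair (1, -1); this keeps the family total.\<close>
  define nm :: "int \<times> int \<Rightarrow> int \<times> int" where
    "nm \<alpha> = (if (fst \<alpha> \<ge> 0 \<and> snd \<alpha> \<le> 0 \<or> fst \<alpha> \<le> 0 \<and> snd \<alpha> \<ge> 0) \<and> \<alpha> \<noteq> (0, 0) then \<alpha> else (1, -1))" for \<alpha>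
  define n where "n \<alpha> = real_of_int (fst (nm \<alpha>))" for \<alpha>
  define m where "m \<alpha> = real_of_int (snd (nm \<alpha>))" for \<alpha>
  have sgn: "n \<alpha> \<ge> 0 \<and> m \<alpha> \<le> 0 \<or> n \<alpha> \<le> 0 \<and> m \<alpha> \<ge> 0" for \<alpha> by (auto simp: n_def m_def nm_def)
  define \<Lambda> where "\<Lambda> \<alpha> = \<bar>n \<alpha>\<bar> + \<bar>m \<alpha>\<bar>" for \<alpha>
  have \<Lambda>1: "\<Lambda> \<alpha> \<ge> 1" for \<alpha>
  proof -
    have "\<bar>fst (nm \<alpha>)\<bar> + \<bar>snd (nm \<alpha>)\<bar> \<ge> 1"
      by (cases "nm \<alpha> = (0, 0)") (auto simp: nm_def prod_eq_iff split: if_splits)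
    then show ?thesis unfolding \<Lambda>_def n_def m_def by linarith
  qed
  have \<Lambda>0: "\<Lambda> \<alpha> > 0" "\<Lambda> \<alpha> \<noteq> 0" for \<alpha> using \<Lambda>1[of \<alpha>] by auto
  define \<theta> where "\<theta> \<alpha> t = (n \<alpha> / \<Lambda> \<alpha>) * G t - (m \<alpha> / \<Lambda> \<alpha>) * t" for \<alpha> t
  define \<theta>' where "\<theta>' \<alpha> t = (n \<alpha> / \<Lambda> \<alpha>) * G' t - (m \<alpha> / \<Lambda> \<alpha>)" for \<alpha> t
  have \<Lambda>\<theta>: "\<Lambda> \<alpha> * \<theta> \<alpha> t = n \<alpha> * G t - m \<alpha> * t" for \<alpha> t using \<Lambda>0 by (simp add: \<theta>_def right_diff_distrib)
  have Gd: "(G has_real_derivative G' t) (at t)" for t using G(1) by (simp add: has_real_derivative_iff_has_vector_derivative)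
  have d: "(\<theta> \<alpha> has_vector_derivative \<theta>' \<alpha> t) (at t)" for \<alpha> t
    unfolding has_real_derivative_iff_has_vector_derivative[symmetric] \<theta>_def[abs_def] \<theta>'_def
    by (rule derivative_eq_intros Gd refl | simp)+
  have le1: "\<bar>n \<alpha> / \<Lambda> \<alpha>\<bar> \<le> 1" "\<bar>m \<alpha> / \<Lambda> \<alpha>\<bar> \<le> 1" for \<alpha> using \<Lambda>0[of \<alpha>] by (auto simp: \<Lambda>_def divide_simps)
  have \<theta>'u: "ub UNIV \<theta>'"
    unfolding \<theta>'_def by (intro ub_diff ub_mult G(2) ub_const[where C=1] ub_const[where C=1]) (use le1 in auto)
  have lower: "\<bar>\<theta>' \<alpha> t\<bar> \<ge> min c 1" for \<alpha> t
  proof -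
    have "\<Lambda> \<alpha> * \<bar>\<theta>' \<alpha> t\<bar> = \<bar>\<Lambda> \<alpha> * \<theta>' \<alpha> t\<bar>" using \<Lambda>0[of \<alpha>] by (simp add: abs_mult)
    also have "\<Lambda> \<alpha> * \<theta>' \<alpha> t = n \<alpha> * G' t - m \<alpha>" using \<Lambda>0[of \<alpha>] by (simp add: \<theta>'_def right_diff_distrib)
    also have "\<bar>n \<alpha> * G' t - m \<alpha>\<bar> = \<bar>n \<alpha>\<bar> * G' t + \<bar>m \<alpha>\<bar>"
    proof -
      have G': "G' t > 0" using c(1) c(2)[of t] by linarith
      from sgn[of \<alpha>] show ?thesis
      proof
        assume s: "n \<alpha> \<ge> 0 \<and> m \<alpha> \<le> 0"
        then have "n \<alpha> * G' t \<ge> 0" using G' by simp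
        then show ?thesis using s by simp
      next
        assume s: "n \<alpha> \<le> 0 \<and> m \<alpha> \<ge> 0"
        then have "n \<alpha> * G' t \<le> 0" using G' by (simp add: mult_nonpos_nonneg)
        then show ?thesis using s by simp
      qed
    qed
    also have "\<dots> \<ge> \<bar>n \<alpha>\<bar> * min c 1 + \<bar>m \<alpha>\<bar> * min c 1"
      using c(2)[of t] c(1) by (intro add_mono mult_left_mono mult_left_le) auto
    finally have "\<Lambda> \<alpha> * min c 1 \<le> \<Lambda> \<alpha> * \<bar>\<theta>' \<alpha> t\<bar>" by (simp add: \<Lambda>_def distrib_right)
    then show ?thesis using \<Lambda>0(1)[of \<alpha>] by simp
  qed
  define h where "h \<alpha> t = dotc (\<beta> (circ t)) (H (fst (nm \<alpha>)) t)" for \<alpha> t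
  have hu: "ub UNIV h"
    unfolding h_def by (rule ub_bilinear[OF bb_dotc iffD1[OF Cinf_ub \<beta>] ub_reindex[OF H(1), of "\<lambda>\<alpha>. fst (nm \<alpha>)"]])
  \<comment> \<open>The section and the factor \<open>cis (of_int k * G t)\<close> are both
    2*pi-periodic, the latter because G is periodic up to full turns; cancelling the nonzero factor
    makes H periodic.\<close>
  have Hp: "H k (t + 2*pi) = H k t" for k t
  proof -
    have "cis (of_int k * G (t + 2*pi)) = ee k (circ (G (t + 2*pi)))" by simp
    also have "\<dots> = cis (of_int k * G t)" by (simp only: p(2) ee_circ)
    finally have ck: "cis (of_int k * G (t + 2*pi)) = cis (of_int k * G t)" .
    have "(of_real ((1 + \<bar>real_of_int k\<bar>) ^ M) * cis (of_int k * G t)) *s H k (t + 2*pi) = A (\<lambda>p. ee k p *s w p) (circ (t + 2*pi))"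
      by (simp only: H(2) ck)
    also have "\<dots> = (of_real ((1 + \<bar>real_of_int k\<bar>) ^ M) * cis (of_int k * G t)) *s H k t"
      by (simp only: circ_2pi H(2))
    finally have "(of_real ((1 + \<bar>real_of_int k\<bar>) ^ M) * cis (of_int k * G t)) *s H k (t + 2*pi) = (of_real ((1 + \<bar>real_of_int k\<bar>) ^ M) * cis (of_int k * G t)) *s H k t" .
    moreover have "of_real ((1 + \<bar>real_of_int k\<bar>) ^ M) * cis (of_int k * G t) \<noteq> 0"
      using one_plus_abs_ge_1[of "real_of_int k"] by (auto simp del: of_real_add)
    ultimately show ?thesis by (simp only: vec.scale_left_imp_eq)
  qed
  have e: "cis (\<Lambda> \<alpha> * \<theta> \<alpha> (2*pi)) = cis (\<Lambda> \<alpha> * \<theta> \<alpha> 0)" for \<alpha>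
  proof -
    have "\<And>t. cis (\<Lambda> \<alpha> * \<theta> \<alpha> t) = ee (fst (nm \<alpha>)) (circ (G t)) * ee (- snd (nm \<alpha>)) (circ t)"
      by (simp add: \<Lambda>\<theta> cis_mult n_def m_def)
    moreover have "circ (G (2*pi)) = circ (G 0)" "circ (2*pi) = circ 0" using p(2)[of 0] circ_2pi[of 0] by simp_all
    ultimately show ?thesis by (simp only:)
  qed
  \<comment> \<open>The exponent provides N powers for each of n and m, and M more to compensate the
    growth (1 + |n|)^M of the operator.\<close>
  have "\<exists>C. \<forall>\<alpha>. norm (integral {0..2*pi} (\<lambda>t. cis (\<Lambda> \<alpha> * \<theta> \<alpha> t) * h \<alpha> t)) * \<bar>\<Lambda> \<alpha>\<bar> ^ (2 * N + M) \<le> C"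
    by (rule nonstationary_phase[OF d \<theta>'u _ lower _ e hu]) (use c(1) p(1) circ_2pi in \<open>auto simp: \<theta>'_def h_def Hp\<close>)
  then obtain C where C: "\<And>\<alpha>. norm (integral {0..2*pi} (\<lambda>t. cis (\<Lambda> \<alpha> * \<theta> \<alpha> t) * h \<alpha> t)) * \<bar>\<Lambda> \<alpha>\<bar> ^ (2 * N + M) \<le> C" by blast
  let ?a = "\<lambda>n m. fc (\<lambda>p. dotc (\<beta> p) (A (\<lambda>p. ee n p *s w p) p)) m"
  have main: "norm (?a k l) * ((1 + \<bar>real_of_int k\<bar>) ^ N * (1 + \<bar>real_of_int l\<bar>) ^ N) \<le> 2 ^ (2 * N + M) * C"
    if g: "k \<ge> 0 \<and> l \<le> 0 \<or> k \<le> 0 \<and> l \<ge> 0" "(k, l) \<noteq> (0, 0)" for k l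
  proof -
    let ?\<alpha> = "(k, l)"
    have nm: "nm ?\<alpha> = (k, l)" using g by (auto simp: nm_def)
    then have nm': "n ?\<alpha> = of_int k" "m ?\<alpha> = of_int l" by (simp_all add: n_def m_def)
    let ?I = "integral {0..2*pi} (\<lambda>t. cis (\<Lambda> ?\<alpha> * \<theta> ?\<alpha> t) * h ?\<alpha> t)"
    have "integral {0..2*pi} (\<lambda>t. dotc (\<beta> (circ t)) (A (\<lambda>p. ee k p *s w p) (circ t)) * cis (- (of_int l * t)))
      = integral {0..2*pi} (\<lambda>t. of_real ((1 + \<bar>real_of_int k\<bar>) ^ M) * (cis (\<Lambda> ?\<alpha> * \<theta> ?\<alpha> t) * h ?\<alpha> t))"
    proof (rule integral_cong)
      fix t
      have "cis (\<Lambda> ?\<alpha> * \<theta> ?\<alpha> t) = cis (of_int k * G t) * cis (- (of_int l * t))" by (simp add: \<Lambda>\<theta> nm' cis_mult)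
      then show "dotc (\<beta> (circ t)) (A (\<lambda>p. ee k p *s w p) (circ t)) * cis (- (of_int l * t)) =
         of_real ((1 + \<bar>real_of_int k\<bar>) ^ M) * (cis (\<Lambda> ?\<alpha> * \<theta> ?\<alpha> t) * h ?\<alpha> t)"
        by (simp only: H(2) h_def nm fst_conv dotc_smult mult_ac)
    qed
    then have "?a k l = (1 / (2*pi)) * (of_real ((1 + \<bar>real_of_int k\<bar>) ^ M) * ?I)"
      by (simp only: fc_def integral_mult_right)
    then have "norm (?a k l) = (1 / (2*pi)) * ((1 + \<bar>real_of_int k\<bar>) ^ M * norm ?I)"
      by (simp add: norm_mult norm_power norm_divide del: of_real_add of_real_power)
    also have "\<dots> \<le> 1 * ((1 + \<bar>real_of_int k\<bar>) ^ M * norm ?I)"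
      using pi_gt3 by (intro mult_right_mono) auto
    finally have 1: "norm (?a k l) \<le> (1 + \<bar>real_of_int k\<bar>) ^ M * norm ?I" by simp
    have k: "1 + \<bar>real_of_int k\<bar> \<le> 2 * \<Lambda> ?\<alpha>"
      unfolding \<Lambda>_def nm' by (rule one_plus_le_double) (use \<Lambda>1[of ?\<alpha>] in \<open>simp_all only: \<Lambda>_def nm' abs_ge_zero\<close>)
    have l: "1 + \<bar>real_of_int l\<bar> \<le> 2 * \<Lambda> ?\<alpha>"
      unfolding \<Lambda>_def nm' add.commute[of "\<bar>real_of_int k\<bar>"]
      by (rule one_plus_le_double) (use \<Lambda>1[of ?\<alpha>] in \<open>simp_all only: \<Lambda>_def nm' abs_ge_zero add.commute[of "\<bar>real_of_int k\<bar>"]\<close>)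
    have "norm (?a k l) * ((1 + \<bar>real_of_int k\<bar>) ^ N * (1 + \<bar>real_of_int l\<bar>) ^ N)
      \<le> ((2 * \<Lambda> ?\<alpha>) ^ M * norm ?I) * ((2 * \<Lambda> ?\<alpha>) ^ N * (2 * \<Lambda> ?\<alpha>) ^ N)"
      by (intro mult_mono order_trans[OF 1] power_mono k l mult_nonneg_nonneg zero_le_power) (use \<Lambda>0(1)[of ?\<alpha>] in auto)
    also have "\<dots> = (2 * \<Lambda> ?\<alpha>) ^ (2 * N + M) * norm ?I" by (rule power_regroup)
    also have "\<dots> = 2 ^ (2 * N + M) * (norm ?I * \<bar>\<Lambda> ?\<alpha>\<bar> ^ (2 * N + M))"
      unfolding power_mult_distrib abs_of_pos[OF \<Lambda>0(1)] by (simp only: mult_ac)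
    also have "\<dots> \<le> 2 ^ (2 * N + M) * C" by (intro mult_left_mono C) auto
    finally show ?thesis .
  qed
  show ?thesis
  \<comment> \<open>The pair (0, 0) carries weight 1 and is covered by the maximum.\<close>
  proof (intro exI[of _ "max (norm (?a 0 0)) (2 ^ (2 * N + M) * C)"] allI impI)
    fix k l :: int assume g: "k \<ge> 0 \<and> l \<le> 0 \<or> k \<le> 0 \<and> l \<ge> 0"
    show "norm (?a k l) * ((1 + \<bar>real_of_int k\<bar>) ^ N * (1 + \<bar>real_of_int l\<bar>) ^ N) \<le> max (norm (?a 0 0)) (2 ^ (2 * N + M) * C)"
      using main[OF g] by (cases "(k, l) = (0, 0)") (auto simp: le_max_iff_disj)
  qed
qed

definition polyb :: "('k \<Rightarrow> int \<Rightarrow> complex) \<Rightarrow> bool" where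
  "polyb s \<longleftrightarrow> (\<exists>K M. \<forall>j n. norm (s j n) \<le> K * (1 + \<bar>real_of_int n\<bar>) ^ M)"

lemma rapid_polyb:
  assumes "polyb s" "rapid a"
  shows "rapid (\<lambda>n. s j n * a n)"
proof -
  obtain K M where KM: "\<And>j n. norm (s j n) \<le> K * (1 + \<bar>real_of_int n\<bar>) ^ M"
    using assms(1) unfolding polyb_def by blast
  show ?thesis
    by (rule rapid_poly[OF assms(2), where K = K and M = M]) (simp add: norm_mult mult_right_mono KM)
qed

text \<open>A global smooth frame w with its dual frame b for the bilinear pairing
  \<open>dotc\<close>; conjugations coming from a hermitian metric are thereby hidden in b. The
  constant frame serves the complex case, an orthonormal frame adapted to the connection the real
  case.\<close>

locale frame =
  fixes w b :: "'k::finite \<Rightarrow> circle \<Rightarrow> complex^'k"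
  assumes w_Cinf: "w j \<in> Cinf" and b_Cinf: "b j \<in> Cinf"
    and dual1: "dotc (b i p) (w j p) = (if i = j then 1 else 0)"
    and dual2: "(\<Sum>j\<in>UNIV. dotc (b j p) u *s w j p) = u"
begin

definition co :: "(circle \<Rightarrow> complex^'k) \<Rightarrow> 'k \<Rightarrow> int \<Rightarrow> complex" where
  "co f j n = fc (\<lambda>p. dotc (b j p) (f p)) n"

definition syn :: "('k \<Rightarrow> int \<Rightarrow> complex) \<Rightarrow> circle \<Rightarrow> complex^'k" where
  "syn a p = (\<Sum>j\<in>UNIV. ser (a j) p *s w j p)"

definition Mult :: "('k \<Rightarrow> int \<Rightarrow> complex) \<Rightarrow> (circle \<Rightarrow> complex^'k) \<Rightarrow> circle \<Rightarrow> complex^'k" where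
  "Mult s f = syn (\<lambda>j n. s j n * co f j n)"

lemma coord_Cinf: "f \<in> Cinf \<Longrightarrow> (\<lambda>p. dotc (b j p) (f p)) \<in> Cinf"
  by (rule Cinf_dotc[OF b_Cinf])

lemma rapid_co: "f \<in> Cinf \<Longrightarrow> rapid (co f j)"
  unfolding co_def[abs_def] by (rule rapid_fc[OF coord_Cinf])

lemma syn_Cinf: "(\<And>j. rapid (a j)) \<Longrightarrow> syn a \<in> Cinf"
  unfolding syn_def[abs_def] by (intro Cinf_sum Cinf_smult ser_Cinf w_Cinf)

lemma coord_syn: "dotc (b j p) (syn a p) = ser (a j) p"
  by (simp add: syn_def dotc_sum dotc_smult dual1 if_distrib[of "\<lambda>x. _ * x"] cong: if_cong)

lemma co_syn: "(\<And>j. rapid (a j)) \<Longrightarrow> co (syn a) j n = a j n"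
  by (simp add: co_def coord_syn fc_ser)

lemma ser_co: "f \<in> Cinf \<Longrightarrow> ser (co f j) p = dotc (b j p) (f p)"
  using ser_fc[OF coord_Cinf, of f j] by (simp add: co_def[abs_def])

lemma syn_co: "f \<in> Cinf \<Longrightarrow> syn (co f) = f"
  by (rule ext) (simp add: syn_def ser_co dual2)

lemma co_inject: "f \<in> Cinf \<Longrightarrow> g \<in> Cinf \<Longrightarrow> (\<And>j n. co f j n = co g j n) \<Longrightarrow> f = g"
  by (metis syn_co ext)

lemma co_add: "f \<in> Cinf \<Longrightarrow> g \<in> Cinf \<Longrightarrow> co (\<lambda>p. f p + g p) j n = co f j n + co g j n"
  unfolding co_def dotc_add by (rule fc_add[OF Cinf_continuous Cinf_continuous]; rule coord_Cinf)

lemma co_diff: "f \<in> Cinf \<Longrightarrow> g \<in> Cinf \<Longrightarrow> co (\<lambda>p. f p - g p) j n = co f j n - co g j n"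
  unfolding co_def dotc_diff by (rule fc_diff[OF Cinf_continuous Cinf_continuous]; rule coord_Cinf)

lemma co_sum: "finite I \<Longrightarrow> (\<And>i. i \<in> I \<Longrightarrow> f i \<in> Cinf) \<Longrightarrow> co (\<lambda>p. \<Sum>i\<in>I. f i p) j n = (\<Sum>i\<in>I. co (f i) j n)"
  unfolding co_def dotc_sum by (rule fc_sum[OF _ coord_Cinf])

lemma co_smult: "co (\<lambda>p. c *s f p) j n = c * co f j n"
  by (simp add: co_def dotc_smult fc_mult)

lemma Mult_Cinf: "polyb s \<Longrightarrow> f \<in> Cinf \<Longrightarrow> Mult s f \<in> Cinf"
  unfolding Mult_def by (intro syn_Cinf rapid_polyb rapid_co)

lemma co_Mult: "polyb s \<Longrightarrow> f \<in> Cinf \<Longrightarrow> co (Mult s f) j n = s j n * co f j n"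
  unfolding Mult_def by (intro co_syn rapid_polyb rapid_co)

lemma Cinf_modulated: "(\<lambda>p. ee n p *s w j p) \<in> Cinf"
  by (intro Cinf_smult ee_Cinf w_Cinf)

text \<open>Expands A as an infinite matrix in the modulated frame. Termwise evaluation of A on a
  series comes from \<open>amp\<close>; the polynomial growth of A on modulated sections, against
  the rapidly decreasing coefficients of f, allows the Fourier coefficient to be taken under the
  sum.\<close>

lemma co_amp:
  assumes A: "amp G A" and f: "f \<in> Cinf"
  shows "co (A f) l m = (\<Sum>j\<in>UNIV. lsum (\<lambda>n. co f j n * co (A (\<lambda>p. ee n p *s w j p)) l m))"
proof -
  have lin: "linear_op A" using A by (simp add: amp_def)
  let ?u = "\<lambda>j n p. ee n p *s w j p"
  have sw: "(\<lambda>p. ser (co f j) p *s w j p) \<in> Cinf" for j by (intro Cinf_smult ser_Cinf rapid_co f w_Cinf)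
  have "A f = A (\<lambda>p. \<Sum>j\<in>UNIV. ser (co f j) p *s w j p)"
    using syn_co[OF f] by (simp add: syn_def[abs_def])
  also have "\<dots> = (\<lambda>q. \<Sum>j\<in>UNIV. A (\<lambda>p. ser (co f j) p *s w j p) q)"
    by (rule linear_op_sum[OF lin _ sw]) simp
  finally have "co (A f) l m = (\<Sum>j\<in>UNIV. co (A (\<lambda>p. ser (co f j) p *s w j p)) l m)"
    by (simp only:) (rule co_sum[OF _ linear_op_Cinf[OF lin sw]], simp)
  also have "\<dots> = (\<Sum>j\<in>UNIV. lsum (\<lambda>n. co f j n * co (A (?u j n)) l m))"
  proof (rule sum.cong[OF refl])
    fix j
    obtain M H where H: "ub UNIV H"
      "\<And>n t. A (?u j n) (circ t) = (of_real ((1 + \<bar>real_of_int n\<bar>) ^ M) * cis (of_int n * G t)) *s (H n t :: complex^'k)"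
      using A w_Cinf[of j] unfolding amp_def by blast
    obtain C where C: "C > 0" "\<And>n t. t \<in> UNIV \<Longrightarrow> norm (H n t) \<le> C" using ub_boundE[OF H(1)] by blast
    have Ab: "norm (A (?u j n) p) \<le> (1 + \<bar>real_of_int n\<bar>) ^ M * C" for n p
    proof -
      obtain t where p: "p = circ t" by (rule circ_surj)
      show ?thesis unfolding p H(2) by (simp add: norm_smult norm_mult norm_power C mult_left_mono del: of_real_add of_real_power)
    qed
    obtain B where B: "B > 0" "\<And>p. norm (b l p) \<le> B" using Cinf_bounded[OF b_Cinf] by blast
    obtain Kd where Kd: "Kd > 0" "\<And>x y::complex^'k. norm (dotc x y) \<le> Kd * (norm x * norm y)" using bb_bound[OF bb_dotc[where 'k='k]] by blast
    have Db: "norm (dotc (b l p) (A (?u j n) p)) \<le> Kd * (B * ((1 + \<bar>real_of_int n\<bar>) ^ M * C))" for n p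
      by (rule order_trans[OF Kd(2)]) (intro mult_left_mono mult_mono B Ab, use Kd B in auto)
    let ?W = "\<lambda>n. norm (co f j n) * (Kd * (B * ((1 + \<bar>real_of_int n\<bar>) ^ M * C)))"
    have "rapid (\<lambda>n. complex_of_real (?W n))"
      by (rule rapid_poly[OF rapid_co[OF f, of j], where K = "Kd * B * C" and M = M])
         (use Kd B C in \<open>simp add: norm_mult norm_power mult_ac del: of_real_add of_real_power\<close>)
    from rapid_asum(1)[OF this] have W: "asum ?W" using Kd B C by (simp add: norm_mult norm_power del: of_real_add of_real_power)
    have "co (A (\<lambda>p. ser (co f j) p *s w j p)) l m = fc (\<lambda>q. lsum (\<lambda>n. co f j n * dotc (b l q) (A (?u j n) q))) m"
    proof -
      have "dotc (b l q) (A (\<lambda>p. ser (co f j) p *s w j p) q) = lsum (\<lambda>n. co f j n * dotc (b l q) (A (?u j n) q))" for q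
      proof -
        have "asum (\<lambda>n. co f j n *s A (?u j n) q)"
        proof (rule asum_bound)
          show "asum (\<lambda>n. norm (co f j n) * ((1 + \<bar>real_of_int n\<bar>) ^ M * C))"
            using integrable_mult_right[OF W, of "1 / (Kd * B)"] Kd B by simp
          show "norm (co f j n *s A (?u j n) q) \<le> norm (co f j n) * ((1 + \<bar>real_of_int n\<bar>) ^ M * C)" for n
            using Ab[of n q] by (simp add: norm_smult mult_left_mono)
        qed
        from integral_bounded_linear[OF bounded_bilinear.bounded_linear_right[OF bb_dotc] this]
        show ?thesis using A f w_Cinf[of j] rapid_co[OF f] unfolding amp_def by (simp add: dotc_smult)
      qed
      then show ?thesis by (simp add: co_def)
    qed
    also have "\<dots> = lsum (\<lambda>n. fc (\<lambda>q. co f j n * dotc (b l q) (A (?u j n) q)) m)"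
    proof (rule fc_lsum[OF _ _ W])
      show "(\<lambda>q. co f j n * dotc (b l q) (A (?u j n) q)) \<in> Cinf" for n
        by (rule Cinf_linear[OF bounded_linear_mult_right]) (intro coord_Cinf linear_op_Cinf[OF lin] Cinf_modulated)
      show "norm (co f j n * dotc (b l q) (A (?u j n) q)) \<le> ?W n" for n q
        using Db[of q n] by (simp add: norm_mult mult_left_mono)
    qed
    finally show "co (A (\<lambda>p. ser (co f j) p *s w j p)) l m = lsum (\<lambda>n. co f j n * co (A (?u j n)) l m)"
      by (simp add: fc_mult co_def)
  qed
  finally show ?thesis .
qed

text \<open>The matrix of the commutator has entries (s j n - s l m) times those of A. For strictly
  equal signs of n and m they vanish even when j and l differ, because sp and sm are common to all
  frame indices. The values s j 0 are free, since the index 0 falls under the decay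
  estimate.\<close>

theorem commutator_smoothing:
  assumes A: "amp G A" and G: "\<And>t. (G has_vector_derivative G' t) (at t)" "ub UNIV (\<lambda>_::int\<times>int. G')"
    and c: "c > 0" "\<And>t. G' t \<ge> c" and p: "\<And>t. G' (t + 2*pi) = G' t" "\<And>t. circ (G (t + 2*pi)) = circ (G t)"
    and S: "\<And>j n. norm (s j n) \<le> S" and sp: "\<And>j n. n > 0 \<Longrightarrow> s j n = sp" and sm: "\<And>j n. n < 0 \<Longrightarrow> s j n = sm"
  shows "smoothing (\<lambda>f p. A (Mult s f) p - Mult s (A f) p)"
proof -
  have lin: "linear_op A" using A by (simp add: amp_def)
  have S0: "S \<ge> 0" using S[of undefined 0] norm_ge_zero order_trans by blast
  have pb: "polyb s" unfolding polyb_def by (rule exI[of _ S], rule exI[of _ 0]) (use S in simp)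
  define a where "a j l n m = co (A (\<lambda>p. ee n p *s w j p)) l m" for j l n m
  define r where "r j l n m = (s j n - s l m) * a j l n m" for j l n m
  have r2: "rapid2 (r j l)" for j l
    unfolding rapid2_def
  proof
    fix N
    obtain C where C: "\<And>n m. (n \<ge> 0 \<and> m \<le> 0 \<or> n \<le> 0 \<and> m \<ge> 0) \<Longrightarrow>
      norm (a j l n m) * ((1 + \<bar>real_of_int n\<bar>) ^ N * (1 + \<bar>real_of_int m\<bar>) ^ N) \<le> C"
      using amp_decay[OF A G c p w_Cinf[of j] b_Cinf[of l], of N] unfolding a_def co_def by blast
    have C0: "0 \<le> C" using C[of 0 0] by (simp add: order_trans[OF norm_ge_zero])
    have "norm (r j l n m) * ((1 + \<bar>real_of_int n\<bar>) ^ N * (1 + \<bar>real_of_int m\<bar>) ^ N) \<le> 2 * S * C" for n m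
    proof (cases "n \<ge> 0 \<and> m \<le> 0 \<or> n \<le> 0 \<and> m \<ge> 0")
      case True
      have "norm (s j n - s l m) \<le> 2 * S" using norm_triangle_ineq4[of "s j n" "s l m"] S[of j n] S[of l m] by linarith
      then have "norm (s j n - s l m) * (norm (a j l n m) * ((1 + \<bar>real_of_int n\<bar>) ^ N * (1 + \<bar>real_of_int m\<bar>) ^ N)) \<le> 2 * S * C"
        by (intro mult_mono C[OF True]) (use S0 in auto)
      then show ?thesis by (simp add: r_def norm_mult mult.assoc)
    next
      case False
      then have "n > 0 \<and> m > 0 \<or> n < 0 \<and> m < 0" by linarith
      then have "s j n = s l m" using sp sm by metis
      then show ?thesis using S0 C0 by (simp add: r_def)
    qed
    then show "\<exists>C. \<forall>n m. norm (r j l n m) * ((1 + \<bar>real_of_int n\<bar>) ^ N * (1 + \<bar>real_of_int m\<bar>) ^ N) \<le> C" by blast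
  qed
  define K where "K j l = (\<lambda>p q. lsum (\<lambda>(n, m). outer (r j l n m *s (ee m p *s w l p)) (ee (- n) q *s b j q)))" for j l
  note ks = kernel_series[OF r2 w_Cinf b_Cinf]
  \<comment> \<open>The factor compensates the 2*pi which \<open>kernel_series\<close> produces from
    the normalization of Fourier coefficients.\<close>
  define L where "L = (\<lambda>z p q. (1 / (2*pi)) *\<^sub>R K (fst z) (snd z) p q)"
  have Ls: "smooth_kernel (L z)" for z
    unfolding L_def by (rule smooth_kernel_linear[OF bounded_linear_scaleR_right]) (unfold K_def, rule ks(1))
  have Lop: "kernel_op (L (j, l)) f p = lsum (\<lambda>(n, m). (r j l n m * co f j n * ee m p)) *s w l p"
    and asum: "asum (\<lambda>(n, m). r j l n m * co f j n * ee m p)" if f: "f \<in> Cinf" for j l f p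
  proof -
    obtain B where B: "B \<ge> 0" "\<And>n. norm (co f j n) \<le> B / (1 + \<bar>real_of_int n\<bar>) ^ 0"
      using rapid_bound[OF rapid_co[OF f, of j], of 0] by blast
    obtain C where C: "C \<ge> 0" "\<And>n m. norm (r j l n m) * ((1 + \<bar>real_of_int n\<bar>) ^ 0 * (1 + \<bar>real_of_int m\<bar>) ^ 0) \<le>
      C * (1 / (1 + \<bar>real_of_int n\<bar>) ^ 2 * (1 / (1 + \<bar>real_of_int m\<bar>) ^ 2))"
      by (rule rapid2_bound[OF r2, where i = 0 and k = 0]) (rule that)
    show as: "asum (\<lambda>(n, m). r j l n m * co f j n * ee m p)"
    proof (rule asum_bound[OF asum_weight2[of "C * B"]])
      fix z :: "int \<times> int"
      obtain n m where z: "z = (n, m)" by (cases z)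
      have "norm (r j l n m) * norm (co f j n) \<le> (C * (1 / (1 + \<bar>real_of_int n\<bar>) ^ 2 * (1 / (1 + \<bar>real_of_int m\<bar>) ^ 2))) * B"
        using C(2)[of n m] B(2)[of n] by (intro mult_mono) (auto intro: order_trans[OF norm_ge_zero])
      then show "norm (case z of (n, m) \<Rightarrow> r j l n m * co f j n * ee m p) \<le>
          (case z of (n, m) \<Rightarrow> C * B * (1 / (1 + \<bar>real_of_int n\<bar>) ^ 2 * (1 / (1 + \<bar>real_of_int m\<bar>) ^ 2)))"
        by (simp add: z norm_mult mult_ac)
    qed
    have "kernel_op (L (j, l)) f p = (1 / (2*pi)) *\<^sub>R kernel_op (K j l) f p"
    proof -
      have "(\<lambda>t. L (j, l) p (circ t) *v f (circ t)) = (\<lambda>t. (1 / (2*pi)) *\<^sub>R (K j l p (circ t) *v f (circ t)))"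
        by (simp add: L_def bounded_bilinear.scaleR_left[OF bb_matvec])
      then show ?thesis unfolding kernel_op_def by (simp only: integral_cmul)
    qed
    also have "kernel_op (K j l) f p = lsum (\<lambda>(n, m). (r j l n m * (of_real (2*pi) * co f j n)) *s (ee m p *s w l p))"
      unfolding K_def co_def by (rule ks(2)[OF f])
    also have "\<dots> = lsum (\<lambda>z. (of_real (2*pi) * (case z of (n, m) \<Rightarrow> r j l n m * co f j n * ee m p)) *s w l p)"
      by (rule Bochner_Integration.integral_cong) (auto simp: smult_assoc mult_ac)
    also have "\<dots> = lsum (\<lambda>z. of_real (2*pi) * (case z of (n, m) \<Rightarrow> r j l n m * co f j n * ee m p)) *s w l p"
      by (rule lsum_smult[OF integrable_mult_right[OF as]])
    also have "(1 / (2*pi)) *\<^sub>R \<dots> = lsum (\<lambda>(n, m). (r j l n m * co f j n * ee m p)) *s w l p"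
      by (simp add: vec_eq_iff scaleR_conv_of_real[where 'a=complex])
    finally show "kernel_op (L (j, l)) f p = lsum (\<lambda>(n, m). (r j l n m * co f j n * ee m p)) *s w l p" .
  qed
  show ?thesis unfolding smoothing_def
  proof (intro exI[of _ "\<lambda>p q. \<Sum>z\<in>UNIV. L z p q"] conjI ballI)
    show "smooth_kernel (\<lambda>p q. \<Sum>z\<in>UNIV. L z p q)" by (rule smooth_kernel_sum[OF Ls])
  next
    fix f :: "circle \<Rightarrow> complex^'k" assume f: "f \<in> Cinf"
    let ?R = "\<lambda>p. A (Mult s f) p - Mult s (A f) p"
    have Af: "A f \<in> Cinf" "A (Mult s f) \<in> Cinf" by (intro linear_op_Cinf[OF lin] f Mult_Cinf[OF pb])+
    have RC: "?R \<in> Cinf" by (intro Cinf_diff Af Mult_Cinf[OF pb])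
    have coR: "co ?R l m = (\<Sum>j\<in>UNIV. lsum (\<lambda>n. r j l n m * co f j n))" for l m
    proof -
      \<comment> \<open>The series with s j n and with s l m are summed separately before being
        combined, so each must converge absolutely. Polynomial growth of \<open>a\<close> in n
        against the coefficients of f is enough for that.\<close>
      have as: "asum (\<lambda>n. x n * co f j n * a j l n m)" if x: "\<And>n. norm (x n) \<le> S" for j x
      proof -
        obtain M and H :: "int \<Rightarrow> real \<Rightarrow> complex^'k" where H: "ub UNIV H"
          "\<And>n t. A (\<lambda>p. ee n p *s w j p) (circ t) = (of_real ((1 + \<bar>real_of_int n\<bar>) ^ M) * cis (of_int n * G t)) *s H n t"
          using A w_Cinf[of j] unfolding amp_def by blast
        obtain C where C: "C > 0" "\<And>n t. t \<in> UNIV \<Longrightarrow> norm (H n t) \<le> C" using ub_boundE[OF H(1)] by blast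
        obtain B where B: "B > 0" "\<And>p. norm (b l p) \<le> B" using Cinf_bounded[OF b_Cinf] by blast
        obtain Kd where Kd: "Kd > 0" "\<And>x y::complex^'k. norm (dotc x y) \<le> Kd * (norm x * norm y)" using bb_bound[OF bb_dotc[where 'k='k]] by blast
        have ab: "norm (a j l n m) \<le> Kd * (B * ((1 + \<bar>real_of_int n\<bar>) ^ M * C))" for n
          unfolding a_def co_def
        proof (rule fc_bound)
          show "continuous_on UNIV (\<lambda>t. dotc (b l (circ t)) (A (\<lambda>p. ee n p *s w j p) (circ t)))"
            by (rule Cinf_continuous[OF coord_Cinf[OF linear_op_Cinf[OF lin Cinf_modulated]]])
          fix p
          obtain t where p: "p = circ t" by (rule circ_surj)
          have "norm (A (\<lambda>p. ee n p *s w j p) p) \<le> (1 + \<bar>real_of_int n\<bar>) ^ M * C"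
            unfolding p H(2) by (simp add: norm_smult norm_mult norm_power C mult_left_mono del: of_real_add of_real_power)
          then show "norm (dotc (b l p) (A (\<lambda>p. ee n p *s w j p) p)) \<le> Kd * (B * ((1 + \<bar>real_of_int n\<bar>) ^ M * C))"
            by (intro order_trans[OF Kd(2)] mult_left_mono mult_mono B) (use Kd B in auto)
        qed
        have "rapid (\<lambda>n. x n * co f j n * a j l n m)"
        proof (rule rapid_poly[OF rapid_co[OF f, of j], where K = "S * (Kd * (B * C))" and M = M])
          fix n
          have "norm (x n) * norm (co f j n) * norm (a j l n m) \<le> S * norm (co f j n) * (Kd * (B * ((1 + \<bar>real_of_int n\<bar>) ^ M * C)))"
            by (intro mult_mono x ab) (use S0 in auto)
          then show "norm (x n * co f j n * a j l n m) \<le> S * (Kd * (B * C)) * (1 + \<bar>real_of_int n\<bar>) ^ M * norm (co f j n)"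
            by (simp add: norm_mult mult_ac)
        qed
        then show ?thesis by (rule rapid_asum(2))
      qed
      have "co ?R l m = co (A (Mult s f)) l m - s l m * co (A f) l m"
        by (simp add: co_diff[OF Af(2) Mult_Cinf[OF pb Af(1)]] co_Mult[OF pb Af(1)])
      also have "\<dots> = (\<Sum>j\<in>UNIV. lsum (\<lambda>n. s j n * co f j n * a j l n m) - lsum (\<lambda>n. s l m * co f j n * a j l n m))"
        by (simp add: co_amp[OF A f] co_amp[OF A Mult_Cinf[OF pb f]] co_Mult[OF pb f] a_def sum_subtractf sum_distrib_left mult.assoc)
      also have "\<dots> = (\<Sum>j\<in>UNIV. lsum (\<lambda>n. r j l n m * co f j n))"
      proof (rule sum.cong[OF refl])
        fix j
        have "lsum (\<lambda>n. s j n * co f j n * a j l n m) - lsum (\<lambda>n. s l m * co f j n * a j l n m)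
          = lsum (\<lambda>n. s j n * co f j n * a j l n m - s l m * co f j n * a j l n m)"
          by (rule Bochner_Integration.integral_diff[symmetric, OF as as]) (rule S)+
        then show "lsum (\<lambda>n. s j n * co f j n * a j l n m) - lsum (\<lambda>n. s l m * co f j n * a j l n m) = lsum (\<lambda>n. r j l n m * co f j n)"
          by (simp add: r_def algebra_simps)
      qed
      finally show ?thesis .
    qed
    have "?R p = kernel_op (\<lambda>p q. \<Sum>z\<in>UNIV. L z p q) f p" for p
    proof -
      have sum_lsum: "(\<Sum>j\<in>UNIV. lsum (\<lambda>n. r j l n m * co f j n)) * ee m p = (\<Sum>j\<in>UNIV. lsum (\<lambda>n. r j l n m * co f j n * ee m p))" for l m
        by (simp add: sum_distrib_right)
      have asm: "asum (\<lambda>m. lsum (\<lambda>n. r j l n m * co f j n * ee m p))" for j l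
      proof -
        interpret P: pair_sigma_finite "count_space (UNIV::int set)" "count_space (UNIV::int set)"
          by (intro pair_sigma_finite.intro sigma_finite_measure_count_space)
        have "count_space (UNIV::int set) \<Otimes>\<^sub>M count_space (UNIV::int set) = count_space UNIV"
          by (subst pair_measure_countable) auto
        then have "integrable (count_space (UNIV::int set) \<Otimes>\<^sub>M count_space (UNIV::int set)) (\<lambda>(n, m). r j l n m * co f j n * ee m p)"
          using asum[OF f] by simp
        from P.integrable_snd[OF this] show ?thesis by simp
      qed
      have "?R p = (\<Sum>l\<in>UNIV. ser (co ?R l) p *s w l p)"
        using syn_co[OF RC] by (metis syn_def)
      also have "\<dots> = (\<Sum>l\<in>UNIV. lsum (\<lambda>m. (\<Sum>j\<in>UNIV. lsum (\<lambda>n. r j l n m * co f j n * ee m p))) *s w l p)"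
        unfolding ser_def coR sum_lsum ..
      also have "\<dots> = (\<Sum>l\<in>UNIV. (\<Sum>j\<in>UNIV. lsum (\<lambda>(n, m). r j l n m * co f j n * ee m p)) *s w l p)"
      proof (rule sum.cong[OF refl])
        fix l
        have "lsum (\<lambda>m. (\<Sum>j\<in>UNIV. lsum (\<lambda>n. r j l n m * co f j n * ee m p))) = (\<Sum>j\<in>UNIV. lsum (\<lambda>m. lsum (\<lambda>n. r j l n m * co f j n * ee m p)))"
          by (rule Bochner_Integration.integral_sum) (rule asm)
        also have "\<dots> = (\<Sum>j\<in>UNIV. lsum (\<lambda>(n, m). r j l n m * co f j n * ee m p))"
          using lsum_prod(2)[OF asum[OF f]] by simp
        finally show "lsum (\<lambda>m. (\<Sum>j\<in>UNIV. lsum (\<lambda>n. r j l n m * co f j n * ee m p))) *s w l p =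
            (\<Sum>j\<in>UNIV. lsum (\<lambda>(n, m). r j l n m * co f j n * ee m p)) *s w l p" by simp
      qed
      also have "\<dots> = (\<Sum>l\<in>UNIV. \<Sum>j\<in>UNIV. kernel_op (L (j, l)) f p)"
        by (simp add: Lop[OF f] vec.scale_sum_left)
      also have "\<dots> = (\<Sum>j\<in>UNIV. \<Sum>l\<in>UNIV. kernel_op (L (j, l)) f p)" by (rule sum.swap)
      also have "\<dots> = (\<Sum>z\<in>UNIV. kernel_op (L z) f p)"
        by (simp add: sum.cartesian_product case_prod_unfold)
      also have "\<dots> = kernel_op (\<lambda>p q. \<Sum>z\<in>UNIV. L z p q) f p"
        by (rule kernel_op_sum[symmetric, OF _ Ls f]) simp
      finally show ?thesis .
    qed
    then show "?R = kernel_op (\<lambda>p q. \<Sum>z\<in>UNIV. L z p q) f" by blast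
  qed
qed

end

section \<open>A smooth partition of unity\<close>

text \<open>Derivatives of exp (- 1 / x) on x > 0 are polynomials in y = 1 / x times the same
  exponential. Carrying the polynomial along makes the class closed under differentiation, which
  acts by p -> y^2 * (p - p').\<close>

definition flatp :: "real poly \<Rightarrow> real \<Rightarrow> real" where
  "flatp p x = (if x \<le> 0 then 0 else poly p (1 / x) * exp (- (1 / x)))"

lemma poly_exp_tendsto_0: "((\<lambda>y. poly p y * exp (- y)) \<longlongrightarrow> 0) at_top" for p :: "real poly"
proof -
  have "((\<lambda>y. \<Sum>i\<le>degree p. coeff p i * (y ^ i / exp y)) \<longlongrightarrow> (\<Sum>i\<le>degree p. coeff p i * 0)) at_top"
    by (intro tendsto_sum tendsto_mult tendsto_const tendsto_power_div_exp_0)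
  then show ?thesis by (simp add: poly_altdef sum_distrib_left sum_distrib_right exp_minus divide_inverse mult_ac)
qed

lemma flatp_deriv: "(flatp p has_real_derivative flatp (monom 1 2 * (p - pderiv p)) x) (at x)"
proof -
  consider "x < 0" | "x = 0" | "x > 0" by linarith
  then show ?thesis
  proof cases
    case 1
    have "((\<lambda>_. 0) has_real_derivative flatp (monom 1 2 * (p - pderiv p)) x) (at x)" using 1 by (simp add: flatp_def)
    then show ?thesis
      by (rule has_field_derivative_transform_within_open[where S = "{..<0}"]) (use 1 in \<open>auto simp: flatp_def\<close>)
  next
    case 3
    have "((\<lambda>x. poly p (1 / x) * exp (- (1 / x))) has_real_derivative
        poly (pderiv p) (1 / x) * (- (1 / x\<^sup>2)) * exp (- (1 / x)) + poly p (1 / x) * (exp (- (1 / x)) * (1 / x\<^sup>2))) (at x)"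
      by (rule derivative_eq_intros DERIV_chain2[OF poly_DERIV] refl | use 3 in \<open>simp add: power2_eq_square\<close>)+
    then have "((\<lambda>x. poly p (1 / x) * exp (- (1 / x))) has_real_derivative flatp (monom 1 2 * (p - pderiv p)) x) (at x)"
      using 3 by (simp add: flatp_def poly_monom field_simps power2_eq_square)
    then show ?thesis
      by (rule has_field_derivative_transform_within_open[where S = "{0<..}"]) (use 3 in \<open>auto simp: flatp_def\<close>)
  next
    case 2
    \<comment> \<open>From the left the difference quotient at 0 is 0; from the right it is y * p(y)
      * exp (- y) at y = 1 / h.\<close>
    have "((\<lambda>h. flatp p h / h) \<longlongrightarrow> 0) (at 0)"
    proof (rule filterlim_split_at)
      have "eventually (\<lambda>h. 0 = flatp p h / h) (at_left (0::real))"
        by (rule eventually_at_leftI[of "-1"]) (auto simp: flatp_def)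
      then show "((\<lambda>h. flatp p h / h) \<longlongrightarrow> 0) (at_left 0)" by (rule Lim_transform_eventually[OF tendsto_const])
      have "((\<lambda>h. poly (pCons 0 p) (inverse h) * exp (- inverse h)) \<longlongrightarrow> 0) (at_right (0::real))"
        by (rule filterlim_compose[OF poly_exp_tendsto_0 filterlim_inverse_at_top_right])
      moreover have "eventually (\<lambda>h. poly (pCons 0 p) (inverse h) * exp (- inverse h) = flatp p h / h) (at_right (0::real))"
        by (rule eventually_at_rightI[of _ 1]) (auto simp: flatp_def field_simps)
      ultimately show "((\<lambda>h. flatp p h / h) \<longlongrightarrow> 0) (at_right 0)" by (rule Lim_transform_eventually)
    qed
    then show ?thesis by (simp add: 2 has_field_derivative_iff flatp_def)
  qed
qed

definition flat :: "real \<Rightarrow> real" where "flat = flatp 1"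

lemma flat_pos: "flat x \<ge> 0" "flat x > 0 \<longleftrightarrow> x > 0" "flat x = 0 \<longleftrightarrow> x \<le> 0"
  by (auto simp: flat_def flatp_def)

lemma flat_ub: "ub {} (\<lambda>_::'a. flat)"
proof -
  have "ub {} (\<lambda>_::'a. flatp (((\<lambda>p. monom 1 2 * (p - pderiv p)) ^^ 0) 1))"
    by (rule ub_of_chain[of "\<lambda>n (_::'a). flatp (((\<lambda>p. monom 1 2 * (p - pderiv p)) ^^ n) 1)"])
       (use flatp_deriv in \<open>auto simp: has_real_derivative_iff_has_vector_derivative\<close>)
  then show ?thesis by (simp add: flat_def)
qed

text \<open>Positive exactly on the open half circle centred at the angle 2*pi*k/3.\<close>

definition bump :: "nat \<Rightarrow> circle \<Rightarrow> real" where
  "bump k p = flat (Re (Rep_circle p * cis (- (2*pi*k/3))))"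

lemma bump_circ: "bump k (circ t) = flat (cos (t - 2*pi*k/3))"
  by (simp add: bump_def cos_diff)

lemma bump_Cinf: "bump k \<in> Cinf"
proof -
  let ?G = "\<lambda>(_::unit) t. Re (cis t * cis (- (2*pi*k/3)))"
  have G: "ub UNIV ?G"
    by (intro ub_linear[OF bounded_linear_Re] ub_mult ub_cis ub_const')
  have "ub {} (\<lambda>u t. flat (?G u t))"
    by (rule ub_comp[OF ub_deriv[OF G] ub_subset[OF ub_dv[OF G]] _ flat_ub]) auto
  then show ?thesis by (simp add: Cinf_def smooth_curve_ub bump_def)
qed

text \<open>If all three cosines were nonpositive, adding those for k = 1 and k = 2 would give cos t
  >= 0, hence cos t = 0, and then each of the two forces a sign on sin t, so that sin t = 0 as
  well.\<close>

lemma bump_sum_pos: "(\<Sum>k<3. bump k p) > 0"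
proof -
  obtain t where p: "p = circ t" by (rule circ_surj)
  have "\<exists>k<3. cos (t - 2*pi*real k/3) > 0"
  proof (rule ccontr)
    assume "\<not> ?thesis"
    then have le: "cos (t - 2*pi*real k/3) \<le> 0" if "k < 3" for k using that by (meson not_le)
    have c: "cos (2*pi/3) = -1/2" "sin (2*pi/3) = sqrt 3 / 2" "cos (4*pi/3) = -1/2" "sin (4*pi/3) = - sqrt 3 / 2"
    proof -
      have *: "2*pi/3 = pi - pi/3" "4*pi/3 = pi + pi/3" by simp_all
      show "cos (2*pi/3) = -1/2" "sin (2*pi/3) = sqrt 3 / 2" "cos (4*pi/3) = -1/2" "sin (4*pi/3) = - sqrt 3 / 2"
        unfolding * by (simp_all only: cos_60 sin_60 cos_diff sin_diff cos_add sin_add cos_pi sin_pi mult_zero_left mult_minus_left mult_1 add_0_right diff_0 diff_zero minus_zero minus_divide_left)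
    qed
    have 0: "cos t \<le> 0" using le[of 0] by simp
    have 1: "- cos t / 2 + sin t * (sqrt 3 / 2) \<le> 0" using le[of 1] c by (simp add: cos_diff)
    have 2: "- cos t / 2 - sin t * (sqrt 3 / 2) \<le> 0" using le[of 2] c by (simp add: cos_diff)
    from 0 1 2 have "cos t = 0" by linarith
    moreover from this 1 2 have "sin t * (sqrt 3 / 2) = 0" by linarith
    ultimately show False using sin_cos_squared_add[of t] by simp
  qed
  then obtain k where "k < 3" "bump k p > 0" by (auto simp: p bump_circ flat_pos)
  then show ?thesis by (intro sum_pos2[of _ k]) (auto simp: bump_def flat_pos)
qed

definition pou :: "nat \<Rightarrow> circle \<Rightarrow> complex" where
  "pou k p = of_real (bump k p) * inverse (of_real (\<Sum>j<3. bump j p))"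

lemma pou_Cinf: "pou k \<in> Cinf"
proof -
  have b: "ub {} (\<lambda>_::unit. \<lambda>t. bump k (circ t))" for k using bump_Cinf[of k] by (simp add: Cinf_def smooth_curve_ub)
  have nz: "(\<Sum>j<3. bump j p) \<noteq> 0" for p using bump_sum_pos[of p] by simp
  have "ub {} (\<lambda>_::unit. \<lambda>t. pou k (circ t))"
    unfolding pou_def
    \<comment> \<open>Over T = {} the lower bound is vacuous, so c = 1 serves.\<close>
    by (intro ub_mult ub_linear[OF bounded_linear_of_real] ub_inverse[where c = 1] ub_sum b)
       (use nz in \<open>auto simp del: of_real_sum\<close>)
  then show ?thesis by (simp add: Cinf_def smooth_curve_ub)
qed

lemma pou_sum: "(\<Sum>k<3. pou k p) = 1"
  unfolding pou_def sum_distrib_right[symmetric] of_real_sum[symmetric]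
  by (rule right_inverse) (use bump_sum_pos[of p] in \<open>simp del: of_real_sum\<close>)

text \<open>Each bump lives on an arc of radius pi/2. Moving the centre by at most pi/3 asks for
  radius pi/2 + pi/3 = 5*pi/6, which is still below pi.\<close>

lemma pou_cutoff:
  assumes "c = 2*pi*real k/3 + d + 2*pi * of_int n" "\<bar>d\<bar> \<le> pi/3"
  shows "cutoff c (5*pi/6) (pou k)"
  unfolding cutoff_def
proof (intro conjI allI impI pou_Cinf)
  fix t assume t: "c + 5*pi/6 < t \<and> t < c + 2*pi - 5*pi/6"
  define x where "x = t - 2*pi*real k/3 + 2*pi * of_int (- n)"
  have "cos (t - 2*pi*real k/3) = cos x"
    using cis_2pi_int[of "t - 2*pi*real k/3" "- n"] unfolding x_def by (metis cis.sel(1))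
  moreover have "x - pi \<ge> - (pi/2)" "x - pi \<le> pi/2" using t assms by (auto simp: x_def abs_le_iff)
  then have "cos (x - pi) \<ge> 0" by (intro cos_ge_zero) auto
  then have "cos x \<le> 0" by (simp add: cos_diff)
  ultimately show "pou k (circ t) = 0" by (simp add: pou_def bump_circ flat_pos)
qed

text \<open>Neighbouring centres are 2*pi/3 apart, so their midpoint is at distance pi/3 from both,
  and on a circle with three centres any two are neighbours.\<close>

lemma pou_pair: "j < 3 \<Longrightarrow> k < 3 \<Longrightarrow> \<exists>c. cutoff c (5*pi/6) (pou j) \<and> cutoff c (5*pi/6) (pou k)"
proof -
  assume jk: "j < 3" "k < 3"
  have *: "\<exists>c. cutoff c (5*pi/6) (pou j) \<and> cutoff c (5*pi/6) (pou k)" if "j \<le> k" "k < 3" for j k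
  proof -
    have "k \<le> j + 1 \<or> j = 0 \<and> k = 2" using that by arith
    then consider "k \<le> j + 1" | "j = 0" "k = 2" by blast
    then show ?thesis
    proof cases
      case 1
      define c where "c = 2*pi*real j/3 + (if k = j then 0 else pi/3)"
      have "cutoff c (5*pi/6) (pou j)"
        by (rule pou_cutoff[where d = "if k = j then 0 else pi/3" and n = 0]) (auto simp: c_def)
      moreover have "cutoff c (5*pi/6) (pou k)"
      proof (rule pou_cutoff[where d = "if k = j then 0 else - (pi/3)" and n = 0])
        have "k = j \<or> k = j + 1" using 1 that by linarith
        then show "c = 2*pi*real k/3 + (if k = j then 0 else - (pi/3)) + 2*pi * of_int 0"
          by (auto simp: c_def field_simps)
      qed simp
      ultimately show ?thesis by blast
    next
      \<comment> \<open>The bumps 0 and 2 are neighbours across the angle 0: the midpoint of 4*pi/3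
        and 2*pi is 5*pi/3, hence the winding number n = 1 for the first of them.\<close>
      case 2
      have "cutoff (5*pi/3) (5*pi/6) (pou j)"
        by (rule pou_cutoff[where d = "- (pi/3)" and n = 1]) (auto simp: 2)
      moreover have "cutoff (5*pi/3) (5*pi/6) (pou k)"
        by (rule pou_cutoff[where d = "pi/3" and n = 0]) (auto simp: 2)
      ultimately show ?thesis by blast
    qed
  qed
  show ?thesis using *[of j k] *[of k j] jk by (metis nat_le_linear)
qed

section \<open>Families of parameter integrals\<close>

text \<open>A derivative is a pointwise limit of difference quotients along the increments 1 / (n +
  1), so it inherits measurability. For a chain of derivatives measurability then has to be checked
  at the start only.\<close>

lemma measurable_vector_derivative:
  fixes g :: "real \<Rightarrow> 'z \<Rightarrow> 'v::{banach,second_countable_topology}"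
  assumes "\<And>x. g x \<in> borel_measurable M" "\<And>z. ((\<lambda>x. g x z) has_vector_derivative g' z) (at x)"
  shows "g' \<in> borel_measurable M"
proof (rule borel_measurable_LIMSEQ_metric)
  let ?h = "\<lambda>n. 1 / real (Suc n)"
  show "(\<lambda>z. (1 / ?h n) *\<^sub>R (g (x + ?h n) z - g x z)) \<in> borel_measurable M" for n
    using assms(1) by measurable
  fix z
  have "((\<lambda>y. (1 / norm (y - x)) *\<^sub>R (g y z - (g x z + (y - x) *\<^sub>R g' z))) \<longlongrightarrow> 0) (at x)"
    using assms(2)[of z] unfolding has_vector_derivative_def has_derivative_within by simp
  moreover have "filterlim (\<lambda>n. x + ?h n) (at x) sequentially"
    using tendsto_add[OF tendsto_const[of x] LIMSEQ_Suc[OF lim_1_over_n]]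
    unfolding filterlim_at by auto
  ultimately have lim: "(\<lambda>n. (1 / norm (x + ?h n - x)) *\<^sub>R (g (x + ?h n) z - (g x z + (x + ?h n - x) *\<^sub>R g' z))) \<longlonglongrightarrow> 0"
    by (rule filterlim_compose)
  have rw: "(1 / norm (x + h - x)) *\<^sub>R (g (x + h) z - (g x z + (x + h - x) *\<^sub>R g' z)) = (1 / h) *\<^sub>R (g (x + h) z - g x z) - g' z" if "h > 0" for h
    using that by (simp add: scaleR_diff_right scaleR_add_right)
  have rw': "\<And>n. (1 / norm (x + ?h n - x)) *\<^sub>R (g (x + ?h n) z - (g x z + (x + ?h n - x) *\<^sub>R g' z)) = (1 / ?h n) *\<^sub>R (g (x + ?h n) z - g x z) - g' z"
    by (rule rw) simp
  have "(\<lambda>n. (1 / ?h n) *\<^sub>R (g (x + ?h n) z - g x z) - g' z) \<longlonglongrightarrow> 0" using lim by (simp only: rw')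
  then show "(\<lambda>n. (1 / ?h n) *\<^sub>R (g (x + ?h n) z - g x z)) \<longlonglongrightarrow> g' z" by (rule LIM_zero_cancel)
qed

lemma ub_integral:
  fixes E :: "nat \<Rightarrow> 'a \<Rightarrow> 'z \<Rightarrow> real \<Rightarrow> 'v::{banach,second_countable_topology}"
  assumes m: "\<And>\<alpha> x. (\<lambda>z. E 0 \<alpha> z x) \<in> borel_measurable M"
    and d: "\<And>i \<alpha> z x. (E i \<alpha> z has_vector_derivative E (Suc i) \<alpha> z x) (at x)"
    and b: "\<And>i. \<exists>W. integrable M W \<and> (\<forall>\<alpha> z x. norm (E i \<alpha> z x) \<le> W z)"
  shows "ub UNIV (\<lambda>\<alpha> x. LINT z|M. E 0 \<alpha> z x)"
proof (rule ub_of_chain[of "\<lambda>i \<alpha> x. LINT z|M. E i \<alpha> z x"])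
  have m: "(\<lambda>z. E i \<alpha> z x) \<in> borel_measurable M" for i \<alpha> x
  proof (induction i arbitrary: x)
    case (Suc i) show ?case by (rule measurable_vector_derivative[OF Suc d])
  qed (rule m)
  have int: "integrable M (\<lambda>z. E i \<alpha> z x)" for i \<alpha> x
  proof -
    obtain W where W: "integrable M W" "\<And>\<alpha> z x. norm (E i \<alpha> z x) \<le> W z" using b by blast
    show ?thesis by (rule Bochner_Integration.integrable_bound[OF W(1) m]) (simp, intro AE_I2 order_trans[OF W(2) abs_ge_self])
  qed
  show "((\<lambda>x. LINT z|M. E n \<alpha> z x) has_vector_derivative (LINT z|M. E (Suc n) \<alpha> z t)) (at t)" for n \<alpha> t
  proof -
    obtain W where W: "integrable M W" "\<And>\<alpha> z x. norm (E (Suc n) \<alpha> z x) \<le> W z" using b by blast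
    show ?thesis
      by (rule has_vector_derivative_integral[where g = "\<lambda>x z. E n \<alpha> z x" and g' = "\<lambda>x z. E (Suc n) \<alpha> z x" and a = "t - 1" and b = "t + 1",
            OF int d W(2) W(1) m]) simp
  qed
  show "\<exists>C. \<forall>\<alpha>. \<forall>t\<in>UNIV. norm (LINT z|M. E n \<alpha> z t) \<le> C" for n
  proof -
    obtain W where W: "integrable M W" "\<And>\<alpha> z x. norm (E n \<alpha> z x) \<le> W z" using b by blast
    have "norm (LINT z|M. E n \<alpha> z t) \<le> (LINT z|M. W z)" for \<alpha> t
      by (rule order_trans[OF integral_norm_bound integral_mono[OF integrable_norm[OF int] W(1) W(2)]])
    then show ?thesis by blast
  qed
qed

text \<open>A chart representation holds on the open window |t - c| < pi, which misses one point of
  the circle. If H is already known to be smooth and periodic, the bounds found on the window pass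
  to its closure by continuity of the derivatives and then to the line by periodicity.\<close>

lemma ub_extend:
  fixes H :: "'a \<Rightarrow> real \<Rightarrow> 'v::real_normed_vector"
  assumes H: "ub {} H" and p: "\<And>\<alpha> t. H \<alpha> (t + 2*pi) = H \<alpha> t" and H': "ub UNIV H'"
    and eq: "\<And>\<alpha> t. \<bar>t - c\<bar> < pi \<Longrightarrow> H \<alpha> t = H' \<alpha> t"
  shows "ub UNIV H"
proof -
  let ?S = "{c - pi <..< c + pi}"
  have e: "(dv ^^ n) H \<alpha> t = (dv ^^ n) H' \<alpha> t" if "t \<in> ?S" for n \<alpha> t
    using that
  proof (induction n arbitrary: t)
    case 0 then show ?case using eq by (auto simp: abs_less_iff)
  next
    case (Suc n)
    have "((dv ^^ n) H' \<alpha> has_vector_derivative (dv ^^ Suc n) H \<alpha> t) (at t)"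
      by (rule has_vector_derivative_transform_within_open[OF ub_chain(1)[OF H], where S = ?S]) (use Suc in auto)
    then show ?case using ub_chain(1)[OF H'] vector_derivative_unique_at by blast
  qed
  have per: "(dv ^^ n) H \<alpha> (t + 2*pi) = (dv ^^ n) H \<alpha> t" for n \<alpha> t
  proof (induction n arbitrary: t)
    case (Suc n)
    show ?case by (rule periodic_deriv[OF Suc ub_chain(1)[OF H]])
  qed (simp add: p)
  have "ub UNIV ((dv ^^ 0) H)"
  proof (rule ub_of_chain[of "\<lambda>n. (dv ^^ n) H"])
    fix n
    obtain C where C: "C > 0" "\<And>\<alpha> t. t \<in> UNIV \<Longrightarrow> norm ((dv ^^ n) H' \<alpha> t) \<le> C" using ub_boundE[OF ub_chain(2)[OF H']] by blast
    have "norm ((dv ^^ n) H \<alpha> t) \<le> C" for \<alpha> t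
    proof -
      obtain k::int where k: "c - pi \<le> t + 2*pi * of_int k" "t + 2*pi * of_int k < c - pi + 2*pi" by (rule period_window)
      have "norm ((dv ^^ n) H \<alpha> (t + 2*pi * of_int k)) \<le> C"
      proof (rule continuous_le_on_closure[of ?S "\<lambda>t. norm ((dv ^^ n) H \<alpha> t)"])
        show "continuous_on (closure ?S) (\<lambda>t. norm ((dv ^^ n) H \<alpha> t))"
          by (intro continuous_on_norm ub_continuous[OF ub_chain(2)[OF H]])
        show "t + 2*pi * of_int k \<in> closure ?S" using k by simp
        show "norm ((dv ^^ n) H \<alpha> s) \<le> C" if "s \<in> ?S" for s using e[OF that] C(2) by simp
      qed
      then show ?thesis using periodic_int[of "(dv ^^ n) H \<alpha>" t k] per by simp
    qed
    then show "\<exists>C. \<forall>\<alpha>. \<forall>t\<in>UNIV. norm ((dv ^^ n) H \<alpha> t) \<le> C" by blast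
  qed (use ub_chain(1)[OF H] in simp)
  then show ?thesis by simp
qed

text \<open>The chain rule along x -> (x, x + z); separate partial derivatives suffice because one
  of them is jointly continuous.\<close>

lemma total_derivative_shift:
  fixes F Fx Fy :: "real \<Rightarrow> real \<Rightarrow> 'v::real_normed_vector"
  assumes dx: "\<And>x y. ((\<lambda>s. F s y) has_vector_derivative Fx x y) (at x)"
    and dy: "\<And>x y. ((\<lambda>s. F x s) has_vector_derivative Fy x y) (at y)"
    and c: "continuous_on UNIV (\<lambda>(x, y). Fy x y)"
  shows "((\<lambda>x. F x (x + z)) has_vector_derivative Fx x (x + z) + Fy x (x + z)) (at x)"
proof -
  have "((\<lambda>(x, y). F x y) has_derivative (\<lambda>(tx, ty). (\<lambda>h. h *\<^sub>R Fx x (x + z)) tx + blinfun_apply (blinfun_scaleR_left (Fy x (x + z))) ty)) (at (x, x + z) within UNIV \<times> UNIV)"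
  proof (rule has_derivative_partialsI[where fy = "\<lambda>x y. blinfun_scaleR_left (Fy x y)"])
    show "((\<lambda>x'. F x' (x + z)) has_derivative (\<lambda>h. h *\<^sub>R Fx x (x + z))) (at x within UNIV)"
      using dx[where x = x and y = "x + z"] by (simp add: has_vector_derivative_def)
    show "((\<lambda>y. F x' y) has_derivative blinfun_apply (blinfun_scaleR_left (Fy x' y))) (at y within UNIV)" for x' y
      using dy[where x = x' and y = y] by (simp add: has_vector_derivative_def)
    have "continuous (at (x, x + z)) (\<lambda>(x, y). Fy x y)" using c by (simp add: continuous_on_eq_continuous_at)
    then show "continuous (at (x, x + z) within UNIV \<times> UNIV) (\<lambda>(x, y). blinfun_scaleR_left (Fy x y))"
      unfolding case_prod_unfold by (simp add: bounded_linear.continuous[OF bounded_linear_blinfun_scaleR_left])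
  qed auto
  then have a2: "((\<lambda>(x, y). F x y) has_derivative (\<lambda>(tx, ty). tx *\<^sub>R Fx x (x + z) + ty *\<^sub>R Fy x (x + z))) (at (x, x + z))"
    by (simp add: case_prod_unfold)
  have a1: "((\<lambda>x. (x, x + z)) has_derivative (\<lambda>h. (h, h))) (at x)"
    by (auto intro!: derivative_eq_intros)
  from has_derivative_compose[OF a1 a2]
  show ?thesis unfolding has_vector_derivative_def prod.case scaleR_right_distrib .
qed

text \<open>In the coordinates (x, z) with y = x + z the factor \<open>cis (of_int n * x)\<close>
  splits off a kernel operator applied to a modulated section; z becomes an index, over which the
  estimates must be uniform. Periodicity in both variables passes to all partial derivatives, so
  they are bounded.\<close>

lemma smooth_kernel_shift_ub:
  assumes "smooth_kernel K"
  shows "ub UNIV (\<lambda>z x. K (circ x) (circ (x + z)))"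
proof -
  obtain F where F: "partials_on UNIV (\<lambda>x y. K (circ x) (circ y)) F" using assms unfolding smooth_kernel_def by blast
  have F0: "F 0 0 x y = K (circ x) (circ y)" and Fc: "continuous_on UNIV (\<lambda>(x, y). F i j x y)"
    and Fx: "((\<lambda>s. F i j s y) has_vector_derivative F (Suc i) j x y) (at x)"
    and Fy: "((\<lambda>s. F i j x s) has_vector_derivative F i (Suc j) x y) (at y)" for i j x y
    using F unfolding partials_on_def by auto
  have per0: "F 0 0 (x + 2*pi) y = F 0 0 x y" "F 0 0 x (y + 2*pi) = F 0 0 x y" for x y by (simp_all add: F0)
  have per1: "F 0 j (x + 2*pi) y = F 0 j x y" "F 0 j x (y + 2*pi) = F 0 j x y" for j x y
  proof (induction j arbitrary: x y)
    case (Suc j)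
    { case 1 
      have "(F 0 j x has_vector_derivative F 0 (Suc j) (x + 2*pi) y) (at y)"
        using Fy[of 0 j "x + 2*pi" y] Suc(1) by simp
      then show ?case using Fy[of 0 j x y] vector_derivative_unique_at by fastforce
    next
      case 2 show ?case by (rule periodic_deriv[OF Suc(2) Fy]) }
  qed (use per0 in auto)
  have per: "F i j (x + 2*pi) y = F i j x y" "F i j x (y + 2*pi) = F i j x y" for i j x y
  proof (induction i arbitrary: x y)
    case (Suc i)
    { case 1 show ?case by (rule periodic_deriv[of "\<lambda>x. F i j x y", OF Suc(1) Fx])
    next
      case 2
      have "((\<lambda>s. F i j s y) has_vector_derivative F (Suc i) j x (y + 2*pi)) (at x)"
        using Fx[of i j "y + 2*pi" x] Suc(2) by simp
      then show ?case using Fx[of i j y x] vector_derivative_unique_at by fastforce }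
  qed (use per1 in auto)
  have bd: "\<exists>C. \<forall>x y. norm (F i j x y) \<le> C" for i j
  proof -
    have "compact ((\<lambda>(x, y). F i j x y) ` ({0..2*pi} \<times> {0..2*pi}))"
      by (intro compact_continuous_image compact_Times continuous_on_subset[OF Fc]) auto
    then obtain C where C: "\<And>v. v \<in> (\<lambda>(x, y). F i j x y) ` ({0..2*pi} \<times> {0..2*pi}) \<Longrightarrow> norm v \<le> C"
      using compact_imp_bounded bounded_iff by metis
    have "norm (F i j x y) \<le> C" for x y
    proof -
      obtain k::int where k: "0 \<le> x + 2*pi * of_int k" "x + 2*pi * of_int k < 0 + 2*pi" by (rule period_window)
      obtain l::int where l: "0 \<le> y + 2*pi * of_int l" "y + 2*pi * of_int l < 0 + 2*pi" by (rule period_window)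
      have "F i j x y = F i j (x + 2*pi * of_int k) (y + 2*pi * of_int l)"
        using periodic_int[of "\<lambda>x. F i j x (y + 2*pi * of_int l)" x k, OF per(1)] periodic_int[of "F i j x" y l, OF per(2)] by simp
      then show ?thesis using C k l by (auto intro!: C rev_image_eqI[of "(x + 2*pi * of_int k, y + 2*pi * of_int l)"])
    qed
    then show ?thesis by blast
  qed
  \<comment> \<open>D is the derivation d/dx + d/dy on a whole scheme of partial derivatives; its
    powers give all derivatives along the shifted diagonal.\<close>
  define D where "D T = (\<lambda>i j x y. T (Suc i) j x y + T i (Suc j) x y :: 'a)" for T :: "nat \<Rightarrow> nat \<Rightarrow> real \<Rightarrow> real \<Rightarrow> 'a"
  have Dn: "(\<forall>i j. \<exists>C. \<forall>x y. norm ((D ^^ n) F i j x y) \<le> C) \<and>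
     (\<forall>i j z x. ((\<lambda>x. (D ^^ n) F i j x (x + z)) has_vector_derivative (D ^^ Suc n) F i j x (x + z)) (at x))" for n
  proof (induction n)
    case 0
    then show ?case using bd total_derivative_shift[OF Fx Fy Fc] by (auto simp: D_def)
  next
    case (Suc n)
    have "\<exists>C. \<forall>x y. norm ((D ^^ Suc n) F i j x y) \<le> C" for i j
    proof -
      obtain C1 C2 where "\<And>x y. norm ((D ^^ n) F (Suc i) j x y) \<le> C1" "\<And>x y. norm ((D ^^ n) F i (Suc j) x y) \<le> C2"
        using Suc.IH by metis
      then have "norm ((D ^^ Suc n) F i j x y) \<le> C1 + C2" for x y by (simp add: D_def norm_triangle_mono)
      then show ?thesis by blast
    qed
    moreover have "((\<lambda>x. (D ^^ Suc n) F i j x (x + z)) has_vector_derivative (D ^^ Suc (Suc n)) F i j x (x + z)) (at x)" for i j z x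
    proof -
      have "((\<lambda>x. (D ^^ n) F (Suc i) j x (x + z) + (D ^^ n) F i (Suc j) x (x + z)) has_vector_derivative
         (D ^^ Suc n) F (Suc i) j x (x + z) + (D ^^ Suc n) F i (Suc j) x (x + z)) (at x)"
        by (intro has_vector_derivative_add) (use Suc.IH in blast)+
      moreover have "(D ^^ Suc n) F i j = (\<lambda>x y. (D ^^ n) F (Suc i) j x y + (D ^^ n) F i (Suc j) x y)" by (simp add: D_def)
      moreover have "(D ^^ Suc (Suc n)) F i j = (\<lambda>x y. (D ^^ Suc n) F (Suc i) j x y + (D ^^ Suc n) F i (Suc j) x y)"
        unfolding funpow.simps(2)[of "Suc n"] o_apply by (simp only: D_def)
      ultimately show ?thesis by (simp only:)
    qed
    ultimately show ?case by blast
  qed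
  have "ub UNIV (\<lambda>z x. (D ^^ 0) F 0 0 x (x + z))"
  proof (rule ub_of_chain[of "\<lambda>n z x. (D ^^ n) F 0 0 x (x + z)"])
    show "((\<lambda>x. (D ^^ n) F 0 0 x (x + z)) has_vector_derivative (D ^^ Suc n) F 0 0 t (t + z)) (at t)" for n z t
      using Dn by blast
    show "\<exists>C. \<forall>z. \<forall>t\<in>UNIV. norm ((D ^^ n) F 0 0 t (t + z)) \<le> C" for n using Dn[of n] by blast
  qed
  then show ?thesis by (simp add: F0)
qed

section \<open>Fourier coefficients of pseudo-differential operators\<close>

text \<open>The section is cut open at the angle c + pi and transformed at a real frequency. For
  sections vanishing near the cut this is the transform of \<open>lift c f\<close> on the
  line.\<close>

definition FT :: "real \<Rightarrow> (circle \<Rightarrow> complex^'k) \<Rightarrow> real \<Rightarrow> complex^'k" where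
  "FT c f \<xi> = integral {c - pi..c + pi} (\<lambda>y. cis (- (y * \<xi>)) *s f (circ y))"

text \<open>The support condition of \<open>cutoff\<close>, detached from smoothness and scalar
  values.\<close>

definition vanishing :: "real \<Rightarrow> real \<Rightarrow> (circle \<Rightarrow> 'v::zero) \<Rightarrow> bool" where
  "vanishing c r f \<longleftrightarrow> (\<forall>t. c + r < t \<and> t < c + 2*pi - r \<longrightarrow> f (circ t) = 0)"

lemma circ_minus_pi: "circ (c - pi) = circ (c + pi)"
  using circ_2pi[of "c - pi"] by (simp add: algebra_simps)

lemma vanishing_end:
  assumes "vanishing c r f" "r < pi"
  shows "f (circ (c + pi)) = 0" "f (circ (c - pi)) = 0"
  using assms unfolding circ_minus_pi vanishing_def by auto

lemma continuous_FT_integrand: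
  "f \<in> Cinf \<Longrightarrow> continuous_on A (\<lambda>y. cis (- (y * \<xi>)) *s (f (circ y) :: complex^'k))"
  by (intro bounded_bilinear.continuous_on[OF bb_smult] continuous_intros Cinf_continuous)

lemma fourier_lift:
  assumes f: "f \<in> Cinf" and v: "vanishing c r f" "r < pi"
  shows "fourier (lift c f) \<xi> = FT c f \<xi>"
proof -
  let ?F = "\<lambda>y. cis (- (y * \<xi>)) *s f (circ y)"
  have si: "set_integrable lborel {c - pi..c + pi} ?F" by (rule borel_integrable_atLeastAtMost') (rule continuous_FT_integrand[OF f])
  have "fourier (lift c f) \<xi> = (LBINT y. indicator {c - pi..c + pi} y *\<^sub>R ?F y)"
    unfolding fourier_def
  proof (rule Bochner_Integration.integral_cong[OF refl])
    fix y
    \<comment> \<open>The lift lives on the open window, the integral on the closed one; at the two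
      ends the section vanishes.\<close>
    have "y \<in> {c - pi..c + pi} \<Longrightarrow> \<not> \<bar>y - c\<bar> < pi \<Longrightarrow> y = c + pi \<or> y = c - pi" by auto
    then show "cis (- (y * \<xi>)) *s lift c f y = indicator {c - pi..c + pi} y *\<^sub>R ?F y"
      using vanishing_end[OF v] by (auto simp: lift_def indicator_def abs_less_iff vec_eq_iff)
  qed
  also have "\<dots> = integral {c - pi..c + pi} ?F"
    using set_borel_integral_eq_integral(2)[OF si] by (simp add: set_lebesgue_integral_def)
  finally show ?thesis by (simp add: FT_def)
qed

lemma FT_modulate: "FT c (\<lambda>p. ee n p *s f p) \<xi> = FT c f (\<xi> - of_int n)"
  unfolding FT_def by (rule integral_cong) (simp add: smult_assoc cis_mult algebra_simps)

lemma vanishing_ddt: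
  fixes f :: "circle \<Rightarrow> 'v::real_normed_vector"
  assumes f: "f \<in> Cinf" and v: "vanishing c r f"
  shows "vanishing c r (ddt f)"
  unfolding vanishing_def
proof (intro allI impI)
  fix t assume t: "c + r < t \<and> t < c + 2*pi - r"
  have "((\<lambda>t. f (circ t)) has_vector_derivative 0) (at t)"
    by (rule has_vector_derivative_transform_within_open[where S = "{c + r <..< c + 2*pi - r}" and f = "\<lambda>_. 0"])
       (use t v in \<open>auto simp: vanishing_def\<close>)
  then show "ddt f (circ t) = 0" using Cinf_deriv[OF f, of t] vector_derivative_unique_at by blast
qed

lemma FT_ddt:
  fixes f :: "circle \<Rightarrow> complex^'k"
  assumes f: "f \<in> Cinf" and v: "vanishing c r f" "r < pi"
  shows "FT c (ddt f) \<xi> = (\<i> * of_real \<xi>) *s FT c f \<xi>"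
proof -
  have e: "c - pi + 2*pi = c + pi" by simp
  have d: "((\<lambda>y. cis (- (y * \<xi>))) has_vector_derivative - (\<i> * of_real \<xi>) * cis (- (y * \<xi>))) (at y)" for y
    using cis_mult_deriv[of "- \<xi>" y] by (simp add: mult_ac)
  have "integral {c - pi..c - pi + 2*pi} (\<lambda>y. (- (\<i> * of_real \<xi>) * cis (- (y * \<xi>))) *s f (circ y))
     = - integral {c - pi..c - pi + 2*pi} (\<lambda>y. cis (- (y * \<xi>)) *s ddt f (circ y))"
    by (rule periodic_by_parts[OF bb_smult d Cinf_deriv[OF f]])
       (auto intro!: continuous_intros Cinf_continuous[OF Cinf_ddt[OF f]] simp only: e vanishing_end[OF v] vec.scale_zero_right)
  moreover have "integral {c - pi..c + pi} (\<lambda>y. (- (\<i> * of_real \<xi>) * cis (- (y * \<xi>))) *s f (circ y)) = (- (\<i> * of_real \<xi>)) *s FT c f \<xi>"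
    unfolding FT_def smult_assoc[symmetric]
    by (rule integral_linear[OF _ bounded_bilinear.bounded_linear_right[OF bb_smult], unfolded o_def])
       (rule integrable_continuous_interval[OF continuous_FT_integrand[OF f]])
  ultimately show ?thesis unfolding e FT_def[symmetric] by (simp add: vec_eq_iff)
qed

lemma FT_bound:
  fixes f :: "circle \<Rightarrow> complex^'k"
  assumes f: "f \<in> Cinf" and B: "\<And>p. norm (f p) \<le> B"
  shows "norm (FT c f \<xi>) \<le> 2*pi*B"
proof -
  have "norm (FT c f \<xi>) \<le> integral {c - pi..c + pi} (\<lambda>_. B)"
    unfolding FT_def
    by (rule integral_norm_bound_integral) (auto intro!: integrable_continuous_interval continuous_FT_integrand f simp: norm_smult B)
  then show ?thesis by simp
qed

text \<open>Each derivative multiplies the transform by i * \<xi>; no boundary terms arise, as the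
  derivatives vanish near the cut as well.\<close>

lemma FT_decay:
  fixes f :: "circle \<Rightarrow> complex^'k"
  assumes f: "f \<in> Cinf" and v: "vanishing c r f" "r < pi"
  obtains C where "C \<ge> 0" "\<And>\<xi>. norm (FT c f \<xi>) \<le> C / (1 + \<bar>\<xi>\<bar>) ^ N"
proof -
  have iter: "(ddt ^^ N) f \<in> Cinf \<and> vanishing c r ((ddt ^^ N) f) \<and> (\<forall>\<xi>. FT c ((ddt ^^ N) f) \<xi> = (\<i> * of_real \<xi>) ^ N *s FT c f \<xi>)"
  proof (induction N)
    case (Suc N)
    then show ?case using FT_ddt[of "(ddt ^^ N) f" c r] v(2) by (auto simp: Cinf_ddt vanishing_ddt smult_assoc)
  qed (use f v in simp)
  obtain B0 where B0: "B0 > 0" "\<And>p. norm (f p) \<le> B0" using Cinf_bounded[OF f] by blast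
  obtain B where B: "B > 0" "\<And>p. norm ((ddt ^^ N) f p) \<le> B" using Cinf_bounded iter by blast
  let ?C = "2 ^ N * (2*pi*B0 + 2*pi*B)"
  have "norm (FT c f \<xi>) \<le> ?C / (1 + \<bar>\<xi>\<bar>) ^ N" for \<xi>
  proof -
    have "norm (FT c f \<xi>) * (1 + \<bar>\<xi>\<bar>) ^ N \<le> norm (FT c f \<xi>) * (2 ^ N * (1 + \<bar>\<xi>\<bar> ^ N))"
      by (intro mult_left_mono power_one_plus_le) auto
    also have "\<dots> = 2 ^ N * (norm (FT c f \<xi>) + norm (FT c ((ddt ^^ N) f) \<xi>))"
      using iter by (simp add: norm_smult norm_mult norm_power algebra_simps)
    also have "\<dots> \<le> ?C"
      by (intro mult_left_mono add_mono FT_bound B0 B) (use f iter in auto)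
    finally show ?thesis by (subst pos_le_divide_eq) (auto intro: zero_less_power add_pos_nonneg)
  qed
  then show ?thesis using that[of ?C] B0 B by simp
qed

lemma FT_continuous:
  fixes f :: "circle \<Rightarrow> complex^'k"
  assumes f: "f \<in> Cinf"
  shows "continuous_on UNIV (FT c f)"
proof -
  let ?M = "restrict_space lborel {c - pi..c + pi}"
  obtain B where B: "B > 0" "\<And>p. norm (f p) \<le> B" using Cinf_bounded[OF f] by blast
  have "continuous_on UNIV (\<lambda>\<xi>. LINT y|?M. cis (- (y * \<xi>)) *s f (circ y))"
  proof (rule continuous_on_integral_dominated[where W = "\<lambda>_. B"])
    show "continuous_on UNIV (\<lambda>\<xi>. cis (- (y * \<xi>)) *s f (circ y))" for y
      by (intro bounded_bilinear.continuous_on[OF bb_smult] continuous_intros)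
    show "(\<lambda>y. cis (- (y * \<xi>)) *s f (circ y)) \<in> borel_measurable ?M" for \<xi>
      by (rule borel_measurable_integrable[OF integral_restrict(2)[OF continuous_FT_integrand[OF f]]])
    show "integrable ?M (\<lambda>_. B)" by (rule integral_restrict(2)) simp
  qed (use B in \<open>simp add: norm_smult\<close>)
  then show ?thesis unfolding FT_def using integral_restrict(1)[OF continuous_FT_integrand[OF f]] by simp
qed

text \<open>Multiplication of matrices by complex scalars as a real-bilinear map; it lets
  matrix-valued symbols be modulated in the same way as sections.\<close>

definition smat :: "complex \<Rightarrow> complex^'k^'k \<Rightarrow> complex^'k^'k" where
  "smat c M = (\<chi> i j. c * M $ i $ j)"

lemma bb_smat: "bounded_bilinear (smat :: complex \<Rightarrow> complex^'k^'k \<Rightarrow> _)"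
  unfolding bilinear_conv_bounded_bilinear[symmetric] bilinear_def
  by (auto intro!: linearI simp: smat_def vec_eq_iff distrib_left distrib_right)

lemma smat_assoc: "smat c (smat d M) = smat (c * d) M"
  by (simp add: smat_def mult.assoc)

lemma smat_mult: "smat c M *v v = c *s (M *v v)"
  by (simp add: smat_def matrix_vector_mult_def vec_eq_iff sum_distrib_left mult_ac)

lemma matvec_smult: "M *v (c *s v) = c *s (M *v (v :: complex^'k))"
  by (simp add: matrix_vector_mult_def vec_eq_iff sum_distrib_left mult_ac)

text \<open>The two estimates in \<open>amp\<close> apart from linearity, so that they can be proved
  for the pieces of an operator under a partition of unity and then added.\<close>

definition ampl :: "(real \<Rightarrow> real) \<Rightarrow> ((circle \<Rightarrow> complex^'k) \<Rightarrow> circle \<Rightarrow> complex^'k) \<Rightarrow> bool" where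
  "ampl G A \<longleftrightarrow>
     (\<forall>w\<in>Cinf. \<exists>M H. ub UNIV H \<and> (\<forall>n t. A (\<lambda>p. ee n p *s w p) (circ t) =
        (of_real ((1 + \<bar>real_of_int n\<bar>) ^ M) * cis (of_int n * G t)) *s H n t)) \<and>
     (\<forall>w\<in>Cinf. \<forall>c. rapid c \<longrightarrow> (\<forall>p. A (\<lambda>p. ser c p *s w p) p = lsum (\<lambda>n. c n *s A (\<lambda>p. ee n p *s w p) p)))"

lemma amp_iff: "amp G A \<longleftrightarrow> linear_op A \<and> ampl G A"
  by (simp add: amp_def ampl_def)

lemma ampl_asum:
  fixes A :: "(circle \<Rightarrow> complex^'k) \<Rightarrow> circle \<Rightarrow> complex^'k"
  assumes A: "ampl G A" and w: "w \<in> Cinf" and c: "rapid c"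
  shows "asum (\<lambda>n. c n *s A (\<lambda>p. ee n p *s w p) p)"
proof -
  obtain M and H :: "int \<Rightarrow> real \<Rightarrow> complex^'k" where H: "ub UNIV H"
    "\<And>n t. A (\<lambda>p. ee n p *s w p) (circ t) = (of_real ((1 + \<bar>real_of_int n\<bar>) ^ M) * cis (of_int n * G t)) *s H n t"
    using A w unfolding ampl_def by blast
  obtain C where C: "C > 0" "\<And>n t. t \<in> UNIV \<Longrightarrow> norm (H n t) \<le> C" using ub_boundE[OF H(1)] by blast
  obtain t where p: "p = circ t" by (rule circ_surj)
  have "rapid (\<lambda>n. c n *s A (\<lambda>p. ee n p *s w p) p)"
  proof (rule rapid_poly[OF c, where K = C and M = M])
    fix n
    have "norm (A (\<lambda>p. ee n p *s w p) p) \<le> (1 + \<bar>real_of_int n\<bar>) ^ M * C"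
      unfolding p H(2) by (simp add: norm_smult norm_mult norm_power C mult_left_mono del: of_real_add of_real_power)
    from mult_left_mono[OF this, of "norm (c n)"]
    show "norm (c n *s A (\<lambda>p. ee n p *s w p) p) \<le> C * (1 + \<bar>real_of_int n\<bar>) ^ M * norm (c n)"
      by (simp add: norm_smult mult_ac)
  qed
  then show ?thesis by (rule rapid_asum(2))
qed

lemma ampl_zero: "ampl G (\<lambda>f p. 0 :: complex^'k)"
  unfolding ampl_def by (auto intro!: exI[of _ "\<lambda>_ _. 0"] ub_const')

lemma ampl_add:
  fixes A B :: "(circle \<Rightarrow> complex^'k) \<Rightarrow> circle \<Rightarrow> complex^'k"
  assumes A: "ampl G A" and B: "ampl G B"
  shows "ampl G (\<lambda>f p. A f p + B f p)"
  unfolding ampl_def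
proof (intro conjI ballI allI impI)
  fix w :: "circle \<Rightarrow> complex^'k" assume w: "w \<in> Cinf"
  obtain M and H :: "int \<Rightarrow> real \<Rightarrow> complex^'k" where H: "ub UNIV H"
    "\<And>n t. A (\<lambda>p. ee n p *s w p) (circ t) = (of_real ((1 + \<bar>real_of_int n\<bar>) ^ M) * cis (of_int n * G t)) *s H n t"
    using A w unfolding ampl_def by blast
  obtain M' and H' :: "int \<Rightarrow> real \<Rightarrow> complex^'k" where H': "ub UNIV H'"
    "\<And>n t. B (\<lambda>p. ee n p *s w p) (circ t) = (of_real ((1 + \<bar>real_of_int n\<bar>) ^ M') * cis (of_int n * G t)) *s H' n t"
    using B w unfolding ampl_def by blast
  \<comment> \<open>The growth exponents M and M' of the summands are both raised to M + M'; the
    excess is absorbed by the bounded factors a.\<close>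
  define a where "a M n = 1 / (1 + \<bar>real_of_int n\<bar>) ^ M" for M n
  have ab: "norm (a M n) \<le> 1" for M n by (simp add: a_def divide_simps one_le_power)
  have aeq: "(1 + \<bar>real_of_int n\<bar>) ^ (M + M') * a M' n = (1 + \<bar>real_of_int n\<bar>) ^ M" 
     "(1 + \<bar>real_of_int n\<bar>) ^ (M + M') * a M n = (1 + \<bar>real_of_int n\<bar>) ^ M'" for n
    by (auto simp: a_def power_add)
  have "ub UNIV (\<lambda>n t. a M' n *\<^sub>R H n t + a M n *\<^sub>R H' n t)"
    by (intro ub_add ub_scaleR H(1) H'(1) ub_const[where C=1] ub_const[where C=1]) (use ab in auto)
  moreover have "A (\<lambda>p. ee n p *s w p) (circ t) + B (\<lambda>p. ee n p *s w p) (circ t) =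
     (of_real ((1 + \<bar>real_of_int n\<bar>) ^ (M + M')) * cis (of_int n * G t)) *s (a M' n *\<^sub>R H n t + a M n *\<^sub>R H' n t)" for n t
  proof -
    have *: "(of_real x * z) *s (y *\<^sub>R v) = (of_real (x * y) * z) *s (v :: complex^'k)" for x y z v
      by (simp add: vec_eq_iff scaleR_conv_of_real[where 'a=complex])
    show ?thesis by (simp only: vec.scale_right_distrib * aeq H(2) H'(2))
  qed
  ultimately show "\<exists>M H. ub UNIV H \<and> (\<forall>n t. A (\<lambda>p. ee n p *s w p) (circ t) + B (\<lambda>p. ee n p *s w p) (circ t) =
      (of_real ((1 + \<bar>real_of_int n\<bar>) ^ M) * cis (of_int n * G t)) *s H n t)" by blast
next
  fix w :: "circle \<Rightarrow> complex^'k" and c :: "int \<Rightarrow> complex" and p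
  assume w: "w \<in> Cinf" and c: "rapid c"
  have "A (\<lambda>p. ser c p *s w p) p + B (\<lambda>p. ser c p *s w p) p = lsum (\<lambda>n. c n *s A (\<lambda>p. ee n p *s w p) p) + lsum (\<lambda>n. c n *s B (\<lambda>p. ee n p *s w p) p)"
    using A B w c unfolding ampl_def by simp
  also have "\<dots> = lsum (\<lambda>n. c n *s A (\<lambda>p. ee n p *s w p) p + c n *s B (\<lambda>p. ee n p *s w p) p)"
    by (rule Bochner_Integration.integral_add[symmetric]) (rule ampl_asum[OF A w c], rule ampl_asum[OF B w c])
  finally show "A (\<lambda>p. ser c p *s w p) p + B (\<lambda>p. ser c p *s w p) p = lsum (\<lambda>n. c n *s (A (\<lambda>p. ee n p *s w p) p + B (\<lambda>p. ee n p *s w p) p))"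
    by (simp only: vec.scale_right_distrib)
qed

lemma ampl_sum: "finite I \<Longrightarrow> (\<And>i. i \<in> I \<Longrightarrow> ampl G (A i)) \<Longrightarrow> ampl G (\<lambda>f p. \<Sum>i\<in>I. (A i f p :: complex^'k))"
proof (induction I rule: finite_induct)
  case empty
  show ?case by (simp only: sum.empty) (rule ampl_zero)
next
  case (insert i I)
  have "ampl G (\<lambda>f p. A i f p + (\<Sum>i\<in>I. A i f p))" by (rule ampl_add) (use insert in auto)
  then show ?case using insert(1,2) by simp
qed

lemma ampl_cong: "(\<And>f. f \<in> Cinf \<Longrightarrow> A f = B f) \<Longrightarrow> ampl G A \<Longrightarrow> ampl G (B :: (circle \<Rightarrow> complex^'k) \<Rightarrow> circle \<Rightarrow> complex^'k)"
proof -
  assume eq: "\<And>f. f \<in> Cinf \<Longrightarrow> A f = B f" and A: "ampl G A"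
  have 1: "B (\<lambda>p. ee n p *s w p) = A (\<lambda>p. ee n p *s w p)" if "w \<in> Cinf" for n w
    by (rule eq[symmetric]) (intro Cinf_smult ee_Cinf that)
  have 2: "B (\<lambda>p. ser c p *s w p) = A (\<lambda>p. ser c p *s w p)" if "w \<in> Cinf" "rapid c" for c w
    by (rule eq[symmetric]) (intro Cinf_smult ser_Cinf that)
  show "ampl G B" using A unfolding ampl_def by (simp add: 1 2)
qed

text \<open>Peetre's inequality for natural exponents.\<close>

lemma peetre: "(1 + \<bar>x + y\<bar>) ^ M \<le> (1 + \<bar>x\<bar>) ^ M * (1 + \<bar>y\<bar>) ^ M" for x y :: real
proof -
  have "1 + \<bar>x + y\<bar> \<le> (1 + \<bar>x\<bar>) * (1 + \<bar>y\<bar>)"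
    using add_increasing2[OF mult_nonneg_nonneg[OF abs_ge_zero[of x] abs_ge_zero[of y]] abs_triangle_ineq[of x y]] by (simp add: algebra_simps)
  from power_mono[OF this, of M] show ?thesis by (simp add: power_mult_distrib)
qed

text \<open>Extracts the symbol and its x-derivatives, with the real order m rounded up to a natural
  exponent M; the same exponent serves every derivative.\<close>

lemma symbol_family:
  assumes "symbol m a"
  obtains M and F :: "nat \<Rightarrow> real \<Rightarrow> real \<Rightarrow> complex^'k^'k" and C :: "nat \<Rightarrow> real" where
    "\<And>x \<xi>. F 0 x \<xi> = a x \<xi>" "\<And>i x \<xi>. ((\<lambda>x. F i x \<xi>) has_vector_derivative F (Suc i) x \<xi>) (at x)"
    "\<And>i x \<xi>. norm (F i x \<xi>) \<le> C i * (1 + \<bar>\<xi>\<bar>) ^ M" "\<And>x. continuous_on UNIV (a x)"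
proof -
  obtain F where F: "partials_on UNIV a F" "\<And>i j. \<exists>C. \<forall>x \<xi>. norm (F i j x \<xi>) \<le> C * (1 + \<bar>\<xi>\<bar>) powr (m - real j)"
    using assms unfolding symbol_def by blast
  define M where "M = nat \<lceil>\<bar>m\<bar>\<rceil>"
  have M: "m \<le> real M" unfolding M_def by linarith
  have "\<exists>C. \<forall>x \<xi>. norm (F i 0 x \<xi>) \<le> C * (1 + \<bar>\<xi>\<bar>) ^ M" for i
  proof -
    obtain C where C: "\<And>x \<xi>. norm (F i 0 x \<xi>) \<le> C * (1 + \<bar>\<xi>\<bar>) powr (m - real 0)" using F(2) by blast
    have "norm (F i 0 x \<xi>) \<le> \<bar>C\<bar> * (1 + \<bar>\<xi>\<bar>) ^ M" for x \<xi>
    proof -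
      have "norm (F i 0 x \<xi>) \<le> \<bar>C\<bar> * (1 + \<bar>\<xi>\<bar>) powr (m - real 0)"
        by (rule order_trans[OF C]) (intro mult_right_mono, auto)
      also have "\<dots> \<le> \<bar>C\<bar> * (1 + \<bar>\<xi>\<bar>) powr real M"
        using M by (intro mult_left_mono powr_mono) auto
      also have "(1 + \<bar>\<xi>\<bar>) powr real M = (1 + \<bar>\<xi>\<bar>) ^ M" by (rule powr_realpow) (simp add: add_pos_nonneg)
      finally show ?thesis .
    qed
    then show ?thesis by blast
  qed
  then obtain C where C: "\<And>i x \<xi>. norm (F i 0 x \<xi>) \<le> C i * (1 + \<bar>\<xi>\<bar>) ^ M" by metis
  have F0: "F 0 0 x \<xi> = a x \<xi>" and Fd: "((\<lambda>x. F i 0 x \<xi>) has_vector_derivative F (Suc i) 0 x \<xi>) (at x)"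
    and Fe: "((\<lambda>\<xi>. F 0 0 x \<xi>) has_vector_derivative F 0 1 x \<xi>) (at \<xi>)" for i x \<xi>
    using F(1) unfolding partials_on_def One_nat_def by blast+
  have "continuous_on UNIV (a x)" for x
    using vector_derivative_continuous_on[OF Fe, of UNIV x] by (simp add: F0)
  with F0 Fd C show ?thesis using that[of "\<lambda>i. F i 0" C M] by blast
qed

lemma integrable_decay:
  fixes f :: "real \<Rightarrow> 'v::{banach,second_countable_topology}"
  assumes "f \<in> borel_measurable lborel" "\<And>x. norm (f x) \<le> C * (1 / (1 + \<bar>x\<bar>) ^ 2)"
  shows "integrable lborel f"
  by (rule Bochner_Integration.integrable_bound[OF integrable_mult_right[OF integrable_inverse_square, of C] assms(1)])
     (simp, intro AE_I2 order_trans[OF assms(2)], simp add: divide_right_mono)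

text \<open>The transform of the modulated section at \<xi> is that of f at \<xi> - n. After the
  substitution \<xi> = n + \<zeta> the factor \<open>cis (of_int n * x)\<close> comes out, and
  Peetre's inequality splits the growth of the symbol at n + \<zeta> into a power of 1 + |n|, which
  is the allowed loss, and a power of 1 + |\<zeta>|, which the decay of the transform
  absorbs.\<close>

lemma osc_part_ub:
  fixes a :: "real \<Rightarrow> real \<Rightarrow> complex^'k^'k"
  assumes a: "symbol m a" and f: "f \<in> Cinf" and v: "vanishing c r f" "r < pi"
  obtains M H where "ub UNIV H"
    "\<And>n x. osc (\<lambda>x \<xi>. x * \<xi>) a (lift c (\<lambda>p. ee n p *s f p)) x = (of_real ((1 + \<bar>real_of_int n\<bar>) ^ M) * cis (of_int n * x)) *s H n x"
proof -
  obtain M and F :: "nat \<Rightarrow> real \<Rightarrow> real \<Rightarrow> complex^'k^'k" and C where F: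
    "\<And>x \<xi>. F 0 x \<xi> = a x \<xi>" "\<And>i x \<xi>. ((\<lambda>x. F i x \<xi>) has_vector_derivative F (Suc i) x \<xi>) (at x)"
    "\<And>i x \<xi>. norm (F i x \<xi>) \<le> C i * (1 + \<bar>\<xi>\<bar>) ^ M" "\<And>x. continuous_on UNIV (a x)"
    using symbol_family[OF a] by metis
  define N where "N x = (1 + \<bar>x\<bar>) ^ M" for x :: real
  have N0: "N x > 0" "N x \<noteq> 0" for x by (auto simp: N_def intro: zero_less_power add_pos_nonneg)
  \<comment> \<open>The symbol at n + \<zeta>, divided by the weights of both summands; the index is
    the pair (n, \<zeta>).\<close>
  define g where "g \<alpha> x = (1 / (N (of_int (fst \<alpha>)) * N (snd \<alpha>))) *\<^sub>R F 0 x (of_int (fst \<alpha>) + snd \<alpha>)" for \<alpha> :: "int \<times> real" and x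
  have "ub UNIV g"
    unfolding g_def
  proof (rule ub_of_chain[of "\<lambda>i \<alpha> x. (1 / (N (of_int (fst \<alpha>)) * N (snd \<alpha>))) *\<^sub>R F i x (of_int (fst \<alpha>) + snd \<alpha>)"])
    show "((\<lambda>x. (1 / (N (of_int (fst \<alpha>)) * N (snd \<alpha>))) *\<^sub>R F n x (of_int (fst \<alpha>) + snd \<alpha>)) has_vector_derivative
       (1 / (N (of_int (fst \<alpha>)) * N (snd \<alpha>))) *\<^sub>R F (Suc n) t (of_int (fst \<alpha>) + snd \<alpha>)) (at t)" for n t and \<alpha> :: "int \<times> real"
      by (rule bounded_linear.has_vector_derivative[OF bounded_linear_scaleR_right F(2)])
    show "\<exists>C. \<forall>\<alpha>::int\<times>real. \<forall>t\<in>UNIV. norm ((1 / (N (of_int (fst \<alpha>)) * N (snd \<alpha>))) *\<^sub>R F n t (of_int (fst \<alpha>) + snd \<alpha>)) \<le> C" for n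
    proof (intro exI[of _ "\<bar>C n\<bar>"] allI ballI)
      fix \<alpha> :: "int \<times> real" and t
      let ?x = "of_int (fst \<alpha>) :: real" and ?y = "snd \<alpha>"
      have "norm (F n t (?x + ?y)) \<le> \<bar>C n\<bar> * (1 + \<bar>?x + ?y\<bar>) ^ M"
        by (rule order_trans[OF F(3)]) (intro mult_right_mono, auto)
      also have "\<dots> \<le> \<bar>C n\<bar> * (N ?x * N ?y)" unfolding N_def by (intro mult_left_mono peetre) auto
      finally have "(1 / (N ?x * N ?y)) * norm (F n t (?x + ?y)) \<le> (1 / (N ?x * N ?y)) * (\<bar>C n\<bar> * (N ?x * N ?y))"
        using N0(1)[of ?x] N0(1)[of ?y] by (intro mult_left_mono) auto
      also have "\<dots> = \<bar>C n\<bar>" using N0(2)[of ?x] N0(2)[of ?y] by simp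
      finally show "norm ((1 / (N ?x * N ?y)) *\<^sub>R F n t (?x + ?y)) \<le> \<bar>C n\<bar>"
        using N0(1)[of ?x] N0(1)[of ?y] by simp
    qed
  qed
  then obtain E :: "nat \<Rightarrow> int \<times> real \<Rightarrow> real \<Rightarrow> complex^'k^'k" and CE :: "nat \<Rightarrow> real" where E:
    "\<And>m t. E 0 m t = smat (cis (snd m * t)) (g m t)"
    "\<And>i m t. (E i m has_vector_derivative E (Suc i) m t) (at t)"
    "\<And>i m t. norm (E i m t) \<le> CE i * (1 + \<bar>snd m\<bar>) ^ i"
    using modulated_family[OF bb_smat smat_assoc, of g snd] by metis
  \<comment> \<open>The weight in \<zeta> is put back; the weight in n stays divided out and
    reappears in front of the integral.\<close>
  define T where "T i n \<zeta> x = N \<zeta> *\<^sub>R (E i (n, \<zeta>) x *v FT c f \<zeta>)" for i and n :: int and \<zeta> x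
  have T0: "T 0 n \<zeta> x = (1 / N (of_int n)) *\<^sub>R (cis (x * \<zeta>) *s (a x (of_int n + \<zeta>) *v FT c f \<zeta>))" for n \<zeta> x
    using N0(2)[of \<zeta>] by (simp add: T_def E g_def F smat_mult bounded_bilinear.scaleR_left[OF bb_matvec] bounded_bilinear.scaleR_right[OF bb_smult] mult.commute)
  have cT: "continuous_on UNIV (\<lambda>\<zeta>. cis (x * \<zeta>) *s (a x (of_int n + \<zeta>) *v FT c f \<zeta>))" for x and n :: int
    by (intro bounded_bilinear.continuous_on[OF bb_smult] bounded_bilinear.continuous_on[OF bb_matvec] continuous_intros FT_continuous[OF f]
        continuous_on_compose2[OF F(4)[of x]]) auto
  have Tbound: "\<exists>D. \<forall>n \<zeta> x. norm (T i n \<zeta> x) \<le> D * (1 / (1 + \<bar>\<zeta>\<bar>) ^ 2)" for i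
  proof -
    obtain Kv where Kv: "Kv > 0" "\<And>M f. norm ((M::complex^'k^'k) *v f) \<le> Kv * (norm M * norm f)" using bb_bound[OF bb_matvec[where 'k='k]] by blast
    \<comment> \<open>M powers absorb the weight in \<zeta>, i powers the derivatives of the factor
      \<open>cis (\<zeta> * x)\<close>, and two make the rest integrable.\<close>
    obtain D where D: "D \<ge> 0" "\<And>\<xi>. norm (FT c f \<xi>) \<le> D / (1 + \<bar>\<xi>\<bar>) ^ (M + i + 2)"
      by (rule FT_decay[OF f v]) (rule that)
    have "norm (T i n \<zeta> x) \<le> Kv * \<bar>CE i\<bar> * D * (1 / (1 + \<bar>\<zeta>\<bar>) ^ 2)" for n \<zeta> x
    proof -
      let ?z = "1 + \<bar>\<zeta>\<bar>"
      have z: "?z > 0" "?z \<noteq> 0" by simp_all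
      have "norm (E i (n, \<zeta>) x) \<le> \<bar>CE i\<bar> * ?z ^ i"
        using order_trans[OF E(3)[of i "(n, \<zeta>)" x] mult_right_mono[OF abs_ge_self]] by simp
      then have "norm (E i (n, \<zeta>) x) * norm (FT c f \<zeta>) \<le> (\<bar>CE i\<bar> * ?z ^ i) * (D / ?z ^ (M + i + 2))"
        by (intro mult_mono D(2)) auto
      then have "norm (E i (n, \<zeta>) x *v FT c f \<zeta>) \<le> Kv * ((\<bar>CE i\<bar> * ?z ^ i) * (D / ?z ^ (M + i + 2)))"
        using Kv(1) by (intro order_trans[OF Kv(2)] mult_left_mono) auto
      then have "?z ^ M * norm (E i (n, \<zeta>) x *v FT c f \<zeta>) \<le> ?z ^ M * (Kv * ((\<bar>CE i\<bar> * ?z ^ i) * (D / ?z ^ (M + i + 2))))"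
        by (intro mult_left_mono) auto
      also have "\<dots> = Kv * \<bar>CE i\<bar> * D * (?z ^ M * ?z ^ i / ?z ^ (M + i + 2))" by simp
      also have "?z ^ M * ?z ^ i / ?z ^ (M + i + 2) = 1 / ?z ^ 2"
        unfolding power_add using z(2) by (simp del: power_Suc)
      finally show ?thesis by (simp add: T_def N_def)
    qed
    then show ?thesis by blast
  qed
  have Tm: "(\<lambda>\<zeta>. T 0 n \<zeta> x) \<in> borel_measurable lborel" for n x
    unfolding T0 using borel_measurable_continuous_onI[OF cT] by simp
  have Tu: "ub UNIV (\<lambda>n x. LINT \<zeta>|lborel. T 0 n \<zeta> x)"
  proof (rule ub_integral[where E = T])
    show "(\<lambda>\<zeta>. T 0 n \<zeta> x) \<in> borel_measurable lborel" for n x by (rule Tm)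
    show "(T i n \<zeta> has_vector_derivative T (Suc i) n \<zeta> x) (at x)" for i n \<zeta> x
      unfolding T_def
      by (rule bounded_linear.has_vector_derivative[OF bounded_linear_scaleR_right],
          rule bounded_linear.has_vector_derivative[OF bounded_bilinear.bounded_linear_left[OF bb_matvec] E(2)])
    fix i
    obtain D where "\<And>n \<zeta> x. norm (T i n \<zeta> x) \<le> D * (1 / (1 + \<bar>\<zeta>\<bar>) ^ 2)" using Tbound by blast
    then show "\<exists>W. integrable lborel W \<and> (\<forall>n \<zeta> x. norm (T i n \<zeta> x) \<le> W \<zeta>)"
      using integrable_mult_right[OF integrable_inverse_square, of D] by blast
  qed
  define H where "H n x = (1 / (2*pi)) *\<^sub>R (LINT \<zeta>|lborel. T 0 n \<zeta> x)" for n x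
  have Hu: "ub UNIV H" unfolding H_def by (intro ub_scaleR ub_const' Tu)
  have "osc (\<lambda>x \<xi>. x * \<xi>) a (lift c (\<lambda>p. ee n p *s f p)) x = (of_real ((1 + \<bar>real_of_int n\<bar>) ^ M) * cis (of_int n * x)) *s H n x" for n x
  proof -
    have ef: "(\<lambda>p. ee n p *s f p) \<in> Cinf" "vanishing c r (\<lambda>p. ee n p *s f p)"
      using v by (auto simp: vanishing_def intro: Cinf_smult ee_Cinf f)
    have "(LBINT \<xi>. cis (x * \<xi>) *s (a x \<xi> *v fourier (lift c (\<lambda>p. ee n p *s f p)) \<xi>)) =
       (LBINT \<xi>. cis (x * \<xi>) *s (a x \<xi> *v FT c f (\<xi> - of_int n)))"
      by (simp only: fourier_lift[OF ef v(2)] FT_modulate)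
    also have "\<dots> = (LBINT \<zeta>. cis (x * (of_int n + 1 * \<zeta>)) *s (a x (of_int n + 1 * \<zeta>) *v FT c f (of_int n + 1 * \<zeta> - of_int n)))"
      by (subst lborel_integral_real_affine[where c = 1 and t = "of_int n"]) simp_all
    also have "\<dots> = (LBINT \<zeta>. (of_real (N (of_int n)) * cis (of_int n * x)) *s T 0 n \<zeta> x)"
      by (rule Bochner_Integration.integral_cong[OF refl])
         (use N0(2)[of "of_int n"] in \<open>simp add: T0 vec_eq_iff scaleR_conv_of_real[where 'a=complex] cis_mult algebra_simps flip: cis_mult\<close>)
    also have "\<dots> = (of_real (N (of_int n)) * cis (of_int n * x)) *s (LBINT \<zeta>. T 0 n \<zeta> x)"
    proof (rule integral_bounded_linear[OF bounded_bilinear.bounded_linear_right[OF bb_smult]])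
      obtain D where "\<And>n \<zeta> x. norm (T 0 n \<zeta> x) \<le> D * (1 / (1 + \<bar>\<zeta>\<bar>) ^ 2)" using Tbound by blast
      then show "integrable lborel (\<lambda>\<zeta>. T 0 n \<zeta> x)" by (rule integrable_decay[OF Tm])
    qed
    finally show ?thesis by (simp add: osc_def H_def N_def bounded_bilinear.scaleR_right[OF bb_smult])
  qed
  with Hu show ?thesis using that by blast
qed

lemma inverse_le_of_le_mult: "A \<le> B * N \<Longrightarrow> A > 0 \<Longrightarrow> B > 0 \<Longrightarrow> 1 / B \<le> N / A" for A B N :: real
  by (simp add: divide_simps mult.commute)

text \<open>The sum over n has to be exchanged with the integral over \<xi>, although the n-th term
  is concentrated near \<xi> = n. Peetre's inequality trades decay around n for decay around 0, at a
  polynomial cost in n that the rapidly decreasing cf pays.\<close>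

lemma osc_part_ser:
  fixes a :: "real \<Rightarrow> real \<Rightarrow> complex^'k^'k"
  assumes a: "symbol m a" and f: "f \<in> Cinf" and v: "vanishing c r f" "r < pi" and cf: "rapid cf"
  shows "osc (\<lambda>x \<xi>. x * \<xi>) a (lift c (\<lambda>p. ser cf p *s f p)) x
      = lsum (\<lambda>n. cf n *s osc (\<lambda>x \<xi>. x * \<xi>) a (lift c (\<lambda>p. ee n p *s f p)) x)"
proof -
  obtain M and F :: "nat \<Rightarrow> real \<Rightarrow> real \<Rightarrow> complex^'k^'k" and C where F:
    "\<And>x \<xi>. F 0 x \<xi> = a x \<xi>" "\<And>i x \<xi>. ((\<lambda>x. F i x \<xi>) has_vector_derivative F (Suc i) x \<xi>) (at x)"
    "\<And>i x \<xi>. norm (F i x \<xi>) \<le> C i * (1 + \<bar>\<xi>\<bar>) ^ M" "\<And>x. continuous_on UNIV (a x)"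
    using symbol_family[OF a] by metis
  have sC: "(\<lambda>p. ser cf p *s f p) \<in> Cinf" and eC: "(\<lambda>p. ee n p *s f p) \<in> Cinf" for n
    by (intro Cinf_smult ee_Cinf ser_Cinf f cf)+
  have sV: "vanishing c r (\<lambda>p. ser cf p *s f p)" and eV: "vanishing c r (\<lambda>p. ee n p *s f p)" for n
    using v(1) by (auto simp: vanishing_def)
  have FTs: "FT c (\<lambda>p. ser cf p *s f p) \<xi> = lsum (\<lambda>n. cf n *s FT c f (\<xi> - of_int n))" for \<xi>
  proof -
    obtain B where B: "B > 0" "\<And>p. norm (f p) \<le> B" using Cinf_bounded[OF f] by blast
    have "FT c (\<lambda>p. ser cf p *s f p) \<xi> = integral {c - pi..c + pi} (\<lambda>y. lsum (\<lambda>n. cf n *s (cis (- (y * \<xi>)) *s (ee n (circ y) *s f (circ y)))))"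
      unfolding FT_def
    proof (rule integral_cong)
      fix y
      have as: "asum (\<lambda>n. cf n * ee n (circ y))"
        by (rule asum_bound[OF rapid_asum(1)[OF cf]]) (simp add: norm_mult)
      have "cis (- (y * \<xi>)) *s (ser cf (circ y) *s f (circ y)) = lsum (\<lambda>n. cf n * ee n (circ y)) *s (cis (- (y * \<xi>)) *s f (circ y))"
        by (simp only: ser_def smult_assoc mult.commute)
      also have "\<dots> = lsum (\<lambda>n. (cf n * ee n (circ y)) *s (cis (- (y * \<xi>)) *s f (circ y)))"
        by (rule lsum_smult[OF as, symmetric])
      finally show "cis (- (y * \<xi>)) *s (ser cf (circ y) *s f (circ y)) = lsum (\<lambda>n. cf n *s (cis (- (y * \<xi>)) *s (ee n (circ y) *s f (circ y))))"
        by (simp only: smult_assoc mult_ac)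
    qed
    also have "\<dots> = lsum (\<lambda>n. integral {c - pi..c + pi} (\<lambda>y. cf n *s (cis (- (y * \<xi>)) *s (ee n (circ y) *s f (circ y)))))"
    proof (rule integral_lsum(1)[where w = "\<lambda>n. norm (cf n) * B"])
      show "continuous_on UNIV (\<lambda>y. cf n *s (cis (- (y * \<xi>)) *s (ee n (circ y) *s f (circ y))))" for n
        by (rule bounded_bilinear.continuous_on[OF bb_smult continuous_on_const continuous_FT_integrand[OF eC]])
      show "norm (cf n *s (cis (- (y * \<xi>)) *s (ee n (circ y) *s f (circ y)))) \<le> norm (cf n) * B" for n y
        using B(2)[of "circ y"] by (simp add: norm_smult norm_mult mult_left_mono)
    qed (intro integrable_mult_left rapid_asum(1) cf)
    also have "\<dots> = lsum (\<lambda>n. cf n *s FT c (\<lambda>p. ee n p *s f p) \<xi>)"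
      unfolding FT_def
      by (rule Bochner_Integration.integral_cong[OF refl],
          rule integral_linear[OF _ bounded_bilinear.bounded_linear_right[OF bb_smult], unfolded o_def],
          rule integrable_continuous_interval[OF continuous_FT_integrand[OF eC]])
    finally show ?thesis by (simp only: FT_modulate)
  qed
  obtain Kv where Kv: "Kv > 0" "\<And>M f. norm ((M::complex^'k^'k) *v f) \<le> Kv * (norm M * norm f)" using bb_bound[OF bb_matvec[where 'k='k]] by blast
  obtain D where D: "D \<ge> 0" "\<And>\<xi>. norm (FT c f \<xi>) \<le> D / (1 + \<bar>\<xi>\<bar>) ^ (M + 2)"
    by (rule FT_decay[OF f v]) (rule that)
  define T where "T n \<xi> = cis (x * \<xi>) *s (a x \<xi> *v (cf n *s FT c f (\<xi> - of_int n)))" for n \<xi>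
  have shift: "norm (FT c f (\<xi> - of_int n)) \<le> D * (1 + \<bar>real_of_int n\<bar>) ^ (M + 2) / (1 + \<bar>\<xi>\<bar>) ^ (M + 2)" for \<xi> n
  proof -
    have "(1 + \<bar>\<xi>\<bar>) ^ (M + 2) \<le> (1 + \<bar>\<xi> - of_int n\<bar>) ^ (M + 2) * (1 + \<bar>real_of_int n\<bar>) ^ (M + 2)"
      using peetre[of "\<xi> - of_int n" "of_int n" "M + 2"] by simp
    then have "1 / (1 + \<bar>\<xi> - of_int n\<bar>) ^ (M + 2) \<le> (1 + \<bar>real_of_int n\<bar>) ^ (M + 2) / (1 + \<bar>\<xi>\<bar>) ^ (M + 2)"
      by (rule inverse_le_of_le_mult) (auto intro: zero_less_power add_pos_nonneg)
    from mult_left_mono[OF this D(1)] show ?thesis using D(2)[of "\<xi> - of_int n"] by simp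
  qed
  define W where "W n = Kv * (C 0 * (norm (cf n) * (D * (1 + \<bar>real_of_int n\<bar>) ^ (M + 2))))" for n
  have C0: "C 0 \<ge> 0" using order_trans[OF norm_ge_zero F(3)[of 0 0 0]] by simp
  have Tb: "norm (T n \<xi>) \<le> W n * (1 / (1 + \<bar>\<xi>\<bar>) ^ 2)" for n \<xi>
  proof -
    let ?z = "1 + \<bar>\<xi>\<bar>"
    have z: "?z \<noteq> 0" by simp
    have "norm (T n \<xi>) \<le> Kv * (norm (a x \<xi>) * (norm (cf n) * norm (FT c f (\<xi> - of_int n))))"
      using Kv(2)[of "a x \<xi>" "cf n *s FT c f (\<xi> - of_int n)"] by (simp add: T_def norm_smult)
    also have "\<dots> \<le> Kv * ((C 0 * ?z ^ M) * (norm (cf n) * (D * (1 + \<bar>real_of_int n\<bar>) ^ (M + 2) / ?z ^ (M + 2))))"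
      using Kv(1) F(3)[of 0 x \<xi>] C0 D(1) by (intro mult_left_mono mult_mono shift) (auto simp: F)
    also have "\<dots> = W n * (?z ^ M / ?z ^ (M + 2))" by (simp add: W_def)
    also have "?z ^ M / ?z ^ (M + 2) = 1 / ?z ^ 2"
      unfolding power_add using z by (simp del: power_Suc)
    finally show ?thesis .
  qed
  have Tm: "T n \<in> borel_measurable lborel" for n
  proof -
    have "continuous_on UNIV (T n)" unfolding T_def
      by (intro bounded_bilinear.continuous_on[OF bb_smult] bounded_bilinear.continuous_on[OF bb_matvec] continuous_intros F(4)
        continuous_on_compose2[OF FT_continuous[OF f]]) auto
    then show ?thesis using borel_measurable_continuous_onI by simp
  qed
  have "rapid (\<lambda>n. complex_of_real (W n))"
    by (rule rapid_poly[OF cf, where K = "Kv * C 0 * D" and M = "M + 2"])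
       (use Kv C0 D in \<open>simp add: W_def norm_mult norm_power mult_ac del: of_real_add of_real_power\<close>)
  moreover have "W n \<ge> 0" for n using Kv(1) C0 D(1) by (simp add: W_def)
  ultimately have Ws: "asum W" using rapid_asum(1) by fastforce
  note sw = lsum_swap_bound[OF _ Tm Tb Ws integrable_inverse_square]
  have "(LBINT \<xi>. cis (x * \<xi>) *s (a x \<xi> *v fourier (lift c (\<lambda>p. ser cf p *s f p)) \<xi>)) = (LBINT \<xi>. lsum (\<lambda>n. T n \<xi>))"
  proof (rule Bochner_Integration.integral_cong[OF refl])
    fix \<xi>
    have as: "asum (\<lambda>n. cf n *s FT c f (\<xi> - of_int n))"
    proof (rule rapid_asum(2), rule rapid_poly[OF cf, where K = D and M = 0])
      fix n
      have "D / (1 + \<bar>\<xi> - of_int n\<bar>) ^ (M + 2) \<le> D / 1"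
        using D(1) by (intro divide_left_mono one_le_power mult_pos_pos zero_less_power) (auto intro: add_pos_nonneg)
      then have "norm (FT c f (\<xi> - of_int n)) \<le> D" using D(2)[of "\<xi> - of_int n"] by simp
      from mult_left_mono[OF this, of "norm (cf n)"]
      show "norm (cf n *s FT c f (\<xi> - of_int n)) \<le> D * (1 + \<bar>real_of_int n\<bar>) ^ 0 * norm (cf n)"
        by (simp add: norm_smult mult.commute)
    qed
    have bl: "bounded_linear (\<lambda>u. cis (x * \<xi>) *s (a x \<xi> *v u))"
      by (rule bounded_linear_compose[OF bounded_bilinear.bounded_linear_right[OF bb_smult] bounded_bilinear.bounded_linear_right[OF bb_matvec]])
    show "cis (x * \<xi>) *s (a x \<xi> *v fourier (lift c (\<lambda>p. ser cf p *s f p)) \<xi>) = lsum (\<lambda>n. T n \<xi>)"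
      unfolding fourier_lift[OF sC sV v(2)] FTs T_def by (rule integral_bounded_linear[OF bl as, symmetric])
  qed
  also have "\<dots> = lsum (\<lambda>n. LBINT \<xi>. T n \<xi>)" by (rule sw(1)) (rule lborel.sigma_finite_measure_axioms)
  also have "\<dots> = lsum (\<lambda>n. cf n *s (LBINT \<xi>. cis (x * \<xi>) *s (a x \<xi> *v fourier (lift c (\<lambda>p. ee n p *s f p)) \<xi>)))"
  proof (rule Bochner_Integration.integral_cong[OF refl])
    fix n
    show "(LBINT \<xi>. T n \<xi>) = cf n *s (LBINT \<xi>. cis (x * \<xi>) *s (a x \<xi> *v fourier (lift c (\<lambda>p. ee n p *s f p)) \<xi>))"
    \<comment> \<open>Integrability is known for \<open>T n\<close>, which contains the factor cf n;
      so the scalar is moved by dividing, and the value 0 is treated apart.\<close>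
    proof (cases "cf n = 0")
      case False
      have eq: "cis (x * \<xi>) *s (a x \<xi> *v fourier (lift c (\<lambda>p. ee n p *s f p)) \<xi>) = (1 / cf n) *s T n \<xi>" for \<xi>
        using False by (simp add: fourier_lift[OF eC eV v(2)] FT_modulate T_def matvec_smult smult_assoc)
      have "(LBINT \<xi>. (1 / cf n) *s T n \<xi>) = (1 / cf n) *s (LBINT \<xi>. T n \<xi>)"
        by (rule integral_bounded_linear[OF bounded_bilinear.bounded_linear_right[OF bb_smult] sw(3)]) (rule lborel.sigma_finite_measure_axioms)
      then show ?thesis unfolding eq using False by (simp add: smult_assoc)
    qed (simp add: T_def)
  qed
  finally have main: "(LBINT \<xi>. cis (x * \<xi>) *s (a x \<xi> *v fourier (lift c (\<lambda>p. ser cf p *s f p)) \<xi>)) = 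
    lsum (\<lambda>n. cf n *s (LBINT \<xi>. cis (x * \<xi>) *s (a x \<xi> *v fourier (lift c (\<lambda>p. ee n p *s f p)) \<xi>)))" .
  show ?thesis unfolding osc_def main
    by (simp add: bounded_bilinear.scaleR_right[OF bb_smult])
qed

lemma periodic_integral_shift:
  fixes f :: "real \<Rightarrow> 'v::euclidean_space"
  assumes c: "continuous_on UNIV f" and p: "\<And>t. f (t + 2*pi) = f t"
  shows "integral {0..2*pi} (\<lambda>z. f (x + z)) = integral {0..2*pi} f"
proof -
  obtain \<Phi> where \<Phi>: "\<And>t. (\<Phi> has_vector_derivative f t) (at t)" using global_antiderivative[OF c] by blast
  have "((\<lambda>z. \<Phi> (x + z)) has_vector_derivative f (x + z)) (at z)" for z
  proof -
    have "((\<Phi> \<circ> (\<lambda>z. x + z)) has_vector_derivative 1 *\<^sub>R f (x + z)) (at z)"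
      by (rule vector_diff_chain_at) (auto intro!: derivative_eq_intros \<Phi>)
    then show ?thesis by (simp add: o_def)
  qed
  then have "integral {0..2*pi} (\<lambda>z. f (x + z)) = \<Phi> (x + 2*pi) - \<Phi> (x + 0)"
    by (intro integral_unique fundamental_theorem_of_calculus) (auto intro: has_vector_derivative_at_within)
  also have "\<dots> = integral {x..x + 2*pi} f"
    by (rule sym, rule integral_unique, simp, rule fundamental_theorem_of_calculus) (auto intro: has_vector_derivative_at_within \<Phi>)
  finally show ?thesis using periodic_integral[OF c p] by simp
qed

text \<open>Substituting y = x + z and using periodicity moves the oscillation in x out of the
  integral. No power of n is lost, since the x-derivatives of the shifted kernel are bounded
  uniformly in z.\<close>

lemma kernel_part_ub:
  fixes K :: "circle \<Rightarrow> circle \<Rightarrow> complex^'k^'k"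
  assumes K: "smooth_kernel K" and w: "w \<in> Cinf"
  obtains H where "ub UNIV H"
    "\<And>n x. kernel_op K (\<lambda>p. ee n p *s w p) (circ x) = cis (of_int n * x) *s H (n::int) x"
proof -
  define \<kappa> where "\<kappa> z x = K (circ x) (circ (x + z)) *v w (circ (x + z))" for z x
  have wz: "ub UNIV (\<lambda>z x. w (circ (x + z)))"
    by (rule ub_comp[where F = "\<lambda>z x. w (circ x)" and G = "\<lambda>z x. x + z" and T' = UNIV, OF _ ub_const'[of UNIV 1]])
       (auto intro!: derivative_eq_intros simp: Cinf_ub[symmetric] w)
  have \<kappa>u: "ub UNIV \<kappa>" unfolding \<kappa>_def by (rule ub_bilinear[OF bb_matvec smooth_kernel_shift_ub[OF K] wz])
  let ?M = "restrict_space lborel {0..2*pi}"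
  have shift: "continuous_on UNIV (\<lambda>z. h (x + z))" if "continuous_on UNIV h" for h :: "real \<Rightarrow> 'w::topological_space" and x :: real
    by (rule continuous_on_compose2[OF that]) (auto intro: continuous_intros)
  have \<kappa>c: "continuous_on A (\<lambda>z. cis (of_int n * z) *s \<kappa> z x)" for A n x
    unfolding \<kappa>_def
    by (rule continuous_on_subset[OF _ subset_UNIV])
       (intro bounded_bilinear.continuous_on[OF bb_smult] bounded_bilinear.continuous_on[OF bb_matvec] continuous_intros
         shift[OF smooth_kernel_continuous(2)[OF K]] shift[OF Cinf_continuous[OF w]])
  define H where "H n x = (LINT z|?M. cis (of_int n * z) *s \<kappa> z x)" for n :: int and x
  have "ub UNIV (\<lambda>n x. LINT z|?M. (\<lambda>i n z x. cis (of_int n * z) *s (dv ^^ i) \<kappa> z x) 0 (n::int) z x)"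
  proof (rule ub_integral)
    show "(\<lambda>z. cis (of_int n * z) *s (dv ^^ 0) \<kappa> z x) \<in> borel_measurable ?M" for n :: int and x
      unfolding funpow_0 by (rule borel_measurable_integrable[OF integral_restrict(2)[OF \<kappa>c]])
    show "((\<lambda>x. cis (of_int n * z) *s (dv ^^ i) \<kappa> z x) has_vector_derivative cis (of_int n * z) *s (dv ^^ Suc i) \<kappa> z x) (at x)" for i and n :: int and z x
      by (rule bounded_linear.has_vector_derivative[OF bounded_bilinear.bounded_linear_right[OF bb_smult] ub_chain(1)[OF \<kappa>u]])
    fix i
    obtain C where C: "C > 0" "\<And>z x. x \<in> UNIV \<Longrightarrow> norm ((dv ^^ i) \<kappa> z x) \<le> C" using ub_boundE[OF ub_chain(2)[OF \<kappa>u, of i]] by blast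
    have "integrable ?M (\<lambda>_. C)" by (rule integral_restrict(2)) simp
    then show "\<exists>W. integrable ?M W \<and> (\<forall>(n::int) z x. norm (cis (of_int n * z) *s (dv ^^ i) \<kappa> z x) \<le> W z)"
      using C(2) by (intro exI[of _ "\<lambda>_. C"]) (simp add: norm_smult)
  qed
  then have "ub UNIV H" by (simp add: H_def[abs_def])
  moreover have "kernel_op K (\<lambda>p. ee n p *s w p) (circ x) = cis (of_int n * x) *s H n x" for n x
  proof -
    let ?f = "\<lambda>y. K (circ x) (circ y) *v (ee n (circ y) *s w (circ y))"
    have fc: "continuous_on UNIV ?f"
      by (intro bounded_bilinear.continuous_on[OF bb_matvec] smooth_kernel_continuous(2)[OF K] Cinf_continuous Cinf_smult ee_Cinf w)
    have "kernel_op K (\<lambda>p. ee n p *s w p) (circ x) = integral {0..2*pi} (\<lambda>z. ?f (x + z))"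
      unfolding kernel_op_def by (rule periodic_integral_shift[OF fc, symmetric]) (simp only: circ_2pi)
    also have "\<dots> = integral {0..2*pi} (\<lambda>z. cis (of_int n * x) *s (cis (of_int n * z) *s \<kappa> z x))"
      by (rule integral_cong) (simp add: \<kappa>_def matvec_smult smult_assoc cis_mult distrib_left)
    also have "\<dots> = cis (of_int n * x) *s integral {0..2*pi} (\<lambda>z. cis (of_int n * z) *s \<kappa> z x)"
      by (rule integral_linear[OF _ bounded_bilinear.bounded_linear_right[OF bb_smult], unfolded o_def])
         (rule integrable_continuous_interval[OF \<kappa>c])
    finally show ?thesis by (simp add: H_def integral_restrict(1)[OF \<kappa>c])
  qed
  ultimately show ?thesis using that by blast
qed

lemma kernel_part_ser:
  fixes K :: "circle \<Rightarrow> circle \<Rightarrow> complex^'k^'k"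
  assumes K: "smooth_kernel K" and w: "w \<in> Cinf" and cf: "rapid cf"
  shows "kernel_op K (\<lambda>p. ser cf p *s w p) p = lsum (\<lambda>n. cf n *s kernel_op K (\<lambda>p. ee n p *s w p) p)"
proof -
  have Kw: "continuous_on UNIV (\<lambda>t. K p (circ t) *v w (circ t))"
    by (intro bounded_bilinear.continuous_on[OF bb_matvec] smooth_kernel_continuous(2)[OF K] Cinf_continuous w)
  obtain B where B: "\<And>t. norm (K p (circ t) *v w (circ t)) \<le> B"
    using periodic_bounded[OF _ Kw] by auto
  have "kernel_op K (\<lambda>p. ser cf p *s w p) p = integral {0..2*pi} (\<lambda>t. lsum (\<lambda>n. (cf n * ee n (circ t)) *s (K p (circ t) *v w (circ t))))"
    unfolding kernel_op_def
  proof (rule integral_cong)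
    fix t
    have as: "asum (\<lambda>n. cf n * ee n (circ t))"
      by (rule asum_bound[OF rapid_asum(1)[OF cf]]) (simp add: norm_mult)
    show "K p (circ t) *v (ser cf (circ t) *s w (circ t)) = lsum (\<lambda>n. (cf n * ee n (circ t)) *s (K p (circ t) *v w (circ t)))"
      unfolding lsum_smult[OF as] matvec_smult ser_def ..
  qed
  also have "\<dots> = lsum (\<lambda>n. integral {0..2*pi} (\<lambda>t. (cf n * ee n (circ t)) *s (K p (circ t) *v w (circ t))))"
  proof (rule integral_lsum(1)[where w = "\<lambda>n. norm (cf n) * B"])
    show "continuous_on UNIV (\<lambda>t. (cf n * ee n (circ t)) *s (K p (circ t) *v w (circ t)))" for n
      by (intro bounded_bilinear.continuous_on[OF bb_smult] continuous_intros Cinf_continuous ee_Cinf Kw)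
    show "norm ((cf n * ee n (circ t)) *s (K p (circ t) *v w (circ t))) \<le> norm (cf n) * B" for n t
      using B[of t] by (simp add: norm_smult norm_mult mult_left_mono)
  qed (intro integrable_mult_left rapid_asum(1) cf)
  also have "\<dots> = lsum (\<lambda>n. cf n *s kernel_op K (\<lambda>p. ee n p *s w p) p)"
  proof (rule Bochner_Integration.integral_cong[OF refl])
    fix n
    have i: "(\<lambda>t. K p (circ t) *v (ee n (circ t) *s w (circ t))) integrable_on {0..2*pi}"
      by (rule integrable_continuous_interval, rule continuous_on_subset[OF _ subset_UNIV],
          intro bounded_bilinear.continuous_on[OF bb_matvec] smooth_kernel_continuous(2)[OF K] Cinf_continuous Cinf_smult ee_Cinf w)
    have "integral {0..2*pi} (\<lambda>t. (cf n * ee n (circ t)) *s (K p (circ t) *v w (circ t)))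
       = integral {0..2*pi} (\<lambda>t. cf n *s (K p (circ t) *v (ee n (circ t) *s w (circ t))))"
      by (simp only: matvec_smult smult_assoc)
    also have "\<dots> = cf n *s kernel_op K (\<lambda>p. ee n p *s w p) p"
      unfolding kernel_op_def by (rule integral_linear[OF i bounded_bilinear.bounded_linear_right[OF bb_smult], unfolded o_def])
    finally show "integral {0..2*pi} (\<lambda>t. (cf n * ee n (circ t)) *s (K p (circ t) *v w (circ t))) = cf n *s kernel_op K (\<lambda>p. ee n p *s w p) p" .
  qed
  finally show ?thesis .
qed

lemma kernel_part_asum:
  fixes K :: "circle \<Rightarrow> circle \<Rightarrow> complex^'k^'k"
  assumes K: "smooth_kernel K" and w: "w \<in> Cinf" and cf: "rapid cf"
  shows "asum (\<lambda>n. cf n *s kernel_op K (\<lambda>p. ee n p *s w p) p)"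
proof -
  obtain H where H: "ub UNIV H" "\<And>n x. kernel_op K (\<lambda>p. ee n p *s w p) (circ x) = cis (of_int n * x) *s H (n::int) x"
    by (rule kernel_part_ub[OF K w]) (rule that)
  obtain C where C: "C > 0" "\<And>n t. t \<in> UNIV \<Longrightarrow> norm (H n t) \<le> C" using ub_boundE[OF H(1)] by blast
  obtain x where p: "p = circ x" by (rule circ_surj)
  show ?thesis
  proof (rule rapid_asum(2), rule rapid_poly[OF cf, where K = C and M = 0])
    fix n
    have "norm (kernel_op K (\<lambda>p. ee n p *s w p) p) \<le> C" using C(2)[of x n] unfolding p H(2) by (simp add: norm_smult)
    from mult_left_mono[OF this, of "norm (cf n)"]
    show "norm (cf n *s kernel_op K (\<lambda>p. ee n p *s w p) p) \<le> C * (1 + \<bar>real_of_int n\<bar>) ^ 0 * norm (cf n)"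
      by (simp add: norm_smult mult.commute)
  qed
qed

lemma osc_part_asum:
  fixes a :: "real \<Rightarrow> real \<Rightarrow> complex^'k^'k"
  assumes a: "symbol m a" and f: "f \<in> Cinf" and v: "vanishing c r f" "r < pi" and cf: "rapid cf"
  shows "asum (\<lambda>n. cf n *s osc (\<lambda>x \<xi>. x * \<xi>) a (lift c (\<lambda>p. ee n p *s f p)) x)"
proof -
  obtain M and H :: "int \<Rightarrow> real \<Rightarrow> complex^'k" where H: "ub UNIV H"
    "\<And>n x. osc (\<lambda>x \<xi>. x * \<xi>) a (lift c (\<lambda>p. ee n p *s f p)) x = (of_real ((1 + \<bar>real_of_int n\<bar>) ^ M) * cis (of_int n * x)) *s H n x"
    by (rule osc_part_ub[OF a f v]) (rule that)
  obtain C where C: "C > 0" "\<And>n t. t \<in> UNIV \<Longrightarrow> norm (H n t) \<le> C" using ub_boundE[OF H(1)] by blast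
  show ?thesis
  proof (rule rapid_asum(2), rule rapid_poly[OF cf, where K = C and M = M])
    fix n
    have "norm (osc (\<lambda>x \<xi>. x * \<xi>) a (lift c (\<lambda>p. ee n p *s f p)) x) \<le> (1 + \<bar>real_of_int n\<bar>) ^ M * C"
      unfolding H(2) by (simp add: norm_smult norm_mult norm_power C mult_left_mono del: of_real_add of_real_power)
    from mult_left_mono[OF this, of "norm (cf n)"]
    show "norm (cf n *s osc (\<lambda>x \<xi>. x * \<xi>) a (lift c (\<lambda>p. ee n p *s f p)) x) \<le> C * (1 + \<bar>real_of_int n\<bar>) ^ M * norm (cf n)"
      by (simp add: norm_smult mult_ac)
  qed
qed

text \<open>On the open arc |x - c| < pi the piece is the sum of an oscillatory and a kernel part,
  both estimated above. The missing point is reached by smoothness and periodicity for the first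
  condition, and by the vanishing of \<eta> for the second.\<close>

lemma ampl_localized:
  fixes B :: "(circle \<Rightarrow> complex^'k) \<Rightarrow> circle \<Rightarrow> complex^'k"
  assumes lin: "linear_op B" and r: "0 < r" "r < pi" and cut: "cutoff c r \<eta>" "cutoff c r \<psi>"
    and rep: "osc_rep m (\<lambda>x \<xi>. x * \<xi>) c pi c \<eta> \<psi> B"
  shows "ampl (\<lambda>x. x) (\<lambda>f p. \<eta> p *s B (\<lambda>q. \<psi> q *s f q) p)"
proof -
  obtain a K where a: "symbol m a" and K: "smooth_kernel K" and eq:
    "\<And>f x. f \<in> Cinf \<Longrightarrow> \<bar>x - c\<bar> < pi \<Longrightarrow> \<eta> (circ x) *s B (\<lambda>p. \<psi> p *s f p) (circ x)
          = osc (\<lambda>x \<xi>. x * \<xi>) a (lift c (\<lambda>p. \<psi> p *s f p)) x + kernel_op K f (circ x)"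
    using rep unfolding osc_rep_def by blast
  have \<eta>: "\<eta> \<in> Cinf" and \<psi>: "\<psi> \<in> Cinf" using cut by (auto simp: cutoff_def)
  have \<eta>0: "\<eta> (circ (c + pi)) = 0" using cut(1) r unfolding cutoff_def by auto
  let ?P = "\<lambda>f p. \<eta> p *s B (\<lambda>q. \<psi> q *s f q) p"
  have PC: "?P f \<in> Cinf" if "f \<in> Cinf" for f by (intro Cinf_smult \<eta> linear_op_Cinf[OF lin] \<psi> that)
  have comm: "(\<lambda>p. \<psi> p *s (s p *s w p)) = (\<lambda>p. s p *s (\<psi> p *s w p))" for s :: "circle \<Rightarrow> complex" and w :: "circle \<Rightarrow> complex^'k"
    by (simp add: smult_assoc mult.commute)
  have ew: "(\<lambda>p. ee n p *s w p) \<in> Cinf" if "w \<in> Cinf" for n and w :: "circle \<Rightarrow> complex^'k" by (intro Cinf_smult ee_Cinf that)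
  have \<psi>w: "(\<lambda>p. \<psi> p *s w p) \<in> Cinf" "vanishing c r (\<lambda>p. \<psi> p *s w p)" if "w \<in> Cinf" for w :: "circle \<Rightarrow> complex^'k"
    using cut(2) by (auto simp: vanishing_def cutoff_def intro: Cinf_smult that)
  have E: "?P (\<lambda>p. s p *s w p) (circ x) = osc (\<lambda>x \<xi>. x * \<xi>) a (lift c (\<lambda>p. s p *s (\<psi> p *s w p))) x + kernel_op K (\<lambda>p. s p *s w p) (circ x)"
    if "(\<lambda>p. s p *s w p) \<in> Cinf" "\<bar>x - c\<bar> < pi" for s w x
    using eq[OF that] by (simp only: comm)
  show ?thesis unfolding ampl_def
  proof (intro conjI ballI allI impI)
    fix w :: "circle \<Rightarrow> complex^'k" assume w: "w \<in> Cinf"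
    obtain M and H1 :: "int \<Rightarrow> real \<Rightarrow> complex^'k" where H1: "ub UNIV H1"
      "\<And>n x. osc (\<lambda>x \<xi>. x * \<xi>) a (lift c (\<lambda>p. ee n p *s (\<psi> p *s w p))) x = (of_real ((1 + \<bar>real_of_int n\<bar>) ^ M) * cis (of_int n * x)) *s H1 n x"
      by (rule osc_part_ub[OF a \<psi>w[OF w] r(2)]) (rule that)
    obtain H2 where H2: "ub UNIV H2" "\<And>n x. kernel_op K (\<lambda>p. ee n p *s w p) (circ x) = cis (of_int n * x) *s H2 (n::int) x"
      by (rule kernel_part_ub[OF K w]) (rule that)
    \<comment> \<open>The kernel part comes without a power of 1 + |n|; in the common normalization
      it acquires the bounded factor d n.\<close>
    define d where "d n = 1 / (1 + \<bar>real_of_int n\<bar>) ^ M" for n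
    have d: "norm (d n) \<le> 1" "(1 + \<bar>real_of_int n\<bar>) ^ M * d n = 1" for n
      by (auto simp: d_def divide_simps one_le_power)
    \<comment> \<open>The amplitude is the known smooth section divided by its expected leading
      factor. This makes it smooth and periodic from the outset, and the chart representation then
      supplies the uniform bounds.\<close>
    define H where "H n x = (of_real (d n) * cis (- (of_int n * x))) *s ?P (\<lambda>p. ee n p *s w p) (circ x)" for n x
    have Pe: "?P (\<lambda>p. ee n p *s w p) (circ t) = (of_real ((1 + \<bar>real_of_int n\<bar>) ^ M) * cis (of_int n * t)) *s H n t" for n t
    proof -
      have "of_real ((1 + \<bar>real_of_int n\<bar>) ^ M) * cis (of_int n * t) * (of_real (d n) * cis (- (of_int n * t))) =
         of_real ((1 + \<bar>real_of_int n\<bar>) ^ M * d n) * (cis (of_int n * t) * cis (- (of_int n * t)))" by (simp add: mult_ac)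
      also have "\<dots> = 1" by (simp only: d(2) cis_mult) simp
      finally show ?thesis unfolding H_def
        by (simp only: smult_assoc[where v = "?P (\<lambda>p. ee n p *s w p) (circ t)"]) (simp only: vec.scale_one)
    qed
    have "ub UNIV H"
    proof (rule ub_extend[where c = c and H' = "\<lambda>n x. H1 n x + d n *\<^sub>R H2 n x"])
      show "ub {} H" unfolding ub_smooth_iff
      proof
        fix n
        have 1: "ub {} (\<lambda>_::unit. \<lambda>x. of_real (d n) * cis (- (of_int n * x)))"
          using smooth_curve_cis_mult[of "- of_int n"] by (intro ub_mult ub_const') (simp add: smooth_curve_ub)
        have 2: "ub {} (\<lambda>_::unit. \<lambda>x. ?P (\<lambda>p. ee n p *s w p) (circ x))"
          using PC[OF ew[OF w, of n]] by (simp add: Cinf_def smooth_curve_ub)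
        show "smooth_curve (H n)" using ub_smult[OF 1 2] by (simp add: smooth_curve_ub H_def[abs_def])
      qed
      show "H n (t + 2*pi) = H n t" for n t
      proof -
        have "cis (- (of_int n * (t + 2*pi))) = cis (- (of_int n * t))"
          using cis_2pi_int[of "- (of_int n * t)" "- n"] by (simp add: algebra_simps)
        then show ?thesis unfolding H_def circ_2pi by simp
      qed
      show "ub UNIV (\<lambda>n x. H1 n x + d n *\<^sub>R H2 n x)"
        by (intro ub_add ub_scaleR H1(1) H2(1) ub_const[where C=1]) (use d in auto)
      show "H n x = H1 n x + d n *\<^sub>R H2 n x" if x: "\<bar>x - c\<bar> < pi" for n x
      proof -
        have z: "of_real (d n) * cis (- (of_int n * x)) * (of_real ((1 + \<bar>real_of_int n\<bar>) ^ M) * cis (of_int n * x)) = 1"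
        proof -
          have "of_real (d n) * cis (- (of_int n * x)) * (of_real ((1 + \<bar>real_of_int n\<bar>) ^ M) * cis (of_int n * x)) =
            of_real ((1 + \<bar>real_of_int n\<bar>) ^ M * d n) * (cis (of_int n * x) * cis (- (of_int n * x)))" by (simp add: mult_ac)
          then show ?thesis by (simp only: d(2) cis_mult) simp
        qed
        have z2: "of_real (d n) * cis (- (of_int n * x)) * cis (of_int n * x) = complex_of_real (d n)"
          by (simp add: mult.assoc cis_mult)
        have sr: "complex_of_real y *s v = y *\<^sub>R v" for y and v :: "complex^'k"
          by (simp add: vec_eq_iff scaleR_conv_of_real[where 'a=complex])
        have Px: "?P (\<lambda>p. ee n p *s w p) (circ x) = (of_real ((1 + \<bar>real_of_int n\<bar>) ^ M) * cis (of_int n * x)) *s H1 n x + cis (of_int n * x) *s H2 n x"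
          using eq[OF ew[OF w] x] by (simp only: comm H1(2) H2(2))
        show ?thesis unfolding H_def Px
          unfolding vec.scale_right_distrib smult_assoc z z2 sr by simp
      qed
    qed
    then show "\<exists>M H. ub UNIV H \<and> (\<forall>n t. ?P (\<lambda>p. ee n p *s w p) (circ t) = (of_real ((1 + \<bar>real_of_int n\<bar>) ^ M) * cis (of_int n * t)) *s H n t)"
      using Pe by blast
  next
    fix w :: "circle \<Rightarrow> complex^'k" and cf :: "int \<Rightarrow> complex" and p
    assume w: "w \<in> Cinf" and cf: "rapid cf"
    obtain x where x: "c - pi \<le> x" "x < c - pi + 2*pi" "p = circ x" by (rule circ_window)
    show "?P (\<lambda>p. ser cf p *s w p) p = lsum (\<lambda>n. cf n *s ?P (\<lambda>p. ee n p *s w p) p)"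
    proof (cases "x = c - pi")
      \<comment> \<open>This is the point opposite to c, where \<eta> vanishes and both sides are
        0.\<close>
      case True
      then show ?thesis using \<eta>0 by (simp add: x(3) circ_minus_pi)
    next
      case False
      then have xc: "\<bar>x - c\<bar> < pi" using x by (auto simp: abs_less_iff)
      have "?P (\<lambda>p. ser cf p *s w p) p = lsum (\<lambda>n. cf n *s osc (\<lambda>x \<xi>. x * \<xi>) a (lift c (\<lambda>p. ee n p *s (\<psi> p *s w p))) x)
          + lsum (\<lambda>n. cf n *s kernel_op K (\<lambda>p. ee n p *s w p) (circ x))"
        unfolding x(3) E[OF Cinf_smult[OF ser_Cinf[OF cf] w] xc] osc_part_ser[OF a \<psi>w[OF w] r(2) cf] kernel_part_ser[OF K w cf] ..
      also have "\<dots> = lsum (\<lambda>n. cf n *s osc (\<lambda>x \<xi>. x * \<xi>) a (lift c (\<lambda>p. ee n p *s (\<psi> p *s w p))) x + cf n *s kernel_op K (\<lambda>p. ee n p *s w p) (circ x))"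
        by (rule Bochner_Integration.integral_add[symmetric, OF osc_part_asum[OF a \<psi>w[OF w] r(2) cf] kernel_part_asum[OF K w cf]])
      also have "\<dots> = lsum (\<lambda>n. cf n *s ?P (\<lambda>p. ee n p *s w p) p)"
        unfolding x(3) E[OF ew[OF w] xc] vec.scale_right_distrib ..
      finally show ?thesis .
    qed
  qed
qed

text \<open>Inserting the partition of unity on both sides makes B the sum of nine pieces; the two
  cutoffs of each piece fit into one arc, over which a chart representation of B is
  available.\<close>

theorem PDO_amp:
  assumes "B \<in> PDO"
  shows "amp (\<lambda>x. x) B"
proof -
  obtain m where lin: "linear_op B" and m: "\<And>c r \<eta> \<psi>. 0 < r \<Longrightarrow> r < pi \<Longrightarrow> cutoff c r \<eta> \<Longrightarrow> cutoff c r \<psi> \<Longrightarrow>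
      osc_rep m (\<lambda>x \<xi>. x * \<xi>) c pi c \<eta> \<psi> B"
    using assms unfolding PDO_def by blast
  have 1: "ampl (\<lambda>x. x) (\<lambda>f p. \<Sum>j<3. \<Sum>k<3. pou j p *s B (\<lambda>q. pou k q *s f q) p)"
  proof (intro ampl_sum)
    fix j k :: nat assume "j \<in> {..<3}" "k \<in> {..<3}"
    then obtain c where c: "cutoff c (5*pi/6) (pou j)" "cutoff c (5*pi/6) (pou k)" using pou_pair by auto
    show "ampl (\<lambda>x. x) (\<lambda>f p. pou j p *s B (\<lambda>q. pou k q *s f q) p)"
      by (rule ampl_localized[OF lin _ _ c m[OF _ _ c]]) auto
  qed auto
  have 2: "(\<lambda>p. \<Sum>j<3. \<Sum>k<3. pou j p *s B (\<lambda>q. pou k q *s f q) p) = B f" if f: "f \<in> Cinf" for f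
  proof
    fix p
    have "B f = B (\<lambda>p. \<Sum>k<3. pou k p *s f p)" by (simp add: vec.scale_sum_left[symmetric] pou_sum)
    also have "\<dots> = (\<lambda>p. \<Sum>k<3. B (\<lambda>q. pou k q *s f q) p)"
      by (rule linear_op_sum[OF lin]) (auto intro: Cinf_smult pou_Cinf f)
    finally have Bf: "B f p = (\<Sum>k<3. B (\<lambda>q. pou k q *s f q) p)" by simp
    have "(\<Sum>j<3. \<Sum>k<3. pou j p *s B (\<lambda>q. pou k q *s f q) p) = (\<Sum>j<3. pou j p *s B f p)"
      by (simp only: Bf vec.scale_sum_right)
    also have "\<dots> = B f p" by (simp only: vec.scale_sum_left[symmetric] pou_sum vec.scale_one)
    finally show "(\<Sum>j<3. \<Sum>k<3. pou j p *s B (\<lambda>q. pou k q *s f q) p) = B f p" .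
  qed
  show ?thesis unfolding amp_iff by (intro conjI lin ampl_cong[OF 2 1])
qed

text \<open>Evaluation at \<open>circ (G t)\<close> turns the phase n * t into n * G t; the
  amplitude stays uniformly controlled because G' and its derivatives are bounded.\<close>

lemma amp_comp:
  fixes B :: "(circle \<Rightarrow> complex^'k) \<Rightarrow> circle \<Rightarrow> complex^'k"
  assumes B: "amp (\<lambda>x. x) B" and A: "linear_op A" "\<And>f. f \<in> Cinf \<Longrightarrow> A f = B f \<circ> g"
    and G: "\<And>t. (G has_vector_derivative G' t) (at t)" "ub UNIV (\<lambda>_::int. G')" "\<And>t. g (circ t) = circ (G t)"
  shows "amp G A"
  unfolding amp_def
proof (intro conjI ballI allI impI A(1))
  fix w :: "circle \<Rightarrow> complex^'k" assume w: "w \<in> Cinf"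
  have ew: "(\<lambda>p. ee n p *s w p) \<in> Cinf" for n by (intro Cinf_smult ee_Cinf w)
  obtain M and H :: "int \<Rightarrow> real \<Rightarrow> complex^'k" where H: "ub UNIV H"
    "\<And>n t. B (\<lambda>p. ee n p *s w p) (circ t) = (of_real ((1 + \<bar>real_of_int n\<bar>) ^ M) * cis (of_int n * t)) *s H n t"
    using B w unfolding amp_def by blast
  have "ub UNIV (\<lambda>n t. H n (G t))"
    by (rule ub_comp[where G = "\<lambda>_. G", OF G(1,2) _ H(1)]) simp
  then show "\<exists>M H. ub UNIV H \<and> (\<forall>n t. A (\<lambda>p. ee n p *s w p) (circ t) = (of_real ((1 + \<bar>real_of_int n\<bar>) ^ M) * cis (of_int n * G t)) *s H n t)"
    by (intro exI[of _ M] exI[of _ "\<lambda>n t. H n (G t)"]) (simp only: A(2)[OF ew] o_apply G(3) H(2) simp_thms)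
next
  fix w :: "circle \<Rightarrow> complex^'k" and c :: "int \<Rightarrow> complex" and p
  assume w: "w \<in> Cinf" and c: "rapid c"
  have ew: "(\<lambda>p. ee n p *s w p) \<in> Cinf" for n by (intro Cinf_smult ee_Cinf w)
  have sw: "(\<lambda>p. ser c p *s w p) \<in> Cinf" by (intro Cinf_smult ser_Cinf w c)
  show "A (\<lambda>p. ser c p *s w p) p = lsum (\<lambda>n. c n *s A (\<lambda>p. ee n p *s w p) p)"
    using B w c unfolding amp_def by (simp add: A(2)[OF ew] A(2)[OF sw])
qed

section \<open>Composition with diffeomorphisms\<close>

text \<open>The quantity in the definition of \<open>Diff_plus\<close>; it will be the derivative of
  a lift of h to the line.\<close>

definition speed :: "(circle \<Rightarrow> circle) \<Rightarrow> circle \<Rightarrow> real" where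
  "speed h p = Im (cnj (Rep_circle (h p)) * ddt (\<lambda>q. Rep_circle (h q)) p)"

lemma speed_Cinf:
  assumes h: "(\<lambda>p. Rep_circle (h p)) \<in> Cinf"
  shows "speed h \<in> Cinf"
  unfolding speed_def[abs_def]
  by (rule Cinf_linear[OF bounded_linear_Im], rule Cinf_bilinear[OF bounded_bilinear_mult],
      rule Cinf_linear[OF bounded_linear_cnj h], rule Cinf_ddt[OF h])

text \<open>For a curve z of modulus 1 the product of z' with the conjugate of z is purely
  imaginary, so z' = i * speed * z. An antiderivative G0 of the speed then makes z * cis (- G0)
  constant, and the argument of this constant corrects G0 to a lift.\<close>

lemma circle_lift:
  assumes h: "(\<lambda>p. Rep_circle (h p)) \<in> Cinf"
  obtains G where "\<And>t. (G has_vector_derivative speed h (circ t)) (at t)" "\<And>t. h (circ t) = circ (G t)"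
proof -
  define z where "z t = Rep_circle (h (circ t))" for t
  define z' where "z' t = ddt (\<lambda>q. Rep_circle (h q)) (circ t)" for t
  have dz: "(z has_vector_derivative z' t) (at t)" for t
    using Cinf_deriv[OF h] by (simp add: z_def[abs_def] z'_def)
  have zz: "cnj (z t) * z t = 1" for t
    using complex_norm_square[of "z t"] by (simp add: z_def mult.commute)
  have "((\<lambda>t. cnj (z t) * z t) has_vector_derivative cnj (z t) * z' t + cnj (z' t) * z t) (at t)" for t
    by (rule bounded_bilinear.has_vector_derivative[OF bounded_bilinear_mult bounded_linear.has_vector_derivative[OF bounded_linear_cnj dz] dz])
  then have "((\<lambda>t. 1 :: complex) has_vector_derivative cnj (z t) * z' t + cnj (z' t) * z t) (at t)" for t
    by (simp only: zz)
  then have "cnj (z t) * z' t + cnj (z' t) * z t = 0" for t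
    using vector_derivative_unique_at[OF _ has_vector_derivative_const] by blast
  then have r0: "Re (cnj (z t) * z' t + cnj (z' t) * z t) = 0" for t by simp
  have re: "Re (cnj (z t) * z' t) = 0" for t using r0[of t] by (simp add: mult.commute)
  have cz: "cnj (z t) * z' t = \<i> * of_real (speed h (circ t))" for t
    using re[of t] by (simp add: complex_eq_iff speed_def z_def z'_def)
  have z': "z' t = \<i> * of_real (speed h (circ t)) * z t" for t
  proof -
    have "z' t = (cnj (z t) * z t) * z' t" by (simp add: zz)
    also have "\<dots> = (cnj (z t) * z' t) * z t" by (simp add: mult_ac)
    finally show ?thesis by (simp only: cz)
  qed
  obtain G0 where G0: "\<And>t. (G0 has_vector_derivative speed h (circ t)) (at t)"
    using global_antiderivative[OF Cinf_continuous[OF speed_Cinf[OF h]]] by blast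
  have G0': "(G0 has_real_derivative speed h (circ t)) (at t)" for t
    using G0 by (simp add: has_real_derivative_iff_has_vector_derivative)
  have dc: "((\<lambda>t. cis (- G0 t)) has_vector_derivative - (\<i> * of_real (speed h (circ t)) * cis (- G0 t))) (at t)" for t
    using G0[of t] unfolding has_vector_derivative_def
    by (auto intro!: derivative_eq_intros simp: scaleR_conv_of_real mult_ac)
  have d0: "((\<lambda>t. z t * cis (- G0 t)) has_vector_derivative 0) (at t within UNIV)" for t
    using bounded_bilinear.has_vector_derivative[OF bounded_bilinear_mult dz dc, of t] by (simp add: z' mult_ac)
  obtain k where k: "\<And>t. z t * cis (- G0 t) = k"
    by (rule has_vector_derivative_zero_constant[OF convex_UNIV d0]) simp
  have "norm k = 1" using k[of 0] by (metis norm_cis norm_mult norm_Rep z_def mult_1)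
  then have kc: "cis (Arg k) = k" using cis_Arg[of k] by (cases "k = 0") (auto simp: sgn_div_norm)
  have "h (circ t) = circ (G0 t + Arg k)" for t
  proof -
    have "cis (G0 t + Arg k) = cis (G0 t) * k" by (simp only: cis_mult[symmetric] kc)
    also have "\<dots> = cis (G0 t) * (z t * cis (- G0 t))" by (simp only: k)
    also have "\<dots> = z t * (cis (- G0 t) * cis (G0 t))" by (simp only: mult_ac)
    finally have "cis (G0 t + Arg k) = z t * (cis (- G0 t) * cis (G0 t))" .
    then have "cis (G0 t + Arg k) = z t" by (simp add: cis_mult)
    then show ?thesis by (simp add: circ_def z_def Rep_circle_inverse)
  qed
  moreover have "((\<lambda>t. G0 t + Arg k) has_vector_derivative speed h (circ t)) (at t)" for t
    using has_vector_derivative_add[OF G0 has_vector_derivative_const] by simp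
  ultimately show ?thesis using that by blast
qed

lemma speed_ub: "(\<lambda>p. Rep_circle (h p)) \<in> Cinf \<Longrightarrow> ub UNIV (\<lambda>_::'b. \<lambda>t. speed h (circ t))"
  using Cinf_ub[of "speed h"] speed_Cinf by blast

lemma Cinf_comp:
  assumes h: "(\<lambda>p. Rep_circle (h p)) \<in> Cinf" and f: "f \<in> Cinf"
  shows "f \<circ> h \<in> Cinf"
proof -
  obtain G where G: "\<And>t. (G has_vector_derivative speed h (circ t)) (at t)" "\<And>t. h (circ t) = circ (G t)"
    by (rule circle_lift[OF h]) (rule that)
  have "ub UNIV (\<lambda>_::unit. \<lambda>t. f (circ (G t)))"
    by (rule ub_comp[where G = "\<lambda>_. G" and F = "\<lambda>_ t. f (circ t)" and T' = UNIV, OF G(1) speed_ub[OF h]])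
       (auto simp: Cinf_ub[symmetric] f)
  then show ?thesis by (simp add: Cinf_ub[where 'b = unit] G(2))
qed

text \<open>Compactness turns positivity of the speed into a lower bound. The bounds on G' are given
  for two index types, since callers combine it with differently indexed families. G itself is
  periodic up to full turns.\<close>

lemma Diff_plus_lift:
  assumes g: "g \<in> Diff_plus"
  obtains G G' c where "\<And>t. (G has_vector_derivative G' t) (at t)" "ub UNIV (\<lambda>_::'b. G')" "ub UNIV (\<lambda>_::'a. G')"
    "c > 0" "\<And>t. G' t \<ge> c" "\<And>t. G' (t + 2*pi) = G' t" "\<And>t. g (circ t) = circ (G t)"
    "\<And>t. circ (G (t + 2*pi)) = circ (G t)"
proof -
  have gC: "(\<lambda>p. Rep_circle (g p)) \<in> Cinf" and pos: "\<And>p. speed g p > 0"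
    using g by (auto simp: Diff_plus_def Diff_def speed_def)
  obtain G where G: "\<And>t. (G has_vector_derivative speed g (circ t)) (at t)" "\<And>t. g (circ t) = circ (G t)"
    by (rule circle_lift[OF gC]) (rule that)
  have cont: "continuous_on {0..2*pi} (\<lambda>t. speed g (circ t))" by (rule Cinf_continuous[OF speed_Cinf[OF gC]])
  obtain s where s: "s \<in> {0..2*pi}" "\<And>t. t \<in> {0..2*pi} \<Longrightarrow> speed g (circ s) \<le> speed g (circ t)"
    using continuous_attains_inf[OF compact_Icc _ cont] by fastforce
  have ge: "speed g p \<ge> speed g (circ s)" for p
  proof -
    obtain t where "0 \<le> t" "t < 0 + 2*pi" "p = circ t" by (rule circ_window)
    then show ?thesis using s(2)[of t] by auto
  qed
  have "circ (G (t + 2*pi)) = circ (G t)" for t using G(2)[of "t + 2*pi"] G(2)[of t] by simp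
  then show ?thesis
    by (intro that[of G "\<lambda>t. speed g (circ t)" "speed g (circ s)"] G speed_ub[OF gC] pos ge) simp_all
qed

text \<open>The coefficients of the chain rule of higher order: P i l multiplies the l-th
  x-derivative of a in the i-th x-derivative of a (G x) y, and P (Suc i) l = (P i l)' + G' * P i (l
  - 1).\<close>

lemma partials_comp:
  fixes a :: "real \<Rightarrow> real \<Rightarrow> 'v::real_normed_vector"
  assumes F: "partials_on UNIV a F" and G: "\<And>t. (G has_vector_derivative G' t) (at t)" "ub UNIV (\<lambda>_::nat. G')"
  obtains P :: "nat \<Rightarrow> nat \<Rightarrow> real \<Rightarrow> real" where "\<And>i. ub UNIV (P i)"
    "partials_on UNIV (\<lambda>x y. a (G x) y) (\<lambda>i j x y. \<Sum>l\<le>i. P i l x *\<^sub>R F l j (G x) y)"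
proof -
  \<comment> \<open>The conditional suppresses the second summand at l = 0, where truncated
    subtraction would give l - 1 = 0.\<close>
  define step where "step Q = (\<lambda>l x. dv Q l x + (if l = 0 then 0 else 1) * (G' x * Q (l - 1) x))" for Q :: "nat \<Rightarrow> real \<Rightarrow> real"
  define P where "P i = (step ^^ i) (\<lambda>l x. if l = 0 then 1 else 0)" for i
  have PS: "P (Suc i) = step (P i)" for i by (simp add: P_def)
  have Pu: "ub UNIV (P i)" for i
  proof (induction i)
    case 0
    have "ub UNIV (\<lambda>(l::nat) (x::real). if l = 0 then 1 else 0::real)"
      by (rule ub_const[where c = "\<lambda>l. if l = 0 then 1 else 0" and C = 1]) simp
    then show ?case by (simp add: P_def)
  next
    case (Suc i)
    show ?case unfolding PS step_def
      by (intro ub_add ub_mult ub_dv Suc G(2) ub_reindex[OF Suc] ub_const[where C = 1]) simp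
  qed
  \<comment> \<open>Coefficients with l > i vanish, so that extending the sum to l = i + 1
    introduces no derivative of P.\<close>
  have P0: "P i l = (\<lambda>x. 0)" if "l > i" for i l
    using that
  proof (induction i arbitrary: l)
    case 0 then show ?case by (simp add: P_def)
  next
    case (Suc i)
    have "dv (P i) l x = 0" for x using Suc.IH[of l] Suc.prems by (simp add: dv_def)
    moreover have "P i (l - 1) = (\<lambda>x. 0)" using Suc.IH[of "l - 1"] Suc.prems by simp
    ultimately show ?case by (simp add: PS step_def)
  qed
  have F0: "F 0 0 x y = a x y" and Fc: "continuous_on UNIV (\<lambda>(x, y). F i j x y)"
    and Fx: "((\<lambda>s. F i j s y) has_vector_derivative F (Suc i) j x y) (at x)"
    and Fy: "((\<lambda>s. F i j x s) has_vector_derivative F i (Suc j) x y) (at y)" for i j x y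
    using F unfolding partials_on_def by auto
  have Gc: "continuous_on A G" for A by (rule vector_derivative_continuous_on[OF G(1)])
  let ?F = "\<lambda>i j x y. \<Sum>l\<le>i. P i l x *\<^sub>R F l j (G x) y"
  have "partials_on UNIV (\<lambda>x y. a (G x) y) ?F"
    unfolding partials_on_def
  proof (intro conjI allI ballI)
    fix z show "case z of (x, y) \<Rightarrow> ?F 0 0 x y = a (G x) y" by (auto simp: P_def F0)
  next
    fix i j
    have 1: "continuous_on UNIV (\<lambda>z. P i l (fst z))" for l
      by (rule continuous_on_compose2[OF ub_continuous[OF Pu, of UNIV]]) (auto intro: continuous_intros)
    have "continuous_on UNIV (\<lambda>z. G (fst z))" 
      by (rule continuous_on_compose2[OF Gc[of UNIV]]) (auto intro: continuous_intros)
    then have "continuous_on UNIV (\<lambda>z. (G (fst z), snd z))" by (intro continuous_on_Pair continuous_intros)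
    from continuous_on_compose2[OF Fc this] have 2: "continuous_on UNIV (\<lambda>z. F l j (G (fst z)) (snd z))" for l by auto
    show "continuous_on UNIV (\<lambda>(x, y). ?F i j x y)"
      unfolding case_prod_unfold by (intro continuous_on_sum continuous_on_scaleR 1 2)
  next
    fix i j and z :: "real \<times> real"
    obtain x y where z: "z = (x, y)" by (cases z)
    have Fg: "((\<lambda>s. F l j (G s) y) has_vector_derivative G' x *\<^sub>R F (Suc l) j (G x) y) (at x)" for l
      using vector_diff_chain_at[OF G(1) Fx] by (simp add: o_def)
    have "((\<lambda>s. ?F i j s y) has_vector_derivative (\<Sum>l\<le>i. P i l x *\<^sub>R (G' x *\<^sub>R F (Suc l) j (G x) y) + dv (P i) l x *\<^sub>R F l j (G x) y)) (at x)"
      by (intro has_vector_derivative_sum bounded_bilinear.has_vector_derivative[OF bounded_bilinear_scaleR ub_deriv[OF Pu] Fg])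
    moreover have "(\<Sum>l\<le>i. P i l x *\<^sub>R (G' x *\<^sub>R F (Suc l) j (G x) y) + dv (P i) l x *\<^sub>R F l j (G x) y) = ?F (Suc i) j x y"
    proof -
      have "dv (P i) (Suc i) x = 0" using P0[of i "Suc i"] by (simp add: dv_def)
      then have "?F (Suc i) j x y = (\<Sum>l\<le>i. dv (P i) l x *\<^sub>R F l j (G x) y) + (\<Sum>l\<le>Suc i. ((if l = 0 then 0 else 1) * (G' x * P i (l - 1) x)) *\<^sub>R F l j (G x) y)"
        by (simp add: PS step_def scaleR_add_left sum.distrib)
      also have "(\<Sum>l\<le>Suc i. ((if l = 0 then 0 else 1) * (G' x * P i (l - 1) x)) *\<^sub>R F l j (G x) y) = (\<Sum>l\<le>i. P i l x *\<^sub>R (G' x *\<^sub>R F (Suc l) j (G x) y))"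
        by (subst sum.atMost_Suc_shift) (simp add: mult.commute)
      finally show ?thesis by (simp add: sum.distrib)
    qed
    moreover have "((\<lambda>s. ?F i j x s) has_vector_derivative ?F i (Suc j) x y) (at y)"
      by (intro has_vector_derivative_sum bounded_linear.has_vector_derivative[OF bounded_linear_scaleR_right Fy])
    ultimately show "case z of (x, y) \<Rightarrow> ((\<lambda>s. ?F i j s y) has_vector_derivative ?F (Suc i) j x y) (at x) \<and>
        ((\<lambda>s. ?F i j x s) has_vector_derivative ?F i (Suc j) x y) (at y)" by (simp add: z)
  qed
  with Pu show ?thesis using that by blast
qed

lemma smooth_kernel_comp:
  assumes K: "smooth_kernel K" and h: "(\<lambda>p. Rep_circle (h p)) \<in> Cinf"
  shows "smooth_kernel (\<lambda>p q. K (h p) q)"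
proof -
  obtain G where G: "\<And>t. (G has_vector_derivative speed h (circ t)) (at t)" "\<And>t. h (circ t) = circ (G t)"
    by (rule circle_lift[OF h]) (rule that)
  obtain F where F: "partials_on UNIV (\<lambda>x y. K (circ x) (circ y)) F" using K unfolding smooth_kernel_def by blast
  obtain P where "partials_on UNIV (\<lambda>x y. K (circ (G x)) (circ y)) (\<lambda>i j x y. \<Sum>l\<le>i. P i l x *\<^sub>R F l j (G x) y)"
    by (rule partials_comp[OF F G(1) speed_ub[OF h]]) (rule that)
  then show ?thesis unfolding smooth_kernel_def G(2) by blast
qed

lemma symbol_comp:
  assumes a: "symbol m a" and G: "\<And>t. (G has_vector_derivative G' t) (at t)" "ub UNIV (\<lambda>_::nat. G')"
  shows "symbol m (\<lambda>x \<xi>. a (G x) \<xi>)"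
proof -
  obtain F where F: "partials_on UNIV a F" "\<And>i j. \<exists>C. \<forall>x \<xi>. norm (F i j x \<xi>) \<le> C * (1 + \<bar>\<xi>\<bar>) powr (m - real j)"
    using a unfolding symbol_def by blast
  obtain P :: "nat \<Rightarrow> nat \<Rightarrow> real \<Rightarrow> real" where P: "\<And>i. ub UNIV (P i)"
    "partials_on UNIV (\<lambda>x y. a (G x) y) (\<lambda>i j x y. \<Sum>l\<le>i. P i l x *\<^sub>R F l j (G x) y)"
    by (rule partials_comp[OF F(1) G]) (rule that)
  have "\<exists>C. \<forall>x \<xi>. norm (\<Sum>l\<le>i. P i l x *\<^sub>R F l j (G x) \<xi>) \<le> C * (1 + \<bar>\<xi>\<bar>) powr (m - real j)" for i j
  proof -
    obtain D where D: "D > 0" "\<And>l x. x \<in> UNIV \<Longrightarrow> norm (P i l x) \<le> D" using ub_boundE[OF P(1)] by blast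
    obtain C where C: "\<And>l x \<xi>. norm (F l j x \<xi>) \<le> C l * (1 + \<bar>\<xi>\<bar>) powr (m - real j)" using F(2)[of _ j] by metis
    have "norm (\<Sum>l\<le>i. P i l x *\<^sub>R F l j (G x) \<xi>) \<le> (\<Sum>l\<le>i. D * C l) * (1 + \<bar>\<xi>\<bar>) powr (m - real j)" for x \<xi>
    proof -
      have "norm (\<Sum>l\<le>i. P i l x *\<^sub>R F l j (G x) \<xi>) \<le> (\<Sum>l\<le>i. D * (C l * (1 + \<bar>\<xi>\<bar>) powr (m - real j)))"
      proof (rule sum_norm_le)
        fix l
        show "norm (P i l x *\<^sub>R F l j (G x) \<xi>) \<le> D * (C l * (1 + \<bar>\<xi>\<bar>) powr (m - real j))"
          using mult_mono[OF D(2)[of x l] C[of l "G x" \<xi>]] D(1) by simp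
      qed
      then show ?thesis by (simp add: sum_distrib_right mult.assoc)
    qed
    then show ?thesis by blast
  qed
  with P(2) show ?thesis unfolding symbol_def by blast
qed

text \<open>The constant b leaves room for the choice of an angle of the source point. The mixed
  second derivative is G', whence the nondegeneracy.\<close>

lemma phase_on_lift:
  assumes G: "\<And>t. (G has_vector_derivative G' t) (at t)" "ub UNIV (\<lambda>_::unit. G')" and nz: "\<And>t. G' t \<noteq> 0"
  shows "phase_on I (\<lambda>x \<xi>. (G x - b) * \<xi>)"
proof -
  define Gi where "Gi i x = (case i of 0 \<Rightarrow> G x - b | Suc i \<Rightarrow> (dv ^^ i) (\<lambda>_::unit. G') () x)" for i x
  have dGi: "(Gi i has_vector_derivative Gi (Suc i) x) (at x)" for i x
  proof (cases i)
    case 0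
    have "((\<lambda>x. G x - b) has_vector_derivative G' x - 0) (at x)"
      by (intro has_vector_derivative_diff G(1) has_vector_derivative_const)
    then show ?thesis by (simp add: 0 Gi_def[abs_def])
  next
    case (Suc j)
    then show ?thesis using ub_chain(1)[OF G(2), where \<alpha> = "()"] by (simp add: Gi_def[abs_def])
  qed
  define X where "X j \<xi> = (if j = 0 then \<xi> else if j = 1 then 1 else 0::real)" for j :: nat and \<xi> :: real
  have dX: "(X j has_vector_derivative X (Suc j) \<xi>) (at \<xi>)" for j \<xi>
  proof -
    consider "j = 0" | "j = 1" | "j \<ge> 2" by linarith
    then show ?thesis by cases (auto simp: X_def[abs_def] intro!: derivative_eq_intros)
  qed
  define F where "F i j x \<xi> = Gi i x * X j \<xi>" for i j x \<xi>
  have "partials_on (I \<times> - {0}) (\<lambda>x \<xi>. (G x - b) * \<xi>) F"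
    unfolding partials_on_def
  proof (intro conjI allI ballI)
    fix z show "case z of (x, y) \<Rightarrow> F 0 0 x y = (G x - b) * y" by (auto simp: F_def Gi_def X_def)
  next
    fix i j
    have "continuous_on (I \<times> - {0}) (\<lambda>z. Gi i (fst z))" "continuous_on (I \<times> - {0}) (\<lambda>z. X j (snd z))"
      by (rule continuous_on_compose2[OF vector_derivative_continuous_on[OF dGi, of UNIV]]
               continuous_on_compose2[OF vector_derivative_continuous_on[OF dX, of UNIV]]; auto intro: continuous_intros)+
    then show "continuous_on (I \<times> - {0}) (\<lambda>(x, y). F i j x y)"
      unfolding F_def case_prod_unfold by (intro continuous_on_mult)
  next
    fix i j and z :: "real \<times> real"
    obtain x y where z: "z = (x, y)" by (cases z)
    have "((\<lambda>s. F i j s y) has_vector_derivative F (Suc i) j x y) (at x)" unfolding F_def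
      by (rule bounded_linear.has_vector_derivative[OF bounded_linear_mult_left dGi])
    moreover have "((\<lambda>s. F i j x s) has_vector_derivative F i (Suc j) x y) (at y)" unfolding F_def
      by (rule bounded_linear.has_vector_derivative[OF bounded_linear_mult_right dX])
    ultimately show "case z of (x, y) \<Rightarrow> ((\<lambda>s. F i j s y) has_vector_derivative F (Suc i) j x y) (at x) \<and>
        ((\<lambda>s. F i j x s) has_vector_derivative F i (Suc j) x y) (at y)" by (simp add: z)
  qed
  moreover have "F 1 1 x \<xi> \<noteq> 0" for x \<xi> using nz by (simp add: F_def Gi_def X_def)
  ultimately show ?thesis unfolding phase_on_def by (intro conjI exI[of _ F]) (simp_all add: mult.left_commute)
qed

lemma fourier_shift:
  fixes u v :: "real \<Rightarrow> complex^'k"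
  assumes "\<And>y. u y = v (y - b)"
  shows "fourier u \<xi> = cis (- (b * \<xi>)) *s fourier v \<xi>"
proof -
  have "fourier u \<xi> = (LBINT y. cis (- ((b + 1 * y) * \<xi>)) *s u (b + 1 * y))"
    unfolding fourier_def by (subst lborel_integral_real_affine[where c = 1 and t = b]) simp_all
  also have "\<dots> = (LBINT y. cis (- (b * \<xi>)) *s (cis (- (y * \<xi>)) *s v y))"
    by (rule Bochner_Integration.integral_cong[OF refl]) (simp add: assms smult_assoc cis_mult algebra_simps)
  also have "\<dots> = cis (- (b * \<xi>)) *s fourier v \<xi>"
    unfolding fourier_def
    \<comment> \<open>The scalar is invertible, so it moves out of the integral even where the
      integrand is not integrable.\<close>
    by (rule integral_bounded_linear'[OF bounded_bilinear.bounded_linear_right[OF bb_smult]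
          bounded_bilinear.bounded_linear_right[OF bb_smult, of "cis (b * \<xi>)"]]) (simp add: smult_assoc cis_mult)
  finally show ?thesis .
qed

text \<open>The same section is cut open at two places. Its support lies within r < pi/2 of the
  angle d + 2*pi*k, which is within pi/2 of c, so neither cut meets the support and the two lifts
  differ by a translation.\<close>

lemma lift_shift:
  fixes u :: "circle \<Rightarrow> complex^'k"
  assumes v: "vanishing d r u" and r: "r < pi/2" and c: "\<bar>d + 2*pi * of_int k - c\<bar> \<le> pi/2"
  shows "lift c u y = lift d u (y - 2*pi * of_int k)"
proof -
  let ?d = "d + 2*pi * of_int k"
  have ck: "circ (y - 2*pi * of_int k) = circ y" for y using circ_2pi_int[of y "- k"] by simp
  have v': "u (circ t) = 0" if "?d + r < t" "t < ?d + 2*pi - r" for t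
  proof -
    have "d + r < t - 2*pi * of_int k \<and> t - 2*pi * of_int k < d + 2*pi - r" using that by auto
    then have "u (circ (t - 2*pi * of_int k)) = 0" using v unfolding vanishing_def by blast
    then show ?thesis by (simp only: ck)
  qed
  show ?thesis
  proof (cases "\<bar>y - c\<bar> < pi \<longleftrightarrow> \<bar>y - ?d\<bar> < pi")
    case True
    then show ?thesis by (simp add: lift_def ck diff_diff_eq add.commute)
  next
    case False
    have "u (circ y) = 0"
    proof (cases "y \<ge> ?d")
      case True
      then show ?thesis using False r c by (intro v') (auto simp: abs_if split: if_splits)
    next
      case F: False
      have "u (circ (y + 2*pi)) = 0" using False F r c by (intro v') (auto simp: abs_if split: if_splits)
      then show ?thesis by simp
    qed
    then show ?thesis by (simp add: lift_def ck)
  qed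
qed

text \<open>A chart of A near the target angle c and the source angle d comes from a chart of B
  containing both G c and a suitable angle of the source point. The target cutoff is transported by
  the inverse of g, and the symbol, the kernel and the phase are pulled back along G.\<close>

theorem PDO_comp_FIO:
  fixes B :: "(circle \<Rightarrow> complex^'k) \<Rightarrow> circle \<Rightarrow> complex^'k"
  assumes B: "B \<in> PDO" and g: "g \<in> Diff_plus" and A: "\<And>f. f \<in> Cinf \<Longrightarrow> A f = B f \<circ> g"
  shows "linear_op A" "A \<in> FIO"
proof -
  obtain m where lin: "linear_op B" and m: "\<And>c r \<eta> \<psi>. 0 < r \<Longrightarrow> r < pi \<Longrightarrow> cutoff c r \<eta> \<Longrightarrow> cutoff c r \<psi> \<Longrightarrow>
      osc_rep m (\<lambda>x \<xi>. x * \<xi>) c pi c \<eta> \<psi> B"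
    using B unfolding PDO_def by blast
  have gC: "(\<lambda>p. Rep_circle (g p)) \<in> Cinf" and igC: "(\<lambda>p. Rep_circle (inv g p)) \<in> Cinf" and bij: "bij g"
    using g by (auto simp: Diff_plus_def Diff_def)
  have inv: "inv g (g p) = p" "g (inv g p) = p" for p
    using bij by (simp_all add: bij_is_inj bij_is_surj surj_f_inv_f)
  obtain G G' c0 where G: "\<And>t. (G has_vector_derivative G' t) (at t)" and Gu: "ub UNIV (\<lambda>_::nat. G')" "ub UNIV (\<lambda>_::unit. G')"
    and c0: "c0 > 0" "\<And>t. G' t \<ge> c0" and Gg: "\<And>t. g (circ t) = circ (G t)"
    by (rule Diff_plus_lift[OF g]) (rule that)
  have G'nz: "G' t \<noteq> 0" for t using c0(1) c0(2)[of t] by linarith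
  obtain L where L: "L > 0" "\<And>\<alpha> t. t \<in> UNIV \<Longrightarrow> norm (G' t) \<le> L"
    by (rule ub_boundE[OF Gu(2)]) (rule that)
  have GL: "\<bar>G x - G c\<bar> \<le> L * \<bar>x - c\<bar>" for x c
  proof -
    have "norm (G x - G c) \<le> L * \<bar>x - c\<bar>"
      by (rule vector_derivative_bound_linearization[where a = "min x c - 1" and b = "max x c + 1", OF G L(2)]) auto
    then show ?thesis by simp
  qed
  show lA: "linear_op A"
    unfolding linear_op_def
  proof (intro conjI ballI allI)
    fix f assume "f \<in> (Cinf :: (circle \<Rightarrow> complex^'k) set)"
    then show "A f \<in> Cinf" using Cinf_comp[OF gC linear_op_Cinf[OF lin]] A by simp
  next
    fix f h :: "circle \<Rightarrow> complex^'k" and c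
    assume fh: "f \<in> Cinf" "h \<in> Cinf"
    have "(\<lambda>p. c *s f p + h p) \<in> Cinf" by (intro Cinf_add Cinf_smult Cinf_const fh)
    then show "A (\<lambda>p. c *s f p + h p) = (\<lambda>p. c *s A f p + A h p)"
      using lin fh by (simp add: A linear_op_def o_def)
  qed
  have "\<exists>\<delta> \<phi>. 0 < \<delta> \<and> \<delta> \<le> pi \<and> phase_on {c - \<delta> <..< c + \<delta>} \<phi> \<and>
        (\<forall>r \<eta> \<psi>. 0 < r \<and> r < \<delta> \<and> cutoff c r \<eta> \<and> cutoff d r \<psi> \<longrightarrow> osc_rep m \<phi> c \<delta> d \<eta> \<psi> A)" for c d
  proof -
    \<comment> \<open>With the Lipschitz constant L of G, the arc of radius \<delta> is mapped into
      distance pi/4 of G c, and cutoff radii r < \<delta> stay below pi/4.\<close>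
    define \<delta> where "\<delta> = min (pi/4) (pi / (4 * L))"
    have \<delta>: "0 < \<delta>" "\<delta> \<le> pi/4" "L * \<delta> \<le> pi/4"
    proof -
      show "0 < \<delta>" "\<delta> \<le> pi/4" using L(1) by (auto simp: \<delta>_def)
      have "L * \<delta> \<le> L * (pi / (4 * L))" using L(1) by (intro mult_left_mono) (auto simp: \<delta>_def)
      then show "L * \<delta> \<le> pi/4" using L(1) by simp
    qed
    have near: "\<bar>G x - G c\<bar> < pi/4" if "\<bar>x - c\<bar> < \<delta>" for x
    proof -
      have "L * \<bar>x - c\<bar> < L * \<delta>" using that L(1) by simp
      then show ?thesis using GL[of x c] \<delta>(3) by linarith
    qed
    obtain k :: int where k: "G c - pi \<le> d + 2*pi * of_int k" "d + 2*pi * of_int k < G c - pi + 2*pi" by (rule period_window)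
    define d' where "d' = d + 2*pi * of_int k"
    \<comment> \<open>The angle d' of the source point lies within pi of G c, so the midpoint c' is
      within pi/2 of both. Arcs of radius pi/4 around G c and d' then fit into the arc of radius
      3*pi/4 around c', which is admissible for B.\<close>
    define c' where "c' = (G c + d') / 2"
    have dc: "\<bar>d' - c'\<bar> \<le> pi/2" "\<bar>G c - c'\<bar> \<le> pi/2" using k by (auto simp: c'_def d'_def abs_le_iff field_simps)
    have Gx: "\<bar>G x - c'\<bar> < 3*pi/4" if "\<bar>x - c\<bar> < \<delta>" for x using near[OF that] dc(2) by linarith
    \<comment> \<open>The translation by 2*pi*k compensates for passing from the source angle d to
      d'.\<close>
    define \<phi> where "\<phi> x \<xi> = (G x - 2*pi * of_int k) * \<xi>" for x \<xi>
    have ph: "phase_on {c - \<delta> <..< c + \<delta>} \<phi>" unfolding \<phi>_def by (rule phase_on_lift[OF G Gu(2) G'nz])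
    have "osc_rep m \<phi> c \<delta> d \<eta> \<psi> A" if r: "0 < r" "r < \<delta>" and cut: "cutoff c r \<eta>" "cutoff d r \<psi>" for r \<eta> \<psi>
    proof -
      have \<eta>: "\<eta> \<in> Cinf" and \<psi>: "\<psi> \<in> Cinf" using cut by (auto simp: cutoff_def)
      have rp: "r < pi/4" using r \<delta>(2) by linarith
      have \<psi>0: "\<psi> (circ t) = 0" if "d' + r < t" "t < d' + 2*pi - r" for t
      proof -
        have "\<psi> (circ (t - 2*pi * of_int k)) = 0" using cut(2) that unfolding cutoff_def d'_def by auto
        then show ?thesis using circ_2pi_int[of t "- k"] by simp
      qed
      have cut\<psi>: "cutoff c' (3*pi/4) \<psi>"
        unfolding cutoff_def
      proof (intro conjI allI impI \<psi>)
        fix t assume "c' + 3*pi/4 < t \<and> t < c' + 2*pi - 3*pi/4"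
        then have "d' + r < t" "t < d' + 2*pi - r" using dc(1) rp by linarith+
        then show "\<psi> (circ t) = 0" by (rule \<psi>0)
      qed
      define \<eta>' where "\<eta>' = \<eta> \<circ> inv g"
      have cut\<eta>: "cutoff c' (3*pi/4) \<eta>'"
        unfolding cutoff_def
      proof (intro conjI allI impI)
        show "\<eta>' \<in> Cinf" unfolding \<eta>'_def by (rule Cinf_comp[OF igC \<eta>])
        fix t assume t: "c' + 3*pi/4 < t \<and> t < c' + 2*pi - 3*pi/4"
        obtain s where s: "c - pi \<le> s" "s < c - pi + 2*pi" "inv g (circ t) = circ s" by (rule circ_window)
        have "circ (G s) = circ t" using s(3) inv(2)[of "circ t"] Gg[of s] by simp
        then obtain n::int where n: "G s = t + 2*pi * of_int n" by (auto simp only: circ_eq_iff)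
        \<comment> \<open>The angles G s and t agree up to full turns, and no such translate of t
          comes within 3*pi/4 of c', where G would put s if s were close to c.\<close>
        have far: "\<not> \<bar>s - c\<bar> \<le> r"
        proof
          assume "\<bar>s - c\<bar> \<le> r"
          then have sm: "\<bar>G s - c'\<bar> < 3*pi/4" using r by (intro Gx) linarith
          show False
          proof (cases "n \<ge> 0")
            case True
            then have "2*pi * of_int n \<ge> 0" by simp
            then show False using sm n t by linarith
          next
            case False
            then have "real_of_int n \<le> -1" by linarith
            then have "2*pi * of_int n \<le> 2*pi * (-1)" by (intro mult_left_mono) auto
            then show False using sm n t by linarith
          qed
        qed
        show "\<eta>' (circ t) = 0"
        proof (cases "s > c")
          case True
          then have "c + r < s" "s < c + 2*pi - r" using far s rp pi_gt_zero by linarith+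
          then show ?thesis using cut(1) by (simp add: \<eta>'_def s(3) cutoff_def)
        next
          case False
          then have "c + r < s + 2*pi" "s + 2*pi < c + 2*pi - r" using far s rp pi_gt_zero by linarith+
          then have "\<eta> (circ (s + 2*pi)) = 0" using cut(1) unfolding cutoff_def by blast
          then show ?thesis by (simp add: \<eta>'_def s(3))
        qed
      qed
      obtain a K where a: "symbol m a" and K: "smooth_kernel K" and eq:
        "\<And>f x. f \<in> Cinf \<Longrightarrow> \<bar>x - c'\<bar> < pi \<Longrightarrow> \<eta>' (circ x) *s B (\<lambda>p. \<psi> p *s f p) (circ x)
          = osc (\<lambda>x \<xi>. x * \<xi>) a (lift c' (\<lambda>p. \<psi> p *s f p)) x + kernel_op K f (circ x)"
      proof -
        have "osc_rep m (\<lambda>x \<xi>. x * \<xi>) c' pi c' \<eta>' \<psi> B" by (rule m[OF _ _ cut\<eta> cut\<psi>]) (use pi_gt_zero in auto)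
        then show ?thesis unfolding osc_rep_def using that by blast
      qed
      show ?thesis unfolding osc_rep_def
      proof (intro exI[of _ "\<lambda>x. a (G x)"] exI[of _ "\<lambda>p. K (g p)"] conjI ballI allI impI)
        show "symbol m (\<lambda>x. a (G x))" by (rule symbol_comp[OF a G Gu(1)])
        show "smooth_kernel (\<lambda>p. K (g p))" by (rule smooth_kernel_comp[OF K gC])
        fix f :: "circle \<Rightarrow> complex^'k" and x assume f: "f \<in> Cinf" and x: "\<bar>x - c\<bar> < \<delta>"
        let ?u = "\<lambda>p. \<psi> p *s f p"
        have u: "?u \<in> Cinf" by (intro Cinf_smult \<psi> f)
        have uv: "vanishing d r ?u" using cut(2) by (auto simp: vanishing_def cutoff_def)
        have "\<eta> (circ x) *s A ?u (circ x) = \<eta>' (circ (G x)) *s B ?u (circ (G x))"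
          by (simp add: A[OF u] Gg[symmetric] \<eta>'_def inv)
        also have "\<dots> = osc (\<lambda>x \<xi>. x * \<xi>) a (lift c' ?u) (G x) + kernel_op K f (circ (G x))"
          by (rule eq[OF f]) (use Gx[OF x] pi_gt_zero in linarith)
        also have "osc (\<lambda>x \<xi>. x * \<xi>) a (lift c' ?u) (G x) = osc \<phi> (\<lambda>x. a (G x)) (lift d ?u) x"
        proof -
          have "fourier (lift c' ?u) \<xi> = cis (- ((2*pi * of_int k) * \<xi>)) *s fourier (lift d ?u) \<xi>" for \<xi>
            by (rule fourier_shift, rule lift_shift[OF uv]) (use rp dc(1)[unfolded d'_def] pi_gt_zero in linarith)+
          then show ?thesis unfolding osc_def
            by (simp add: matvec_smult smult_assoc cis_mult \<phi>_def algebra_simps)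
        qed
        also have "kernel_op K f (circ (G x)) = kernel_op (\<lambda>p. K (g p)) f (circ x)"
          by (simp add: kernel_op_def Gg)
        finally show "\<eta> (circ x) *s A ?u (circ x) = osc \<phi> (\<lambda>x. a (G x)) (lift d ?u) x + kernel_op (\<lambda>p. K (g p)) f (circ x)" .
      qed
    qed
    then show ?thesis using \<delta> ph pi_gt_zero by (intro exI[of _ \<delta>] exI[of _ \<phi>]) auto
  qed
  with lA show "A \<in> FIO" unfolding FIO_def by blast
qed

section \<open>Multipliers and square roots\<close>

text \<open>Any symmetric nonnegative P with the same square as Q is shown to agree with Q on a
  complete set E of eigensections of Q; by symmetry, P f and Q f then have the same inner products
  with E. Linearity of P comes from symmetry and definiteness. Real scalars suffice throughout, so
  that real and complex inner products are treated alike.\<close>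

lemma pos_sqrt_eq:
  fixes ip :: "(circle \<Rightarrow> 'v::real_normed_vector) \<Rightarrow> (circle \<Rightarrow> 'v) \<Rightarrow> 'f::real_algebra_1"
  assumes add: "\<And>f g h. f \<in> Cinf \<Longrightarrow> g \<in> Cinf \<Longrightarrow> h \<in> Cinf \<Longrightarrow> ip (\<lambda>p. f p + g p) h = ip f h + ip g h"
    and scale: "\<And>f h c. f \<in> Cinf \<Longrightarrow> h \<in> Cinf \<Longrightarrow> ip (\<lambda>p. c *\<^sub>R f p) h = c *\<^sub>R ip f h"
    and pos: "\<And>f. f \<in> Cinf \<Longrightarrow> ip f f \<in> nonneg_Reals"
    and definite: "\<And>f. f \<in> Cinf \<Longrightarrow> ip f f = 0 \<Longrightarrow> f = (\<lambda>_. 0)"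
    and Q: "\<And>f. f \<in> Cinf \<Longrightarrow> Q f \<in> Cinf" "\<And>f g. f \<in> Cinf \<Longrightarrow> g \<in> Cinf \<Longrightarrow> ip (Q f) g = ip f (Q g)"
      "\<And>f. f \<in> Cinf \<Longrightarrow> ip (Q f) f \<in> nonneg_Reals" "\<And>f. f \<in> Cinf \<Longrightarrow> Q (Q f) = S f"
    and E: "E \<subseteq> Cinf" "\<And>r. r \<in> E \<Longrightarrow> \<exists>l\<ge>0. Q r = (\<lambda>p. l *\<^sub>R r p)"
    and complete: "\<And>f. f \<in> Cinf \<Longrightarrow> (\<And>r. r \<in> E \<Longrightarrow> ip f r = 0) \<Longrightarrow> f = (\<lambda>_. 0)"
    and f: "f \<in> Cinf"
  shows "pos_sqrt ip S f = Q f"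
proof -
  define P where "P = pos_sqrt ip S"
  have "\<exists>P. (\<forall>f\<in>Cinf. P f \<in> Cinf) \<and> (\<forall>f\<in>Cinf. \<forall>g\<in>Cinf. ip (P f) g = ip f (P g)) \<and>
     (\<forall>f\<in>Cinf. ip (P f) f \<in> nonneg_Reals) \<and> (\<forall>f\<in>Cinf. P (P f) = S f)"
    by (intro exI[of _ Q] conjI ballI Q)
  from someI_ex[OF this] have P: "\<And>f. f \<in> Cinf \<Longrightarrow> P f \<in> Cinf" "\<And>f g. f \<in> Cinf \<Longrightarrow> g \<in> Cinf \<Longrightarrow> ip (P f) g = ip f (P g)"
      "\<And>f. f \<in> Cinf \<Longrightarrow> ip (P f) f \<in> nonneg_Reals" "\<And>f. f \<in> Cinf \<Longrightarrow> P (P f) = S f"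
    unfolding P_def pos_sqrt_def by auto
  have scC: "(\<lambda>p. c *\<^sub>R g p) \<in> Cinf" if "g \<in> Cinf" for g :: "circle \<Rightarrow> 'v" and c
    by (rule Cinf_linear[OF bounded_linear_scaleR_right that])
  have combC: "(\<lambda>p. g p + c *\<^sub>R h p) \<in> Cinf" if "g \<in> Cinf" "h \<in> Cinf" for g h :: "circle \<Rightarrow> 'v" and c
    by (intro Cinf_add scC that)
  have comb: "ip (\<lambda>p. g p + c *\<^sub>R h p) k = ip g k + c *\<^sub>R ip h k" if "g \<in> Cinf" "h \<in> Cinf" "k \<in> Cinf" for g h k c
    using that by (simp add: add scC scale)
  have eqI: "g = h" if "g \<in> Cinf" "h \<in> Cinf" "\<And>k. k \<in> Cinf \<Longrightarrow> ip g k = ip h k" for g h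
  proof -
    have "(\<lambda>p. g p + (-1) *\<^sub>R h p) = (\<lambda>_. 0)"
      by (rule definite[OF combC[OF that(1,2)]]) (simp only: comb[OF that(1,2) combC[OF that(1,2)]] that(3)[OF combC[OF that(1,2)]], simp)
    then show ?thesis by (simp add: fun_eq_iff)
  qed
  have lin: "T (\<lambda>p. g p + c *\<^sub>R h p) = (\<lambda>p. T g p + c *\<^sub>R T h p)"
    if T: "\<And>f. f \<in> Cinf \<Longrightarrow> T f \<in> Cinf" "\<And>f g. f \<in> Cinf \<Longrightarrow> g \<in> Cinf \<Longrightarrow> ip (T f) g = ip f (T g)"
      and gh: "g \<in> Cinf" "h \<in> Cinf" for T g h c
    by (rule eqI) (auto simp: T combC gh comb)
  have ip0: "ip (\<lambda>_. 0) k = 0" if "k \<in> Cinf" for k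
    using scale[OF Cinf_const[of 0] that, of 0] by simp
  have T0: "T (\<lambda>_. 0) = (\<lambda>_. 0)"
    if T: "\<And>f. f \<in> Cinf \<Longrightarrow> T f \<in> Cinf" "\<And>f g. f \<in> Cinf \<Longrightarrow> g \<in> Cinf \<Longrightarrow> ip (T f) g = ip f (T g)" for T
    by (rule eqI) (auto simp: T ip0 Cinf_const)
  have Tsc: "T (\<lambda>p. c *\<^sub>R h p) = (\<lambda>p. c *\<^sub>R T h p)"
    if T: "\<And>f. f \<in> Cinf \<Longrightarrow> T f \<in> Cinf" "\<And>f g. f \<in> Cinf \<Longrightarrow> g \<in> Cinf \<Longrightarrow> ip (T f) g = ip f (T g)"
      and h: "h \<in> Cinf" for T h c
    using lin[OF T Cinf_const[of 0] h, of c] T0[OF T] by simp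
  have PE: "P r = Q r" if r: "r \<in> E" for r
  proof -
    have rC: "r \<in> Cinf" using E(1) r by blast
    obtain l where l: "l \<ge> 0" "Q r = (\<lambda>p. l *\<^sub>R r p)" using E(2)[OF r] by blast
    have "Q (Q r) = (\<lambda>p. l *\<^sub>R Q r p)" using arg_cong[OF l(2), of Q] Tsc[OF Q(1,2) rC, of l] by (rule trans)
    also have "\<dots> = (\<lambda>p. (l * l) *\<^sub>R r p)" by (simp add: fun_cong[OF l(2)])
    finally have "Q (Q r) = (\<lambda>p. (l * l) *\<^sub>R r p)" .
    then have PP: "P (P r) = (\<lambda>p. (l * l) *\<^sub>R r p)" using P(4)[OF rC] Q(4)[OF rC] by simp
    show ?thesis
    proof (cases "l = 0")
      case True
      have "ip (P r) (P r) = ip (P (P r)) r" using P(2)[OF P(1)[OF rC] rC] by simp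
      also have "\<dots> = 0" using PP True ip0[OF rC] by simp
      finally have "P r = (\<lambda>_. 0)" by (rule definite[OF P(1)[OF rC]])
      then show ?thesis using l(2) True by simp
    next
      case False
      \<comment> \<open>h measures how far r is from being an eigensection of P for l. Since P (P r)
        is l * l times r, P sends h to - l times h, which positivity allows for h = 0 alone.\<close>
      define h where "h = (\<lambda>p. P r p + (- l) *\<^sub>R r p)"
      have hC: "h \<in> Cinf" unfolding h_def by (rule combC[OF P(1)[OF rC] rC])
      have "P h = (\<lambda>p. P (P r) p + (- l) *\<^sub>R P r p)"
        unfolding h_def by (rule lin[OF P(1,2) P(1)[OF rC] rC])
      also have "\<dots> = (\<lambda>p. (- l) *\<^sub>R h p)" unfolding PP by (simp add: h_def fun_eq_iff algebra_simps)
      finally have "P h = (\<lambda>p. (- l) *\<^sub>R h p)" .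
      then have "ip (P h) h = (- l) *\<^sub>R ip h h" by (simp only: scale[OF hC hC])
      moreover obtain x where x: "ip (P h) h = of_real x" "x \<ge> 0" using P(3)[OF hC] by (auto elim: nonneg_Reals_cases)
      moreover obtain y where y: "ip h h = of_real y" "y \<ge> 0" using pos[OF hC] by (auto elim: nonneg_Reals_cases)
      ultimately have "(of_real x :: 'f) = of_real (- l * y)" by (simp add: scaleR_conv_of_real)
      then have "x = - l * y" by (simp only: of_real_eq_iff)
      then have "l * y \<le> 0" using x(2) by simp
      then have "y = 0" using False l(1) y(2) by (simp add: mult_le_0_iff)
      then have "h = (\<lambda>_. 0)" using definite[OF hC] y(1) by simp
      then show ?thesis using l(2) by (simp add: h_def fun_eq_iff)
    qed
  qed
  have "(\<lambda>p. P f p + (-1) *\<^sub>R Q f p) = (\<lambda>_. 0)"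
  proof (rule complete[OF combC[OF P(1)[OF f] Q(1)[OF f]]])
    fix r assume r: "r \<in> E"
    then have rC: "r \<in> Cinf" using E(1) by blast
    have "ip (P f) r = ip (Q f) r" using P(2)[OF f rC] Q(2)[OF f rC] PE[OF r] by simp
    then show "ip (\<lambda>p. P f p + (-1) *\<^sub>R Q f p) r = 0"
      by (simp only: comb[OF P(1)[OF f] Q(1)[OF f] rC]) simp
  qed
  then show ?thesis by (simp add: fun_eq_iff P_def)
qed

context frame
begin

text \<open>The inner product for which the modulated frame sections are orthogonal with square norm
  2*pi. It is the given inner product when the frame is orthonormal.\<close>

definition cip :: "(circle \<Rightarrow> complex^'k) \<Rightarrow> (circle \<Rightarrow> complex^'k) \<Rightarrow> complex" where
  "cip f g = integral {0..2*pi} (\<lambda>t. \<Sum>j\<in>UNIV. dotc (b j (circ t)) (f (circ t)) * cnj (dotc (b j (circ t)) (g (circ t))))"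

lemma cip_co:
  assumes f: "f \<in> Cinf" and g: "g \<in> Cinf"
  shows "cip f g = of_real (2*pi) * (\<Sum>j\<in>UNIV. lsum (\<lambda>n. co f j n * cnj (co g j n)))"
proof -
  have "cip f g = (\<Sum>j\<in>UNIV. integral {0..2*pi} (\<lambda>t. dotc (b j (circ t)) (f (circ t)) * cnj (dotc (b j (circ t)) (g (circ t)))))"
    unfolding cip_def
    by (rule integral_sum) (auto intro!: integrable_continuous_interval continuous_intros Cinf_continuous[OF coord_Cinf[OF f]] Cinf_continuous[OF coord_Cinf[OF g]])
  also have "\<dots> = (\<Sum>j\<in>UNIV. of_real (2*pi) * lsum (\<lambda>n. co f j n * cnj (co g j n)))"
    by (simp only: parseval[OF coord_Cinf[OF f] coord_Cinf[OF g]] co_def)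
  finally show ?thesis by (simp only: sum_distrib_left)
qed

lemma polyb_cnj: "polyb s \<Longrightarrow> polyb (\<lambda>j n. cnj (s j n))"
  by (simp add: polyb_def)

lemma cip_Mult:
  assumes s: "polyb s" and f: "f \<in> Cinf" and g: "g \<in> Cinf"
  shows "cip (Mult s f) g = cip f (Mult (\<lambda>j n. cnj (s j n)) g)"
  by (simp add: cip_co Mult_Cinf s f g polyb_cnj co_Mult mult_ac)

lemma lsum_nonneg_Reals: "asum x \<Longrightarrow> (\<And>i. x i = of_real (y i) \<and> y i \<ge> 0) \<Longrightarrow> lsum x \<in> (nonneg_Reals :: complex set)"
proof -
  assume *: "asum x" "\<And>i. x i = of_real (y i) \<and> y i \<ge> 0"
  have "x = (\<lambda>i. complex_of_real (y i))" using *(2) by (auto simp: fun_eq_iff)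
  then have "lsum x = of_real (lsum y)" by (simp only: integral_complex_of_real)
  moreover have "lsum y \<ge> 0" by (rule integral_nonneg_AE) (use *(2) in simp)
  ultimately show ?thesis by simp
qed

lemma sum_nonneg_Reals: "(\<And>i. x i \<in> nonneg_Reals) \<Longrightarrow> (\<Sum>i\<in>I. x i) \<in> (nonneg_Reals :: complex set)"
  by (induction I rule: infinite_finite_induct) auto

lemma asum_co_product: "f \<in> Cinf \<Longrightarrow> g \<in> Cinf \<Longrightarrow> polyb s \<Longrightarrow> asum (\<lambda>n. s j n * co f j n * cnj (co g j n))"
proof -
  assume f: "f \<in> Cinf" and g: "g \<in> Cinf" and s: "polyb s"
  obtain B where B: "B \<ge> 0" "\<And>n. norm (co g j n) \<le> B / (1 + \<bar>real_of_int n\<bar>) ^ 0"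
    by (rule rapid_bound[OF rapid_co[OF g, of j], of 0]) (rule that)
  show ?thesis
  proof (rule rapid_asum(2), rule rapid_poly[OF rapid_polyb[OF s rapid_co[OF f]], where K = B and M = 0])
    fix n
    show "norm (s j n * co f j n * cnj (co g j n)) \<le> B * (1 + \<bar>real_of_int n\<bar>) ^ 0 * norm (s j n * co f j n)"
      using mult_left_mono[OF B(2)[of n], of "norm (s j n * co f j n)"] by (simp add: norm_mult mult_ac)
  qed
qed

lemma cip_Mult_nonneg:
  assumes s: "polyb s" and f: "f \<in> Cinf" and r: "\<And>j n. s j n = of_real (\<sigma> j n)" "\<And>j n. \<sigma> j n \<ge> 0"
  shows "cip (Mult s f) f \<in> nonneg_Reals"
proof -
  have "lsum (\<lambda>n. s j n * co f j n * cnj (co f j n)) \<in> nonneg_Reals" for j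
  proof (rule lsum_nonneg_Reals[OF asum_co_product[OF f f s], where y = "\<lambda>n. \<sigma> j n * (norm (co f j n))\<^sup>2"])
    fix n
    show "s j n * co f j n * cnj (co f j n) = of_real (\<sigma> j n * (norm (co f j n))\<^sup>2) \<and> 0 \<le> \<sigma> j n * (norm (co f j n))\<^sup>2"
      using r by (simp add: complex_norm_square mult.assoc del: of_real_power)
  qed
  then have "(\<Sum>j\<in>UNIV. lsum (\<lambda>n. s j n * co f j n * cnj (co f j n))) \<in> nonneg_Reals"
    by (rule sum_nonneg_Reals)
  then show ?thesis
    using cip_co[OF Mult_Cinf[OF s f] f] by (simp add: co_Mult s f nonneg_Reals_mult_I)
qed

lemma co_modulated: "co (\<lambda>p. ee m p *s w i p) j n = (if i = j \<and> m = n then 1 else 0)"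
proof -
  have "co (\<lambda>p. ee m p *s w i p) j n = fc (\<lambda>p. (if j = i then 1 else 0) * ee m p) n"
    by (simp add: co_def dotc_smult dual1 mult.commute)
  also have "\<dots> = (if j = i then 1 else 0) * fc (ee m) n" by (rule fc_mult)
  also have "fc (ee m) n = (if m = n then 1 else 0)"
  proof -
    have "(\<lambda>t. ee m (circ t) * cis (- (of_int n * t))) = (\<lambda>t. cis (of_int (m - n) * t))"
      by (simp add: cis_mult algebra_simps)
    then show ?thesis unfolding fc_def by (simp only: integral_cis_int) simp
  qed
  finally show ?thesis by auto
qed

lemma cip_modulated:
  assumes "f \<in> Cinf"
  shows "cip f (\<lambda>p. ee n p *s w j p) = of_real (2*pi) * co f j n"
proof -
  have "lsum (\<lambda>m. co f i m * cnj (co (\<lambda>p. ee n p *s w j p) i m)) = (if i = j then co f j n else 0)" for i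
  proof -
    have "lsum (\<lambda>m. co f i m * cnj (co (\<lambda>p. ee n p *s w j p) i m)) = lsum (\<lambda>m. if m = n then (if i = j then co f j n else 0) else 0)"
      by (rule Bochner_Integration.integral_cong) (auto simp: co_modulated)
    then show ?thesis by (simp only: lsum_single)
  qed
  then show ?thesis by (simp add: cip_co assms Cinf_modulated)
qed

lemma cip_complete: "f \<in> Cinf \<Longrightarrow> (\<And>j n. cip f (\<lambda>p. ee n p *s w j p) = 0) \<Longrightarrow> f = (\<lambda>_. 0)"
proof -
  assume f: "f \<in> Cinf" and 0: "\<And>j n. cip f (\<lambda>p. ee n p *s w j p) = 0"
  have "co f j n = 0" for j n using 0[of n j] by (simp add: cip_modulated[OF f])
  moreover have "co (\<lambda>_. 0) j n = 0" for j n using co_smult[of 0 "\<lambda>_. 0" j n] by simp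
  ultimately show ?thesis by (intro co_inject[OF f Cinf_const]) simp
qed

lemma cip_integrable: "f \<in> Cinf \<Longrightarrow> g \<in> Cinf \<Longrightarrow> (\<lambda>t. \<Sum>j\<in>UNIV. dotc (b j (circ t)) (f (circ t)) * cnj (dotc (b j (circ t)) (g (circ t)))) integrable_on {0..2*pi}"
  by (intro integrable_continuous_interval continuous_intros Cinf_continuous coord_Cinf)

lemma cip_add: "f \<in> Cinf \<Longrightarrow> g \<in> Cinf \<Longrightarrow> h \<in> Cinf \<Longrightarrow> cip (\<lambda>p. f p + g p) h = cip f h + cip g h"
  unfolding cip_def by (subst integral_add[symmetric]) (auto simp: cip_integrable dotc_add distrib_right sum.distrib)

lemma cip_smult: "cip (\<lambda>p. c *s f p) h = c * cip f h"
  unfolding cip_def by (subst integral_mult_right[symmetric]) (simp add: dotc_smult sum_distrib_left mult.assoc)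

lemma cip_definite:
  assumes f: "f \<in> Cinf" and 0: "cip f f = 0"
  shows "f = (\<lambda>_. 0)"
proof -
  let ?h = "\<lambda>t. \<Sum>j\<in>UNIV. (norm (dotc (b j (circ t)) (f (circ t))))\<^sup>2"
  have c: "continuous_on A ?h" for A
    by (intro continuous_intros Cinf_continuous coord_Cinf f)
  have "cip f f = integral {0..2*pi} (\<lambda>t. of_real (?h t))"
    unfolding cip_def by (rule integral_cong) (simp add: complex_norm_square del: of_real_power)
  also have "\<dots> = of_real (integral {0..2*pi} ?h)"
    by (rule integral_linear[OF integrable_continuous_interval[OF c] bounded_linear_of_real, unfolded o_def])
  finally have I: "integral {0..2*pi} ?h = 0" using 0 by simp
  show ?thesis
  proof
    fix p
    obtain t where t: "0 \<le> t" "t < 0 + 2*pi" "p = circ t" by (rule circ_window)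
    have "?h t = 0" by (rule integral_zero_continuous[OF c _ I]) (use t pi_gt_zero in \<open>auto intro: sum_nonneg\<close>)
    then have "dotc (b j p) (f p) = 0" for j by (simp add: sum_nonneg_eq_0_iff t(3))
    then show "f p = 0" using dual2[of p "f p"] by simp
  qed
qed

lemma cip_pos: "f \<in> Cinf \<Longrightarrow> cip f f \<in> nonneg_Reals"
proof -
  assume f: "f \<in> Cinf"
  have pb: "polyb (\<lambda>j n. 1)" unfolding polyb_def by (intro exI[of _ 1] exI[of _ "0::nat"]) simp
  have "Mult (\<lambda>j n. 1) f = f" by (simp add: Mult_def syn_co f)
  then show ?thesis using cip_Mult_nonneg[OF pb f, of "\<lambda>j n. 1"] by simp
qed

lemma cip_scaleR: "cip (\<lambda>p. c *\<^sub>R f p) h = c *\<^sub>R cip f h"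
proof -
  have "c *\<^sub>R v = complex_of_real c *s v" for v :: "complex^'k" by (simp add: vec_eq_iff scaleR_conv_of_real[where 'a=complex])
  then show ?thesis by (simp add: cip_smult scaleR_conv_of_real)
qed

lemma Mult_modulated:
  assumes s: "polyb s"
  shows "Mult s (\<lambda>p. ee n p *s w j p) = (\<lambda>p. s j n *s (ee n p *s w j p))"
proof (rule co_inject[OF Mult_Cinf[OF s Cinf_modulated]])
  show "(\<lambda>p. s j n *s (ee n p *s w j p)) \<in> Cinf" by (intro Cinf_smult Cinf_const ee_Cinf w_Cinf)
  show "co (Mult s (\<lambda>p. ee n p *s w j p)) i m = co (\<lambda>p. s j n *s (ee n p *s w j p)) i m" for i m
    unfolding co_smult co_Mult[OF s Cinf_modulated] co_modulated by auto
qed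

lemma Mult_Mult: "polyb s \<Longrightarrow> polyb s' \<Longrightarrow> f \<in> Cinf \<Longrightarrow> Mult s (Mult s' f) = Mult (\<lambda>j n. s j n * s' j n) f"
  unfolding Mult_def[of s] Mult_def[of "\<lambda>j n. s j n * s' j n"] by (simp add: co_Mult mult.assoc)

lemma Mult_one: "(\<And>j n. s j n = 1) \<Longrightarrow> f \<in> Cinf \<Longrightarrow> Mult s f = f"
  by (simp add: Mult_def syn_co)

lemma Mult_add_fun: "f \<in> Cinf \<Longrightarrow> polyb s \<Longrightarrow> polyb s' \<Longrightarrow> (\<lambda>p. Mult s f p + Mult s' f p) = Mult (\<lambda>j n. s j n + s' j n) f"
proof -
  assume f: "f \<in> Cinf" and s: "polyb s" and s': "polyb s'"
  have r: "rapid (\<lambda>n. (s j n + s' j n) * co f j n)" for j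
  proof -
    obtain K M where 1: "\<And>j n. norm (s j n) \<le> K * (1 + \<bar>real_of_int n\<bar>) ^ M" using s unfolding polyb_def by blast
    obtain K' M' where 2: "\<And>j n. norm (s' j n) \<le> K' * (1 + \<bar>real_of_int n\<bar>) ^ M'" using s' unfolding polyb_def by blast
    have "norm (s j n + s' j n) \<le> (\<bar>K\<bar> + \<bar>K'\<bar>) * (1 + \<bar>real_of_int n\<bar>) ^ (M + M')" for n
    proof -
      have "norm (s j n) \<le> \<bar>K\<bar> * (1 + \<bar>real_of_int n\<bar>) ^ (M + M')"
        by (rule order_trans[OF 1]) (intro mult_mono power_increasing, auto)
      moreover have "norm (s' j n) \<le> \<bar>K'\<bar> * (1 + \<bar>real_of_int n\<bar>) ^ (M + M')"
        by (rule order_trans[OF 2]) (intro mult_mono power_increasing, auto)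
      ultimately show ?thesis using norm_triangle_ineq[of "s j n" "s' j n"] by (simp add: distrib_right)
    qed
    then show ?thesis
      by (intro rapid_poly[OF rapid_co[OF f, of j], where K = "\<bar>K\<bar> + \<bar>K'\<bar>" and M = "M + M'"]) (simp add: norm_mult mult_right_mono)
  qed
  show ?thesis
  proof (rule co_inject)
    show "(\<lambda>p. Mult s f p + Mult s' f p) \<in> Cinf" by (intro Cinf_add Mult_Cinf s s' f)
    show "Mult (\<lambda>j n. s j n + s' j n) f \<in> Cinf" unfolding Mult_def by (rule syn_Cinf[OF r])
    show "co (\<lambda>p. Mult s f p + Mult s' f p) j n = co (Mult (\<lambda>j n. s j n + s' j n) f) j n" for j n
      unfolding Mult_def[of "\<lambda>j n. s j n + s' j n"] co_syn[OF r] co_add[OF Mult_Cinf[OF s f] Mult_Cinf[OF s' f]]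
      by (simp add: co_Mult s s' f distrib_right)
  qed
qed

end

section \<open>The complex case\<close>

interpretation std: frame "\<lambda>j (_::circle). axis j (1::complex)" "\<lambda>j _. axis j 1"
proof
  show "dotc (axis i 1) (axis j 1) = (if i = j then 1 else 0)" for i j :: 'a
    by (auto simp: dotc_def axis_def if_distrib[of "\<lambda>x. x * _"] cong: if_cong)
  show "(\<Sum>j\<in>UNIV. dotc (axis j 1) u *s axis j 1) = u" for u :: "complex^'a"
    by (auto simp: dotc_def axis_def vec_eq_iff if_distrib[of "\<lambda>x. x * _"] if_distrib[of "\<lambda>x. _ * x"] cong: if_cong)
qed (rule Cinf_const)+

lemma dotc_axis: "dotc (axis j 1) v = v $ j"
  by (simp add: dotc_def axis_def if_distrib[of "\<lambda>x. x * _"] cong: if_cong)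

lemma ip_complex_cip: "ip_complex = std.cip"
  by (simp add: fun_eq_iff ip_complex_def std.cip_def dotc_axis)

lemma co_ddt:
  fixes f :: "circle \<Rightarrow> complex^'k"
  assumes f: "f \<in> Cinf"
  shows "std.co (ddt f) j n = \<i> * of_int n * std.co f j n"
proof -
  have "ddt (\<lambda>p. dotc (axis j 1) (f p)) = (\<lambda>p. dotc (axis j 1) (ddt f p))"
    by (rule ddt_linear[OF bounded_bilinear.bounded_linear_right[OF bb_dotc] f])
  then show ?thesis using fc_ddt[OF std.coord_Cinf[OF f, of j], of n] by (simp add: std.co_def)
qed

lemma polyb_abs: "polyb (\<lambda>j n. of_real \<bar>real_of_int n\<bar>)"
  unfolding polyb_def by (intro exI[of _ 1] exI[of _ "1::nat"]) simp

lemma polyb_bounded: "(\<And>j n. norm (s j n) \<le> S) \<Longrightarrow> polyb s"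
  unfolding polyb_def by (intro exI[of _ S] exI[of _ "0::nat"]) simp

text \<open>The modulated frame is a complete set of eigensections with eigenvalues |n|, and |n|^2 =
  - (i * n)^2 identifies the square with minus the second derivative, so the characterization of
  square roots applies.\<close>

lemma absD_complex_eq:
  fixes f :: "circle \<Rightarrow> complex^'k"
  assumes f: "f \<in> Cinf"
  shows "absD_complex f = std.Mult (\<lambda>j n. of_real \<bar>real_of_int n\<bar>) f"
  unfolding absD_complex_def ip_complex_cip
proof (rule pos_sqrt_eq[where E = "range (\<lambda>(j, n) p. ee n p *s axis j 1)"])
  let ?s = "\<lambda>(j::'k) n. complex_of_real \<bar>real_of_int n\<bar>"
  show "std.cip (std.Mult ?s f) g = std.cip f (std.Mult ?s g)" if "f \<in> Cinf" "g \<in> Cinf" for f g :: "circle \<Rightarrow> complex^'k"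
    using std.cip_Mult[OF polyb_abs that] by simp
  show "std.cip (std.Mult ?s f) f \<in> nonneg_Reals" if "f \<in> Cinf" for f :: "circle \<Rightarrow> complex^'k"
    by (rule std.cip_Mult_nonneg[OF polyb_abs that, where \<sigma> = "\<lambda>j n. \<bar>real_of_int n\<bar>"]) auto
  show "std.Mult ?s (std.Mult ?s f) = (\<lambda>p. - ddt (ddt f) p)" if f: "f \<in> Cinf" for f :: "circle \<Rightarrow> complex^'k"
  proof (rule std.co_inject)
    have e: "(\<lambda>p. - ddt (ddt f) p) = (\<lambda>p. (-1) *s ddt (ddt f) p)" by (simp add: vec_eq_iff)
    show "(\<lambda>p. - ddt (ddt f) p) \<in> Cinf" unfolding e by (intro Cinf_smult Cinf_const Cinf_ddt f)
    show "std.Mult ?s (std.Mult ?s f) \<in> Cinf" by (intro std.Mult_Cinf polyb_abs f)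
    show "std.co (std.Mult ?s (std.Mult ?s f)) j n = std.co (\<lambda>p. - ddt (ddt f) p) j n" for j n
    proof -
      have "std.co (std.Mult ?s (std.Mult ?s f)) j n = of_real \<bar>real_of_int n\<bar> * (of_real \<bar>real_of_int n\<bar> * std.co f j n)"
        unfolding std.co_Mult[OF polyb_abs std.Mult_Cinf[OF polyb_abs f]] std.co_Mult[OF polyb_abs f] ..
      also have "\<dots> = of_real (\<bar>real_of_int n\<bar> * \<bar>real_of_int n\<bar>) * std.co f j n" by (simp only: of_real_mult mult.assoc)
      also have "\<dots> = - (\<i> * of_int n * (\<i> * of_int n * std.co f j n))"
      proof -
        have q: "complex_of_real (\<bar>real_of_int n\<bar> * \<bar>real_of_int n\<bar>) = of_int n * of_int n" by (simp only: abs_mult_self_eq) simp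
        have "\<i> * of_int n * (\<i> * of_int n * std.co f j n) = (\<i> * \<i>) * (of_int n * of_int n * std.co f j n)"
          by (simp only: mult_ac)
        then show ?thesis unfolding q by simp
      qed
      also have "\<dots> = std.co (\<lambda>p. - ddt (ddt f) p) j n"
        unfolding e std.co_smult co_ddt[OF Cinf_ddt[OF f]] co_ddt[OF f] by simp
      finally show ?thesis .
    qed
  qed
  show "range (\<lambda>(j, n) p. ee n p *s axis j 1) \<subseteq> (Cinf :: (circle \<Rightarrow> complex^'k) set)"
    using std.Cinf_modulated by auto
  show "\<exists>l\<ge>0. std.Mult ?s r = (\<lambda>p. l *\<^sub>R r p)" if r: "r \<in> range (\<lambda>(j, n) p. ee n p *s axis j 1)" for r :: "circle \<Rightarrow> complex^'k"
  proof -
    obtain j n where "r = (\<lambda>p. ee n p *s axis j 1)" using r by auto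
    then have "std.Mult ?s r = (\<lambda>p. \<bar>real_of_int n\<bar> *\<^sub>R r p)"
      by (simp only: std.Mult_modulated[OF polyb_abs]) (simp add: fun_eq_iff vec_eq_iff scaleR_conv_of_real[where 'a=complex])
    then show ?thesis by (intro exI[of _ "\<bar>real_of_int n\<bar>"]) simp
  qed
  show "f = (\<lambda>_. 0)" if "f \<in> Cinf" "\<And>r. r \<in> range (\<lambda>(j, n) p. ee n p *s axis j 1) \<Longrightarrow> std.cip f r = 0" for f :: "circle \<Rightarrow> complex^'k"
    by (rule std.cip_complete[OF that(1)]) (rule that(2), auto)
qed (auto intro: std.cip_add std.cip_scaleR std.cip_pos std.cip_definite std.Mult_Cinf polyb_abs f)

lemma mean_co: "f \<in> Cinf \<Longrightarrow> mean f $ j = std.co f j 0"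
proof -
  assume f: "f \<in> Cinf"
  have "integral {0..2*pi} (\<lambda>t. f (circ t)) $ j = integral {0..2*pi} (\<lambda>t. f (circ t) $ j)"
    by (rule integral_linear[OF integrable_continuous_interval[OF Cinf_continuous[OF f]] bounded_linear_vec_nth, unfolded o_def, symmetric])
  then show ?thesis by (simp add: mean_def std.co_def fc_def dotc_axis scaleR_conv_of_real[where 'a=complex])
qed

lemma co_const: "std.co (\<lambda>_. v) j n = (if n = 0 then v $ j else 0)"
proof -
  have "std.co (\<lambda>_. v) j n = fc (\<lambda>p. v $ j * ee 0 p) n" by (simp add: std.co_def dotc_axis ee_def)
  also have "\<dots> = v $ j * fc (ee 0) n" by (rule fc_mult)
  also have "fc (ee 0) n = (if n = 0 then 1 else 0)"
  proof -
    have "(\<lambda>t. ee 0 (circ t) * cis (- (of_int n * t))) = (\<lambda>t. cis (of_int (- n) * t))" by simp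
    then show ?thesis unfolding fc_def by (simp only: integral_cis_int) simp
  qed
  finally show ?thesis by simp
qed

text \<open>The value 1 at n = 0 reflects that \<epsilon> is the identity on constants.\<close>

definition sgn_symbol :: "int \<Rightarrow> complex" where
  "sgn_symbol n = (if n \<ge> 0 then 1 else - 1)"

theorem eps_complex_eq:
  fixes f :: "circle \<Rightarrow> complex^'k"
  assumes f: "f \<in> Cinf"
  shows "eps_complex f = std.Mult (\<lambda>j. sgn_symbol) f"
proof -
  let ?A = "{h \<in> Cinf. mean h = 0} :: (circle \<Rightarrow> complex^'k) set"
  \<comment> \<open>The convention 1 / 0 = 0 makes the multiplier ?r annihilate constants, so that
    the preimage h built from it has mean zero.\<close>
  let ?s = "\<lambda>(j::'k) n. complex_of_real \<bar>real_of_int n\<bar>" and ?r = "\<lambda>(j::'k) n. complex_of_real (1 / \<bar>real_of_int n\<bar>)"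
  have pr: "polyb ?r"
  proof (rule polyb_bounded[where S = 1])
    fix n :: int
    have "\<bar>real_of_int n\<bar> \<ge> 1" if "n \<noteq> 0" using that by linarith
    then show "norm (complex_of_real (1 / \<bar>real_of_int n\<bar>)) \<le> 1" by (cases "n = 0") (auto simp: norm_divide divide_simps)
  qed
  define h where "h = std.Mult ?r f"
  have hC: "h \<in> Cinf" unfolding h_def by (rule std.Mult_Cinf[OF pr f])
  have coh: "std.co h j n = complex_of_real (1 / \<bar>real_of_int n\<bar>) * std.co f j n" for j n
    unfolding h_def by (rule std.co_Mult[OF pr f])
  have mC: "(\<lambda>q. f q - mean f) \<in> Cinf" by (intro Cinf_diff f Cinf_const)
  have "mean h $ j = 0" for j unfolding mean_co[OF hC] coh by simp
  then have hm: "mean h = 0" by (simp add: vec_eq_iff)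
  have inj: "inj_on absD_complex ?A"
  proof (rule inj_onI)
    fix x y assume xy: "x \<in> ?A" "y \<in> ?A" "absD_complex x = absD_complex y"
    then have C: "x \<in> Cinf" "y \<in> Cinf" and m: "mean x = 0" "mean y = 0" by auto
    show "x = y"
    proof (rule std.co_inject[OF C])
      fix j n
      show "std.co x j n = std.co y j n"
      proof (cases "n = 0")
        case True then show ?thesis using mean_co[OF C(1), of j] mean_co[OF C(2), of j] m by simp
      next
        case False
        have "of_real \<bar>real_of_int n\<bar> * std.co x j n = of_real \<bar>real_of_int n\<bar> * std.co y j n"
          using xy(3) unfolding absD_complex_eq[OF C(1)] absD_complex_eq[OF C(2)]
          by (metis std.co_Mult[OF polyb_abs C(1)] std.co_Mult[OF polyb_abs C(2)])
        then show ?thesis using False by simp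
      qed
    qed
  qed
  have ah: "absD_complex h = (\<lambda>q. f q - mean f)"
    unfolding absD_complex_eq[OF hC]
  proof (rule std.co_inject[OF std.Mult_Cinf[OF polyb_abs hC] mC])
    fix j n
    show "std.co (std.Mult ?s h) j n = std.co (\<lambda>q. f q - mean f) j n"
      unfolding std.co_Mult[OF polyb_abs hC] std.co_diff[OF f Cinf_const] co_const
      by (simp add: coh mean_co[OF f])
  qed
  have inv: "inv_into ?A absD_complex (\<lambda>q. f q - mean f) = h"
    using inv_into_f_f[OF inj, of h] hC hm by (simp add: ah)
  have ps: "polyb (\<lambda>j::'k. sgn_symbol)" by (rule polyb_bounded[where S = 1]) (simp add: sgn_symbol_def)
  have "(\<lambda>p. D_complex h p + mean f) = std.Mult (\<lambda>j. sgn_symbol) f"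
    unfolding D_complex_def
  proof (rule std.co_inject[OF _ std.Mult_Cinf[OF ps f]])
    have DC: "(\<lambda>p. (- \<i>) *s ddt h p) \<in> Cinf" by (intro Cinf_smult Cinf_const Cinf_ddt hC)
    then show "(\<lambda>p. (- \<i>) *s ddt h p + mean f) \<in> Cinf" by (intro Cinf_add Cinf_const)
    fix j n
    show "std.co (\<lambda>p. (- \<i>) *s ddt h p + mean f) j n = std.co (std.Mult (\<lambda>j. sgn_symbol) f) j n"
      unfolding std.co_add[OF DC Cinf_const] std.co_smult co_ddt[OF hC] co_const std.co_Mult[OF ps f]
      by (cases "n = 0") (auto simp: coh mean_co[OF f] sgn_symbol_def abs_if)
  qed
  then show ?thesis by (simp add: eps_complex_def[abs_def] inv)
qed

section \<open>Linear differential equations\<close>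

lemma lsum_nat_Suc:
  fixes a :: "nat \<Rightarrow> 'v::{banach,second_countable_topology}"
  assumes "asum a"
  shows "lsum a = a 0 + lsum (\<lambda>n. a (Suc n))"
proof -
  have s: "a sums lsum a" by (rule sums_integral_count_space_nat[OF assms])
  have "asum (\<lambda>n. norm (a n))" using assms by (rule integrable_norm)
  then have "summable (\<lambda>n. norm (a n))" by (simp add: integrable_count_space_nat_iff)
  then have "summable (\<lambda>n. norm (a (Suc n)))" by (rule iffD2[OF summable_Suc_iff[of "\<lambda>n. norm (a n)"]])
  then have "asum (\<lambda>n. a (Suc n))" by (simp add: integrable_count_space_nat_iff)
  then have "(\<lambda>n. a (Suc n)) sums lsum (\<lambda>n. a (Suc n))" by (rule sums_integral_count_space_nat)
  then have "a sums (lsum (\<lambda>n. a (Suc n)) + a 0)" by (simp add: sums_Suc_iff)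
  with s show ?thesis by (simp add: sums_unique2 add.commute)
qed

text \<open>In the norm weighted by exp (c * |t|), integration from 0 has operator norm at most 1 /
  c.\<close>

lemma norm_le_of_deriv:
  fixes Y :: "real \<Rightarrow> 'v::euclidean_space"
  assumes d: "\<And>t. (Y has_vector_derivative Y' t) (at t)" and 0: "Y 0 = 0"
    and b: "\<And>t. norm (Y' t) \<le> B * exp (c * \<bar>t\<bar>)" and B: "B \<ge> 0" and c: "c > 0"
  shows "norm (Y t) \<le> (B / c) * exp (c * \<bar>t\<bar>)"
proof -
  have key: "norm (Z s) \<le> (B / c) * exp (c * s)"
    if "s \<ge> 0" "\<And>t. (Z has_vector_derivative Z' t) (at t)" "Z 0 = 0" "\<And>t. norm (Z' t) \<le> B * exp (c * \<bar>t\<bar>)" for Z Z' :: "real \<Rightarrow> 'v" and s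
  proof -
    have I: "(Z' has_integral Z s - Z 0) {0..s}"
      by (rule fundamental_theorem_of_calculus) (use that in \<open>auto intro: has_vector_derivative_at_within\<close>)
    have J: "((\<lambda>t. B * exp (c * t)) has_integral (B / c) * exp (c * s) - (B / c) * exp (c * 0)) {0..s}"
      by (rule fundamental_theorem_of_calculus)
         (use that(1) c in \<open>auto intro!: has_vector_derivative_at_within derivative_eq_intros simp flip: has_real_derivative_iff_has_vector_derivative\<close>)
    have "norm (integral {0..s} Z') \<le> integral {0..s} (\<lambda>t. B * exp (c * t))"
    proof (rule integral_norm_bound_integral[OF has_integral_integrable[OF I] has_integral_integrable[OF J]])
      fix t assume "t \<in> {0..s}"
      then show "norm (Z' t) \<le> B * exp (c * t)" using that(4)[of t] by simp
    qed
    then have "norm (Z s - Z 0) \<le> (B / c) * exp (c * s) - (B / c) * exp (c * 0)"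
      by (simp only: integral_unique[OF I] integral_unique[OF J])
    moreover have "(B / c) * exp (c * 0) \<ge> 0" using B c by simp
    ultimately have "norm (Z s - Z 0) \<le> (B / c) * exp (c * s)" by linarith
    then show ?thesis using that(3) by simp
  qed
  show ?thesis
  proof (cases "t \<ge> 0")
    case True
    then show ?thesis using key[OF True d 0 b] by simp
  next
    case False
    have d': "((\<lambda>s. Y (- s)) has_vector_derivative - Y' (- s)) (at s)" for s
    proof -
      have "((Y \<circ> uminus) has_vector_derivative (-1) *\<^sub>R Y' (- s)) (at s)"
        by (rule vector_diff_chain_at) (auto intro!: derivative_eq_intros d)
      then show ?thesis by (simp add: o_def)
    qed
    have "norm (Y (- (- t))) \<le> (B / c) * exp (c * (- t))"
      by (rule key[OF _ d']) (use False 0 b[of "- _"] in auto)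
    then show ?thesis using False by simp
  qed
qed

text \<open>The Picard series: y n is the n-th iterate of the integral operator applied to the
  constant v. With the weight exp (2 * L * |t|) every iteration at least halves the bound, so the
  series converges on the whole line at once.\<close>

theorem linear_ode:
  fixes f :: "real \<Rightarrow> 'v::euclidean_space \<Rightarrow> 'v"
  assumes lin: "\<And>t. bounded_linear (f t)" and L: "L > 0" "\<And>t v. norm (f t v) \<le> L * norm v"
    and c: "\<And>y. continuous_on UNIV y \<Longrightarrow> continuous_on UNIV (\<lambda>t. f t (y t))"
  obtains Y where "Y 0 = v" "\<And>t. (Y has_vector_derivative f t (Y t)) (at t)"
proof -
  define Q where "Q y Y \<longleftrightarrow> Y 0 = 0 \<and> (\<forall>t. (Y has_vector_derivative f t (y t)) (at t))" for y Y
  define J where "J y = (SOME Y. Q y Y)" for y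
  have J: "J y 0 = 0 \<and> (\<forall>t. (J y has_vector_derivative f t (y t)) (at t))" if "continuous_on UNIV y" for y
  proof -
    have c1: "continuous_on UNIV (\<lambda>t. f t (y t))" by (rule c[OF that])
    obtain \<Phi> where \<Phi>: "\<And>t. (\<Phi> has_vector_derivative f t (y t)) (at t)" by (rule global_antiderivative[OF c1]) (rule that)
    have "((\<lambda>t. \<Phi> t - \<Phi> 0) has_vector_derivative f t (y t)) (at t)" for t
      using has_vector_derivative_diff[OF \<Phi> has_vector_derivative_const] by simp
    then have "Q y (\<lambda>t. \<Phi> t - \<Phi> 0)" by (simp add: Q_def)
    then have "Q y (J y)" unfolding J_def by (rule someI[of "Q y"])
    then show ?thesis by (simp add: Q_def)
  qed
  define y where "y n = (J ^^ n) (\<lambda>_. v)" for n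
  have yc: "continuous_on UNIV (y n)" for n
  proof (induction n)
    case (Suc n)
    show ?case using J[OF Suc] by (intro vector_derivative_continuous_on[where f' = "\<lambda>t. f t (y n t)"]) (simp add: y_def)
  qed (simp add: y_def)
  have y0: "y 0 = (\<lambda>_. v)" and yS0: "y (Suc n) 0 = 0" and yS: "(y (Suc n) has_vector_derivative f t (y n t)) (at t)" for n t
    using J[OF yc[of n]] by (simp_all add: y_def)
  have yb: "norm (y n t) \<le> (norm v / 2 ^ n) * exp (2 * L * \<bar>t\<bar>)" for n t
  proof (induction n arbitrary: t)
    case 0
    have "norm v * 1 \<le> norm v * exp (2 * L * \<bar>t\<bar>)" using L(1) by (intro mult_left_mono) auto
    then show ?case by (simp add: y0)
  next
    case (Suc n)
    have "norm (f t (y n t)) \<le> (L * (norm v / 2 ^ n)) * exp (2 * L * \<bar>t\<bar>)" for t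
      using order_trans[OF L(2) mult_left_mono[OF Suc[of t]]] L(1) by (simp add: mult_ac)
    from norm_le_of_deriv[OF yS yS0 this] L(1)
    have "norm (y (Suc n) t) \<le> (L * (norm v / 2 ^ n)) / (2 * L) * exp (2 * L * \<bar>t\<bar>)" by simp
    also have "(L * (norm v / 2 ^ n)) / (2 * L) = norm v / 2 ^ Suc n" using L(1) by simp
    finally show ?case .
  qed
  have geo: "asum (\<lambda>n. (C / 2 ^ n) :: real)" for C
  proof -
    have "summable (\<lambda>n. C * (1 / 2) ^ n)" by (intro summable_mult summable_geometric) simp
    then have "summable (\<lambda>n. \<bar>C\<bar> * (1 / 2) ^ n)" by (intro summable_mult summable_geometric) simp
    then show ?thesis by (simp add: integrable_count_space_nat_iff power_one_over abs_mult field_simps)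
  qed
  have ya: "asum (\<lambda>n. y n t)" for t
    by (rule asum_bound[OF geo[of "norm v * exp (2 * L * \<bar>t\<bar>)"]]) (use yb[of _ t] in simp)
  define Y where "Y t = lsum (\<lambda>n. y n t)" for t
  have YZ: "Y t = v + lsum (\<lambda>n. y (Suc n) t)" for t
    unfolding Y_def using lsum_nat_Suc[OF ya, of t] by (simp add: y0)
  have dZ: "((\<lambda>t. lsum (\<lambda>n. y (Suc n) t)) has_vector_derivative lsum (\<lambda>n. f t (y n t))) (at t)" for t
  proof (rule has_vector_derivative_integral[where a = "t - 1" and b = "t + 1" and W = "\<lambda>n. (L * (norm v * exp (2 * L * (\<bar>t\<bar> + 1)))) / 2 ^ n"])
    fix x n assume x: "x \<in> {t - 1<..<t + 1}"
    have "norm (f x (y n x)) \<le> L * ((norm v / 2 ^ n) * exp (2 * L * \<bar>x\<bar>))"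
      using L(1) by (intro order_trans[OF L(2) mult_left_mono[OF yb]]) simp
    also have "\<dots> \<le> L * ((norm v / 2 ^ n) * exp (2 * L * (\<bar>t\<bar> + 1)))"
      using L(1) x by (intro mult_left_mono) auto
    finally show "norm (f x (y n x)) \<le> (L * (norm v * exp (2 * L * (\<bar>t\<bar> + 1)))) / 2 ^ n" by simp
  next
    fix x
    show "asum (\<lambda>n. y (Suc n) x)"
      by (rule asum_bound[OF geo[of "norm v * exp (2 * L * \<bar>x\<bar>) / 2"]]) (use yb[of "Suc _" x] in simp)
  qed (use yS geo in auto)
  have "lsum (\<lambda>n. f t (y n t)) = f t (Y t)" for t
    unfolding Y_def by (rule integral_bounded_linear[OF lin ya])
  then have dY: "(Y has_vector_derivative f t (Y t)) (at t)" for t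
    using has_vector_derivative_add[OF has_vector_derivative_const[of v] dZ[of t]] by (simp add: YZ[abs_def, symmetric])
  have Y0: "Y 0 = v" using YZ[of 0] by (simp add: yS0)
  show ?thesis by (rule that[OF Y0 dY])
qed

text \<open>The equation expresses the derivative through Y itself, so each order of smoothness
  yields the next.\<close>

lemma ode_smooth:
  fixes W :: "real \<Rightarrow> complex^'k^'k" and Y :: "real \<Rightarrow> complex^'k"
  assumes W: "ub {} (\<lambda>_::unit. W)" and Y: "\<And>t. (Y has_vector_derivative W t *v Y t) (at t)"
  shows "ub {} (\<lambda>_::unit. Y)"
proof -
  have "ubk {} k (\<lambda>_::unit. Y)" for k
  proof (induction k)
    case (Suc k)
    have "ubk {} k (\<lambda>_::unit. \<lambda>t. W t *v Y t)"
      by (rule ubk_bilinear[OF bb_matvec _ Suc]) (use W in \<open>simp add: ub_def\<close>)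
    then show ?case by (rule ubk_SucI[rotated 2]) (use Y in auto)
  qed simp
  then show ?thesis by (simp add: ub_def)
qed

section \<open>Eigenbases of isometries\<close>

lemma matvec_sum: "M *v (\<Sum>i\<in>I. f i) = (\<Sum>i\<in>I. M *v (f i :: complex^'k))"
  by (induction I rule: infinite_finite_induct) (auto simp: matrix_vector_right_distrib)

text \<open>The first CARD('k) + 1 iterates of a vector are linearly dependent, and a dependence
  relation is a polynomial in M annihilating the vector.\<close>

lemma annihilating_poly:
  fixes M :: "complex^'k^'k" and x :: "complex^'k"
  obtains p :: "complex poly" where "p \<noteq> 0" "(\<Sum>i\<le>degree p. coeff p i *s (((*v) M ^^ i) x)) = 0"
proof -
  let ?K = "CARD('k)" and ?y = "\<lambda>i. ((*v) M ^^ i) x"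
  have "\<exists>c. (\<exists>i\<le>?K. c i \<noteq> 0) \<and> (\<Sum>i\<le>?K. c i *s ?y i) = 0"
  proof (cases "inj_on ?y {..?K}")
    case True
    let ?S = "?y ` {..?K}"
    have "card ?S = ?K + 1" using True by (simp add: card_image)
    moreover have "vec.dim ?S \<le> ?K" using vec.dim_subset[OF subset_UNIV, of ?S] by (simp only: vec_dim_card)
    ultimately have "vec.dependent ?S" by (intro vec.dependent_biggerset_general) simp
    then obtain u v where u: "v \<in> ?S" "u v \<noteq> 0" "(\<Sum>v\<in>?S. u v *s v) = 0"
      using vec.dependent_finite[of ?S] by auto
    have "(\<Sum>i\<le>?K. u (?y i) *s ?y i) = 0" using u(3) by (simp add: sum.reindex[OF True])
    with u(1,2) show ?thesis by (intro exI[of _ "\<lambda>i. u (?y i)"]) auto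
  next
    \<comment> \<open>Linear dependence is a property of sets and does not see repetitions, so two
      coinciding iterates are treated apart.\<close>
    case False
    then obtain i j where ij: "i \<le> ?K" "j \<le> ?K" "i \<noteq> j" "?y i = ?y j" by (auto simp: inj_on_def)
    have "(\<Sum>k\<le>?K. (if k = i then 1 else if k = j then - 1 else 0) *s ?y k) = (\<Sum>k\<in>{i, j}. (if k = i then 1 else if k = j then - 1 else 0) *s ?y k)"
      by (rule sum.mono_neutral_right) (use ij in auto)
    also have "\<dots> = 0" using ij by (simp add: vec_eq_iff)
    finally show ?thesis using ij(1) by (intro exI[of _ "\<lambda>k. if k = i then 1 else if k = j then - 1 else 0"]) auto
  qed
  then obtain c i where c: "i \<le> ?K" "c i \<noteq> 0" "(\<Sum>i\<le>?K. c i *s ?y i) = 0" by blast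
  define p where "p = Poly (map c [0..<Suc ?K])"
  have cp: "coeff p n = (if n \<le> ?K then c n else 0)" for n
    by (simp add: p_def nth_default_def less_Suc_eq_le del: upt_Suc)
  have "degree p \<le> ?K" by (rule degree_le) (simp add: cp)
  then have "(\<Sum>i\<le>degree p. coeff p i *s ?y i) = (\<Sum>i\<le>?K. coeff p i *s ?y i)"
    by (intro sum.mono_neutral_left) (auto simp: coeff_eq_0 not_le)
  also have "\<dots> = 0" using c(3) by (simp add: cp)
  finally have "(\<Sum>i\<le>degree p. coeff p i *s ?y i) = 0" .
  moreover have "p \<noteq> 0" using cp[of i] c by auto
  ultimately show ?thesis by (rule that[rotated])
qed

text \<open>Let p have minimal degree among the polynomials annihilating x and let a be a root, p =
  (X - a) * q. Then q(M) x is nonzero by minimality and an eigenvector for a. Being a combination of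
  iterates of x, it stays in every invariant subspace containing x.\<close>

lemma eigenvector_in_orbit:
  fixes M :: "complex^'k^'k" and x :: "complex^'k"
  assumes x: "x \<noteq> 0"
  obtains a y q where "y \<noteq> 0" "M *v y = a *s y" "y = (\<Sum>i\<le>degree q. coeff q i *s (((*v) M ^^ i) x))"
proof -
  let ?y = "\<lambda>i. ((*v) M ^^ i) x"
  let ?ev = "\<lambda>p. \<Sum>i\<le>degree p. coeff p i *s ?y i"
  define P where "P p \<longleftrightarrow> p \<noteq> 0 \<and> ?ev p = 0" for p
  obtain p0 where "P p0" using annihilating_poly[of M x] unfolding P_def by blast
  then obtain p where p: "P p" "\<And>q. P q \<Longrightarrow> degree p \<le> degree q" using ex_has_least_nat[of P p0 degree] by blast
  have "degree p \<noteq> 0"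
  proof
    assume "degree p = 0"
    then have "coeff p 0 *s x = 0" using p(1) by (simp add: P_def)
    moreover have "coeff p 0 \<noteq> 0" using p(1) \<open>degree p = 0\<close> leading_coeff_0_iff[of p] by (simp add: P_def)
    ultimately show False using x by simp
  qed
  then have "\<not> constant (poly p)" by (simp add: constant_degree)
  then obtain a where "poly p a = 0" using fundamental_theorem_of_algebra by blast
  then obtain q where q: "p = [:- a, 1:] * q" by (auto simp: poly_eq_0_iff_dvd elim: dvdE)
  have q0: "q \<noteq> 0" using p(1) q by (auto simp: P_def)
  have dq: "degree p = Suc (degree q)" unfolding q using q0 by (subst degree_mult_eq) auto
  have "?ev q \<noteq> 0" using p(2)[of q] q0 dq by (auto simp: P_def)
  moreover have "M *v ?ev q = a *s ?ev q"
  proof -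
    let ?D = "degree q"
    have cp: "coeff p i = (case i of 0 \<Rightarrow> 0 | Suc j \<Rightarrow> coeff q j) - a * coeff q i" for i
      unfolding q by (simp add: coeff_pCons split: nat.splits)
    have "0 = (\<Sum>i\<le>Suc ?D. coeff p i *s ?y i)" using p(1) dq by (simp add: P_def)
    also have "\<dots> = (\<Sum>i\<le>Suc ?D. (case i of 0 \<Rightarrow> 0 | Suc j \<Rightarrow> coeff q j) *s ?y i) - (\<Sum>i\<le>Suc ?D. (a * coeff q i) *s ?y i)"
      unfolding cp sum_subtractf[symmetric] by (rule sum.cong[OF refl]) (simp add: vec_eq_iff left_diff_distrib)
    also have "(\<Sum>i\<le>Suc ?D. (case i of 0 \<Rightarrow> 0 | Suc j \<Rightarrow> coeff q j) *s ?y i) = (\<Sum>i\<le>?D. coeff q i *s ?y (Suc i))"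
      by (subst sum.atMost_Suc_shift) simp
    also have "\<dots> = M *v ?ev q" by (simp add: matvec_sum matvec_smult)
    also have "(\<Sum>i\<le>Suc ?D. (a * coeff q i) *s ?y i) = a *s ?ev q"
      by (simp add: coeff_eq_0 vec.scale_sum_right)
    finally show ?thesis by simp
  qed
  ultimately show ?thesis by (rule that) (rule refl)
qed

text \<open>Eigenvectors are found one at a time in the orthogonal complement W of the previous
  ones. The isometry maps W into itself because the earlier eigenvalues are nonzero, so the orbit of
  a vector of W, and with it the new eigenvector, remains in W.\<close>

lemma orthonormal_eigenbasis:
  fixes M :: "complex^'k^'k" and h :: "complex^'k \<Rightarrow> complex^'k \<Rightarrow> complex"
  assumes h_add: "\<And>u v x. h (u + v) x = h u x + h v x" and h_sc: "\<And>c u x. h (c *s u) x = c * h u x"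
    and h_sym: "\<And>u v. h v u = cnj (h u v)" and h_pos: "\<And>u. u \<noteq> 0 \<Longrightarrow> Re (h u u) > 0"
    and iso: "\<And>u v. h (M *v u) (M *v v) = h u v"
  obtains v \<mu> where "\<And>i j::'k. h (v i) (v j) = (if i = j then 1 else 0)" "\<And>j. M *v v j = \<mu> j *s v j" "\<And>j. norm (\<mu> j) = 1"
proof -
  have h_sc2: "h u (c *s v) = cnj c * h u v" for c u v
  proof -
    have "h u (c *s v) = cnj (h (c *s v) u)" by (rule h_sym)
    also have "\<dots> = cnj c * cnj (h v u)" by (simp only: h_sc complex_cnj_mult)
    also have "cnj (h v u) = h u v" by (rule h_sym[symmetric])
    finally show ?thesis .
  qed
  have h_0: "h 0 x = 0" for x using h_sc[of 0 0 x] by simp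
  have h_sum: "h (\<Sum>i\<in>I. f i) x = (\<Sum>i\<in>I. h (f i) x)" for I x and f :: "nat \<Rightarrow> complex^'k"
    by (induction I rule: infinite_finite_induct) (auto simp: h_0 h_add)
  have h_diff: "h (u - v) x = h u x - h v x" for u v x using h_add[of "u - v" v x] by simp
  have ext: "\<exists>e \<mu>. (\<forall>i<n. \<forall>j<n. h (e i) (e j) = (if i = j then 1 else 0)) \<and> (\<forall>j<n. M *v e j = \<mu> j *s e j \<and> norm (\<mu> j) = 1)"
    if "n \<le> CARD('k)" for n :: nat
    using that
  proof (induction n)
    case 0 then show ?case by simp
  next
    case (Suc n)
    then obtain e \<mu> where e: "\<And>i j. i < n \<Longrightarrow> j < n \<Longrightarrow> h (e i) (e j) = (if i = j then 1 else 0)"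
      and m: "\<And>j. j < n \<Longrightarrow> M *v e j = \<mu> j *s e j" "\<And>j. j < n \<Longrightarrow> norm (\<mu> j) = 1" by (metis Suc_leD)
    define W where "W = {x. \<forall>i<n. h x (e i) = 0}"
    have "vec.span (e ` {..<n}) \<noteq> UNIV"
    proof
      assume "vec.span (e ` {..<n}) = UNIV"
      then have "vec.dim (UNIV :: (complex^'k) set) \<le> card (e ` {..<n})" by (intro vec.dim_le_card) auto
      also have "\<dots> \<le> n" using card_image_le[of "{..<n}" e] by simp
      finally have "CARD('k) \<le> n" by (simp only: vec_dim_card)
      then show False using Suc.prems by simp
    qed
    then obtain u where u: "u \<notin> vec.span (e ` {..<n})" by blast
    define x where "x = u - (\<Sum>i<n. h u (e i) *s e i)"
    have "(\<Sum>i<n. h u (e i) *s e i) \<in> vec.span (e ` {..<n})"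
      by (intro vec.span_sum vec.span_scale vec.span_base) auto
    then have x0: "x \<noteq> 0" using u by (auto simp: x_def)
    have xW: "x \<in> W" unfolding W_def
    proof (intro CollectI allI impI)
      fix j assume j: "j < n"
      have "(\<Sum>i<n. h u (e i) * h (e i) (e j)) = (\<Sum>i<n. if i = j then h u (e j) else 0)"
        by (rule sum.cong) (use e j in auto)
      then show "h x (e j) = 0" using j by (simp add: x_def h_diff h_sum h_sc)
    qed
    have MW: "M *v y \<in> W" if y: "y \<in> W" for y
      unfolding W_def
    proof (intro CollectI allI impI)
      fix i assume i: "i < n"
      have "h (M *v y) (M *v e i) = 0" using y i by (simp add: iso W_def)
      then have "cnj (\<mu> i) * h (M *v y) (e i) = 0" using m(1)[OF i] by (simp add: h_sc2)
      then show "h (M *v y) (e i) = 0" using m(2)[OF i] by auto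
    qed
    have orb: "((*v) M ^^ i) x \<in> W" for i by (induction i) (auto simp: xW MW)
    obtain a y q where y: "y \<noteq> 0" "M *v y = a *s y" "y = (\<Sum>i\<le>degree q. coeff q i *s (((*v) M ^^ i) x))"
      by (rule eigenvector_in_orbit[OF x0]) (rule that)
    have yW: "y \<in> W" using orb unfolding y(3) W_def by (simp add: h_sum h_sc)
    define r where "r = sqrt (Re (h y y))"
    have r: "r > 0" "r * r = Re (h y y)" using h_pos[OF y(1)] by (auto simp: r_def)
    have hyy: "h y y = of_real (r * r)" using h_sym[of y y] r(2) by (simp add: complex_eq_iff)
    define z where "z = of_real (1 / r) *s y"
    have zz: "h z z = 1" unfolding z_def h_sc h_sc2 hyy using r(1) by simp
    have Mz: "M *v z = a *s z" by (simp add: z_def matvec_smult y(2) smult_assoc mult.commute)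
    have "h (M *v z) (M *v z) = a * cnj a * h z z" unfolding Mz h_sc h_sc2 by simp
    then have "a * cnj a = 1" using iso[of z z] zz by simp
    then have "complex_of_real ((norm a)\<^sup>2) = of_real 1" by (simp only: complex_norm_square of_real_1)
    then have "(norm a)\<^sup>2 = 1\<^sup>2" by (simp only: of_real_eq_iff power_one)
    then have na: "norm a = 1" by (simp only: power2_eq_iff_nonneg norm_ge_zero zero_le_one)
    have ze: "h z (e i) = 0" "h (e i) z = 0" if "i < n" for i
      using yW that h_sym[of z "e i"] by (auto simp: z_def h_sc W_def)
    let ?e = "\<lambda>i. if i = n then z else e i" and ?m = "\<lambda>i. if i = n then a else \<mu> i"
    have "(\<forall>i<Suc n. \<forall>j<Suc n. h (?e i) (?e j) = (if i = j then 1 else 0)) \<and> (\<forall>j<Suc n. M *v ?e j = ?m j *s ?e j \<and> norm (?m j) = 1)"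
      using e m zz Mz na ze by (auto simp: less_Suc_eq)
    then show ?case by (intro exI[of _ ?e] exI[of _ ?m])
  qed
  obtain e \<mu> where em: "(\<forall>i<CARD('k). \<forall>j<CARD('k). h (e i) (e j) = (if i = j then 1 else 0)) \<and> (\<forall>j<CARD('k). M *v e j = \<mu> j *s e j \<and> norm (\<mu> j) = 1)"
    using ext[OF order_refl] by (elim exE) (rule that)
  have e: "\<And>i j. i < CARD('k) \<Longrightarrow> j < CARD('k) \<Longrightarrow> h (e i) (e j) = (if i = j then 1 else 0)"
      and m: "\<And>j. j < CARD('k) \<Longrightarrow> M *v e j = \<mu> j *s e j" "\<And>j. j < CARD('k) \<Longrightarrow> norm (\<mu> j) = 1"
    using em by simp_all
  obtain b where b: "bij_betw b (UNIV :: 'k set) {0..<CARD('k)}" using ex_bij_betw_finite_nat[of "UNIV :: 'k set"] by auto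
  then have bl: "b i < CARD('k)" and bi: "b i = b j \<longleftrightarrow> i = j" for i j
    by (auto simp: bij_betw_def inj_on_def)
  show ?thesis by (rule that[of "\<lambda>i. e (b i)" "\<lambda>i. \<mu> (b i)"]) (use e m bl bi in auto)
qed

section \<open>Riemannian connections\<close>

definition cxv :: "real^'k \<Rightarrow> complex^'k" where "cxv v = (\<chi> i. of_real (v $ i))"
definition cxm :: "real^'k^'k \<Rightarrow> complex^'k^'k" where "cxm M = (\<chi> i j. of_real (M $ i $ j))"
definition vcnj :: "complex^'k \<Rightarrow> complex^'k" where "vcnj v = (\<chi> i. cnj (v $ i))"
definition vre :: "complex^'k \<Rightarrow> real^'k" where "vre v = (\<chi> i. Re (v $ i))"

lemma bounded_linear_cxv: "bounded_linear cxv"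
  by (subst linear_conv_bounded_linear[symmetric], rule linearI) (auto simp: cxv_def vec_eq_iff scaleR_conv_of_real[where 'a=complex])
lemma bounded_linear_cxm: "bounded_linear cxm"
  by (subst linear_conv_bounded_linear[symmetric], rule linearI) (auto simp: cxm_def vec_eq_iff scaleR_conv_of_real[where 'a=complex])
lemma bounded_linear_vcnj: "bounded_linear vcnj"
  by (subst linear_conv_bounded_linear[symmetric], rule linearI) (auto simp: vcnj_def vec_eq_iff)
lemma bounded_linear_vre: "bounded_linear vre"
  by (subst linear_conv_bounded_linear[symmetric], rule linearI) (auto simp: vre_def vec_eq_iff)

lemma vcnj_cxv [simp]: "vcnj (cxv v) = cxv v" and vre_cxv [simp]: "vre (cxv v) = v"
  and vcnj_vcnj [simp]: "vcnj (vcnj u) = u" and cxv_inject [simp]: "cxv v = cxv v' \<longleftrightarrow> v = v'"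
  by (auto simp: vcnj_def cxv_def vre_def vec_eq_iff)

lemma cxv_vre: "vcnj u = u \<Longrightarrow> cxv (vre u) = u"
  by (simp add: vcnj_def cxv_def vre_def vec_eq_iff complex_eq_iff)

lemma vcnj_smult: "vcnj (c *s u) = cnj c *s vcnj u" and vcnj_add: "vcnj (u + v) = vcnj u + vcnj v"
  and cxm_vcnj: "cxm M *v vcnj u = vcnj (cxm M *v u)" and cxm_cxv: "cxm M *v cxv x = cxv (M *v x)"
  by (auto simp: vcnj_def cxm_def cxv_def vec_eq_iff matrix_vector_mult_def)

lemma cxm_mult: "cxm (A ** B) = cxm A ** cxm B" and cxm_add: "cxm (A + B) = cxm A + cxm B"
  and cxm_transpose: "cxm (transpose A) = transpose (cxm A)"
  by (auto simp: cxm_def vec_eq_iff matrix_matrix_mult_def transpose_def)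

lemma dotc_commute: "dotc u v = dotc v u"
  by (simp add: dotc_def mult.commute)

lemma dotc_transpose: "dotc y (transpose W *v x) = dotc (W *v y) x"
proof -
  have "dotc y (transpose W *v x) = (\<Sum>i\<in>UNIV. \<Sum>j\<in>UNIV. y $ i * (W $ j $ i * x $ j))"
    by (simp add: dotc_def matrix_vector_mult_def transpose_def sum_distrib_left)
  also have "\<dots> = (\<Sum>j\<in>UNIV. \<Sum>i\<in>UNIV. y $ i * (W $ j $ i * x $ j))" by (rule sum.swap)
  also have "\<dots> = dotc (W *v y) x"
    by (simp add: dotc_def matrix_vector_mult_def sum_distrib_left sum_distrib_right mult_ac)
  finally show ?thesis .
qed

text \<open>The sesquilinear extension of the fibre metric P, conjugate-linear in the second
  argument.\<close>

definition hf :: "real^'k^'k \<Rightarrow> complex^'k \<Rightarrow> complex^'k \<Rightarrow> complex" where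
  "hf P u v = dotc u (cxm P *v vcnj v)"

lemma dotc_add_left: "dotc (u + v) x = dotc u x + dotc v x"
  by (rule bounded_bilinear.add_left[OF bb_dotc])
lemma dotc_add_right: "dotc x (u + v) = dotc x u + dotc x v"
  by (rule bounded_bilinear.add_right[OF bb_dotc])
lemma dotc_smult_left: "dotc (c *s u) x = c * dotc u x" and dotc_smult_right: "dotc x (c *s u) = c * dotc x u"
  by (auto simp: dotc_def sum_distrib_left mult_ac)

lemma hf_add1: "hf P (u + v) x = hf P u x + hf P v x" and hf_smult1: "hf P (c *s u) x = c * hf P u x"
  and hf_add2: "hf P x (u + v) = hf P x u + hf P x v" and hf_smult2: "hf P x (c *s u) = cnj c * hf P x u"
  by (auto simp: hf_def dotc_add_left dotc_smult_left dotc_add_right dotc_smult_right vcnj_add vcnj_smult matrix_vector_right_distrib matvec_smult)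

lemma hf_zero: "hf P 0 x = 0" "hf P x 0 = 0"
  using hf_smult1[of P 0 0 x] hf_smult2[of P x 0 0] by simp_all

lemma hf_sum2: "hf P x (\<Sum>i\<in>I. f i) = (\<Sum>i\<in>I. hf P x (f i))"
  by (induction I rule: infinite_finite_induct) (auto simp: hf_zero hf_add2)

lemma hf_vcnj: "hf P (vcnj u) (vcnj v) = cnj (hf P u v)"
  unfolding hf_def cxm_vcnj by (simp add: dotc_def vcnj_def)

lemma hf_sym:
  assumes "transpose P = P"
  shows "hf P v u = cnj (hf P u v)"
proof -
  have "hf P v u = dotc (cxm P *v v) (vcnj u)"
    using dotc_transpose[of v "cxm P" "vcnj u"] by (simp add: hf_def assms flip: cxm_transpose)
  also have "\<dots> = cnj (hf P u v)" unfolding hf_def cxm_vcnj by (simp add: dotc_def vcnj_def mult.commute)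
  finally show ?thesis .
qed

lemma hf_cxv: "hf P (cxv x) (cxv y) = of_real (x \<bullet> (P *v y))"
  by (simp add: hf_def cxm_cxv) (simp add: dotc_def cxv_def inner_vec_def)

lemma Re_hf: "Re (hf P (cxv x) v) = x \<bullet> (P *v vre v)"
  by (simp add: hf_def dotc_def cxv_def cxm_def vre_def vcnj_def inner_vec_def matrix_vector_mult_def)

text \<open>For u = x + i * y the mixed terms contribute nothing to the real part, by linearity in
  the first and conjugate-linearity in the second argument.\<close>

lemma hf_pos:
  assumes pos: "\<And>v. v \<noteq> 0 \<Longrightarrow> v \<bullet> (P *v v) > 0" and u: "u \<noteq> 0"
  shows "Re (hf P u u) > 0"
proof -
  define x y where "x = vre u" and "y = (\<chi> i. Im (u $ i))"
  have uxy: "u = cxv x + \<i> *s cxv y" by (simp add: x_def y_def vre_def cxv_def vec_eq_iff complex_eq_iff)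
  have "Re (hf P u u) = x \<bullet> (P *v x) + y \<bullet> (P *v y)"
    unfolding uxy by (simp add: hf_add1 hf_add2 hf_smult1 hf_smult2 hf_cxv)
  moreover have "x \<noteq> 0 \<or> y \<noteq> 0" using u uxy by (auto simp: cxv_def vec_eq_iff)
  moreover have "v \<bullet> (P *v v) \<ge> 0" for v using pos[of v] by (cases "v = 0") auto
  ultimately show ?thesis using pos[of x] pos[of y] by (smt (verit))
qed

locale riemannian =
  fixes H \<omega> :: "circle \<Rightarrow> real^'k::finite^'k"
  assumes rc: "riemannian_connection H \<omega>"
begin

lemma H_Cinf: "H \<in> Cinf" and \<omega>_Cinf: "\<omega> \<in> Cinf"
  and H_sym: "transpose (H p) = H p" and H_pos: "v \<noteq> 0 \<Longrightarrow> v \<bullet> (H p *v v) > 0"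
  using rc by (auto simp: riemannian_connection_def fibre_metric_def)

text \<open>Metric compatibility tested on constant sections, whose covariant derivative is \<omega>
  applied to them.\<close>

lemma ddt_H: "ddt H p = transpose (\<omega> p) ** H p + H p ** \<omega> p"
proof -
  have "u \<bullet> (ddt H p *v v) = u \<bullet> ((transpose (\<omega> p) ** H p + H p ** \<omega> p) *v v)" for u v
  proof -
    have lin: "bounded_linear (\<lambda>M. u \<bullet> (M *v v))"
      by (subst linear_conv_bounded_linear[symmetric], rule linearI)
         (simp_all add: matrix_vector_mult_add_rdistrib inner_add_right scaleR_matrix_vector_assoc[symmetric])
    have n: "nabla \<omega> (\<lambda>_. x) p = \<omega> p *v x" for x
      using ddt_eq[of "\<lambda>_. x" "\<lambda>_. 0"] by (simp add: nabla_def)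
    have "u \<bullet> (ddt H p *v v) = ddt (\<lambda>q. u \<bullet> (H q *v v)) p"
      using ddt_linear[OF lin H_Cinf] by simp
    also have "\<dots> = (\<omega> p *v u) \<bullet> (H p *v v) + u \<bullet> (H p *v (\<omega> p *v v))"
    proof -
      have "\<forall>f\<in>Cinf. \<forall>g\<in>Cinf. \<forall>p. ddt (\<lambda>q. f q \<bullet> (H q *v g q)) p
        = nabla \<omega> f p \<bullet> (H p *v g p) + f p \<bullet> (H p *v nabla \<omega> g p)" using rc by (simp add: riemannian_connection_def)
      from this[rule_format, OF Cinf_const[of u] Cinf_const[of v], of p] show ?thesis by (simp only: n)
    qed
    also have "(\<omega> p *v u) \<bullet> (H p *v v) = u \<bullet> (transpose (\<omega> p) *v (H p *v v))"
      by (subst dot_lmul_matrix[symmetric, of u "transpose (\<omega> p)"]) (simp only: vector_transpose_matrix)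
    finally show ?thesis
      by (simp add: matrix_vector_mult_add_rdistrib inner_add_right matrix_vector_mul_assoc)
  qed
  then have "\<forall>v. ddt H p *v v = (transpose (\<omega> p) ** H p + H p ** \<omega> p) *v v" by (metis vector_eq_ldot)
  then show ?thesis by (rule iffD2[OF matrix_eq])
qed

lemma hf_ddt_H: "hf (ddt H p) y z = hf (H p) (cxm (\<omega> p) *v y) z + hf (H p) y (cxm (\<omega> p) *v z)"
proof -
  have "hf (ddt H p) y z = dotc y ((transpose (cxm (\<omega> p)) ** cxm (H p)) *v vcnj z) + dotc y ((cxm (H p) ** cxm (\<omega> p)) *v vcnj z)"
    unfolding hf_def ddt_H cxm_add cxm_mult cxm_transpose matrix_vector_mult_add_rdistrib dotc_add_right ..
  also have "dotc y ((transpose (cxm (\<omega> p)) ** cxm (H p)) *v vcnj z) = hf (H p) (cxm (\<omega> p) *v y) z"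
    unfolding matrix_vector_mul_assoc[symmetric] dotc_transpose hf_def ..
  also have "dotc y ((cxm (H p) ** cxm (\<omega> p)) *v vcnj z) = hf (H p) y (cxm (\<omega> p) *v z)"
    unfolding matrix_vector_mul_assoc[symmetric] hf_def cxm_vcnj[of "\<omega> p"] ..
  finally show ?thesis .
qed

text \<open>Metric compatibility for complex vectors along the line instead of the circle, because
  parallel sections need not close up after one turn.\<close>

lemma hf_deriv:
  assumes Y: "(Y has_vector_derivative Y') (at t)" and Z: "(Z has_vector_derivative Z') (at t)"
  shows "((\<lambda>t. hf (H (circ t)) (Y t) (Z t)) has_vector_derivative
     hf (H (circ t)) (Y' + cxm (\<omega> (circ t)) *v Y t) (Z t) + hf (H (circ t)) (Y t) (Z' + cxm (\<omega> (circ t)) *v Z t)) (at t)"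
proof -
  have HH: "((\<lambda>t. cxm (H (circ t))) has_vector_derivative cxm (ddt H (circ t))) (at t)"
    by (rule bounded_linear.has_vector_derivative[OF bounded_linear_cxm Cinf_deriv[OF H_Cinf]])
  have ZZ: "((\<lambda>t. vcnj (Z t)) has_vector_derivative vcnj Z') (at t)"
    by (rule bounded_linear.has_vector_derivative[OF bounded_linear_vcnj Z])
  have "((\<lambda>t. dotc (Y t) (cxm (H (circ t)) *v vcnj (Z t))) has_vector_derivative
     dotc (Y t) (cxm (H (circ t)) *v vcnj Z' + cxm (ddt H (circ t)) *v vcnj (Z t)) + dotc Y' (cxm (H (circ t)) *v vcnj (Z t))) (at t)"
    by (rule bounded_bilinear.has_vector_derivative[OF bb_dotc Y bounded_bilinear.has_vector_derivative[OF bb_matvec HH ZZ]])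
  moreover have "dotc (Y t) (cxm (H (circ t)) *v vcnj Z' + cxm (ddt H (circ t)) *v vcnj (Z t)) + dotc Y' (cxm (H (circ t)) *v vcnj (Z t))
     = hf (H (circ t)) (Y' + cxm (\<omega> (circ t)) *v Y t) (Z t) + hf (H (circ t)) (Y t) (Z' + cxm (\<omega> (circ t)) *v Z t)"
    using hf_ddt_H[of "circ t" "Y t" "Z t"] unfolding dotc_add_right hf_def[symmetric] hf_add1 hf_add2 by simp
  ultimately show ?thesis by (simp only: hf_def)
qed

definition parallel :: "(real \<Rightarrow> complex^'k) \<Rightarrow> bool" where
  "parallel Y \<longleftrightarrow> (\<forall>t. (Y has_vector_derivative - (cxm (\<omega> (circ t)) *v Y t)) (at t))"

lemma parallel_hf:
  assumes Y: "parallel Y" and Z: "parallel Z"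
  shows "hf (H (circ s)) (Y s) (Z s) = hf (H (circ t)) (Y t) (Z t)"
proof -
  have d: "((\<lambda>t. hf (H (circ t)) (Y t) (Z t)) has_vector_derivative 0) (at t)" for t
  proof -
    have "hf (H (circ t)) (- (cxm (\<omega> (circ t)) *v Y t) + cxm (\<omega> (circ t)) *v Y t) (Z t) + hf (H (circ t)) (Y t) (- (cxm (\<omega> (circ t)) *v Z t) + cxm (\<omega> (circ t)) *v Z t) = 0"
      by (simp only: left_minus hf_zero add_0)
    then show ?thesis
      using hf_deriv[OF Y[unfolded parallel_def, THEN spec, of t] Z[unfolded parallel_def, THEN spec, of t]] by (simp only:)
  qed
  obtain c where "\<And>t. t \<in> UNIV \<Longrightarrow> hf (H (circ t)) (Y t) (Z t) = c"
    by (rule has_vector_derivative_zero_constant[OF convex_UNIV])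
       (rule has_vector_derivative_at_within[OF d], rule that)
  then show ?thesis by simp
qed

lemma hf_H_pos: "u \<noteq> 0 \<Longrightarrow> Re (hf (H p) u u) > 0"
  by (rule hf_pos) (rule H_pos)

text \<open>Parallel transport preserves a definite form, so a parallel section with one zero
  vanishes; uniqueness for the initial value problem follows from this.\<close>

lemma parallel_zero: "parallel Y \<Longrightarrow> Y s = 0 \<Longrightarrow> Y t = 0"
  using parallel_hf[of Y Y t s] hf_H_pos[of "Y t" "circ t"] by (cases "Y t = 0") (auto simp: hf_zero)

lemma parallel_add: "parallel Y \<Longrightarrow> parallel Z \<Longrightarrow> parallel (\<lambda>t. Y t + Z t)"
  unfolding parallel_def
proof
  fix t
  assume *: "\<forall>t. (Y has_vector_derivative - (cxm (\<omega> (circ t)) *v Y t)) (at t)" "\<forall>t. (Z has_vector_derivative - (cxm (\<omega> (circ t)) *v Z t)) (at t)"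
  show "((\<lambda>t. Y t + Z t) has_vector_derivative - (cxm (\<omega> (circ t)) *v (Y t + Z t))) (at t)"
    using has_vector_derivative_add[OF *(1)[rule_format, of t] *(2)[rule_format, of t]] by (simp add: matrix_vector_right_distrib)
qed

lemma parallel_smult: "parallel Y \<Longrightarrow> parallel (\<lambda>t. c *s Y t)"
  unfolding parallel_def
proof
  fix t
  assume *: "\<forall>t. (Y has_vector_derivative - (cxm (\<omega> (circ t)) *v Y t)) (at t)"
  have "bounded_linear (\<lambda>u. c *s (u :: complex^'k))" by (rule bounded_bilinear.bounded_linear_right[OF bb_smult])
  from bounded_linear.has_vector_derivative[OF this *(1)[rule_format, of t]]
  show "((\<lambda>t. c *s Y t) has_vector_derivative - (cxm (\<omega> (circ t)) *v (c *s Y t))) (at t)"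
    by (simp add: matvec_smult vec.scale_minus_right)
qed

lemma parallel_const_zero: "parallel (\<lambda>_. 0)"
  by (simp add: parallel_def)

lemma parallel_sum: "(\<And>i. i \<in> I \<Longrightarrow> parallel (Y i)) \<Longrightarrow> parallel (\<lambda>t. \<Sum>i\<in>I. Y i t)"
  by (induction I rule: infinite_finite_induct) (simp_all add: parallel_const_zero parallel_add)

lemma parallel_unique:
  assumes Y: "parallel Y" and Z: "parallel Z" and "Y s = Z s"
  shows "Y t = Z t"
proof -
  have "parallel (\<lambda>t. Y t + (-1) *s Z t)" by (rule parallel_add[OF Y parallel_smult[OF Z]])
  from parallel_zero[OF this, of s t] show ?thesis using assms(3) by (simp add: vec_eq_iff)
qed

lemma parallel_shift:
  assumes Y: "parallel Y"
  shows "parallel (\<lambda>t. Y (t + 2*pi))"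
  unfolding parallel_def
proof
  fix t
  have "(Y has_vector_derivative - (cxm (\<omega> (circ t)) *v Y (t + 2*pi))) (at (t + 2*pi))"
    using Y[unfolded parallel_def, THEN spec, of "t + 2*pi"] by simp
  then have "((Y \<circ> (\<lambda>t. t + 2*pi)) has_vector_derivative 1 *\<^sub>R (- (cxm (\<omega> (circ t)) *v Y (t + 2*pi)))) (at t)"
    by (intro vector_diff_chain_at) (auto intro!: derivative_eq_intros)
  then show "((\<lambda>t. Y (t + 2*pi)) has_vector_derivative - (cxm (\<omega> (circ t)) *v Y (t + 2*pi))) (at t)" by (simp add: o_def)
qed

text \<open>\<omega> is bounded on the circle, which supplies the global Lipschitz constant for the
  linear equation.\<close>

lemma parallel_exists: obtains Y where "parallel Y" "Y 0 = v"
proof -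
  let ?f = "\<lambda>t u. - (cxm (\<omega> (circ t)) *v u)"
  have C: "(\<lambda>p. cxm (\<omega> p)) \<in> Cinf" by (rule Cinf_linear[OF bounded_linear_cxm \<omega>_Cinf])
  obtain B where B: "B > 0" "\<And>p. norm (cxm (\<omega> p)) \<le> B" by (rule Cinf_bounded[OF C]) (rule that)
  obtain K where K: "K > 0" "\<And>M u. norm (M *v u :: complex^'k) \<le> norm (M :: complex^'k^'k) * norm u * K"
    using bounded_bilinear.pos_bounded[OF bb_matvec] by blast
  have L: "norm (?f t u) \<le> (B * K) * norm u" for t u
  proof -
    have "norm (?f t u) \<le> norm (cxm (\<omega> (circ t))) * (norm u * K)" using K(2)[of "cxm (\<omega> (circ t))" u] by (simp add: mult_ac)
    also have "\<dots> \<le> B * (norm u * K)" by (intro mult_right_mono B mult_nonneg_nonneg) (use K(1) in auto)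
    finally show ?thesis by (simp add: mult_ac)
  qed
  have lin: "bounded_linear (?f t)" for t
    by (rule bounded_linear_minus[OF bounded_bilinear.bounded_linear_right[OF bb_matvec]])
  have cont: "continuous_on UNIV (\<lambda>t. ?f t (y t))" if "continuous_on UNIV y" for y
    by (rule continuous_on_minus[OF bounded_bilinear.continuous_on[OF bb_matvec Cinf_continuous[OF C] that]])
  have BK: "B * K > 0" using B(1) K(1) by simp
  obtain Y where Y: "Y 0 = v" "\<And>t. (Y has_vector_derivative ?f t (Y t)) (at t)"
    by (rule linear_ode[OF lin BK L cont, of v]) (assumption | rule that)+
  show ?thesis by (rule that[of Y]) (use Y in \<open>auto simp: parallel_def\<close>)
qed

lemma parallel_smooth: "parallel Y \<Longrightarrow> smooth_curve Y"
proof -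
  assume Y: "parallel Y"
  have "(\<lambda>p. cxm (\<omega> p)) \<in> Cinf" by (rule Cinf_linear[OF bounded_linear_cxm \<omega>_Cinf])
  then have "ub {} (\<lambda>_::unit. \<lambda>t. - cxm (\<omega> (circ t)))" by (intro ub_uminus) (simp add: Cinf_def smooth_curve_ub)
  then show ?thesis unfolding smooth_curve_ub
  proof (rule ode_smooth)
    fix t
    show "(Y has_vector_derivative (- cxm (\<omega> (circ t))) *v Y t) (at t)"
      using Y bounded_bilinear.minus_left[OF bb_matvec, of "cxm (\<omega> (circ t))" "Y t"] by (simp add: parallel_def)
  qed
qed

theorem adapted_frame:
  obtains w :: "'k \<Rightarrow> circle \<Rightarrow> complex^'k" and \<theta> :: "'k \<Rightarrow> real" where "\<And>j. w j \<in> Cinf"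
    "\<And>i j p. hf (H p) (w i p) (w j p) = (if i = j then 1 else 0)"
    "\<And>j p. ddt (w j) p + cxm (\<omega> p) *v w j p = (\<i> * of_real (\<theta> j)) *s w j p" "\<And>j. 0 \<le> \<theta> j" "\<And>j. \<theta> j < 1"
proof -
  have "\<forall>u. \<exists>Y. parallel Y \<and> Y 0 = u"
  proof
    fix u show "\<exists>Y. parallel Y \<and> Y 0 = u" by (rule parallel_exists[of u]) (intro exI conjI)
  qed
  from choice[OF this] obtain Sol where "\<forall>u. parallel (Sol u) \<and> Sol u 0 = u" by (elim exE) (rule that)
  then have Sol: "\<And>u. parallel (Sol u)" "\<And>u. Sol u 0 = u" by simp_all
  \<comment> \<open>The monodromy, that is, transport of an initial vector once around the
    circle.\<close>
  define M where "M = (\<chi> i j. Sol (axis j 1) (2*pi) $ i)"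
  \<comment> \<open>Linearity of transport in the initial vector is a consequence of
    uniqueness.\<close>
  have M: "M *v u = Sol u (2*pi)" for u
  proof -
    have "(\<Sum>j\<in>UNIV. u $ j *s Sol (axis j 1) (2*pi)) = Sol u (2*pi)"
    proof (rule parallel_unique[where s = 0])
      show "parallel (\<lambda>t. \<Sum>j\<in>UNIV. u $ j *s Sol (axis j 1) t)" by (intro parallel_sum parallel_smult Sol)
      show "(\<Sum>j\<in>UNIV. u $ j *s Sol (axis j 1) 0) = Sol u 0"
        by (simp add: Sol(2) vec_eq_iff axis_def if_distrib[of "\<lambda>x. _ * x"] cong: if_cong)
    qed (rule Sol(1))
    then show ?thesis by (simp add: M_def matrix_vector_mult_def vec_eq_iff mult.commute)
  qed
  have iso: "hf (H (circ 0)) (M *v u) (M *v v) = hf (H (circ 0)) u v" for u v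
    using parallel_hf[OF Sol(1)[of u] Sol(1)[of v], of "2*pi" 0] circ_2pi[of 0] by (simp add: M Sol(2))
  obtain v \<mu> where v: "\<And>i j::'k. hf (H (circ 0)) (v i) (v j) = (if i = j then 1 else 0)"
    and ev: "\<And>j. M *v v j = \<mu> j *s v j" "\<And>j. norm (\<mu> j) = 1"
    by (rule orthonormal_eigenbasis[of "hf (H (circ 0))" M, OF hf_add1 hf_smult1 hf_sym[OF H_sym] hf_H_pos iso]) (assumption | rule that)+
  have per: "Sol (v j) (t + 2*pi) = \<mu> j *s Sol (v j) t" for j t
    by (rule parallel_unique[OF parallel_shift[OF Sol(1)] parallel_smult[OF Sol(1)], where s = 0])
       (use ev(1)[of j] M[of "v j"] in \<open>simp add: Sol(2)\<close>)
  \<comment> \<open>The exponent is the angle of the inverse eigenvalue, measured in full turns and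
    normalized to the interval from 0 to 1.\<close>
  have "\<forall>j. \<exists>a. 0 \<le> a \<and> a < 1 \<and> cis (a * (2*pi)) * \<mu> j = 1"
  proof
    fix j
    obtain n :: int where n: "0 \<le> - Arg (\<mu> j) + 2*pi * of_int n" "- Arg (\<mu> j) + 2*pi * of_int n < 0 + 2*pi"
      by (rule period_window)
    let ?a = "(- Arg (\<mu> j) + 2*pi * of_int n) / (2*pi)"
    have "\<mu> j = cis (Arg (\<mu> j))" using rcis_cmod_Arg[of "\<mu> j"] ev(2)[of j] by (simp add: rcis_def)
    then have "cis (- Arg (\<mu> j)) * \<mu> j = cis (- Arg (\<mu> j)) * cis (Arg (\<mu> j))" by simp
    also have "\<dots> = 1" by (simp add: cis_mult)
    finally have "cis (- Arg (\<mu> j)) * \<mu> j = 1" .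
    moreover have "?a * (2*pi) = - Arg (\<mu> j) + 2*pi * of_int n" by simp
    ultimately have "cis (?a * (2*pi)) * \<mu> j = 1" by (simp only: cis_2pi_int)
    moreover have "0 \<le> ?a" and "?a < 1" using n pi_gt_zero by (simp_all add: field_simps)
    ultimately show "\<exists>a. 0 \<le> a \<and> a < 1 \<and> cis (a * (2*pi)) * \<mu> j = 1" by blast
  qed
  from choice[OF this] obtain \<theta> where "\<forall>j. 0 \<le> \<theta> j \<and> \<theta> j < 1 \<and> cis (\<theta> j * (2*pi)) * \<mu> j = 1" by (elim exE) (rule that)
  then have \<theta>: "\<And>j. 0 \<le> \<theta> j" "\<And>j. \<theta> j < 1" "\<And>j. cis (\<theta> j * (2*pi)) * \<mu> j = 1" by simp_all
  define y where "y j t = cis (\<theta> j * t) *s Sol (v j) t" for j t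
  have yp: "y j (t + 2*pi) = y j t" for j t
  proof -
    have "y j (t + 2*pi) = (cis (\<theta> j * t) * (cis (\<theta> j * (2*pi)) * \<mu> j)) *s Sol (v j) t"
      by (simp only: y_def per smult_assoc distrib_left mult.assoc cis_mult[symmetric])
    then show ?thesis by (simp add: \<theta>(3) y_def)
  qed
  define w where "w j p = y j (Arg (Rep_circle p))" for j p
  have wc: "w j (circ t) = y j t" for j t
  proof -
    obtain n :: int where "Arg (Rep_circle (circ t)) = t + 2*pi * of_int n"
      using circ_Arg[of "circ t"] by (auto simp only: circ_eq_iff)
    then show ?thesis unfolding w_def using periodic_int[of "y j", OF yp] by simp
  qed
  have dy: "(y j has_vector_derivative (\<i> * of_real (\<theta> j)) *s y j t - cxm (\<omega> (circ t)) *v y j t) (at t)" for j t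
  proof -
    have "(Sol (v j) has_vector_derivative - (cxm (\<omega> (circ t)) *v Sol (v j) t)) (at t)" using Sol(1)[of "v j"] by (simp add: parallel_def)
    from bounded_bilinear.has_vector_derivative[OF bb_smult cis_mult_deriv[of "\<theta> j" t] this]
    have "(y j has_vector_derivative cis (\<theta> j * t) *s (- (cxm (\<omega> (circ t)) *v Sol (v j) t)) + (\<i> * of_real (\<theta> j) * cis (\<theta> j * t)) *s Sol (v j) t) (at t)"
      by (simp only: y_def[abs_def])
    moreover have "cis (\<theta> j * t) *s (- (cxm (\<omega> (circ t)) *v Sol (v j) t)) + (\<i> * of_real (\<theta> j) * cis (\<theta> j * t)) *s Sol (v j) t
       = (\<i> * of_real (\<theta> j)) *s y j t - cxm (\<omega> (circ t)) *v y j t"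
      by (simp add: y_def matvec_smult smult_assoc vec.scale_minus_right)
    ultimately show ?thesis by (simp only:)
  qed
  show ?thesis
  proof (rule that[of w \<theta>])
    show "w j \<in> Cinf" for j
    proof -
      have "ub {} (\<lambda>_::unit. \<lambda>t. cis (\<theta> j * t) *s Sol (v j) t)"
        by (rule ub_bilinear[OF bb_smult]) (use smooth_curve_cis_mult[of "\<theta> j"] parallel_smooth[OF Sol(1)[of "v j"]] in \<open>simp_all add: smooth_curve_ub\<close>)
      then show ?thesis by (simp add: Cinf_def wc smooth_curve_ub y_def)
    qed
    show "hf (H p) (w i p) (w j p) = (if i = j then 1 else 0)" for i j p
    proof -
      obtain t where p: "p = circ t" by (rule circ_surj)
      have "hf (H (circ t)) (Sol (v i) t) (Sol (v j) t) = (if i = j then 1 else 0)"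
        using parallel_hf[OF Sol(1)[of "v i"] Sol(1)[of "v j"], of t 0] v[of i j] by (simp add: Sol(2))
      then show ?thesis by (simp add: p wc y_def hf_smult1 hf_smult2 cis_cnj cis_mult)
    qed
    have dw: "ddt (w j) (circ t) = (\<i> * of_real (\<theta> j)) *s y j t - cxm (\<omega> (circ t)) *v y j t" for j t
    proof -
      have "ddt (w j) = (\<lambda>p. (\<i> * of_real (\<theta> j)) *s w j p - cxm (\<omega> p) *v w j p)"
        by (rule ddt_eq) (simp add: wc dy)
      then show ?thesis by (simp add: wc)
    qed
    show "ddt (w j) p + cxm (\<omega> p) *v w j p = (\<i> * of_real (\<theta> j)) *s w j p" for j p
    proof -
      obtain t where p: "p = circ t" by (rule circ_surj)
      show ?thesis by (simp add: p dw wc)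
    qed
  qed (rule \<theta>)+
qed

end

section \<open>The covariant derivative as a Fourier multiplier in an adapted frame\<close>

locale adapted_frame = riemannian H \<omega> for H \<omega> :: "circle \<Rightarrow> real^'k::finite^'k" +
  fixes w :: "'k \<Rightarrow> circle \<Rightarrow> complex^'k" and \<theta> :: "'k \<Rightarrow> real"
  assumes w_smooth: "w j \<in> Cinf"
    and orth: "hf (H p) (w i p) (w j p) = (if i = j then 1 else 0)"
    and par: "ddt (w j) p + cxm (\<omega> p) *v w j p = (\<i> * of_real (\<theta> j)) *s w j p"
    and \<theta>_nonneg: "0 \<le> \<theta> j" and \<theta>_less: "\<theta> j < 1"
begin

text \<open>The metric dual of w j, arranged so that the bilinear pairing with it is
  \<open>hf\<close> against w j; the conjugation of the metric falls on the frame vector.\<close>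

definition dual :: "'k \<Rightarrow> circle \<Rightarrow> complex^'k" where
  "dual j p = cxm (H p) *v vcnj (w j p)"

lemma dual_hf: "dotc (dual j p) u = hf (H p) u (w j p)"
  unfolding dual_def hf_def by (rule dotc_commute)

lemma dual_Cinf: "dual j \<in> Cinf"
proof -
  have "(\<lambda>p. cxm (H p) *v vcnj (w j p)) \<in> Cinf"
    by (rule Cinf_bilinear[OF bb_matvec Cinf_linear[OF bounded_linear_cxm H_Cinf] Cinf_linear[OF bounded_linear_vcnj w_smooth]])
  then show ?thesis by (simp add: dual_def[abs_def])
qed

text \<open>Orthonormality says that the matrix of dual vectors is a left inverse of the frame
  matrix, and for square matrices a left inverse is a right inverse.\<close>

lemma dual_dual: "(\<Sum>j\<in>UNIV. dotc (dual j p) u *s w j p) = u"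
proof -
  define W :: "complex^'k^'k" where "W = (\<chi> r j. w j p $ r)"
  define B :: "complex^'k^'k" where "B = (\<chi> j r. dual j p $ r)"
  have "B ** W = mat 1"
    using orth by (simp add: vec_eq_iff matrix_matrix_mult_def mat_def W_def B_def dual_hf dotc_def[symmetric])
  then have "W ** B = mat 1" by (simp only: matrix_left_right_inverse)
  then have "W *v (B *v u) = u" by (simp add: matrix_vector_mul_assoc)
  then show ?thesis by (simp add: vec_eq_iff matrix_vector_mult_def W_def B_def dotc_def mult.commute)
qed

sublocale frame w dual
proof
  show "dotc (dual i p) (w j p) = (if i = j then 1 else 0)" for i j p
    using orth[of p j i] by (auto simp: dual_hf)
qed (rule w_smooth dual_Cinf dual_dual)+

lemma cip_hf: "cip f g = integral {0..2*pi} (\<lambda>t. hf (H (circ t)) (f (circ t)) (g (circ t)))"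
proof -
  have "hf (H p) u v = (\<Sum>j\<in>UNIV. dotc (dual j p) u * cnj (dotc (dual j p) v))" for p u v
  proof -
    have "hf (H p) u v = hf (H p) u (\<Sum>j\<in>UNIV. dotc (dual j p) v *s w j p)" by (simp only: dual_dual)
    then show ?thesis by (simp add: hf_sum2 hf_smult2 dual_hf mult.commute)
  qed
  then show ?thesis by (simp add: cip_def)
qed

lemma cip_smult2: "cip f (\<lambda>p. c *s g p) = cnj c * cip f g"
  unfolding cip_hf hf_smult2 by (rule integral_mult_right)

lemma cip_vcnj: "cip (\<lambda>p. vcnj (f p)) (\<lambda>p. vcnj (g p)) = cnj (cip f g)"
  unfolding cip_hf hf_vcnj by (rule integral_cnj[symmetric])

definition nab :: "(circle \<Rightarrow> complex^'k) \<Rightarrow> circle \<Rightarrow> complex^'k" where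
  "nab f p = ddt f p + cxm (\<omega> p) *v f p"

lemma nab_Cinf: "f \<in> Cinf \<Longrightarrow> nab f \<in> Cinf"
proof -
  assume f: "f \<in> Cinf"
  have "(\<lambda>p. ddt f p + cxm (\<omega> p) *v f p) \<in> Cinf"
    by (rule Cinf_add[OF Cinf_ddt[OF f] Cinf_bilinear[OF bb_matvec Cinf_linear[OF bounded_linear_cxm \<omega>_Cinf] f]])
  then show ?thesis by (simp add: nab_def[abs_def])
qed

definition freq :: "'k \<Rightarrow> int \<Rightarrow> real" where "freq j n = real_of_int n + \<theta> j"

text \<open>Metric compatibility moves the covariant derivative onto the frame vector, where it acts
  by i * \<theta>_j; together with the factor i * n from differentiating the coordinate this gives
  the shifted frequency. The conjugation in the second slot of \<open>hf\<close> decides the sign of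
  the shift.\<close>

lemma co_nab:
  assumes f: "f \<in> Cinf"
  shows "co (nab f) j n = \<i> * of_real (freq j n) * co f j n"
proof -
  let ?\<phi> = "\<lambda>p. dotc (dual j p) (f p)"
  let ?d = "\<lambda>p. dotc (dual j p) (nab f p) + - (\<i> * of_real (\<theta> j)) * ?\<phi> p"
  have "ddt ?\<phi> = ?d"
  proof (rule ddt_eq)
    fix t
    have "hf (H (circ t)) (ddt f (circ t) + cxm (\<omega> (circ t)) *v f (circ t)) (w j (circ t)) + hf (H (circ t)) (f (circ t)) (ddt (w j) (circ t) + cxm (\<omega> (circ t)) *v w j (circ t)) = ?d (circ t)"
      unfolding par hf_smult2 nab_def[of f, symmetric] dual_hf by simp
    with hf_deriv[OF Cinf_deriv[OF f, of t] Cinf_deriv[OF w_smooth[of j], of t]]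
    show "((\<lambda>t. ?\<phi> (circ t)) has_vector_derivative ?d (circ t)) (at t)"
      by (simp only: dual_hf)
  qed
  then have "fc ?d n = \<i> * of_int n * fc ?\<phi> n" using fc_ddt[OF coord_Cinf[OF f, of j], of n] by simp
  moreover have "fc ?d n = fc (\<lambda>p. dotc (dual j p) (nab f p)) n + - (\<i> * of_real (\<theta> j)) * fc ?\<phi> n"
    unfolding fc_mult[symmetric]
    by (rule fc_add) (intro continuous_intros Cinf_continuous[OF coord_Cinf] nab_Cinf f)+
  ultimately show ?thesis unfolding co_def by (simp add: freq_def algebra_simps)
qed

text \<open>Symbols are functions of the frequency rather than of (j, n), because conjugation of
  sections negates frequencies without respecting the labels j and n.\<close>

definition sy :: "(real \<Rightarrow> complex) \<Rightarrow> 'k \<Rightarrow> int \<Rightarrow> complex" where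
  "sy \<sigma> j n = \<sigma> (freq j n)"

lemma polyb_sy:
  assumes "\<And>x. norm (\<sigma> x) \<le> 1 + \<bar>x\<bar>"
  shows "polyb (sy \<sigma>)"
proof -
  have "norm (sy \<sigma> j n) \<le> 2 * (1 + \<bar>real_of_int n\<bar>) ^ 1" for j n
    using assms[of "freq j n"] \<theta>_nonneg[of j] \<theta>_less[of j] by (simp add: sy_def freq_def)
  then show ?thesis unfolding polyb_def by blast
qed

lemma Mult_linear:
  assumes s: "polyb s" and f: "f \<in> Cinf" and g: "g \<in> Cinf"
  shows "Mult s (\<lambda>p. f p + c *s g p) = (\<lambda>p. Mult s f p + c *s Mult s g p)"
proof (rule co_inject)
  have cg: "(\<lambda>p. c *s g p) \<in> Cinf" by (rule Cinf_smult[OF Cinf_const g])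
  have cm: "(\<lambda>p. c *s Mult s g p) \<in> Cinf" by (rule Cinf_smult[OF Cinf_const Mult_Cinf[OF s g]])
  show "Mult s (\<lambda>p. f p + c *s g p) \<in> Cinf" by (rule Mult_Cinf[OF s Cinf_add[OF f cg]])
  show "(\<lambda>p. Mult s f p + c *s Mult s g p) \<in> Cinf" by (rule Cinf_add[OF Mult_Cinf[OF s f] cm])
  show "co (Mult s (\<lambda>p. f p + c *s g p)) j n = co (\<lambda>p. Mult s f p + c *s Mult s g p) j n" for j n
    unfolding co_Mult[OF s Cinf_add[OF f cg]] co_add[OF f cg] co_add[OF Mult_Cinf[OF s f] cm] co_smult co_Mult[OF s f] co_Mult[OF s g]
    by (simp add: algebra_simps)
qed

abbreviation uu :: "'k \<Rightarrow> int \<Rightarrow> circle \<Rightarrow> complex^'k" where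
  "uu j n \<equiv> \<lambda>p. ee n p *s w j p"

lemma nab_uu: "nab (uu j n) = (\<lambda>p. (\<i> * of_real (freq j n)) *s uu j n p)"
proof (rule co_inject[OF nab_Cinf[OF Cinf_modulated]])
  show "(\<lambda>p. (\<i> * of_real (freq j n)) *s uu j n p) \<in> Cinf" by (rule Cinf_smult[OF Cinf_const Cinf_modulated])
  show "co (nab (uu j n)) i m = co (\<lambda>p. (\<i> * of_real (freq j n)) *s uu j n p) i m" for i m
    unfolding co_nab[OF Cinf_modulated] co_smult co_modulated by auto
qed

lemma vcnj_Cinf: "f \<in> Cinf \<Longrightarrow> (\<lambda>p. vcnj (f p)) \<in> Cinf"
  by (rule Cinf_linear[OF bounded_linear_vcnj])

lemma nab_vcnj: "f \<in> Cinf \<Longrightarrow> nab (\<lambda>p. vcnj (f p)) = (\<lambda>p. vcnj (nab f p))"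
  using ddt_linear[OF bounded_linear_vcnj, of f] by (simp add: nab_def[abs_def] vcnj_add cxm_vcnj)

text \<open>The connection form is real, so conjugation commutes with the covariant derivative and
  turns an eigensection into one for the opposite frequency.\<close>

lemma co_vcnj_uu:
  assumes "co (\<lambda>p. vcnj (uu j n p)) l m \<noteq> 0"
  shows "freq l m = - freq j n"
proof -
  let ?v = "\<lambda>p. vcnj (uu j n p)"
  have "nab ?v = (\<lambda>p. cnj (\<i> * of_real (freq j n)) *s ?v p)"
    by (simp only: nab_vcnj[OF Cinf_modulated] nab_uu vcnj_smult[of "\<i> * of_real (freq j n)"])
  then have "co (nab ?v) l m = cnj (\<i> * of_real (freq j n)) * co ?v l m" by (simp only: co_smult)
  then have "(\<i> * of_real (freq l m)) * co ?v l m = cnj (\<i> * of_real (freq j n)) * co ?v l m"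
    by (simp only: co_nab[OF vcnj_Cinf[OF Cinf_modulated]])
  then have "\<i> * of_real (freq l m) = cnj (\<i> * of_real (freq j n))" using assms by (simp only: mult_cancel_right simp_thms)
  then show ?thesis by (simp add: complex_eq_iff)
qed

definition compat :: "(real \<Rightarrow> complex) \<Rightarrow> bool" where
  "compat \<sigma> \<longleftrightarrow> (\<forall>x. \<sigma> (- x) = cnj (\<sigma> x)) \<and> polyb (sy \<sigma>)"

lemma polyb_compat: "compat \<sigma> \<Longrightarrow> polyb (sy \<sigma>)" by (simp add: compat_def)

text \<open>Both sides are tested against the complete family \<open>uu\<close>. A conjugated member
  spreads over the opposite frequency alone, where \<sigma> takes the conjugate value, so it is
  again an eigensection of the adjoint multiplier.\<close>

lemma Mult_vcnj:
  assumes \<sigma>: "compat \<sigma>" and f: "f \<in> Cinf"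
  shows "Mult (sy \<sigma>) (\<lambda>p. vcnj (f p)) = (\<lambda>p. vcnj (Mult (sy \<sigma>) f p))"
proof (rule co_inject)
  note s = polyb_compat[OF \<sigma>]
  show C1: "Mult (sy \<sigma>) (\<lambda>p. vcnj (f p)) \<in> Cinf" by (rule Mult_Cinf[OF s vcnj_Cinf[OF f]])
  show C2: "(\<lambda>p. vcnj (Mult (sy \<sigma>) f p)) \<in> Cinf" by (rule vcnj_Cinf[OF Mult_Cinf[OF s f]])
  fix j n
  let ?u = "uu j n" and ?v = "\<lambda>p. vcnj (uu j n p)"
  have v: "?v \<in> Cinf" by (rule vcnj_Cinf[OF Cinf_modulated])
  have e: "Mult (\<lambda>j n. cnj (sy \<sigma> j n)) ?v = (\<lambda>p. sy \<sigma> j n *s ?v p)"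
  proof (rule co_inject[OF Mult_Cinf[OF polyb_cnj[OF s] v] Cinf_smult[OF Cinf_const v]])
    fix l m
    show "co (Mult (\<lambda>j n. cnj (sy \<sigma> j n)) ?v) l m = co (\<lambda>p. sy \<sigma> j n *s ?v p) l m"
    proof (cases "co ?v l m = 0")
      case False
      have "cnj (sy \<sigma> l m) = sy \<sigma> j n" using co_vcnj_uu[OF False] \<sigma> by (simp add: sy_def compat_def)
      then show ?thesis by (simp only: co_Mult[OF polyb_cnj[OF s] v] co_smult)
    qed (simp only: co_Mult[OF polyb_cnj[OF s] v] co_smult mult_zero_right)
  qed
  have "cip (Mult (sy \<sigma>) (\<lambda>p. vcnj (f p))) ?u = sy \<sigma> j n * cip (\<lambda>p. vcnj (f p)) ?u"
    by (simp only: cip_modulated C1 vcnj_Cinf[OF f] co_Mult[OF s vcnj_Cinf[OF f]] mult_ac)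
  also have "cip (\<lambda>p. vcnj (f p)) ?u = cnj (cip f ?v)"
    using cip_vcnj[of f ?v] by (simp only: vcnj_vcnj)
  finally have 1: "cip (Mult (sy \<sigma>) (\<lambda>p. vcnj (f p))) ?u = sy \<sigma> j n * cnj (cip f ?v)" .
  have "cip (\<lambda>p. vcnj (Mult (sy \<sigma>) f p)) ?u = cnj (cip (Mult (sy \<sigma>) f) ?v)"
    using cip_vcnj[of "Mult (sy \<sigma>) f" ?v] by (simp only: vcnj_vcnj)
  also have "cip (Mult (sy \<sigma>) f) ?v = cnj (sy \<sigma> j n) * cip f ?v"
    by (simp only: cip_Mult[OF s f v] e cip_smult2)
  finally have "cip (\<lambda>p. vcnj (Mult (sy \<sigma>) f p)) ?u = sy \<sigma> j n * cnj (cip f ?v)" by simp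
  with 1 have "complex_of_real (2*pi) * co (Mult (sy \<sigma>) (\<lambda>p. vcnj (f p))) j n = of_real (2*pi) * co (\<lambda>p. vcnj (Mult (sy \<sigma>) f p)) j n"
    unfolding cip_modulated[OF C1] cip_modulated[OF C2] by (simp only:)
  then show "co (Mult (sy \<sigma>) (\<lambda>p. vcnj (f p))) j n = co (\<lambda>p. vcnj (Mult (sy \<sigma>) f p)) j n"
    by simp
qed

text \<open>Compatible symbols define multipliers which commute with conjugation, so that they act on real
  sections.\<close>

definition RM :: "(real \<Rightarrow> complex) \<Rightarrow> (circle \<Rightarrow> real^'k) \<Rightarrow> circle \<Rightarrow> real^'k" where
  "RM \<sigma> f p = vre (Mult (sy \<sigma>) (\<lambda>q. cxv (f q)) p)"

lemma cxv_Cinf: "f \<in> Cinf \<Longrightarrow> (\<lambda>p. cxv (f p)) \<in> Cinf"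
  by (rule Cinf_linear[OF bounded_linear_cxv])

lemma cxv_RM: "compat \<sigma> \<Longrightarrow> f \<in> Cinf \<Longrightarrow> cxv (RM \<sigma> f p) = Mult (sy \<sigma>) (\<lambda>q. cxv (f q)) p"
  unfolding RM_def using fun_cong[OF Mult_vcnj[OF _ cxv_Cinf], of \<sigma> f p] by (intro cxv_vre) simp

lemma RM_Cinf: "compat \<sigma> \<Longrightarrow> f \<in> Cinf \<Longrightarrow> RM \<sigma> f \<in> Cinf"
  using Cinf_linear[OF bounded_linear_vre Mult_Cinf[OF polyb_compat cxv_Cinf], of \<sigma> f] by (simp add: RM_def[abs_def])

lemma RM_RM:
  assumes "compat \<sigma>" "compat \<tau>" "f \<in> Cinf"
  shows "RM \<sigma> (RM \<tau> f) = RM (\<lambda>x. \<sigma> x * \<tau> x) f"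
proof -
  have "(\<lambda>q. cxv (RM \<tau> f q)) = Mult (sy \<tau>) (\<lambda>q. cxv (f q))" using assms by (simp add: cxv_RM)
  then have "Mult (sy \<sigma>) (\<lambda>q. cxv (RM \<tau> f q)) = Mult (sy (\<lambda>x. \<sigma> x * \<tau> x)) (\<lambda>q. cxv (f q))"
    by (simp only: Mult_Mult[OF polyb_compat polyb_compat cxv_Cinf] assms) (simp only: sy_def[abs_def])
  then show ?thesis by (simp add: RM_def[abs_def])
qed

lemma RM_add:
  assumes "compat \<sigma>" "compat \<tau>" "f \<in> Cinf"
  shows "(\<lambda>p. RM \<sigma> f p + RM \<tau> f p) = RM (\<lambda>x. \<sigma> x + \<tau> x) f"
proof -
  have "Mult (sy (\<lambda>x. \<sigma> x + \<tau> x)) (\<lambda>q. cxv (f q)) = (\<lambda>p. Mult (sy \<sigma>) (\<lambda>q. cxv (f q)) p + Mult (sy \<tau>) (\<lambda>q. cxv (f q)) p)"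
    by (simp only: Mult_add_fun[OF cxv_Cinf polyb_compat polyb_compat] assms) (simp only: sy_def[abs_def])
  then show ?thesis by (simp add: RM_def[abs_def] linear_add[OF bounded_linear.linear[OF bounded_linear_vre]])
qed

lemma RM_one: "f \<in> Cinf \<Longrightarrow> (\<And>x. \<sigma> x = 1) \<Longrightarrow> RM \<sigma> f = f"
  using Mult_one[OF _ cxv_Cinf, of "sy \<sigma>" f] by (simp add: RM_def[abs_def] sy_def)

text \<open>A complex section is split into a + i * c with real sections a and c; the multiplier is
  complex linear and maps real sections to real ones.\<close>

lemma RM_vre:
  assumes \<sigma>: "compat \<sigma>" and g: "g \<in> Cinf"
  shows "RM \<sigma> (\<lambda>q. vre (g q)) = (\<lambda>p. vre (Mult (sy \<sigma>) g p))"
proof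
  fix p
  have li: "bounded_linear (\<lambda>u. vre (- \<i> *s (u :: complex^'k)))"
    by (rule bounded_linear_compose[OF bounded_linear_vre bounded_bilinear.bounded_linear_right[OF bb_smult]])
  have C: "(\<lambda>q. vre (g q)) \<in> Cinf" "(\<lambda>q. vre (- \<i> *s g q)) \<in> Cinf"
    by (rule Cinf_linear[OF bounded_linear_vre g], rule Cinf_linear[OF li g])
  have "g = (\<lambda>q. cxv (vre (g q)) + \<i> *s cxv (vre (- \<i> *s g q)))"
    by (simp add: fun_eq_iff vre_def cxv_def vec_eq_iff complex_eq_iff)
  then have "Mult (sy \<sigma>) g = Mult (sy \<sigma>) (\<lambda>q. cxv (vre (g q)) + \<i> *s cxv (vre (- \<i> *s g q)))" by (rule arg_cong)
  also have "\<dots> = (\<lambda>q. Mult (sy \<sigma>) (\<lambda>q. cxv (vre (g q))) q + \<i> *s Mult (sy \<sigma>) (\<lambda>q. cxv (vre (- \<i> *s g q))) q)"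
    by (rule Mult_linear[OF polyb_compat[OF \<sigma>] cxv_Cinf[OF C(1)] cxv_Cinf[OF C(2)]])
  also have "\<dots> = (\<lambda>q. cxv (RM \<sigma> (\<lambda>q. vre (g q)) q) + \<i> *s cxv (RM \<sigma> (\<lambda>q. vre (- \<i> *s g q)) q))"
    by (simp only: cxv_RM[OF \<sigma> C(1)] cxv_RM[OF \<sigma> C(2)])
  finally have "Mult (sy \<sigma>) g p = cxv (RM \<sigma> (\<lambda>q. vre (g q)) p) + \<i> *s cxv (RM \<sigma> (\<lambda>q. vre (- \<i> *s g q)) p)" by (rule fun_cong)
  moreover have "vre (cxv a + \<i> *s cxv c) = a" for a c :: "real^'k" by (simp add: vre_def cxv_def vec_eq_iff)
  ultimately show "RM \<sigma> (\<lambda>q. vre (g q)) p = vre (Mult (sy \<sigma>) g p)" by simp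
qed

abbreviation "ip \<equiv> ip_real H"

lemma ip_vre:
  assumes f: "f \<in> Cinf" and g: "g \<in> Cinf"
  shows "ip f (\<lambda>p. vre (g p)) = Re (cip (\<lambda>p. cxv (f p)) g)"
proof -
  have c: "continuous_on {0..2*pi} (\<lambda>t. hf (H (circ t)) (cxv (f (circ t))) (g (circ t)))"
    unfolding hf_def
    by (rule Cinf_continuous[OF Cinf_dotc[OF cxv_Cinf[OF f] Cinf_bilinear[OF bb_matvec Cinf_linear[OF bounded_linear_cxm H_Cinf] vcnj_Cinf[OF g]]]])
  have "integral {0..2*pi} (\<lambda>t. Re (hf (H (circ t)) (cxv (f (circ t))) (g (circ t)))) = Re (integral {0..2*pi} (\<lambda>t. hf (H (circ t)) (cxv (f (circ t))) (g (circ t))))"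
    by (rule integral_linear[OF integrable_continuous_interval[OF c] bounded_linear_Re, unfolded o_def])
  then show ?thesis by (simp add: ip_real_def cip_hf Re_hf)
qed

lemma cip_cxv:
  assumes f: "f \<in> Cinf" and g: "g \<in> Cinf"
  shows "cip (\<lambda>p. cxv (f p)) (\<lambda>p. cxv (g p)) = of_real (ip f g)"
  using ip_vre[OF f cxv_Cinf[OF g]] cip_vcnj[of "\<lambda>p. cxv (f p)" "\<lambda>p. cxv (g p)"] by (simp add: complex_eq_iff)

lemma ip_add: "f \<in> Cinf \<Longrightarrow> g \<in> Cinf \<Longrightarrow> h \<in> Cinf \<Longrightarrow> ip (\<lambda>p. f p + g p) h = ip f h + ip g h"
proof -
  assume *: "f \<in> Cinf" "g \<in> Cinf" "h \<in> Cinf"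
  have "complex_of_real (ip (\<lambda>p. f p + g p) h) = of_real (ip f h + ip g h)"
    unfolding of_real_add cip_cxv[OF Cinf_add[OF *(1,2)] *(3), symmetric] cip_cxv[OF *(1,3), symmetric] cip_cxv[OF *(2,3), symmetric]
      linear_add[OF bounded_linear.linear[OF bounded_linear_cxv]] by (intro cip_add cxv_Cinf *)
  then show ?thesis by (simp only: of_real_eq_iff)
qed

lemma ip_scaleR: "ip (\<lambda>p. c *\<^sub>R f p) h = c *\<^sub>R ip f h"
  unfolding ip_real_def by simp

lemma ip_sym: "ip f g = ip g f"
proof -
  have "x \<bullet> (H p *v y) = y \<bullet> (H p *v x)" for x y p
    using hf_sym[OF H_sym, of p "cxv x" "cxv y"] by (simp add: hf_cxv)
  then show ?thesis by (simp only: ip_real_def)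
qed

lemma ip_diff: "f \<in> Cinf \<Longrightarrow> g \<in> Cinf \<Longrightarrow> h \<in> Cinf \<Longrightarrow> ip (\<lambda>p. f p - g p) h = ip f h - ip g h"
  using ip_add[of "\<lambda>p. f p - g p" g h] by (simp add: Cinf_diff)

lemma ip_definite: "f \<in> Cinf \<Longrightarrow> ip f f = 0 \<Longrightarrow> f = (\<lambda>_. 0)"
proof -
  assume f: "f \<in> Cinf" and 0: "ip f f = 0"
  have "(\<lambda>p. cxv (f p)) = (\<lambda>_. 0)"
    by (rule cip_definite[OF cxv_Cinf[OF f]]) (simp add: cip_cxv[OF f f] 0)
  then show ?thesis by (auto simp: fun_eq_iff cxv_def vec_eq_iff)
qed

lemma nonneg_Reals_ip: "complex_of_real x \<in> nonneg_Reals \<Longrightarrow> (x :: real) \<in> nonneg_Reals"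
proof -
  assume "complex_of_real x \<in> nonneg_Reals"
  then have "(of_real x :: real) \<in> nonneg_Reals" by (simp only: nonneg_Reals_of_real_iff)
  then show ?thesis by simp
qed

lemma ip_pos: "f \<in> Cinf \<Longrightarrow> ip f f \<in> nonneg_Reals"
  using cip_pos[OF cxv_Cinf, of f] cip_cxv[of f f] by (intro nonneg_Reals_ip) simp

lemma RM_adjoint:
  assumes \<sigma>: "compat \<sigma>" "compat (\<lambda>x. cnj (\<sigma> x))" and f: "f \<in> Cinf" and g: "g \<in> Cinf"
  shows "ip (RM \<sigma> f) g = ip f (RM (\<lambda>x. cnj (\<sigma> x)) g)"
proof -
  have s: "(\<lambda>j n. cnj (sy \<sigma> j n)) = sy (\<lambda>x. cnj (\<sigma> x))" by (simp add: fun_eq_iff sy_def)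
  have "complex_of_real (ip (RM \<sigma> f) g) = cip (Mult (sy \<sigma>) (\<lambda>p. cxv (f p))) (\<lambda>p. cxv (g p))"
    unfolding cip_cxv[OF RM_Cinf[OF \<sigma>(1) f] g, symmetric] cxv_RM[OF \<sigma>(1) f] ..
  also have "\<dots> = cip (\<lambda>p. cxv (f p)) (Mult (sy (\<lambda>x. cnj (\<sigma> x))) (\<lambda>p. cxv (g p)))"
    by (simp only: cip_Mult[OF polyb_compat[OF \<sigma>(1)] cxv_Cinf[OF f] cxv_Cinf[OF g]] s)
  also have "\<dots> = complex_of_real (ip f (RM (\<lambda>x. cnj (\<sigma> x)) g))"
    unfolding cip_cxv[OF f RM_Cinf[OF \<sigma>(2) g], symmetric] cxv_RM[OF \<sigma>(2) g] ..
  finally show ?thesis by (simp only: of_real_eq_iff)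
qed

end

text \<open>The symbols, as functions of the frequency x, of the covariant derivative, the
  projection onto its kernel, D, |D|, the inverse of |D|, and \<epsilon>. D is the identity on the
  kernel, whence the value 1 at x = 0 of the last four.\<close>

definition sym_nab :: "real \<Rightarrow> complex" where "sym_nab x = \<i> * of_real x"
definition sym_ker :: "real \<Rightarrow> complex" where "sym_ker x = (if x = 0 then 1 else 0)"
definition sym_D :: "real \<Rightarrow> complex" where "sym_D x = sym_nab x + sym_ker x"
definition sym_abs :: "real \<Rightarrow> complex" where "sym_abs x = of_real (\<bar>x\<bar> + (if x = 0 then 1 else 0))"
definition sym_inv :: "real \<Rightarrow> complex" where "sym_inv x = 1 / sym_abs x"
definition sym_eps :: "real \<Rightarrow> complex" where "sym_eps x = (if x = 0 then 1 else \<i> * of_real (sgn x))"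

context adapted_frame
begin

lemma compatI: "(\<And>x. \<sigma> (- x) = cnj (\<sigma> x)) \<Longrightarrow> (\<And>x. norm (\<sigma> x) \<le> 1 + \<bar>x\<bar>) \<Longrightarrow> compat \<sigma>"
  by (simp add: compat_def polyb_sy)

lemma compat_nab: "compat sym_nab"
  by (rule compatI) (simp_all add: sym_nab_def norm_mult)

lemma compat_ker: "compat sym_ker" "compat (\<lambda>x. cnj (sym_ker x))"
  by (rule compatI; simp add: sym_ker_def)+

lemma compat_D: "compat sym_D" "compat (\<lambda>x. cnj (sym_D x))"
  by (rule compatI; simp add: sym_D_def sym_nab_def sym_ker_def norm_mult)+

lemma compat_abs: "compat sym_abs" "compat (\<lambda>x. cnj (sym_abs x))"
  by (rule compatI; simp add: sym_abs_def)+

text \<open>Near x = 0 the symbol grows like 1 / |x|, so the general criterion does not apply; on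
  the discrete set of frequencies n + \<theta>_j it is bounded.\<close>

lemma compat_inv: "compat sym_inv"
  unfolding compat_def
proof
  show "\<forall>x. sym_inv (- x) = cnj (sym_inv x)" by (simp add: sym_inv_def sym_abs_def)
  \<comment> \<open>The smallest modulus of a nonzero frequency n + \<theta>_j: it is attained at n
    = 0 or n = -1 if \<theta>_j is not 0, and is 1 otherwise.\<close>
  define \<kappa> where "\<kappa> j = (if \<theta> j = 0 then 1 else min (\<theta> j) (1 - \<theta> j))" for j
  have \<kappa>: "\<kappa> j > 0" for j using \<theta>_nonneg[of j] \<theta>_less[of j] by (simp add: \<kappa>_def)
  have \<kappa>_le: "\<kappa> j \<le> \<bar>freq j n\<bar>" if "freq j n \<noteq> 0" for j n
  proof (cases "n \<ge> 0")
    case True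
    show ?thesis
    proof (cases "n = 0")
      case False
      then have "real_of_int n \<ge> 1" using True by simp
      then show ?thesis using \<theta>_nonneg[of j] by (auto simp: \<kappa>_def freq_def min_def)
    qed (use that \<theta>_nonneg[of j] in \<open>auto simp: \<kappa>_def freq_def min_def\<close>)
  next
    case False
    then have "real_of_int n \<le> - 1" by simp
    then show ?thesis using \<theta>_nonneg[of j] \<theta>_less[of j] by (auto simp: \<kappa>_def freq_def min_def)
  qed
  show "polyb (sy sym_inv)"
  proof (rule polyb_bounded)
    fix j n
    have "norm (sy sym_inv j n) \<le> 1 + 1 / \<kappa> j"
    proof (cases "freq j n = 0")
      case True
      then show ?thesis using \<kappa>[of j] by (simp add: sy_def sym_inv_def sym_abs_def)
    next
      case False
      have "1 / \<bar>freq j n\<bar> \<le> 1 / \<kappa> j" by (rule frac_le) (use \<kappa> \<kappa>_le[OF False] in auto)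
      then show ?thesis using False by (simp add: sy_def sym_inv_def sym_abs_def norm_divide)
    qed
    also have "\<dots> \<le> (\<Sum>j\<in>UNIV. 1 + 1 / \<kappa> j)"
      by (rule member_le_sum) (use \<kappa> in \<open>auto intro!: add_nonneg_nonneg divide_nonneg_pos\<close>)
    finally show "norm (sy sym_inv j n) \<le> (\<Sum>j\<in>UNIV. 1 + 1 / \<kappa> j)" .
  qed
qed

lemma cxv_nabla: "f \<in> Cinf \<Longrightarrow> cxv (nabla \<omega> f p) = nab (\<lambda>q. cxv (f q)) p"
  using fun_cong[OF ddt_linear[OF bounded_linear_cxv, of f], of p]
  by (simp add: nabla_def nab_def linear_add[OF bounded_linear.linear[OF bounded_linear_cxv]] cxm_cxv)

lemma nabla_eq:
  assumes f: "f \<in> Cinf"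
  shows "nabla \<omega> f = RM sym_nab f"
proof
  fix p
  have "nab (\<lambda>q. cxv (f q)) = Mult (sy sym_nab) (\<lambda>q. cxv (f q))"
    by (rule co_inject[OF nab_Cinf[OF cxv_Cinf[OF f]] Mult_Cinf[OF polyb_compat[OF compat_nab] cxv_Cinf[OF f]]])
       (simp only: co_nab[OF cxv_Cinf[OF f]] co_Mult[OF polyb_compat[OF compat_nab] cxv_Cinf[OF f]] sy_def sym_nab_def)
  then have "cxv (nabla \<omega> f p) = cxv (RM sym_nab f p)" by (simp only: cxv_nabla[OF f] cxv_RM[OF compat_nab f])
  then show "nabla \<omega> f p = RM sym_nab f p" by simp
qed

lemma nabla_diff:
  assumes f: "f \<in> Cinf" and g: "g \<in> Cinf"
  shows "nabla \<omega> (\<lambda>p. f p - g p) = (\<lambda>p. nabla \<omega> f p - nabla \<omega> g p)"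
proof -
  have "ddt (\<lambda>p. f p - g p) = (\<lambda>p. ddt f p - ddt g p)"
    by (rule ddt_eq) (rule has_vector_derivative_diff[OF Cinf_deriv[OF f] Cinf_deriv[OF g]])
  then show ?thesis by (simp add: nabla_def[abs_def] matrix_vector_mult_diff_distrib fun_eq_iff)
qed

lemma RM_zero: "RM (\<lambda>_. 0) f = (\<lambda>_. 0)"
  by (simp add: fun_eq_iff RM_def Mult_def syn_def ser_def sy_def vre_def vec_eq_iff)

lemma nabla_zero_imp:
  assumes h: "h \<in> Cinf" and 0: "nabla \<omega> h = (\<lambda>_. 0)"
  shows "RM sym_ker h = h"
proof -
  let ?h = "\<lambda>p. cxv (h p)"
  have "nab ?h = (\<lambda>_. 0)"
    by (rule ext) (simp only: cxv_nabla[OF h, symmetric] 0, simp add: cxv_def vec_eq_iff)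
  moreover have "co (\<lambda>_. 0) j n = 0" for j n using co_smult[of 0 "\<lambda>_. 0" j n] by simp
  ultimately have *: "of_real (freq j n) * co ?h j n = 0" for j n using co_nab[OF cxv_Cinf[OF h], of j n] by simp
  have "Mult (sy sym_ker) ?h = ?h"
  proof (rule co_inject[OF Mult_Cinf[OF polyb_compat[OF compat_ker(1)] cxv_Cinf[OF h]] cxv_Cinf[OF h]])
    show "co (Mult (sy sym_ker) ?h) j n = co ?h j n" for j n
      unfolding co_Mult[OF polyb_compat[OF compat_ker(1)] cxv_Cinf[OF h]] using *[of j n] by (auto simp: sy_def sym_ker_def)
  qed
  then show ?thesis by (simp add: RM_def[abs_def])
qed

text \<open>Uniqueness pins down the choice operator: two candidates for the projection of f differ
  by a section that lies in the kernel and is orthogonal to it, hence by 0.\<close>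

lemma kernel_proj_eq:
  assumes f: "f \<in> Cinf"
  shows "kernel_proj ip (nabla \<omega>) f = RM sym_ker f"
proof -
  have ker: "ip (\<lambda>q. f q - RM sym_ker f q) h = 0" if f: "f \<in> Cinf" and h: "h \<in> Cinf" "nabla \<omega> h = (\<lambda>_. 0)" for f h
  proof -
    have "ip (RM sym_ker f) h = ip f (RM (\<lambda>x. cnj (sym_ker x)) h)" by (rule RM_adjoint[OF compat_ker f h(1)])
    also have "(\<lambda>x. cnj (sym_ker x)) = sym_ker" by (auto simp: sym_ker_def)
    finally show ?thesis by (simp add: ip_diff[OF f RM_Cinf[OF compat_ker(1) f] h(1)] nabla_zero_imp[OF h])
  qed
  have nk: "nabla \<omega> (RM sym_ker f) = (\<lambda>_. 0)" if f: "f \<in> Cinf" for f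
  proof -
    have "(\<lambda>x. sym_nab x * sym_ker x) = (\<lambda>_. 0)" by (auto simp: sym_nab_def sym_ker_def)
    then show ?thesis by (simp only: nabla_eq[OF RM_Cinf[OF compat_ker(1) f]] RM_RM[OF compat_nab compat_ker(1) f] RM_zero)
  qed
  let ?P = "kernel_proj ip (nabla \<omega>)"
  have "\<exists>q. \<forall>f\<in>Cinf. q f \<in> Cinf \<and> nabla \<omega> (q f) = (\<lambda>_. 0) \<and> (\<forall>h\<in>Cinf. nabla \<omega> h = (\<lambda>_. 0) \<longrightarrow> ip (\<lambda>r. f r - q f r) h = 0)"
    by (rule exI[of _ "RM sym_ker"]) (use ker nk RM_Cinf[OF compat_ker(1)] in simp)
  from someI_ex[OF this] have P: "?P f \<in> Cinf" "nabla \<omega> (?P f) = (\<lambda>_. 0)" "\<And>h. h \<in> Cinf \<Longrightarrow> nabla \<omega> h = (\<lambda>_. 0) \<Longrightarrow> ip (\<lambda>r. f r - ?P f r) h = 0"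
    using f unfolding kernel_proj_def by auto
  note R = RM_Cinf[OF compat_ker(1) f]
  let ?d = "\<lambda>r. ?P f r - RM sym_ker f r"
  have d: "?d \<in> Cinf" "nabla \<omega> ?d = (\<lambda>_. 0)" by (rule Cinf_diff[OF P(1) R], simp add: nabla_diff[OF P(1) R] P(2) nk[OF f])
  have "ip ?d ?d = 0"
    using P(3)[OF d] ker[OF f d] unfolding ip_diff[OF P(1) R d(1)] ip_diff[OF f P(1) d(1)] ip_diff[OF f R d(1)] by simp
  from ip_definite[OF d(1) this] show ?thesis by (simp add: fun_eq_iff)
qed

lemma D_real_eq: "f \<in> Cinf \<Longrightarrow> D_real H \<omega> f = RM sym_D f"
  using RM_add[OF compat_nab compat_ker(1), of f]
  by (simp add: D_real_def[abs_def] kernel_proj_eq nabla_eq sym_D_def[abs_def])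

text \<open>Two adjoints differ by a section orthogonal to every smooth section, in particular to
  itself.\<close>

lemma l2_adjoint_eq:
  assumes g: "g \<in> Cinf"
  shows "l2_adjoint ip (D_real H \<omega>) g = RM (\<lambda>x. cnj (sym_D x)) g"
proof -
  let ?R = "RM (\<lambda>x. cnj (sym_D x))" and ?T = "l2_adjoint ip (D_real H \<omega>)"
  have R: "ip (D_real H \<omega> f) g = ip f (?R g)" if "f \<in> Cinf" "g \<in> Cinf" for f g
    using RM_adjoint[OF compat_D that] by (simp add: D_real_eq that)
  have "\<exists>T. (\<forall>f\<in>Cinf. T f \<in> Cinf) \<and> (\<forall>f\<in>Cinf. \<forall>g\<in>Cinf. ip (D_real H \<omega> f) g = ip f (T g))"
    by (rule exI[of _ ?R]) (use R RM_Cinf[OF compat_D(2)] in simp)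
  from someI_ex[OF this] have T: "?T g \<in> Cinf" "\<And>f. f \<in> Cinf \<Longrightarrow> ip (D_real H \<omega> f) g = ip f (?T g)"
    using g unfolding l2_adjoint_def by auto
  note Rg = RM_Cinf[OF compat_D(2) g]
  let ?d = "\<lambda>r. ?T g r - ?R g r"
  have d: "?d \<in> Cinf" by (rule Cinf_diff[OF T(1) Rg])
  have "ip ?d ?d = ip (?T g) ?d - ip (?R g) ?d" by (rule ip_diff[OF T(1) Rg d])
  also have "\<dots> = ip ?d (?T g) - ip ?d (?R g)" by (simp only: ip_sym[of _ ?d])
  also have "\<dots> = 0" using T(2)[OF d] R[OF d g] by simp
  finally show ?thesis using ip_definite[OF d] by (simp add: fun_eq_iff)
qed

lemma Mult_smult_uu:
  assumes s: "polyb s"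
  shows "Mult s (\<lambda>p. a *s uu j n p) = (\<lambda>p. a *s (s j n *s uu j n p))"
proof -
  have C: "(\<lambda>p. a *s uu j n p) \<in> Cinf" "(\<lambda>p. s j n *s uu j n p) \<in> Cinf" by (intro Cinf_smult[OF Cinf_const Cinf_modulated])+
  show ?thesis
  proof (rule co_inject[OF Mult_Cinf[OF s C(1)] Cinf_smult[OF Cinf_const C(2)]])
    show "co (Mult s (\<lambda>p. a *s uu j n p)) l m = co (\<lambda>p. a *s (s j n *s uu j n p)) l m" for l m
      unfolding co_Mult[OF s C(1)] co_smult co_modulated by auto
  qed
qed

text \<open>Real parts of modulated frame sections are eigensections, since the eigenvalues of |D|
  are real. Admitting all complex multiples a before taking the real part makes the collection
  complete among real sections.\<close>

lemma absD_real_eq: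
  assumes f: "f \<in> Cinf"
  shows "absD_real H \<omega> f = RM sym_abs f"
  unfolding absD_real_def
proof (rule pos_sqrt_eq[where E = "{r. \<exists>a j n. r = (\<lambda>p. vre (a *s uu j n p))}"])
  have uC: "(\<lambda>p. a *s uu j n p) \<in> Cinf" for a j n by (rule Cinf_smult[OF Cinf_const Cinf_modulated])
  show "RM sym_abs g \<in> Cinf" if "g \<in> Cinf" for g by (rule RM_Cinf[OF compat_abs(1) that])
  show "ip (RM sym_abs g) h = ip g (RM sym_abs h)" if "g \<in> Cinf" "h \<in> Cinf" for g h
    using RM_adjoint[OF compat_abs that] by (simp add: sym_abs_def[abs_def])
  show "ip (RM sym_abs g) g \<in> nonneg_Reals" if g: "g \<in> Cinf" for g
  proof (rule nonneg_Reals_ip)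
    have "complex_of_real (ip (RM sym_abs g) g) = cip (Mult (sy sym_abs) (\<lambda>p. cxv (g p))) (\<lambda>p. cxv (g p))"
      unfolding cip_cxv[OF RM_Cinf[OF compat_abs(1) g] g, symmetric] cxv_RM[OF compat_abs(1) g] ..
    also have "\<dots> \<in> nonneg_Reals"
      by (rule cip_Mult_nonneg[OF polyb_compat[OF compat_abs(1)] cxv_Cinf[OF g], where \<sigma> = "\<lambda>j n. \<bar>freq j n\<bar> + (if freq j n = 0 then 1 else 0)"])
         (simp_all add: sy_def sym_abs_def)
    finally show "complex_of_real (ip (RM sym_abs g) g) \<in> nonneg_Reals" .
  qed
  show "RM sym_abs (RM sym_abs g) = l2_adjoint ip (D_real H \<omega>) (D_real H \<omega> g)" if g: "g \<in> Cinf" for g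
  proof -
    have "(\<lambda>x. cnj (sym_D x) * sym_D x) = (\<lambda>x. sym_abs x * sym_abs x)"
      by (auto simp: fun_eq_iff sym_D_def sym_nab_def sym_ker_def sym_abs_def complex_eq_iff)
    then show ?thesis
      by (simp only: D_real_eq[OF g] l2_adjoint_eq[OF RM_Cinf[OF compat_D(1) g]] RM_RM[OF compat_D(2,1) g] RM_RM[OF compat_abs(1) compat_abs(1) g])
  qed
  show "{r. \<exists>a j n. r = (\<lambda>p. vre (a *s uu j n p))} \<subseteq> Cinf"
    using Cinf_linear[OF bounded_linear_vre uC] by auto
  show "\<exists>l\<ge>0. RM sym_abs r = (\<lambda>p. l *\<^sub>R r p)" if r: "r \<in> {r. \<exists>a j n. r = (\<lambda>p. vre (a *s uu j n p))}" for r
  proof -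
    obtain a j n where r: "r = (\<lambda>p. vre (a *s uu j n p))" using r by (elim CollectE exE) (rule that)
    let ?l = "\<bar>freq j n\<bar> + (if freq j n = 0 then 1 else 0)"
    have l: "vre (a *s (complex_of_real l *s v)) = l *\<^sub>R vre (a *s v)" for l and v :: "complex^'k"
      by (simp add: vre_def vec_eq_iff algebra_simps)
    have "sy sym_abs j n = complex_of_real ?l" by (simp only: sy_def sym_abs_def)
    then have "RM sym_abs r = (\<lambda>p. ?l *\<^sub>R r p)"
      by (simp only: r RM_vre[OF compat_abs(1) uC] Mult_smult_uu[OF polyb_compat[OF compat_abs(1)]] l)
    moreover have "?l \<ge> 0" by simp
    ultimately show ?thesis by (intro exI conjI)
  qed
  show "g = (\<lambda>_. 0)" if g: "g \<in> Cinf" and 0: "\<And>r. r \<in> {r. \<exists>a j n. r = (\<lambda>p. vre (a *s uu j n p))} \<Longrightarrow> ip g r = 0" for g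
  proof -
    have "(\<lambda>p. cxv (g p)) = (\<lambda>_. 0)"
    proof (rule cip_complete[OF cxv_Cinf[OF g]])
      fix j n
      \<comment> \<open>Testing with the multiple of \<open>uu j n\<close> by the coefficient c
        itself turns the hypothesis into |c|^2 = 0.\<close>
      define c where "c = cip (\<lambda>p. cxv (g p)) (uu j n)"
      have "ip g (\<lambda>p. vre (c *s uu j n p)) = 0" by (rule 0) (intro CollectI exI, rule refl)
      then have "Re (cnj c * c) = 0" by (simp only: ip_vre[OF g uC] cip_smult2 c_def)
      then have "c = 0" by (simp add: complex_eq_iff add_nonneg_eq_0_iff)
      then show "cip (\<lambda>p. cxv (g p)) (uu j n) = 0" by (simp only: c_def)
    qed
    then show ?thesis by (auto simp: fun_eq_iff cxv_def vec_eq_iff)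
  qed
qed (assumption | rule ip_add ip_scaleR ip_pos ip_definite f)+

theorem eps_real_eq:
  assumes f: "f \<in> Cinf"
  shows "eps_real H \<omega> f = RM sym_eps f"
proof -
  have inv: "RM sym_inv (RM sym_abs g) = g" "RM sym_abs (RM sym_inv g) = g" if "g \<in> Cinf" for g
    by (subst RM_RM[OF compat_inv compat_abs(1) that] RM_RM[OF compat_abs(1) compat_inv that], rule RM_one[OF that], simp add: sym_inv_def sym_abs_def)+
  have "inj_on (absD_real H \<omega>) Cinf"
    by (rule inj_on_inverseI[where g = "RM sym_inv"]) (simp add: absD_real_eq inv)
  then have "inv_into Cinf (absD_real H \<omega>) f = RM sym_inv f"
    by (rule inv_into_f_eq) (simp_all add: absD_real_eq RM_Cinf[OF compat_inv] inv f)
  then have "eps_real H \<omega> f = D_real H \<omega> (RM sym_inv f)" by (simp add: eps_real_def[abs_def])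
  also have "\<dots> = RM (\<lambda>x. sym_D x * sym_inv x) f"
    by (simp only: D_real_eq[OF RM_Cinf[OF compat_inv f]] RM_RM[OF compat_D(1) compat_inv f])
  also have "(\<lambda>x. sym_D x * sym_inv x) = sym_eps"
    by (auto simp: fun_eq_iff sym_D_def sym_inv_def sym_eps_def sym_nab_def sym_ker_def sym_abs_def sgn_if)
  finally show ?thesis .
qed

lemma compat_eps: "compat sym_eps"
  by (rule compatI) (simp_all add: sym_eps_def norm_mult sgn_if)

text \<open>Since 0 <= \<theta>_j < 1, the sign of n + \<theta>_j is that of n for every nonzero n,
  whatever j is; the exponents were normalized for this purpose.\<close>

lemma sy_eps:
  "norm (sy sym_eps j n) \<le> 1" "n > 0 \<Longrightarrow> sy sym_eps j n = \<i>" "n < 0 \<Longrightarrow> sy sym_eps j n = - \<i>"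
proof -
  show "norm (sy sym_eps j n) \<le> 1" by (simp add: sy_def sym_eps_def norm_mult sgn_if)
  show "sy sym_eps j n = \<i>" if "n > 0"
  proof -
    have "freq j n > 0" using that \<theta>_nonneg[of j] by (simp add: freq_def add_pos_nonneg)
    then show ?thesis by (simp add: sy_def sym_eps_def)
  qed
  show "sy sym_eps j n = - \<i>" if "n < 0"
  proof -
    have "real_of_int n \<le> - 1" using that by simp
    then have "freq j n < 0" using \<theta>_less[of j] by (simp add: freq_def)
    then show ?thesis by (simp add: sy_def sym_eps_def)
  qed
qed

end

section \<open>Commutators with Fourier integral operators\<close>

lemma (in frame) FIO_commutator:
  assumes B: "B \<in> PDO" and g: "g \<in> Diff_plus" and A: "\<And>f. f \<in> Cinf \<Longrightarrow> A f = B f \<circ> g"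
    and S: "\<And>j n. norm (s j n) \<le> S" and sp: "\<And>j n. n > 0 \<Longrightarrow> s j n = sp" and sm: "\<And>j n. n < 0 \<Longrightarrow> s j n = sm"
  shows "smoothing (\<lambda>f p. A (Mult s f) p - Mult s (A f) p)"
proof -
  obtain G G' c where G: "\<And>t. (G has_vector_derivative G' t) (at t)" "ub UNIV (\<lambda>_::int. G')" "ub UNIV (\<lambda>_::int\<times>int. G')"
    "c > 0" "\<And>t. G' t \<ge> c" "\<And>t. G' (t + 2*pi) = G' t" "\<And>t. g (circ t) = circ (G t)" "\<And>t. circ (G (t + 2*pi)) = circ (G t)"
    by (rule Diff_plus_lift[OF g]) (rule that)
  have "amp G A" by (rule amp_comp[OF PDO_amp[OF B] PDO_comp_FIO(1)[OF B g A] A G(1,2,7)])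
  then show ?thesis by (rule commutator_smoothing[OF _ G(1,3,4,5,6,8) S sp sm])
qed

lemma smoothing_cong: "smoothing R \<Longrightarrow> (\<And>f. f \<in> Cinf \<Longrightarrow> R f = R' f) \<Longrightarrow> smoothing R'"
  unfolding smoothing_def by (metis (no_types, lifting))

text \<open>\<open>pi_tilde\<close> is a choice among the admissible diffeomorphisms, so it is
  itself admissible and comes with a pseudo-differential factor B.\<close>

lemma FIO_DiffE:
  assumes "A \<in> FIO_Diff P"
  obtains B where "B \<in> P" "\<And>f. f \<in> Cinf \<Longrightarrow> A f = B f \<circ> pi_tilde P A"
proof -
  have "\<exists>g. is_FIO_over P g A" using assms by (simp add: FIO_Diff_def)
  then have "is_FIO_over P (pi_tilde P A) A" unfolding pi_tilde_def by (rule someI_ex)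
  then have "\<exists>B\<in>invertibles P. \<forall>f\<in>Cinf. A f = B f \<circ> pi_tilde P A" by (simp add: is_FIO_over_def)
  then obtain B where "B \<in> invertibles P" "\<forall>f\<in>Cinf. A f = B f \<circ> pi_tilde P A" by (elim bexE) (rule that)
  then show ?thesis by (intro that[of B]) (simp_all add: invertibles_def)
qed

theorem FIO_res_complex:
  fixes A :: "(circle \<Rightarrow> complex^'k) \<Rightarrow> circle \<Rightarrow> complex^'k"
  assumes A: "A \<in> FIO_Diff PDO" and g: "pi_tilde PDO A \<in> Diff_plus"
  shows "A \<in> FIO_res FIO eps_complex"
proof -
  obtain B where B: "B \<in> PDO" "\<And>f. f \<in> Cinf \<Longrightarrow> A f = B f \<circ> pi_tilde PDO A" by (rule FIO_DiffE[OF A]) (rule that)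
  have lin: "linear_op A" and FIO: "A \<in> FIO" by (rule PDO_comp_FIO[OF B(1) g B(2)], assumption)+
  have "smoothing (\<lambda>f p. A (std.Mult (\<lambda>j. sgn_symbol) f) p - std.Mult (\<lambda>j. sgn_symbol) (A f) p)"
    by (rule std.FIO_commutator[OF B(1) g B(2), where S = 1 and sp = 1 and sm = "- 1"]) (auto simp: sgn_symbol_def)
  then have "smoothing (\<lambda>f p. A (eps_complex f) p - eps_complex (A f) p)"
    by (rule smoothing_cong) (simp only: eps_complex_eq linear_op_Cinf[OF lin])
  then show ?thesis using FIO by (simp add: FIO_res_def)
qed

text \<open>The commutator theorem is applied to the complexification of A. Restricted to real
  sections it gives back the real commutator, whose kernel is the real part of the complex
  one.\<close>

theorem (in adapted_frame) FIO_res_real: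
  assumes A: "A \<in> FIO_Diff PDO_real" and g: "pi_tilde PDO_real A \<in> Diff_plus"
  shows "A \<in> FIO_res FIO_real (eps_real H \<omega>)"
proof -
  obtain B where B: "B \<in> PDO_real" "\<And>f. f \<in> Cinf \<Longrightarrow> A f = B f \<circ> pi_tilde PDO_real A" by (rule FIO_DiffE[OF A]) (rule that)
  let ?A = "complexify A" and ?B = "complexify B" and ?g = "pi_tilde PDO_real A"
  have B': "?B \<in> PDO" using B(1) by (simp add: PDO_real_def)
  have A': "?A f = ?B f \<circ> ?g" if f: "f \<in> Cinf" for f
  proof -
    have "bounded_linear (\<lambda>u::complex^'k. \<chi> j. Im (u $ j))"
      by (subst linear_conv_bounded_linear[symmetric], rule linearI) (auto simp: vec_eq_iff)
    from Cinf_linear[OF this f] Cinf_linear[OF bounded_linear_vre f]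
    show ?thesis by (simp add: fun_eq_iff complexify_def B(2) vre_def)
  qed
  have lin: "linear_op ?A" and FIO: "?A \<in> FIO" by (rule PDO_comp_FIO[OF B' g A'], assumption)+
  have z: "(\<chi> j. 0) = (0 :: real^'k)" by (simp add: vec_eq_iff)
  \<comment> \<open>Linearity is known for the complexification. That A annihilates the zero section
    is what makes \<open>complexify A\<close> an extension of A.\<close>
  have A0: "A (\<lambda>_. 0) = (\<lambda>_. 0)"
  proof -
    have "?A (\<lambda>_. 0) p $ i = 0" for p i by (simp add: linear_op_zero[OF lin])
    then have "A (\<lambda>_. 0) p $ i = 0" for p i by (simp add: complexify_def z complex_eq_iff)
    then show ?thesis by (simp add: fun_eq_iff vec_eq_iff)
  qed
  have cA: "?A (\<lambda>q. cxv (f q)) = (\<lambda>p. cxv (A f p))" for f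
    by (simp add: fun_eq_iff complexify_def cxv_def z A0 complex_eq_iff vec_eq_iff)
  have AC: "A f \<in> Cinf" if f: "f \<in> Cinf" for f
    using Cinf_linear[OF bounded_linear_vre linear_op_Cinf[OF lin cxv_Cinf[OF f]]] by (simp add: cA)
  have "smoothing (\<lambda>f p. ?A (Mult (sy sym_eps) f) p - Mult (sy sym_eps) (?A f) p)"
    by (rule FIO_commutator[OF B' g A', where S = 1]) (assumption | rule sy_eps)+
  then obtain K where K: "smooth_kernel K" "\<And>f. f \<in> Cinf \<Longrightarrow> (\<lambda>p. ?A (Mult (sy sym_eps) f) p - Mult (sy sym_eps) (?A f) p) = kernel_op K f"
    unfolding smoothing_def by (elim exE conjE) (rule that, assumption, erule bspec)
  \<comment> \<open>On a real section, the real part of the integral against K is the integral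
    against the entrywise real part of K.\<close>
  define K' where "K' p q = (\<chi> i j. Re (K p q $ i $ j))" for p q
  have "bounded_linear (\<lambda>M::complex^'k^'k. \<chi> i j. Re (M $ i $ j))"
    by (subst linear_conv_bounded_linear[symmetric], rule linearI) (auto simp: vec_eq_iff)
  then have "smooth_kernel (\<lambda>p q. \<chi> i j. Re (K p q $ i $ j))" by (rule smooth_kernel_linear[OF _ K(1)])
  then have K': "smooth_kernel K'" by (simp add: K'_def[abs_def])
  have "A (eps_real H \<omega> f) p - eps_real H \<omega> (A f) p = kernel_op K' f p" if f: "f \<in> Cinf" for f p
  proof -
    have cu: "cxv u - cxv v = cxv (u - v)" for u v :: "real^'k" by (simp add: cxv_def vec_eq_iff)
    have "cxv (A (eps_real H \<omega> f) p - eps_real H \<omega> (A f) p) = ?A (\<lambda>q. cxv (RM sym_eps f q)) p - cxv (RM sym_eps (A f) p)"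
      by (simp only: cu[symmetric] cA eps_real_eq[OF f] eps_real_eq[OF AC[OF f]])
    also have "\<dots> = ?A (Mult (sy sym_eps) (\<lambda>q. cxv (f q))) p - Mult (sy sym_eps) (?A (\<lambda>q. cxv (f q))) p"
      by (simp only: cxv_RM[OF compat_eps f] cxv_RM[OF compat_eps AC[OF f]] cA)
    also have "\<dots> = kernel_op K (\<lambda>q. cxv (f q)) p" by (rule fun_cong[OF K(2)[OF cxv_Cinf[OF f]]])
    finally have "A (eps_real H \<omega> f) p - eps_real H \<omega> (A f) p = vre (kernel_op K (\<lambda>q. cxv (f q)) p)"
      by (metis vre_cxv)
    also have "\<dots> = integral {0..2*pi} (\<lambda>t. vre (K p (circ t) *v cxv (f (circ t))))"
    proof -
      have "continuous_on {0..2*pi} (\<lambda>t. K p (circ t) *v cxv (f (circ t)))"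
        by (rule bounded_bilinear.continuous_on[OF bb_matvec continuous_on_subset[OF smooth_kernel_continuous(2)[OF K(1)] subset_UNIV] Cinf_continuous[OF cxv_Cinf[OF f]]])
      from integral_linear[OF integrable_continuous_interval[OF this] bounded_linear_vre]
      show ?thesis by (simp add: kernel_op_def o_def)
    qed
    also have "\<dots> = kernel_op K' f p"
      by (simp add: kernel_op_def vre_def cxv_def K'_def matrix_vector_mult_def)
    finally show ?thesis .
  qed
  then have "smoothing (\<lambda>f p. A (eps_real H \<omega> f) p - eps_real H \<omega> (A f) p)"
    unfolding smoothing_def using K' by (intro exI[of _ K'] conjI ballI) auto
  then show ?thesis using FIO by (simp add: FIO_res_def FIO_real_def)
qed

theorem theorem3p4:
  shows "{A \<in> FIO_Diff (PDO :: ((circle \<Rightarrow> complex^'k) \<Rightarrow> circle \<Rightarrow> complex^'k) set).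
            pi_tilde PDO A \<in> Diff_plus} \<subseteq> FIO_res FIO eps_complex
    \<and> (\<forall>H \<omega>. riemannian_connection H \<omega> \<longrightarrow>
         {A \<in> FIO_Diff (PDO_real :: ((circle \<Rightarrow> real^'k) \<Rightarrow> circle \<Rightarrow> real^'k) set).
            pi_tilde PDO_real A \<in> Diff_plus} \<subseteq> FIO_res FIO_real (eps_real H \<omega>))"
proof (intro conjI allI impI subsetI)
  fix A :: "(circle \<Rightarrow> complex^'k) \<Rightarrow> circle \<Rightarrow> complex^'k"
  assume "A \<in> {A \<in> FIO_Diff PDO. pi_tilde PDO A \<in> Diff_plus}"
  then show "A \<in> FIO_res FIO eps_complex" by (intro FIO_res_complex) auto
next
  fix H \<omega> :: "circle \<Rightarrow> real^'k^'k" and A :: "(circle \<Rightarrow> real^'k) \<Rightarrow> circle \<Rightarrow> real^'k"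
  assume rc: "riemannian_connection H \<omega>" and A: "A \<in> {A \<in> FIO_Diff PDO_real. pi_tilde PDO_real A \<in> Diff_plus}"
  interpret riemannian H \<omega> by unfold_locales (rule rc)
  show "A \<in> FIO_res FIO_real (eps_real H \<omega>)"
  proof (rule adapted_frame)
    fix w :: "'k \<Rightarrow> circle \<Rightarrow> complex^'k" and \<theta> :: "'k \<Rightarrow> real"
    assume "\<And>j. w j \<in> Cinf" "\<And>i j p. hf (H p) (w i p) (w j p) = (if i = j then 1 else 0)"
      "\<And>j p. ddt (w j) p + cxm (\<omega> p) *v w j p = (\<i> * of_real (\<theta> j)) *s w j p" "\<And>j. 0 \<le> \<theta> j" "\<And>j. \<theta> j < 1"
    then interpret adapted_frame H \<omega> w \<theta> by unfold_locales
    show "A \<in> FIO_res FIO_real (eps_real H \<omega>)" using A by (intro FIO_res_real) auto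
  qed
qed

end
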